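(* Let $\Omega\subset\mathbb{R}^N$ ($N\ge 2$) be a bounded domain with Lipschitz boundary. Let $p,q\in C^{0,1}(\overline{\Omega})$ satisfy $1<p(x)<q(x)<N$ for all $x\in\overline{\Omega}$ and $\max_{x\in\overline{\Omega}}\frac{q(x)}{p(x)}<1+\frac1N$, and let $\mu\in C^{0,1}(\overline{\Omega})$ with $\mu\ge 0$. Let $\mathcal{H}(x,t):=t^{p(x)}+\mu(x)t^{q(x)}$. Let $\mathcal{A}:\Omega\times\mathbb{R}\times\mathbb{R}^N\to\mathbb{R}^N$ and $\mathcal{B}:\Omega\times\mathbb{R}\times\mathbb{R}^N\to\mathbb{R}$ be Carathéodory functions such that, for a.a. $x\in\Omega$ and all $(t,\xi)\in\mathbb{R}\times\mathbb{R}^N$, (i) $|\mathcal{A}(x,t,\xi)|\le\alpha_1\left[|t|^{\frac{p^*(x)}{p'(x)}}+\mu(x)^{\frac{N-1}{N-q(x)}}|t|^{\frac{q^*(x)}{q'(x)}}+|\xi|^{p(x)-1}+\mu(x)|\xi|^{q(x)-1}+1\right]$, (ii) $\mathcal{A}(x,t,\xi)\cdot\xi\ge\alpha_2\left[|\xi|^{p(x)}+\mu(x)|\xi|^{q(x)}\right]-\alpha_3\left[|t|^{r(x)}+\mu(x)^{\frac{s(x)}{q(x)}}|t|^{s(x)}+1\right]$, (iii) $|\mathcal{B}(x,t,\xi)|\le\beta\left[|t|^{r(x)-1}+\mu(x)^{\frac{s(x)}{q(x)}}|t|^{s(x)-1}+|\xi|^{\frac{p(x)}{r'(x)}}+\mu(x)^{\frac1{q(x)}+\frac1{s'(x)}}|\xi|^{\frac{q(x)}{s'(x)}}+1\right]$,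 where $\alpha_1,\alpha_2,\alpha_3,\beta$ are positive constants and $r,s\in C(\overline{\Omega})$ satisfy $p(x)<r(x)<p^*(x)$ and $q(x)<s(x)<q^*(x)$ for all $x\in\overline{\Omega}$. Then any weak solution $u\in W^{1,\mathcal{H}}_0(\Omega)$ of the problem $$-\operatorname{div}\mathcal{A}(x,u,\nabla u)=\mathcal{B}(x,u,\nabla u)\ \text{ in }\Omega,\qquad u=0\ \text{ on }\partial\Omega,$$ belongs to $L^\infty(\Omega)$ and satisfies the a priori estimate $$\|u\|_{\infty,\Omega}\le C\max\left\{\|u\|_{\Psi,\Omega}^{\tau_1},\|u\|_{\Psi,\Omega}^{\tau_2}\right\},$$ where $C,\tau_1,\tau_2$ are positive constants independent of $u$ and $$\Psi(x,t):=t^{r(x)}+\mu(x)^{\frac{s(x)}{q(x)}}t^{s(x)}\quad\text{for }(x,t)\in\overline{\Omega}\times[0,\infty).$$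
   Context: For an exponent function $h$ with $1<h(x)<N$, $h^*(x)=\frac{Nh(x)}{N-h(x)}$; for $h(x)>1$, $h'(x)=\frac{h(x)}{h(x)-1}$. For a function $\varphi:\Omega\times[0,\infty)\to[0,\infty)$ with $\varphi(\cdot,t)$ measurable for every $t\ge 0$ and, for a.a. $x\in\Omega$, $\varphi(x,\cdot)$ continuous, convex, $\varphi(x,0)=0$ and $\varphi(x,t)>0$ for $t>0$, the Musielak-Orlicz space $L^\varphi(\Omega)$ is the set of measurable $u:\Omega\to\mathbb{R}$ for which there is $\alpha>0$ with $\int_\Omega\varphi(x,\alpha|u|)\,dx<\infty$, with norm $\|u\|_{\varphi,\Omega}=\inf\{\alpha>0:\int_\Omega\varphi(x,|u|/\alpha)\,dx\le1\}$. $W^{1,\mathcal{H}}(\Omega)=\{u\in L^{\mathcal{H}}(\Omega):|\nabla u|\in L^{\mathcal{H}}(\Omega)\}$ with norm $\|u\|_{1,\mathcal{H}}=\|u\|_{\mathcal{H},\Omega}+\|\,|\nabla u|\,\|_{\mathcal{H},\Omega}$, and $W_0^{1,\mathcal{H}}(\Omega)$ is the completion of $C_0^\infty(\Omega)$ in $W^{1,\mathcal{H}}(\Omega)$. $\|\cdot\|_{\infty,\Omega}$ is the norm of $L^\infty(\Omega)$. A weak solution of the problem is a function $u\in W_0^{1,\mathcal{H}}(\Omega)$ such that $\int_\Omega\mathcal{A}(x,u,\nabla u)\cdot\nabla\varphi\,dx=\int_\Omega\mathcal{B}(x,u,\nabla u)\varphi\,dx$ for all $\varphi\in W_0^{1,\mathcal{H}}(\Omega)$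 (all integrals are well defined under the assumptions). *)

theory Defs
  imports "HOL-Analysis.Analysis" "HOL-Probability.Essential_Supremum"
begin

text \<open>Functions on a domain \<open>\<Omega>\<close> of \<open>real ^ 'n\<close> are represented by total functions on
  \<open>real ^ 'n\<close> whose values outside \<open>\<Omega>\<close> (or its closure) are irrelevant. Real powers are
  written \<open>powr\<close>; all exponents below are positive, so \<open>0 powr a = 0\<close> is the usual convention.\<close>

subsection \<open>Domains and exponents\<close>

definition domain :: "(real ^ 'n) set \<Rightarrow> bool" where
  "domain \<Omega> \<longleftrightarrow> open \<Omega> \<and> connected \<Omega> \<and> \<Omega> \<noteq> {}"

text \<open>Near each boundary point, \<open>\<Omega>\<close> is the set lying strictly above the graph of a Lipschitz
  function. The rotated coordinate system is encoded by the direction \<open>e\<close> of its last axis; the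
  remaining \<open>N - 1\<close> coordinates are those of the hyperplane orthogonal to \<open>e\<close>.\<close>

definition lipschitz_boundary :: "(real ^ 'n) set \<Rightarrow> bool" where
  "lipschitz_boundary \<Omega> \<longleftrightarrow>
    (\<forall>x0 \<in> frontier \<Omega>. \<exists>\<rho>>0. \<exists>e \<gamma> L. norm e = 1 \<and> L-lipschitz_on {z. z \<bullet> e = 0} \<gamma> \<and>
      \<Omega> \<inter> ball x0 \<rho> = {y \<in> ball x0 \<rho>. \<gamma> (y - (y \<bullet> e) *\<^sub>R e) < y \<bullet> e})"

definition crit_exp :: "(real ^ 'n \<Rightarrow> real) \<Rightarrow> real ^ 'n \<Rightarrow> real" where
  "crit_exp h x = real CARD('n) * h x / (real CARD('n) - h x)"

definition conj_exp :: "(real ^ 'n \<Rightarrow> real) \<Rightarrow> real ^ 'n \<Rightarrow> real" where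
  "conj_exp h x = h x / (h x - 1)"

definition caratheodory ::
  "(real ^ 'n) set \<Rightarrow> (real ^ 'n \<Rightarrow> real \<Rightarrow> real ^ 'n \<Rightarrow> 'b::topological_space) \<Rightarrow> bool" where
  "caratheodory \<Omega> F \<longleftrightarrow>
    (\<forall>t \<xi>. (\<lambda>x. F x t \<xi>) \<in> borel_measurable (lebesgue_on \<Omega>)) \<and>
    (AE x in lebesgue_on \<Omega>. continuous_on UNIV (\<lambda>(t, \<xi>). F x t \<xi>))"

subsection \<open>Test functions and weak gradients\<close>

definition grad :: "(real ^ 'n \<Rightarrow> real) \<Rightarrow> real ^ 'n \<Rightarrow> real ^ 'n" where
  "grad f x = (\<chi> i. frechet_derivative f (at x) (axis i 1))"

primrec C_k :: "nat \<Rightarrow> (real ^ 'n \<Rightarrow> real) \<Rightarrow> bool" where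
  "C_k 0 f \<longleftrightarrow> continuous_on UNIV f"
| "C_k (Suc k) f \<longleftrightarrow> (\<forall>x. f differentiable (at x)) \<and> (\<forall>i. C_k k (\<lambda>x. grad f x $ i))"

text \<open>Test functions are extended by zero, so they are smooth on the whole space.\<close>

definition test_functions :: "(real ^ 'n) set \<Rightarrow> (real ^ 'n \<Rightarrow> real) set" where
  "test_functions \<Omega> =
    {\<phi>. (\<forall>k. C_k k \<phi>) \<and> compact (closure {x. \<phi> x \<noteq> 0}) \<and> closure {x. \<phi> x \<noteq> 0} \<subseteq> \<Omega>}"

definition locally_integrable ::
  "(real ^ 'n) set \<Rightarrow> (real ^ 'n \<Rightarrow> 'b::{banach, second_countable_topology}) \<Rightarrow> bool" where
  "locally_integrable \<Omega> f \<longleftrightarrow> (\<forall>K. compact K \<and> K \<subseteq> \<Omega> \<longrightarrow> integrable (lebesgue_on K) f)"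

definition has_weak_gradient ::
  "(real ^ 'n) set \<Rightarrow> (real ^ 'n \<Rightarrow> real) \<Rightarrow> (real ^ 'n \<Rightarrow> real ^ 'n) \<Rightarrow> bool" where
  "has_weak_gradient \<Omega> u g \<longleftrightarrow> locally_integrable \<Omega> u \<and> locally_integrable \<Omega> g \<and>
    (\<forall>\<phi> \<in> test_functions \<Omega>.
      (LINT x|lebesgue_on \<Omega>. u x *\<^sub>R grad \<phi> x) = - (LINT x|lebesgue_on \<Omega>. \<phi> x *\<^sub>R g x))"

text \<open>The weak gradient is unique almost everywhere in \<open>\<Omega>\<close>; any representative will do.\<close>

definition weak_grad :: "(real ^ 'n) set \<Rightarrow> (real ^ 'n \<Rightarrow> real) \<Rightarrow> real ^ 'n \<Rightarrow> real ^ 'n" where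
  "weak_grad \<Omega> u = (SOME g. has_weak_gradient \<Omega> u g)"

subsection \<open>Musielak--Orlicz and Musielak--Orlicz--Sobolev spaces\<close>

definition modular ::
  "(real ^ 'n) set \<Rightarrow> (real ^ 'n \<Rightarrow> real \<Rightarrow> real) \<Rightarrow> (real ^ 'n \<Rightarrow> real) \<Rightarrow> ennreal" where
  "modular \<Omega> \<Phi> u = (\<integral>\<^sup>+ x. ennreal (\<Phi> x \<bar>u x\<bar>) \<partial>lebesgue_on \<Omega>)"

definition orlicz_space ::
  "(real ^ 'n) set \<Rightarrow> (real ^ 'n \<Rightarrow> real \<Rightarrow> real) \<Rightarrow> (real ^ 'n \<Rightarrow> real) set" where
  "orlicz_space \<Omega> \<Phi> =
    {u \<in> borel_measurable (lebesgue_on \<Omega>). \<exists>\<alpha>>0. modular \<Omega> \<Phi> (\<lambda>x. \<alpha> * u x) < \<infinity>}"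

text \<open>The infimum ranges over a nonempty set whenever \<open>u\<close> belongs to the Musielak--Orlicz space
  of a \<open>\<Phi>\<close> that is convex in the second variable and vanishes at \<open>0\<close>.\<close>

definition orlicz_norm ::
  "(real ^ 'n) set \<Rightarrow> (real ^ 'n \<Rightarrow> real \<Rightarrow> real) \<Rightarrow> (real ^ 'n \<Rightarrow> real) \<Rightarrow> real" where
  "orlicz_norm \<Omega> \<Phi> u = Inf {\<alpha>. \<alpha> > 0 \<and> modular \<Omega> \<Phi> (\<lambda>x. u x / \<alpha>) \<le> 1}"

definition W1 ::
  "(real ^ 'n) set \<Rightarrow> (real ^ 'n \<Rightarrow> real \<Rightarrow> real) \<Rightarrow> (real ^ 'n \<Rightarrow> real) set" where
  "W1 \<Omega> \<Phi> = {u \<in> orlicz_space \<Omega> \<Phi>.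
    (\<exists>g. has_weak_gradient \<Omega> u g) \<and> (\<lambda>x. norm (weak_grad \<Omega> u x)) \<in> orlicz_space \<Omega> \<Phi>}"

definition W1_norm ::
  "(real ^ 'n) set \<Rightarrow> (real ^ 'n \<Rightarrow> real \<Rightarrow> real) \<Rightarrow> (real ^ 'n \<Rightarrow> real) \<Rightarrow> real" where
  "W1_norm \<Omega> \<Phi> u = orlicz_norm \<Omega> \<Phi> u + orlicz_norm \<Omega> \<Phi> (\<lambda>x. norm (weak_grad \<Omega> u x))"

text \<open>The completion of the test functions, realised as their closure in the space \<open>W1\<close>.\<close>

definition W1_0 ::
  "(real ^ 'n) set \<Rightarrow> (real ^ 'n \<Rightarrow> real \<Rightarrow> real) \<Rightarrow> (real ^ 'n \<Rightarrow> real) set" where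
  "W1_0 \<Omega> \<Phi> =
    {u \<in> W1 \<Omega> \<Phi>. \<forall>\<epsilon>>0. \<exists>\<phi> \<in> test_functions \<Omega>. W1_norm \<Omega> \<Phi> (\<lambda>x. u x - \<phi> x) < \<epsilon>}"

definition Linf_space :: "(real ^ 'n) set \<Rightarrow> (real ^ 'n \<Rightarrow> real) set" where
  "Linf_space \<Omega> = {u \<in> borel_measurable (lebesgue_on \<Omega>).
    esssup (lebesgue_on \<Omega>) (\<lambda>x. ereal \<bar>u x\<bar>) < \<infinity>}"

definition Linf_norm :: "(real ^ 'n) set \<Rightarrow> (real ^ 'n \<Rightarrow> real) \<Rightarrow> real" where
  "Linf_norm \<Omega> u = real_of_ereal (esssup (lebesgue_on \<Omega>) (\<lambda>x. ereal \<bar>u x\<bar>))"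

subsection \<open>The double phase problem\<close>

definition double_phase ::
  "(real ^ 'n \<Rightarrow> real) \<Rightarrow> (real ^ 'n \<Rightarrow> real) \<Rightarrow> (real ^ 'n \<Rightarrow> real) \<Rightarrow> real ^ 'n \<Rightarrow> real \<Rightarrow> real" where
  "double_phase p q \<mu> x t = t powr p x + \<mu> x * t powr q x"

definition double_phase_sub ::
  "(real ^ 'n \<Rightarrow> real) \<Rightarrow> (real ^ 'n \<Rightarrow> real) \<Rightarrow> (real ^ 'n \<Rightarrow> real) \<Rightarrow> (real ^ 'n \<Rightarrow> real)
    \<Rightarrow> real ^ 'n \<Rightarrow> real \<Rightarrow> real" where
  "double_phase_sub q \<mu> r s x t = t powr r x + \<mu> x powr (s x / q x) * t powr s x"

text \<open>Weak solutions of \<open>- div A(x, u, \<nabla>u) = B(x, u, \<nabla>u)\<close> in \<open>\<Omega>\<close> with \<open>u = 0\<close> on the boundary,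
  in the space \<open>W1_0 \<Omega> \<Phi>\<close>.\<close>

definition weak_solution ::
  "(real ^ 'n) set \<Rightarrow> (real ^ 'n \<Rightarrow> real \<Rightarrow> real) \<Rightarrow> (real ^ 'n \<Rightarrow> real \<Rightarrow> real ^ 'n \<Rightarrow> real ^ 'n)
    \<Rightarrow> (real ^ 'n \<Rightarrow> real \<Rightarrow> real ^ 'n \<Rightarrow> real) \<Rightarrow> (real ^ 'n \<Rightarrow> real) \<Rightarrow> bool" where
  "weak_solution \<Omega> \<Phi> A B u \<longleftrightarrow> u \<in> W1_0 \<Omega> \<Phi> \<and>
    (\<forall>\<phi> \<in> W1_0 \<Omega> \<Phi>.
      (LINT x|lebesgue_on \<Omega>. A x (u x) (weak_grad \<Omega> u x) \<bullet> weak_grad \<Omega> \<phi> x) =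
      (LINT x|lebesgue_on \<Omega>. B x (u x) (weak_grad \<Omega> u x) * \<phi> x))"

end

theory Submission
  imports Defs
begin

text \<open>Applied to powers of a test function, the Gagliardo--Nirenberg--Sobolev inequality in \<open>L\<^sup>1\<close> shows that
  for some \<open>\<kappa> < 1\<close> the integral of \<open>\<bar>w\<bar>\<^bsup>\<kappa>p*\<^esup> + (\<mu>\<^bsup>1/q\<^esup>\<bar>w\<bar>)\<^bsup>\<kappa>q*\<^esup>\<close> is bounded by a power greater than \<open>1\<close> of the
  modular of \<open>w\<close> and its gradient. The derivatives of the exponents only produce logarithms, which \<open>\<kappa> < 1\<close>
  absorbs; the derivative of the weight is absorbed because \<open>q / p < 1 + 1 / N\<close>. Testing the
  equation with truncations of \<open>u\<close> bounds the modular of the gradient on \<open>{\<bar>u\<bar> > k}\<close> by the integral of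
  \<open>\<Psi>(x, \<bar>u\<bar>) + 1\<close> on that set. As \<open>r\<close> and \<open>s\<close> are strictly subcritical, both facts together give a superlinear
  recursion for the integrals of \<open>\<Psi>(x, (\<bar>u\<bar> - k)\<^sub>+)\<close>, and De Giorgi iteration yields a level above which
  \<open>\<bar>u\<bar>\<close> vanishes almost everywhere.\<close>

subsection \<open>Inequalities for real powers\<close>

text \<open>Modulars with variable exponents are not homogeneous, so the integral estimates carry
  sums \<open>X powr a + X powr b\<close>, one power deciding for small and the other for large
  arguments; the two exponents \<open>\<tau>1\<close>, \<open>\<tau>2\<close> of the conclusion
  descend from this. The pointwise estimates interpolate with a free \<epsilon> at the price of a
  negative power of \<epsilon>, whose exponent must not depend on the point; this is the purpose of
  the hypotheses of the form \<open>e - p \<le> K * (P - e)\<close>. Near a zero of \<mu> the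
  derivative of \<mu> divided by \<mu> is unbounded. The resulting term is shared between the
  weighted critical power and an unweighted power of w, so the bound of the unweighted Sobolev
  inequality has to be among the data of the weighted one. Strict inequalities between exponents
  hold at each point of a compact set. The intermediate results are parametrised by the uniform
  constants \<kappa>, \<eta>, \<theta>1, \<theta>2 that compactness extracts from them. Inequalities
  are shown for test functions and reach Sobolev functions by Fatou's lemma.\<close>

lemma powr_interp:
  fixes t \<epsilon> p e P K :: real
  assumes "0 \<le> t" "0 < \<epsilon>" "\<epsilon> \<le> 1" "p \<le> e" "e < P" "e - p \<le> K * (P - e)"
  shows "t powr e \<le> \<epsilon> powr (-K) * t powr p + \<epsilon> * t powr P"
proof (cases "t = 0")
  case False
  then have t: "t > 0" using assms by simp
  \<comment> \<open>Either \<epsilon> t^(P-e) is at least 1 and the last term alone dominates, or t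
    is bounded by a power of 1/\<epsilon>. Then t^(e-p) is at most (1/\<epsilon>)^((e-p)/(P-e)), and
    the hypothesis on \<open>K\<close> replaces this exponent by one that can be kept fixed while p,
    e, P vary.\<close>
  show ?thesis
  proof (cases "1 \<le> \<epsilon> * t powr (P - e)")
    case True
    have "t powr e * 1 \<le> t powr e * (\<epsilon> * t powr (P - e))"
      using True by (intro mult_left_mono) auto
    also have "\<dots> = \<epsilon> * t powr P" using t by (simp add: powr_diff)
    also have "\<dots> \<le> \<epsilon> powr (-K) * t powr p + \<epsilon> * t powr P" by simp
    finally show ?thesis by simp
  next
    case False
    then have "t powr (P - e) < 1 / \<epsilon>" using assms by (simp add: field_simps)
    then have "(t powr (P - e)) powr ((e - p) / (P - e)) \<le> (1 / \<epsilon>) powr ((e - p) / (P - e))"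
      using assms by (intro powr_mono2) auto
    then have "t powr (e - p) \<le> (1 / \<epsilon>) powr ((e - p) / (P - e))"
      using assms by (simp add: powr_powr)
    also have "\<dots> \<le> (1 / \<epsilon>) powr K"
      using assms by (intro powr_mono) (auto simp: field_simps)
    also have "\<dots> = \<epsilon> powr (-K)" using assms by (simp add: powr_divide powr_minus divide_simps)
    finally have "t powr p * t powr (e - p) \<le> t powr p * \<epsilon> powr (-K)"
      by (intro mult_left_mono) auto
    moreover have "t powr p * t powr (e - p) = t powr e" using t by (simp add: powr_diff)
    moreover have "0 \<le> \<epsilon> * t powr P" using assms by simp
    ultimately show ?thesis by (simp add: mult.commute)
  qed
qed (use assms in auto)

text \<open>Homogeneity reduces this to \<open>powr_interp\<close> for the quotient y/x with the
  exponents 0, \<alpha>, 1. The usual constant of Young's inequality is traded for a power of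
  \<epsilon> that can be chosen uniformly in \<alpha>.\<close>

lemma Young_eps:
  fixes x y \<epsilon> \<alpha> K :: real
  assumes "0 \<le> x" "0 \<le> y" "0 < \<epsilon>" "\<epsilon> \<le> 1" "0 \<le> \<alpha>" "\<alpha> < 1" "\<alpha> \<le> K * (1 - \<alpha>)"
  shows "x powr (1 - \<alpha>) * y powr \<alpha> \<le> \<epsilon> powr (-K) * x + \<epsilon> * y"
proof (cases "x = 0 \<or> y = 0")
  case True
  then show ?thesis using assms by auto
next
  case False
  then have xy: "x > 0" "y > 0" using assms by auto
  have "(y / x) powr \<alpha> \<le> \<epsilon> powr (-K) * (y / x) powr 0 + \<epsilon> * (y / x) powr 1"
    using assms xy by (intro powr_interp) auto
  then have "x * (y / x) powr \<alpha> \<le> x * (\<epsilon> powr (-K) + \<epsilon> * (y / x))"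
    using xy by (intro mult_left_mono) auto
  also have "\<dots> = \<epsilon> powr (-K) * x + \<epsilon> * y" using xy by (simp add: field_simps)
  finally show ?thesis using xy by (simp add: powr_divide powr_diff)
qed

lemma powr_le_add:
  fixes t a e b :: real
  assumes "0 \<le> t" "a \<le> e" "e \<le> b"
  shows "t powr e \<le> t powr a + t powr b"
proof (cases "t \<le> 1")
  case True
  then have "t powr e \<le> t powr a" using assms by (intro powr_mono') auto
  then show ?thesis by (simp add: add_increasing2)
next
  case False
  then have "t powr e \<le> t powr b" using assms by (intro powr_mono) auto
  then show ?thesis by (simp add: add_increasing)
qed

text \<open>From ln z < z for z = t^\<eta> and z = t^(-\<eta>). This converts a logarithm into a
  shift of the exponent by \<eta>.\<close>

lemma abs_ln_le:
  fixes t \<eta> :: real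
  assumes "0 < t" "0 < \<eta>"
  shows "\<bar>ln t\<bar> \<le> (t powr \<eta> + t powr (-\<eta>)) / \<eta>"
proof -
  have "ln (t powr \<eta>) \<le> t powr \<eta>" "ln (t powr (-\<eta>)) \<le> t powr (-\<eta>)"
    using assms ln_less_self[of "t powr \<eta>"] ln_less_self[of "t powr (-\<eta>)"] by auto
  then have "\<eta> * ln t \<le> t powr \<eta>" "-(\<eta> * ln t) \<le> t powr (-\<eta>)" using assms by (auto simp: ln_powr)
  moreover have "0 \<le> t powr \<eta>" "0 \<le> t powr (-\<eta>)" by auto
  ultimately have "\<bar>\<eta> * ln t\<bar> \<le> t powr \<eta> + t powr (-\<eta>)" by linarith
  then show ?thesis using assms by (simp add: field_simps abs_mult)
qed

text \<open>The logarithm shifts m by \<eta> in both directions; both shifted exponents lie between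
  h and Q and can be interpolated with the same \<open>K\<close>.\<close>

lemma powr_mult_abs_ln_le:
  fixes t m \<eta> h Q K \<epsilon> :: real
  assumes "0 \<le> t" "0 < \<eta>" "h \<le> m - \<eta>" "m + \<eta> < Q" "m + \<eta> - h \<le> K * (Q - (m + \<eta>))"
    "0 < \<epsilon>" "\<epsilon> \<le> 1" "0 \<le> K"
  shows "t powr m * \<bar>ln t\<bar> \<le> 2 / \<eta> * (\<epsilon> powr (-K) * t powr h + \<epsilon> * t powr Q)"
proof (cases "t = 0")
  case False
  then have t: "t > 0" using assms by simp
  have "K * (Q - (m + \<eta>)) \<le> K * (Q - (m - \<eta>))" using assms by (intro mult_left_mono) auto
  then have "m - \<eta> - h \<le> K * (Q - (m - \<eta>))" using assms by linarith
  then have 1: "t powr (m - \<eta>) \<le> \<epsilon> powr (-K) * t powr h + \<epsilon> * t powr Q"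
    using assms by (intro powr_interp) auto
  have 2: "t powr (m + \<eta>) \<le> \<epsilon> powr (-K) * t powr h + \<epsilon> * t powr Q"
    using assms by (intro powr_interp) auto
  have "t powr m * \<bar>ln t\<bar> \<le> t powr m * ((t powr \<eta> + t powr (-\<eta>)) / \<eta>)"
    using abs_ln_le[OF t \<open>0 < \<eta>\<close>] by (intro mult_left_mono) auto
  also have "\<dots> = (t powr (m + \<eta>) + t powr (m - \<eta>)) / \<eta>"
    using t by (simp add: powr_add powr_diff powr_minus field_simps)
  also have "\<dots> \<le> (2 * (\<epsilon> powr (-K) * t powr h + \<epsilon> * t powr Q)) / \<eta>"
    using 1 2 assms by (intro divide_right_mono) auto
  finally show ?thesis by (simp add: field_simps)
qed auto

text \<open>Differentiating w^m leaves w^(m-1) times a gradient \<tau>. Young's inequality with the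
  conjugate pair h, h/(h-1) produces \<tau>^h and the power (m-1)h/(h-1) of w, which lies between h
  and Q.\<close>

lemma powr_mult_le_Young:
  fixes w \<tau> m h Q K \<epsilon> :: real
  assumes "0 \<le> w" "0 \<le> \<tau>" "1 < h" "h \<le> m" "(m - 1) * h / (h - 1) \<le> Q" "h - 1 \<le> K"
    "0 < \<epsilon>" "\<epsilon> \<le> 1"
  shows "w powr (m - 1) * \<tau> \<le> \<epsilon> powr (-K) * \<tau> powr h + \<epsilon> * (w powr h + w powr Q)"
proof -
  define \<alpha> where "\<alpha> = (h - 1) / h"
  have \<alpha>: "1 - \<alpha> = 1 / h" "0 \<le> \<alpha>" "\<alpha> < 1" using assms by (auto simp: \<alpha>_def field_simps)
  have "(m - 1) * h / (h - 1) * \<alpha> = m - 1" using assms by (auto simp: \<alpha>_def)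
  then have "w powr (m - 1) * \<tau> = (\<tau> powr h) powr (1 - \<alpha>) * (w powr ((m - 1) * h / (h - 1))) powr \<alpha>"
    using assms \<alpha> by (simp add: powr_powr)
  also have "\<dots> \<le> \<epsilon> powr (-K) * \<tau> powr h + \<epsilon> * w powr ((m - 1) * h / (h - 1))"
  proof (intro Young_eps)
    have "(h - 1) / h \<le> K / h" using assms by (intro divide_right_mono) auto
    then show "\<alpha> \<le> K * (1 - \<alpha>)" using \<alpha>(1) by (simp add: \<alpha>_def)
  qed (use assms \<alpha> in auto)
  also have "w powr ((m - 1) * h / (h - 1)) \<le> w powr h + w powr Q"
  proof (intro powr_le_add)
    have "(h - 1) * h \<le> (m - 1) * h" using assms by (intro mult_right_mono) auto
    then show "h \<le> (m - 1) * h / (h - 1)" using assms by (simp add: field_simps)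
  qed (use assms in auto)
  finally show ?thesis using assms by (simp add: mult_left_mono)
qed

text \<open>Multiplying \<open>abs_ln_le\<close> by z removes the singularity at 0. The logarithm of
  a weight is thus at most a constant divided by the weight, also where the weight comes close to
  0.\<close>

lemma abs_ln_mult_le:
  fixes z M :: real
  assumes "0 \<le> z" "z \<le> M"
  shows "z * \<bar>ln z\<bar> \<le> 1 + M\<^sup>2"
proof (cases "z = 0")
  case False
  then have z: "z > 0" using assms by simp
  have "z * \<bar>ln z\<bar> \<le> z * ((z powr 1 + z powr (-1)) / 1)"
    using abs_ln_le[OF z, of 1] z by (intro mult_left_mono) auto
  also have "\<dots> = z\<^sup>2 + 1" using z by (simp add: powr_minus field_simps power2_eq_square)
  also have "z\<^sup>2 \<le> M\<^sup>2" using assms by (intro power_mono) auto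
  finally show ?thesis by simp
qed auto

text \<open>After division of F by U and of H by V, the weighted inequality between arithmetic and
  geometric mean holds pointwise and integrates to at most 1. If one of the bounds is 0, one factor
  vanishes a.e.\<close>

lemma nn_integral_Holder:
  fixes F H :: "'a \<Rightarrow> real"
  assumes [measurable]: "F \<in> borel_measurable M" "H \<in> borel_measurable M"
    and nn: "\<And>x. 0 \<le> F x" "\<And>x. 0 \<le> H x"
    and U: "(\<integral>\<^sup>+x. ennreal (F x) \<partial>M) \<le> ennreal U" "0 \<le> U"
    and V: "(\<integral>\<^sup>+x. ennreal (H x) \<partial>M) \<le> ennreal V" "0 \<le> V"
    and \<theta>: "0 < \<theta>" "\<theta> < 1"
  shows "(\<integral>\<^sup>+x. ennreal (F x powr (1 - \<theta>) * H x powr \<theta>) \<partial>M) \<le> ennreal (U powr (1 - \<theta>) * V powr \<theta>)"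
proof (cases "U = 0 \<or> V = 0")
  case True
  then have "AE x in M. F x = 0 \<or> H x = 0"
  proof
    assume "U = 0"
    then have "(\<integral>\<^sup>+x. ennreal (F x) \<partial>M) = 0" using U by simp
    then have "AE x in M. ennreal (F x) = 0" by (subst (asm) nn_integral_0_iff_AE) auto
    then show ?thesis using nn by (auto simp: antisym)
  next
    assume "V = 0"
    then have "(\<integral>\<^sup>+x. ennreal (H x) \<partial>M) = 0" using V by simp
    then have "AE x in M. ennreal (H x) = 0" by (subst (asm) nn_integral_0_iff_AE) auto
    then show ?thesis using nn by (auto simp: antisym)
  qed
  then have "(\<integral>\<^sup>+x. ennreal (F x powr (1 - \<theta>) * H x powr \<theta>) \<partial>M) = (\<integral>\<^sup>+x. 0 \<partial>M)"
    by (intro nn_integral_cong_AE) auto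
  then show ?thesis by simp
next
  case False
  then have UV: "U > 0" "V > 0" using U V by auto
  let ?c = "U powr (1 - \<theta>) * V powr \<theta>"
  have pt: "F x powr (1 - \<theta>) * H x powr \<theta> \<le> ?c * ((1 - \<theta>) / U * F x + \<theta> / V * H x)" for x
  proof (cases "F x = 0 \<or> H x = 0")
    case True
    then have "F x powr (1 - \<theta>) * H x powr \<theta> = 0" by auto
    moreover have "0 \<le> ?c * ((1 - \<theta>) / U * F x + \<theta> / V * H x)" using UV \<theta> nn[of x]
      by (intro mult_nonneg_nonneg add_nonneg_nonneg) auto
    ultimately show ?thesis by linarith
  next
    case False
    then have FH: "F x > 0" "H x > 0" using nn[of x] by (auto simp: less_le)
    have "(F x / U) powr (1 - \<theta>) * (H x / V) powr \<theta> \<le> (1 - \<theta>) * (F x / U) + \<theta> * (H x / V)"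
      using FH UV \<theta> by (intro Youngs_inequality_0) auto
    then have "?c * ((F x / U) powr (1 - \<theta>) * (H x / V) powr \<theta>) \<le> ?c * ((1 - \<theta>) * (F x / U) + \<theta> * (H x / V))"
      by (intro mult_left_mono) auto
    then show ?thesis using FH UV by (simp add: powr_divide)
  qed
  have "(\<integral>\<^sup>+x. ennreal (F x powr (1 - \<theta>) * H x powr \<theta>) \<partial>M)
      \<le> (\<integral>\<^sup>+x. ennreal (?c * (1 - \<theta>) / U) * ennreal (F x) + ennreal (?c * \<theta> / V) * ennreal (H x) \<partial>M)"
  proof (intro nn_integral_mono)
    fix x
    have "0 \<le> ?c * (1 - \<theta>) / U * F x" "0 \<le> ?c * \<theta> / V * H x" using UV \<theta> nn[of x] by auto
    then have "ennreal (?c * (1 - \<theta>) / U * F x) + ennreal (?c * \<theta> / V * H x)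
      = ennreal (?c * ((1 - \<theta>) / U * F x + \<theta> / V * H x))"
      by (subst ennreal_plus[symmetric]) (auto simp: algebra_simps)
    then have "ennreal (?c * (1 - \<theta>) / U) * ennreal (F x) + ennreal (?c * \<theta> / V) * ennreal (H x)
      = ennreal (?c * ((1 - \<theta>) / U * F x + \<theta> / V * H x))"
      using UV \<theta> nn[of x] by (subst (1 2) ennreal_mult[symmetric]) auto
    then show "ennreal (F x powr (1 - \<theta>) * H x powr \<theta>) \<le> ennreal (?c * (1 - \<theta>) / U) * ennreal (F x) + ennreal (?c * \<theta> / V) * ennreal (H x)"
      using pt[of x] by (simp add: ennreal_leI)
  qed
  also have "\<dots> = ennreal (?c * (1 - \<theta>) / U) * (\<integral>\<^sup>+x. ennreal (F x) \<partial>M) + ennreal (?c * \<theta> / V) * (\<integral>\<^sup>+x. ennreal (H x) \<partial>M)"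
    by (simp add: nn_integral_add nn_integral_cmult)
  also have "\<dots> \<le> ennreal (?c * (1 - \<theta>) / U) * ennreal U + ennreal (?c * \<theta> / V) * ennreal V"
    using U V by (intro add_mono mult_left_mono) auto
  also have "\<dots> = ennreal ?c"
  proof -
    have "ennreal (?c * (1 - \<theta>)) + ennreal (?c * \<theta>) = ennreal ?c"
      using UV \<theta> by (subst ennreal_plus[symmetric]) (auto simp: algebra_simps)
    then show ?thesis using UV \<theta> by (simp add: ennreal_mult[symmetric])
  qed
  finally show ?thesis .
qed

subsection \<open>The Gagliardo--Nirenberg--Sobolev inequality\<close>

text \<open>With the coordinate j frozen at t, the slice of f is controlled in two ways: the
  induction hypothesis bounds its power m/(m-1) by the slice integral a(t) of G, and the
  one-dimensional hypothesis in direction j bounds its integral by A. Hoelder's inequality combines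
  both into a(t) A^(1/m), and a integrates to at most A. A single G serves all directions because it
  will bound the full gradient.\<close>

lemma (in product_sigma_finite) Nirenberg_induction:
  fixes f :: "('i \<Rightarrow> 'a) \<Rightarrow> real" and G :: "('i \<Rightarrow> 'a) \<Rightarrow> ennreal"
  assumes "finite I" "2 \<le> card I"
    and "f \<in> borel_measurable (PiM I M)" "G \<in> borel_measurable (PiM I M)"
    and "\<And>x. 0 \<le> f x"
    and "\<And>x i. x \<in> space (PiM I M) \<Longrightarrow> i \<in> I \<Longrightarrow> ennreal (f x) \<le> (\<integral>\<^sup>+t. G (x(i := t)) \<partial>M i)"
    and "(\<integral>\<^sup>+x. G x \<partial>PiM I M) \<le> ennreal A" "0 \<le> A"
  shows "(\<integral>\<^sup>+x. ennreal (f x powr (card I / (card I - 1))) \<partial>PiM I M)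
    \<le> ennreal (A powr (card I / (card I - 1)))"
  using assms
proof (induction I arbitrary: f G A rule: finite_induct)
  case (insert j J)
  note [measurable] = insert.prems(2,3)
  note [simp] = insert.hyps(1,2)
  note f0 = insert.prems(4)
  define m where "m = card J"
  have m1: "m \<ge> 1" using insert.prems(1) by (simp add: m_def)
  define E where "E = 1 + 1 / real m"
  have E: "card (insert j J) / (card (insert j J) - 1) = E"
    using m1 by (simp add: m_def[symmetric] E_def field_simps)
  define a where "a t = (\<integral>\<^sup>+x. G (x(j := t)) \<partial>PiM J M)" for t
  interpret J: sigma_finite_measure "PiM J M" by (rule sigma_finite) simp
  have [measurable]: "a \<in> borel_measurable (M j)" unfolding a_def by measurable
  have aA: "(\<integral>\<^sup>+t. a t \<partial>M j) \<le> ennreal A"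
    using insert.prems(6) unfolding a_def by (subst (asm) product_nn_integral_insert_rev) auto
  have fin: "AE t in M j. a t \<noteq> \<infinity>"
    using aA by (intro nn_integral_PInf_AE) (auto simp: top_unique)
  have upd: "x(j := t) \<in> space (PiM (insert j J) M)" if "x \<in> space (PiM J M)" "t \<in> space (M j)" for x t
    using that by (auto simp: space_PiM PiE_def extensional_def)
  have slice: "(\<integral>\<^sup>+x. ennreal (f (x(j := t)) powr E) \<partial>PiM J M) \<le> a t * ennreal (A powr (E - 1))"
    if t[measurable]: "t \<in> space (M j)" and at: "a t \<noteq> \<infinity>" for t
  proof -
    have ft[measurable]: "(\<lambda>x. f (x(j := t))) \<in> borel_measurable (PiM J M)" by measurable
    have Gt[measurable]: "(\<lambda>x. G (x(j := t))) \<in> borel_measurable (PiM J M)" by measurable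
    have "(\<integral>\<^sup>+x. ennreal (f (x(j := t))) \<partial>PiM J M) \<le> (\<integral>\<^sup>+x. (\<integral>\<^sup>+s. G (x(j := s)) \<partial>M j) \<partial>PiM J M)"
    proof (intro nn_integral_mono)
      fix x assume "x \<in> space (PiM J M)"
      from insert.prems(5)[OF upd[OF this t], of j]
      show "ennreal (f (x(j := t))) \<le> (\<integral>\<^sup>+s. G (x(j := s)) \<partial>M j)" by (simp only: fun_upd_upd insertI1)
    qed
    also have "\<dots> = (\<integral>\<^sup>+x. G x \<partial>PiM (insert j J) M)" by (subst product_nn_integral_insert) auto
    finally have fA: "(\<integral>\<^sup>+x. ennreal (f (x(j := t))) \<partial>PiM J M) \<le> ennreal A"
      using insert.prems(6) by simp
    have sl: "ennreal (f (x(j := t))) \<le> (\<integral>\<^sup>+s. G ((x(i := s))(j := t)) \<partial>M i)"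
      if "x \<in> space (PiM J M)" "i \<in> J" for x i
    proof -
      have "i \<noteq> j" using that by auto
      then have *: "(x(i := s))(j := t) = (x(j := t))(i := s)" for s by (rule fun_upd_twist)
      have "i \<in> insert j J" using that by blast
      from insert.prems(5)[OF upd[OF that(1) t] this] show ?thesis unfolding * .
    qed
    \<comment> \<open>With one remaining coordinate there is no induction hypothesis. The exponent
      is then 2 and f is at most a(t) pointwise, so one factor f is replaced by a(t) and the other
      one integrated.\<close>
    show ?thesis
    proof (cases "m = 1")
      case True
      then obtain i where J: "J = {i}" by (auto simp: m_def card_1_singleton_iff)
      have "ennreal (f (x(j := t))) \<le> a t" if "x \<in> space (PiM J M)" for x
      proof -
        have "a t = (\<integral>\<^sup>+x. (\<integral>\<^sup>+s. G ((x(i := s))(j := t)) \<partial>M i) \<partial>PiM {} M)"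
          unfolding a_def J using Gt by (subst product_nn_integral_insert) (auto simp: J)
        also have "\<dots> = (\<integral>\<^sup>+s. G (((\<lambda>k. undefined)(i := s))(j := t)) \<partial>M i)"
          by (simp add: nn_integral_empty)
        also have "\<dots> = (\<integral>\<^sup>+s. G ((x(i := s))(j := t)) \<partial>M i)"
        proof -
          have "(\<lambda>k. undefined)(i := s) = x(i := s)" for s
            using that by (intro ext) (auto simp: space_PiM PiE_def extensional_def J)
          then show ?thesis by simp
        qed
        finally show ?thesis using sl[OF that, of i] J by simp
      qed
      then have "(\<integral>\<^sup>+x. ennreal (f (x(j := t)) powr E) \<partial>PiM J M)
        \<le> (\<integral>\<^sup>+x. a t * ennreal (f (x(j := t))) \<partial>PiM J M)"
        using f0 True by (intro nn_integral_mono)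
          (auto simp: E_def power2_eq_square ennreal_mult intro!: mult_right_mono)
      also have "\<dots> = a t * (\<integral>\<^sup>+x. ennreal (f (x(j := t))) \<partial>PiM J M)"
        by (rule nn_integral_cmult) measurable
      also have "\<dots> \<le> a t * ennreal A" using fA by (intro mult_left_mono) auto
      finally show ?thesis using True insert.prems(7) by (simp add: E_def)
    next
      case False
      then have m2: "m \<ge> 2" using m1 by simp
      define U where "U = enn2real (a t)"
      have U: "a t = ennreal U" "0 \<le> U" using at by (auto simp: U_def top.not_eq_extremum)
      have IH: "(\<integral>\<^sup>+x. ennreal (f (x(j := t)) powr (m / (m - 1))) \<partial>PiM J M) \<le> ennreal (U powr (m / (m - 1)))"
        unfolding m_def
        by (rule insert.IH[where f="\<lambda>x. f (x(j := t))" and G="\<lambda>x. G (x(j := t))"], use m2 in \<open>simp add: m_def\<close>,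
            rule ft, rule Gt, rule f0, rule sl, assumption+, use U in \<open>simp add: a_def\<close>, rule U(2))
      have "(\<integral>\<^sup>+x. ennreal ((f (x(j := t)) powr (m / (m - 1))) powr (1 - 1 / m) * f (x(j := t)) powr (1 / m)) \<partial>PiM J M)
        \<le> ennreal ((U powr (m / (m - 1))) powr (1 - 1 / m) * A powr (1 / m))"
        using IH fA f0 insert.prems(7) m2 by (intro nn_integral_Holder) auto
      moreover have "real m / real (m - 1) * (1 - 1 / real m) = 1" using m2 by (simp add: field_simps of_nat_diff)
      ultimately show ?thesis using U insert.prems(7) f0
        by (simp add: powr_powr powr_add E_def ennreal_mult)
    qed
  qed
  have "(\<integral>\<^sup>+x. ennreal (f x powr E) \<partial>PiM (insert j J) M)
      = (\<integral>\<^sup>+t. (\<integral>\<^sup>+x. ennreal (f (x(j := t)) powr E) \<partial>PiM J M) \<partial>M j)"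
    by (subst product_nn_integral_insert_rev) auto
  also have "\<dots> \<le> (\<integral>\<^sup>+t. a t * ennreal (A powr (E - 1)) \<partial>M j)"
    using fin slice by (intro nn_integral_mono_AE) auto
  also have "\<dots> = (\<integral>\<^sup>+t. a t \<partial>M j) * ennreal (A powr (E - 1))" by (rule nn_integral_multc) measurable
  also have "\<dots> \<le> ennreal A * ennreal (A powr (E - 1))" using aA by (intro mult_right_mono) auto
  also have "\<dots> = ennreal (A powr E)"
    using insert.prems(7) m1 by (cases "A = 0") (auto simp: ennreal_mult[symmetric] E_def powr_add)
  finally show ?case unfolding E .
qed simp

text \<open>\<open>lborel\<close> is the image of the product of one-dimensional Lebesgue measures
  under the coordinate map \<open>S\<close>, which carries the product inequality over to a
  Euclidean space.\<close>

lemma GNS_lborel: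
  fixes f G :: "'a::euclidean_space \<Rightarrow> real"
  assumes N: "2 \<le> DIM('a)"
    and [measurable]: "f \<in> borel_measurable borel" "G \<in> borel_measurable borel"
    and f0: "\<And>x. 0 \<le> f x"
    and fG: "\<And>x b. b \<in> Basis \<Longrightarrow> ennreal (f x) \<le> (\<integral>\<^sup>+t. ennreal (G (x + t *\<^sub>R b)) \<partial>lborel)"
    and A: "(\<integral>\<^sup>+x. ennreal (G x) \<partial>lborel) \<le> ennreal A" "0 \<le> A"
  shows "(\<integral>\<^sup>+x. ennreal (f x powr (DIM('a) / (DIM('a) - 1))) \<partial>lborel)
    \<le> ennreal (A powr (DIM('a) / (DIM('a) - 1)))"
proof -
  interpret product_sigma_finite "\<lambda>b::'a. lborel :: real measure" by standard
  define S where "S \<sigma> = (\<Sum>b\<in>Basis. \<sigma> b *\<^sub>R b)" for \<sigma> :: "'a \<Rightarrow> real"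
  have lb: "(lborel :: 'a measure) = distr (\<Pi>\<^sub>M b\<in>Basis. lborel) borel S"
    unfolding S_def by (simp add: lborel_def[where 'a='a] lborel_eq_real)
  have S[measurable]: "S \<in> borel_measurable (\<Pi>\<^sub>M b\<in>Basis. (lborel :: real measure))"
    unfolding S_def by measurable
  have "(\<integral>\<^sup>+\<sigma>. ennreal (f (S \<sigma>) powr (DIM('a) / (DIM('a) - 1))) \<partial>(\<Pi>\<^sub>M b\<in>Basis. lborel))
    \<le> ennreal (A powr (DIM('a) / (DIM('a) - 1)))"
  proof (rule Nirenberg_induction[where G="\<lambda>\<sigma>. ennreal (G (S \<sigma>))"])
    show "(\<integral>\<^sup>+x. ennreal (G (S x)) \<partial>(\<Pi>\<^sub>M b\<in>Basis. lborel)) \<le> ennreal A"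
      using A(1) unfolding lb by (subst (asm) nn_integral_distr) auto
    fix \<sigma> :: "'a \<Rightarrow> real" and b :: 'a assume b: "b \<in> Basis"
    \<comment> \<open>The hypothesis parametrises a line by the displacement from the point, the
      product space by the absolute coordinate; translation invariance reconciles the two.\<close>
    have "S (\<sigma>(b := t)) = S \<sigma> + (t - \<sigma> b) *\<^sub>R b" for t
      using b by (simp add: S_def sum.remove[OF finite_Basis b] algebra_simps)
    then have "(\<integral>\<^sup>+t. ennreal (G (S (\<sigma>(b := t)))) \<partial>lborel) = (\<integral>\<^sup>+t. ennreal (G (S \<sigma> + (t - \<sigma> b) *\<^sub>R b)) \<partial>lborel)"
      by simp
    also have "\<dots> = (\<integral>\<^sup>+t. ennreal (G (S \<sigma> + t *\<^sub>R b)) \<partial>lborel)"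
      by (subst nn_integral_real_affine[where c=1 and t="\<sigma> b"]) auto
    finally show "ennreal (f (S \<sigma>)) \<le> (\<integral>\<^sup>+t. ennreal (G (S (\<sigma>(b := t)))) \<partial>lborel)"
      using fG[OF b, of "S \<sigma>"] by simp
  qed (use N f0 A in \<open>auto\<close>)
  then show ?thesis unfolding lb by (subst nn_integral_distr) auto
qed

text \<open>\<open>\<bar>\<phi>\<bar>\<close> raised to a variable power need not be differentiable where \<open>\<phi> = 0\<close>, so the Sobolev inequality is stated for
  functions with a continuous upper bound on their pointwise Lipschitz constant.\<close>

definition lip_at :: "('a::metric_space \<Rightarrow> real) \<Rightarrow> 'a \<Rightarrow> real \<Rightarrow> bool" where
  "lip_at f x c \<longleftrightarrow> (\<forall>\<delta>>0. \<forall>\<^sub>F y in at x. \<bar>f y - f x\<bar> \<le> (c + \<delta>) * dist y x)"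

text \<open>A substitute for the fundamental theorem of calculus. With an additional error
  \<delta>(b - a) the estimate is additive under juxtaposition of intervals and true near every
  point, so the bisection principle \<open>Bolzano\<close> extends it to the whole interval; finally
  \<delta> tends to 0.\<close>

lemma lip_at_le_integral:
  fixes \<phi> g :: "real \<Rightarrow> real"
  assumes lip: "\<And>t. lip_at \<phi> t (g t)" and g: "continuous_on UNIV g" and ab: "a \<le> b"
  shows "\<phi> b - \<phi> a \<le> integral {a..b} g"
proof -
  have int: "g integrable_on {c..d}" for c d
    using g by (intro integrable_continuous_interval) (auto intro: continuous_on_subset)
  have eps: "\<phi> b - \<phi> a \<le> integral {a..b} g + \<delta> * (b - a)" if \<delta>: "\<delta> > 0" for \<delta>
    using ab
  proof (induction rule: Bolzano)
    case (trans u v w)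
    then have "integral {u..v} g + integral {v..w} g = integral {u..w} g"
      by (intro Henstock_Kurzweil_Integration.integral_combine int) auto
    then show ?case using trans by (simp add: algebra_simps)
  next
    case (local x)
    have "\<forall>\<^sub>F y in at x. \<bar>\<phi> y - \<phi> x\<bar> \<le> (g x + \<delta> / 2) * dist y x"
      using lip[of x] \<delta> by (simp add: lip_at_def)
    then obtain d1 where d1: "d1 > 0"
      "\<And>y. y \<noteq> x \<Longrightarrow> dist y x < d1 \<Longrightarrow> \<bar>\<phi> y - \<phi> x\<bar> \<le> (g x + \<delta> / 2) * dist y x"
      unfolding eventually_at by auto
    have "isCont g x" using g by (simp add: continuous_on_eq_continuous_at)
    then obtain d2 where d2: "d2 > 0" "\<And>y. dist y x < d2 \<Longrightarrow> dist (g y) (g x) < \<delta> / 2"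
      using \<delta> unfolding continuous_at_eps_delta by (metis half_gt_zero)
    have "\<phi> v - \<phi> u \<le> integral {u..v} g + \<delta> * (v - u)" if uv: "u \<le> x" "x \<le> v" "v - u < min d1 d2" for u v
    proof -
      have "\<bar>\<phi> v - \<phi> x\<bar> \<le> (g x + \<delta> / 2) * (v - x)"
        using d1(2)[of v] uv by (cases "v = x") (auto simp: dist_real_def)
      moreover have "\<bar>\<phi> u - \<phi> x\<bar> \<le> (g x + \<delta> / 2) * (x - u)"
        using d1(2)[of u] uv by (cases "u = x") (auto simp: dist_real_def)
      ultimately have "\<phi> v - \<phi> u \<le> (g x + \<delta> / 2) * (v - x) + (g x + \<delta> / 2) * (x - u)" by linarith
      then have 1: "\<phi> v - \<phi> u \<le> (g x + \<delta> / 2) * (v - u)" by (simp add: field_simps)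
      have "g x - \<delta> / 2 \<le> g y" if "y \<in> {u..v}" for y
      proof -
        have "dist y x < d2" using that uv by (auto simp: dist_real_def)
        from d2(2)[OF this] show ?thesis by (simp add: dist_real_def abs_if split: if_splits)
      qed
      then have "integral {u..v} (\<lambda>_. g x - \<delta> / 2) \<le> integral {u..v} g"
        by (intro integral_le int) auto
      then have "(g x - \<delta> / 2) * (v - u) \<le> integral {u..v} g" using uv by (simp add: mult.commute)
      moreover have "(g x + \<delta> / 2) * (v - u) = (g x - \<delta> / 2) * (v - u) + \<delta> * (v - u)"
        by (simp add: algebra_simps)
      ultimately show ?thesis using 1 by linarith
    qed
    then show ?case using d1(1) d2(1) by (intro exI[of _ "min d1 d2"]) auto
  qed
  \<comment> \<open>The denominator b - a + 1 spares a separate case for a = b.\<close>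
  have *: "\<phi> b - \<phi> a \<le> integral {a..b} g + \<delta>" if "\<delta> > 0" for \<delta>
  proof -
    have "\<phi> b - \<phi> a \<le> integral {a..b} g + \<delta> / (b - a + 1) * (b - a)"
      using eps[of "\<delta> / (b - a + 1)"] that ab by simp
    also have "\<delta> / (b - a + 1) * (b - a) \<le> \<delta>" using that ab by (simp add: field_simps)
    finally show ?thesis by simp
  qed
  show ?thesis by (rule field_le_epsilon) (use * in auto)
qed

text \<open>f vanishes outside a bounded set, so its value at x is its increment along a segment in
  a coordinate direction that starts beyond that set; this is at most the integral of G over the
  whole line.\<close>

lemma GNS_upper_gradient:
  fixes f G :: "'a::euclidean_space \<Rightarrow> real"
  assumes N: "2 \<le> DIM('a)"
    and f: "continuous_on UNIV f" "\<And>x. 0 \<le> f x" "\<And>x. x \<notin> K \<Longrightarrow> f x = 0" and K: "bounded K"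
    and G: "continuous_on UNIV G" "\<And>x. 0 \<le> G x"
    and lip: "\<And>x. lip_at f x (G x)"
    and A: "(\<integral>\<^sup>+x. ennreal (G x) \<partial>lborel) \<le> ennreal A" "0 \<le> A"
  shows "(\<integral>\<^sup>+x. ennreal (f x powr (DIM('a) / (DIM('a) - 1))) \<partial>lborel)
    \<le> ennreal (A powr (DIM('a) / (DIM('a) - 1)))"
proof (rule GNS_lborel[OF N _ _ _ _ A])
  show "f \<in> borel_measurable borel" "G \<in> borel_measurable borel"
    using f G by (auto intro: borel_measurable_continuous_onI)
  fix x b :: 'a assume b: "b \<in> Basis"
  obtain R where R: "R > 0" "\<And>y. y \<in> K \<Longrightarrow> norm y < R"
    using K by (metis bounded_pos_less)
  define c where "c = - (R + norm x)"
  have c: "c \<le> 0" using R norm_ge_zero[of x] unfolding c_def by linarith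
  have "norm (x + c *\<^sub>R b) \<ge> norm (c *\<^sub>R b) - norm x" by (metis add.commute norm_diff_ineq)
  then have "norm (x + c *\<^sub>R b) \<ge> R" using b R by (simp add: c_def)
  then have fc: "f (x + c *\<^sub>R b) = 0" using R(2) f(3) by force
  define g where "g t = G (x + t *\<^sub>R b)" for t
  have g: "continuous_on UNIV g" unfolding g_def
    by (intro continuous_on_compose2[OF G(1)] continuous_intros) auto
  have "f (x + 0 *\<^sub>R b) - f (x + c *\<^sub>R b) \<le> integral {c..0} g"
  proof (rule lip_at_le_integral[OF _ g c])
    fix t
    show "lip_at (\<lambda>t. f (x + t *\<^sub>R b)) t (g t)"
      unfolding lip_at_def
    proof safe
      fix \<delta> :: real assume "\<delta> > 0"
      then have "\<forall>\<^sub>F y in at (x + t *\<^sub>R b). \<bar>f y - f (x + t *\<^sub>R b)\<bar> \<le> (g t + \<delta>) * dist y (x + t *\<^sub>R b)"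
        using lip[of "x + t *\<^sub>R b"] by (simp add: lip_at_def g_def)
      moreover have "filterlim (\<lambda>s. x + s *\<^sub>R b) (at (x + t *\<^sub>R b)) (at t)"
        unfolding filterlim_at using b by (auto intro!: tendsto_eq_intros simp: eventually_at_filter)
      ultimately have "\<forall>\<^sub>F s in at t. \<bar>f (x + s *\<^sub>R b) - f (x + t *\<^sub>R b)\<bar> \<le> (g t + \<delta>) * dist (x + s *\<^sub>R b) (x + t *\<^sub>R b)"
        unfolding filterlim_iff by blast
      moreover have "dist (x + s *\<^sub>R b) (x + t *\<^sub>R b) = dist s t" for s
        using b by (simp add: dist_norm scaleR_left_diff_distrib[symmetric])
      ultimately show "\<forall>\<^sub>F s in at t. \<bar>f (x + s *\<^sub>R b) - f (x + t *\<^sub>R b)\<bar> \<le> (g t + \<delta>) * dist s t" by simp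
    qed
  qed
  then have "ennreal (f x) \<le> ennreal (integral {c..0} g)" using fc by (simp add: ennreal_leI)
  also have "\<dots> = (\<integral>\<^sup>+t. ennreal (indicator {c..0} t * g t) \<partial>lborel)"
  proof (rule nn_integral_has_integral_lborel[symmetric])
    have [measurable]: "g \<in> borel_measurable borel" using g by (rule borel_measurable_continuous_onI)
    show "(\<lambda>t. indicator {c..0} t * g t) \<in> borel_measurable borel" by measurable
    have "(g has_integral integral {c..0} g) {c..0}"
      using g by (intro integrable_integral integrable_continuous_interval) (auto intro: continuous_on_subset)
    moreover have "(\<lambda>t. indicator {c..0} t * g t) = (\<lambda>t. if t \<in> {c..0} then g t else 0)"
      by (auto simp: fun_eq_iff)
    ultimately show "((\<lambda>t. indicator {c..0} t * g t) has_integral integral {c..0} g) UNIV"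
      using has_integral_restrict_UNIV[of "{c..0}" g] by simp
  qed (auto simp: g_def G)
  also have "\<dots> \<le> (\<integral>\<^sup>+t. ennreal (g t) \<partial>lborel)"
    using G(2) by (intro nn_integral_mono ennreal_leI) (auto simp: g_def indicator_def)
  finally show "ennreal (f x) \<le> (\<integral>\<^sup>+t. ennreal (G (x + t *\<^sub>R b)) \<partial>lborel)" by (simp add: g_def)
qed (use f in auto)

subsection \<open>Smooth functions\<close>

text \<open>One-dimensional smoothness, closed under composition by the chain rule; \<open>C_k\<close> is reduced to it.\<close>

primrec D_k :: "nat \<Rightarrow> (real \<Rightarrow> real) \<Rightarrow> bool" where
  "D_k 0 f \<longleftrightarrow> continuous_on UNIV f"
| "D_k (Suc k) f \<longleftrightarrow> (\<exists>f'. (\<forall>t. (f has_real_derivative f' t) (at t)) \<and> D_k k f')"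

lemma D_k_SucI: "(\<And>t. (f has_real_derivative f' t) (at t)) \<Longrightarrow> D_k k f' \<Longrightarrow> D_k (Suc k) f"
  unfolding D_k.simps by blast

lemma has_real_derivative_continuous_on:
  "(\<And>t. (f has_real_derivative f' t) (at t)) \<Longrightarrow> continuous_on UNIV f"
  by (meson DERIV_isCont continuous_at_imp_continuous_on)

lemma D_k_SucD: "D_k (Suc k) f \<Longrightarrow> D_k k f"
proof (induction k arbitrary: f)
  case 0
  then show ?case unfolding D_k.simps by (meson has_real_derivative_continuous_on)
next
  case (Suc k)
  then obtain f' where f': "\<And>t. (f has_real_derivative f' t) (at t)" "D_k (Suc k) f'" by auto
  show ?case by (rule D_k_SucI[OF f'(1) Suc.IH[OF f'(2)]])
qed

lemma D_k_continuous: "D_k k f \<Longrightarrow> continuous_on UNIV f"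
proof (induction k)
  case (Suc k)
  then show ?case by (blast dest: D_k_SucD)
qed simp

lemma D_k_add: "D_k k f \<Longrightarrow> D_k k g \<Longrightarrow> D_k k (\<lambda>t. f t + g t)"
proof (induction k arbitrary: f g)
  case (Suc k)
  then obtain f' g' where "\<And>t. (f has_real_derivative f' t) (at t)" "D_k k f'"
    "\<And>t. (g has_real_derivative g' t) (at t)" "D_k k g'" by auto
  then show ?case using Suc.IH[of f' g'] by (intro D_k_SucI[where f'="\<lambda>t. f' t + g' t"] DERIV_add)
qed (auto intro!: continuous_intros)

lemma D_k_mult: "D_k k f \<Longrightarrow> D_k k g \<Longrightarrow> D_k k (\<lambda>t. f t * g t)"
proof (induction k arbitrary: f g)
  case (Suc k)
  then obtain f' g' where *: "\<And>t. (f has_real_derivative f' t) (at t)" "D_k k f'"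
    "\<And>t. (g has_real_derivative g' t) (at t)" "D_k k g'" by auto
  have "D_k k (\<lambda>t. f' t * g t + f t * g' t)"
    using Suc.prems[THEN D_k_SucD] * by (intro D_k_add Suc.IH)
  moreover have "((\<lambda>t. f t * g t) has_real_derivative f' t * g t + f t * g' t) (at t)" for t
    using *(1,3)[of t] by (auto intro!: derivative_eq_intros simp: algebra_simps)
  ultimately show ?case by (rule D_k_SucI[rotated])
qed (auto intro!: continuous_intros)

lemma D_k_cmult: "D_k k f \<Longrightarrow> D_k k (\<lambda>t. c * f t)"
proof (induction k arbitrary: f)
  case (Suc k)
  then obtain f' where *: "\<And>t. (f has_real_derivative f' t) (at t)" "D_k k f'" by auto
  have "((\<lambda>t. c * f t) has_real_derivative c * f' t) (at t)" for t
    using *(1)[of t] by (auto intro!: derivative_eq_intros)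
  then show ?case using Suc.IH[OF *(2)] by (rule D_k_SucI)
qed (auto intro!: continuous_intros)

lemma D_k_affine: "D_k k f \<Longrightarrow> D_k k (\<lambda>t. f (c * t + d))"
proof (induction k arbitrary: f)
  case 0
  then have f: "continuous_on UNIV f" by simp
  have "continuous_on UNIV (\<lambda>t. c * t + d)" by (intro continuous_intros)
  from continuous_on_compose2[OF f this] show ?case by simp
next
  case (Suc k)
  then obtain f' where *: "\<And>t. (f has_real_derivative f' t) (at t)" "D_k k f'" by auto
  have "((\<lambda>t. f (c * t + d)) has_real_derivative c * f' (c * t + d)) (at t)" for t
  proof -
    have "((\<lambda>t. c * t + d) has_real_derivative c) (at t)" by (auto intro!: derivative_eq_intros)
    from DERIV_chain2[where f=f and g="\<lambda>t. c * t + d", OF *(1) this] show ?thesis by (simp add: mult.commute)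
  qed
  then show ?case using D_k_cmult[OF Suc.IH[OF *(2)], of c] by (rule D_k_SucI)
qed

text \<open>The classical flat function exp(-\<epsilon>/t) with the powers of 1/t that
  differentiation produces, so that derivatives are combinations of members of the family. The
  parameter \<epsilon> is kept because letting it tend to 0 turns smooth functions into
  indicators.\<close>

definition exp_inv :: "real \<Rightarrow> nat \<Rightarrow> real \<Rightarrow> real" where
  "exp_inv \<epsilon> k t = (if t > 0 then (1 / t) ^ k * exp (- \<epsilon> / t) else 0)"

lemma exp_inv_tendsto_0:
  assumes "\<epsilon> > 0"
  shows "(exp_inv \<epsilon> k \<longlongrightarrow> 0) (at 0)"
proof (rule filterlim_split_at)
  have "\<forall>\<^sub>F t in at_left (0::real). 0 = exp_inv \<epsilon> k t"
    by (auto simp: eventually_at_left_field exp_inv_def intro!: exI[of _ "-1"])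
  then show "(exp_inv \<epsilon> k \<longlongrightarrow> 0) (at_left 0)" by (rule Lim_transform_eventually[OF tendsto_const])
  have "filterlim (\<lambda>t. \<epsilon> * inverse t) at_top (at_right 0)"
    by (rule filterlim_tendsto_pos_mult_at_top[OF tendsto_const assms filterlim_inverse_at_top_right])
  from filterlim_compose[OF tendsto_power_div_exp_0 this, of k]
  have "((\<lambda>t. (1 / \<epsilon>) ^ k * ((\<epsilon> * inverse t) ^ k / exp (\<epsilon> * inverse t))) \<longlongrightarrow> (1 / \<epsilon>) ^ k * 0) (at_right 0)"
    by (intro tendsto_mult tendsto_const)
  then have "((\<lambda>t. (1 / \<epsilon>) ^ k * ((\<epsilon> * inverse t) ^ k / exp (\<epsilon> * inverse t))) \<longlongrightarrow> 0) (at_right 0)" by simp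
  moreover have "\<forall>\<^sub>F t in at_right (0::real).
      (1 / \<epsilon>) ^ k * ((\<epsilon> * inverse t) ^ k / exp (\<epsilon> * inverse t)) = exp_inv \<epsilon> k t"
    using assms by (auto simp: eventually_at_right_field exp_inv_def power_mult_distrib power_divide
        exp_minus field_simps intro!: exI[of _ 1])
  ultimately show "(exp_inv \<epsilon> k \<longlongrightarrow> 0) (at_right 0)" by (rule Lim_transform_eventually)
qed

lemma exp_inv_derivative:
  assumes "\<epsilon> > 0"
  shows "(exp_inv \<epsilon> k has_real_derivative
    \<epsilon> * exp_inv \<epsilon> (Suc (Suc k)) t - real k * exp_inv \<epsilon> (Suc k) t) (at t)"
proof -
  consider "t > 0" | "t = 0" | "t < 0" by linarith
  then show ?thesis
  proof cases
    case 1
    have "((\<lambda>t. (1 / t) ^ k * exp (- \<epsilon> / t)) has_real_derivative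
      \<epsilon> * ((1 / t) ^ Suc (Suc k) * exp (- \<epsilon> / t)) - real k * ((1 / t) ^ Suc k * exp (- \<epsilon> / t))) (at t)"
    proof (cases k)
      case (Suc l)
      have "((\<lambda>t. 1 / t) has_real_derivative - ((1 / t)\<^sup>2)) (at t)"
        using 1 by (auto intro!: derivative_eq_intros simp: field_simps power2_eq_square)
      from DERIV_power[OF this, of k]
      have 1: "((\<lambda>t. (1 / t) ^ k) has_real_derivative - real k * (1 / t) ^ Suc k) (at t)"
        by (simp add: Suc power2_eq_square algebra_simps add_divide_distrib diff_divide_distrib)
      have "((\<lambda>t. exp (- \<epsilon> / t)) has_real_derivative \<epsilon> * (1 / t)\<^sup>2 * exp (- \<epsilon> / t)) (at t)"
        using \<open>t > 0\<close> by (auto intro!: derivative_eq_intros simp: field_simps power2_eq_square)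
      from DERIV_mult[OF 1 this] show ?thesis
        by (simp add: power2_eq_square algebra_simps)
    qed (use 1 in \<open>auto intro!: derivative_eq_intros simp: field_simps power2_eq_square\<close>)
    then show ?thesis using 1
      by (subst has_field_derivative_cong_eventually[where g="\<lambda>t. (1 / t) ^ k * exp (- \<epsilon> / t)"])
        (auto simp: exp_inv_def eventually_at dist_real_def intro!: exI[of _ t])
  next
    case 2
    \<comment> \<open>At 0 the difference quotient is itself the next member of the family, and its
      limit is known.\<close>
    have "(\<lambda>h. (exp_inv \<epsilon> k (0 + h) - exp_inv \<epsilon> k 0) / h) = exp_inv \<epsilon> (Suc k)"
      by (auto simp: exp_inv_def fun_eq_iff)
    then show ?thesis using 2 exp_inv_tendsto_0[OF assms, of "Suc k"]
      by (auto simp: DERIV_def exp_inv_def)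
  next
    case 3
    then show ?thesis
      by (subst has_field_derivative_cong_eventually[where g="\<lambda>t. 0"])
        (auto simp: exp_inv_def eventually_at dist_real_def intro!: exI[of _ "-t"])
  qed
qed

lemma D_k_exp_inv: "\<epsilon> > 0 \<Longrightarrow> D_k n (exp_inv \<epsilon> k)"
proof (induction n arbitrary: k)
  case 0
  then show ?case by (auto intro!: has_real_derivative_continuous_on[OF exp_inv_derivative])
next
  case (Suc n)
  have "D_k n (\<lambda>t. \<epsilon> * exp_inv \<epsilon> (Suc (Suc k)) t + (- real k) * exp_inv \<epsilon> (Suc k) t)"
    using Suc by (intro D_k_add D_k_cmult)
  then show ?case using exp_inv_derivative[OF Suc.prems, of k] by (intro D_k_SucI) auto
qed

text \<open>Not a normalised mollifier: the values stay in [0, 1], the function vanishes outside the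
  interval from a to b for every j, and the limit in j is the indicator of the open
  interval.\<close>

definition bump :: "real \<Rightarrow> real \<Rightarrow> nat \<Rightarrow> real \<Rightarrow> real" where
  "bump a b j t = exp_inv (1 / real (Suc j)) 0 (t - a) * exp_inv (1 / real (Suc j)) 0 (b - t)"

lemma D_k_bump: "D_k n (bump a b j)"
  using D_k_mult[OF D_k_affine[OF D_k_exp_inv[of "1 / real (Suc j)" n 0], of 1 "-a"]
      D_k_affine[OF D_k_exp_inv[of "1 / real (Suc j)" n 0], of "-1" b]]
  unfolding bump_def by (simp add: algebra_simps)

lemma bump_bounds: "0 \<le> bump a b j t" "bump a b j t \<le> 1"
proof -
  have *: "0 \<le> exp_inv (1 / real (Suc j)) 0 t \<and> exp_inv (1 / real (Suc j)) 0 t \<le> 1" for t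
    by (auto simp: exp_inv_def)
  show "0 \<le> bump a b j t" using * by (simp add: bump_def)
  show "bump a b j t \<le> 1" using * unfolding bump_def by (intro mult_le_one) auto
qed

lemma bump_eq_0: "t \<le> a \<or> b \<le> t \<Longrightarrow> bump a b j t = 0"
  by (auto simp: bump_def exp_inv_def)

lemma exp_inv_tendsto_1: "t > 0 \<Longrightarrow> (\<lambda>j. exp_inv (1 / real (Suc j)) 0 t) \<longlonglongrightarrow> 1"
proof -
  assume "t > 0"
  have "(\<lambda>j. exp (- (1 / real (Suc j)) / t)) \<longlonglongrightarrow> exp (- 0 / t)"
    using \<open>t > 0\<close> by (intro tendsto_exp tendsto_divide tendsto_minus tendsto_const) (auto simp: lim_1_over_n LIMSEQ_Suc[OF lim_1_over_n, simplified])
  then show ?thesis using \<open>t > 0\<close> by (simp add: exp_inv_def)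
qed

lemma bump_tendsto: "(\<lambda>j. bump a b j t) \<longlonglongrightarrow> indicator {a<..<b} t"
proof (cases "a < t \<and> t < b")
  case True
  then have "(\<lambda>j. bump a b j t) \<longlonglongrightarrow> 1 * 1"
    unfolding bump_def by (intro tendsto_mult exp_inv_tendsto_1) auto
  then show ?thesis using True by simp
qed (auto simp: bump_eq_0)

text \<open>The right end moves off with j, so its factor is squeezed between the value of
  \<open>exp_inv\<close> at 1 and the number 1. What remains is a smooth approximation of a
  half-line, as truncations need it.\<close>

lemma bump_tendsto_at_top: "a < t \<Longrightarrow> (\<lambda>j. bump a (b + real j) j t) \<longlonglongrightarrow> 1"
proof -
  assume at: "a < t"
  obtain J where J: "real J \<ge> t - b + 1" using real_arch_simple by blast
  have "(\<lambda>j. exp_inv (1 / real (Suc j)) 0 (b + real j - t)) \<longlonglongrightarrow> 1"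
  proof (rule tendsto_sandwich[OF _ _ exp_inv_tendsto_1[of 1] tendsto_const])
    show "\<forall>\<^sub>F j in sequentially. exp_inv (1 / real (Suc j)) 0 1 \<le> exp_inv (1 / real (Suc j)) 0 (b + real j - t)"
      using eventually_ge_at_top[of J]
    proof eventually_elim
      case (elim j)
      then have "b + real j - t \<ge> 1" using J of_nat_mono[OF elim, where 'a=real] by linarith
      then show ?case by (auto simp: exp_inv_def frac_le)
    qed
    show "\<forall>\<^sub>F j in sequentially. exp_inv (1 / real (Suc j)) 0 (b + real j - t) \<le> 1"
      by (auto simp: exp_inv_def)
  qed simp
  then have "(\<lambda>j. bump a (b + real j) j t) \<longlonglongrightarrow> 1 * 1"
    unfolding bump_def using at by (intro tendsto_mult exp_inv_tendsto_1) auto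
  then show ?thesis by simp
qed

section \<open>Gradients, the classes \<open>C_k\<close> and test functions\<close>

lemma has_derivative_grad:
  fixes f :: "real ^ 'n \<Rightarrow> real"
  assumes "f differentiable at x"
  shows "(f has_derivative (\<lambda>h. grad f x \<bullet> h)) (at x)"
proof -
  let ?D = "frechet_derivative f (at x)"
  have D: "(f has_derivative ?D) (at x)" using assms by (simp add: frechet_derivative_works)
  then interpret linear ?D by (rule has_derivative_linear)
  have "?D h = grad f x \<bullet> h" for h
  proof -
    have "?D h = ?D (\<Sum>i\<in>UNIV. (h $ i) *\<^sub>R axis i 1)" by (simp add: basis_expansion scalar_mult_eq_scaleR[symmetric])
    also have "\<dots> = grad f x \<bullet> h" by (simp add: sum scale inner_vec_def grad_def mult.commute)
    finally show ?thesis .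
  qed
  with D show ?thesis by (metis (no_types, lifting) ext)
qed

lemma grad_eqI:
  fixes f :: "real ^ 'n \<Rightarrow> real"
  assumes "(f has_derivative (\<lambda>h. g \<bullet> h)) (at x)"
  shows "grad f x = g"
  using frechet_derivative_at[OF assms, symmetric]
  by (simp add: grad_def vec_eq_iff inner_axis)

lemma grad_add:
  fixes f g :: "real ^ 'n \<Rightarrow> real"
  assumes "f differentiable at x" "g differentiable at x"
  shows "grad (\<lambda>x. f x + g x) x = grad f x + grad g x"
  by (rule grad_eqI) (use has_derivative_add[OF assms[THEN has_derivative_grad]] in \<open>simp add: inner_add_left\<close>)

lemma grad_mult:
  fixes f g :: "real ^ 'n \<Rightarrow> real"
  assumes "f differentiable at x" "g differentiable at x"
  shows "grad (\<lambda>x. f x * g x) x = f x *\<^sub>R grad g x + g x *\<^sub>R grad f x"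
  by (rule grad_eqI) (use has_derivative_mult[OF assms[THEN has_derivative_grad]] in
      \<open>simp add: inner_add_left mult.commute\<close>)

lemma has_derivative_compose_real:
  fixes f :: "real ^ 'n \<Rightarrow> real"
  assumes "f differentiable at x" "(h has_real_derivative h') (at (f x))"
  shows "((\<lambda>x. h (f x)) has_derivative (\<lambda>v. (h' *\<^sub>R grad f x) \<bullet> v)) (at x)"
  using has_derivative_compose[OF has_derivative_grad[OF assms(1)], of h "\<lambda>v. h' * v"] assms(2)
  by (simp add: has_field_derivative_def)

lemma grad_compose:
  fixes f :: "real ^ 'n \<Rightarrow> real"
  assumes "f differentiable at x" "(h has_real_derivative h') (at (f x))"
  shows "grad (\<lambda>x. h (f x)) x = h' *\<^sub>R grad f x"
  by (rule grad_eqI, rule has_derivative_compose_real[OF assms])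

lemma C_k_SucD: "C_k (Suc k) f \<Longrightarrow> C_k k f"
proof (induction k arbitrary: f)
  case 0
  then show ?case
    by (simp add: continuous_at_imp_continuous_on differentiable_imp_continuous_within)
next
  case (Suc k)
  then show ?case by (metis C_k.simps(2))
qed

lemma C_k_const: "C_k k (\<lambda>_ :: real ^ 'n. c)"
proof (induction k arbitrary: c)
  case (Suc k)
  have "grad (\<lambda>_. c) = (\<lambda>_ :: real ^ 'n. 0)" by (rule ext, rule grad_eqI) simp
  with Suc show ?case by simp
qed simp

lemma C_k_add: "C_k k f \<Longrightarrow> C_k k g \<Longrightarrow> C_k k (\<lambda>x. f x + g x)"
proof (induction k arbitrary: f g)
  case (Suc k)
  then have "f differentiable (at x)" "g differentiable (at x)" for x by auto
  then show ?case using Suc by (simp add: grad_add)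
qed (auto intro!: continuous_intros)

lemma C_k_mult: "C_k k f \<Longrightarrow> C_k k g \<Longrightarrow> C_k k (\<lambda>x. f x * g x)"
proof (induction k arbitrary: f g)
  case (Suc k)
  then have "f differentiable (at x)" "g differentiable (at x)" for x by auto
  with Suc.prems[THEN C_k_SucD] Suc.prems show ?case by (simp add: grad_mult C_k_add Suc.IH)
qed (auto intro!: continuous_intros)

lemma C_k_prod: "finite I \<Longrightarrow> (\<And>i. i \<in> I \<Longrightarrow> C_k k (f i)) \<Longrightarrow> C_k k (\<lambda>x. \<Prod>i\<in>I. f i x)"
  by (induction I rule: finite_induct) (auto intro!: C_k_const C_k_mult)

lemma C_k_nth: "C_k k (\<lambda>x :: real ^ 'n. x $ i)"
proof (cases k)
  case (Suc k')
  have "((\<lambda>x. x $ i) has_derivative (\<lambda>h. axis i 1 \<bullet> h)) (at x)" for x :: "real ^ 'n"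
    using bounded_linear_imp_has_derivative[OF bounded_linear_vec_nth] by (simp add: inner_axis')
  then have "grad (\<lambda>x. x $ i) x = axis i 1" "(\<lambda>x. x $ i) differentiable (at x)" for x :: "real ^ 'n"
    by (blast intro: grad_eqI differentiableI)+
  with Suc show ?thesis by (simp add: C_k_const)
qed (auto intro!: continuous_intros)

lemma C_k_compose: "D_k k h \<Longrightarrow> C_k k f \<Longrightarrow> C_k k (\<lambda>x. h (f x))"
proof (induction k arbitrary: h)
  case 0
  then show ?case using continuous_on_compose2[of UNIV h UNIV f] by simp
next
  case (Suc k)
  then obtain h' where h': "\<And>t. (h has_real_derivative h' t) (at t)" "D_k k h'" by auto
  have f: "f differentiable (at x)" for x using Suc.prems by simp
  have "grad (\<lambda>x. h (f x)) x $ i = h' (f x) * grad f x $ i" for x i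
    by (simp add: grad_compose[OF f h'(1)])
  moreover have "(\<lambda>x. h (f x)) differentiable (at x)" for x
    using has_derivative_compose_real[OF f h'(1)] unfolding differentiable_def by blast
  moreover have "C_k k (\<lambda>x. h' (f x))" using Suc.IH[OF h'(2)] C_k_SucD[OF Suc.prems(2)] .
  ultimately show ?case using Suc.prems by (simp add: C_k_mult)
qed

lemma not_in_closure_Collect: "x \<notin> closure {x. P x} \<Longrightarrow> \<not> P x"
  by (meson closure_subset mem_Collect_eq subsetD)

lemma test_functionsD:
  assumes "\<phi> \<in> test_functions \<Omega>"
  shows "C_k k \<phi>" "\<phi> differentiable (at x)" "continuous_on UNIV \<phi>" "continuous_on UNIV (grad \<phi>)"
    "compact (closure {x. \<phi> x \<noteq> 0})" "closure {x. \<phi> x \<noteq> 0} \<subseteq> \<Omega>"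
    "x \<notin> closure {x. \<phi> x \<noteq> 0} \<Longrightarrow> \<phi> x = 0" "x \<notin> closure {x. \<phi> x \<noteq> 0} \<Longrightarrow> grad \<phi> x = 0"
proof -
  have C: "C_k k \<phi>" for k using assms by (simp add: test_functions_def)
  then show "C_k k \<phi>" .
  from C[of "Suc 0"] show "\<phi> differentiable (at x)" by simp
  show "continuous_on UNIV \<phi>" using C[of 0] by simp
  have "continuous_on UNIV (\<lambda>x. \<chi> i. grad \<phi> x $ i)"
    using C[of "Suc 0"] by (intro continuous_on_vec_lambda) simp
  then show "continuous_on UNIV (grad \<phi>)" by simp
  show "compact (closure {x. \<phi> x \<noteq> 0})" "closure {x. \<phi> x \<noteq> 0} \<subseteq> \<Omega>"
    using assms by (simp_all add: test_functions_def)
  show "x \<notin> closure {x. \<phi> x \<noteq> 0} \<Longrightarrow> \<phi> x = 0" using not_in_closure_Collect by blast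
  show "grad \<phi> x = 0" if "x \<notin> closure {x. \<phi> x \<noteq> 0}"
  proof (rule grad_eqI)
    have "((\<lambda>_. 0 :: real) has_derivative (\<lambda>h. 0 \<bullet> h)) (at x)" by simp
    moreover have "\<forall>\<^sub>F y in nhds x. 0 = \<phi> y"
    proof -
      have "\<forall>\<^sub>F y in nhds x. y \<in> - closure {x. \<phi> x \<noteq> 0}"
        using that by (intro eventually_nhds_in_open) auto
      then show ?thesis by eventually_elim (use not_in_closure_Collect in fastforce)
    qed
    moreover have "\<phi> x = 0" using not_in_closure_Collect[OF that] by simp
    ultimately show "(\<phi> has_derivative (\<lambda>h. 0 \<bullet> h)) (at x)"
      using has_derivative_transform_eventually[of "\<lambda>_. 0" "\<lambda>h. 0 \<bullet> h" x UNIV \<phi>]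
      by (metis (mono_tags, lifting) UNIV_I eventually_nhds_conv_at)
  qed
qed

lemma test_functionsI:
  assumes "\<And>k. C_k k \<phi>" "{x. \<phi> x \<noteq> 0} \<subseteq> K" "compact K" "K \<subseteq> \<Omega>"
  shows "\<phi> \<in> test_functions \<Omega>"
proof -
  have "closure {x. \<phi> x \<noteq> 0} \<subseteq> K" using assms by (simp add: closure_minimal compact_imp_closed)
  moreover from this have "compact (closure {x. \<phi> x \<noteq> 0})"
    using assms(3) compact_Int_closed[of K "closure {x. \<phi> x \<noteq> 0}"] by (simp add: Int_absorb1)
  ultimately show ?thesis using assms by (auto simp: test_functions_def)
qed

text \<open>The value of G at 0 keeps the support from growing. In this way smooth truncations can
  act on approximating sequences.\<close>

lemma test_functions_compose:
  assumes "\<phi> \<in> test_functions \<Omega>" "\<And>k. D_k k G" "G 0 = 0"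
  shows "(\<lambda>x. G (\<phi> x)) \<in> test_functions \<Omega>"
proof (rule test_functionsI)
  show "{x. G (\<phi> x) \<noteq> 0} \<subseteq> closure {x. \<phi> x \<noteq> 0}"
    using assms(3) closure_subset[of "{x. \<phi> x \<noteq> 0}"] by (smt (verit) mem_Collect_eq subset_iff)
  show "C_k k (\<lambda>x. G (\<phi> x))" for k by (rule C_k_compose[OF assms(2) test_functionsD(1)[OF assms(1)]])
qed (use test_functionsD(5,6)[OF assms(1)] in auto)

section \<open>Integration by parts and weak gradients of test functions\<close>

lemma bounded_cont_compact_support:
  fixes f :: "'a::euclidean_space \<Rightarrow> 'b::real_normed_vector"
  assumes "continuous_on UNIV f" "compact K" "\<And>x. x \<notin> K \<Longrightarrow> f x = 0"
  obtains M where "M > 0" "\<And>x. norm (f x) \<le> M"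
proof -
  have "compact (f ` K)" using assms by (intro compact_continuous_image) (auto intro: continuous_on_subset)
  then obtain M where M: "M > 0" "\<And>x. x \<in> K \<Longrightarrow> norm (f x) \<le> M"
    by (metis bounded_pos compact_imp_bounded imageI)
  have "norm (f x) \<le> M" for x using M assms(3)[of x] by (cases "x \<in> K") auto
  with M(1) show ?thesis by (rule that)
qed

lemma integrable_cont_compact_support:
  fixes f :: "'a::euclidean_space \<Rightarrow> 'b::{banach, second_countable_topology}"
  assumes "continuous_on UNIV f" "compact K" "\<And>x. x \<notin> K \<Longrightarrow> f x = 0"
  shows "integrable lborel f"
proof -
  have "integrable lborel (\<lambda>x. indicator K x *\<^sub>R f x)"
    using assms by (intro borel_integrable_compact) (auto intro: continuous_on_subset)
  moreover have "(\<lambda>x. indicator K x *\<^sub>R f x) = f" using assms(3) by (auto simp: indicator_def fun_eq_iff)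
  ultimately show ?thesis by simp
qed

text \<open>Difference quotients of h in direction e have integral 0 by translation invariance, and
  dominated convergence carries this over to the derivative.\<close>

lemma integral_grad_eq_0:
  fixes h :: "real ^ 'n \<Rightarrow> real"
  assumes d: "\<And>x. h differentiable (at x)" and c: "continuous_on UNIV (grad h)"
    and K: "compact K" "\<And>x. x \<notin> K \<Longrightarrow> h x = 0" "\<And>x. x \<notin> K \<Longrightarrow> grad h x = 0"
  shows "(LINT x|lborel. grad h x \<bullet> e) = 0"
proof -
  obtain M where M: "M > 0" "\<And>x. norm (grad h x) \<le> M"
    using bounded_cont_compact_support[OF c K(1,3)] by blast
  have hc: "continuous_on UNIV h"
    using d by (simp add: continuous_at_imp_continuous_on differentiable_imp_continuous_within)
  have [measurable]: "h \<in> borel_measurable borel" "grad h \<in> borel_measurable borel"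
    using hc c by (auto intro: borel_measurable_continuous_onI)
  obtain R where R: "\<And>x. x \<in> K \<Longrightarrow> norm x \<le> R" using K(1) by (metis bounded_iff compact_imp_bounded)
  define a where "a j = 1 / real (Suc j)" for j
  have a: "a \<longlonglongrightarrow> 0" unfolding a_def using LIMSEQ_Suc[OF lim_1_over_n] by simp
  have a01: "0 < a j" "a j \<le> 1" for j by (auto simp: a_def)
  define D where "D j x = (h (x + a j *\<^sub>R e) - h x) / a j" for j x
  have lim: "(\<lambda>j. LINT x|lborel. D j x) \<longlonglongrightarrow> (LINT x|lborel. grad h x \<bullet> e)"
  \<comment> \<open>As the steps \<open>a j\<close> are at most 1, all quotients vanish outside one
    ball; inside it the mean value inequality bounds them by M times the norm of e.\<close>
  proof (rule integral_dominated_convergence[where w="\<lambda>x. indicator (cball 0 (R + norm e)) x * (M * norm e)"])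
    show "AE x in lborel. (\<lambda>j. D j x) \<longlonglongrightarrow> grad h x \<bullet> e"
    proof (intro always_eventually allI)
      fix x
      have "((\<lambda>t. h (x + t *\<^sub>R e)) has_derivative (\<lambda>t. grad h x \<bullet> (t *\<^sub>R e))) (at 0)"
        by (rule has_derivative_compose[of "\<lambda>t. x + t *\<^sub>R e" "\<lambda>t. t *\<^sub>R e" 0 UNIV h])
          (auto intro!: derivative_eq_intros has_derivative_grad d)
      then have "((\<lambda>t. h (x + t *\<^sub>R e)) has_real_derivative grad h x \<bullet> e) (at 0)"
        by (simp add: has_field_derivative_def mult.commute[of _ "grad h x \<bullet> e"])
      then have "((\<lambda>t. (h (x + t *\<^sub>R e) - h x) / t) \<longlongrightarrow> grad h x \<bullet> e) (at 0)"
        by (simp add: DERIV_def)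
      moreover have "filterlim a (at 0) sequentially"
        using a a01(1) by (auto simp: filterlim_at less_imp_neq[symmetric])
      ultimately show "(\<lambda>j. D j x) \<longlonglongrightarrow> grad h x \<bullet> e"
        unfolding D_def by (rule filterlim_compose)
    qed
    fix j
    show "AE x in lborel. norm (D j x) \<le> indicator (cball 0 (R + norm e)) x * (M * norm e)"
    proof (intro always_eventually allI)
      fix x
      show "norm (D j x) \<le> indicator (cball 0 (R + norm e)) x * (M * norm e)"
      proof (cases "norm x \<le> R + norm e")
        case True
        have "norm (h (x + a j *\<^sub>R e) - h x) \<le> M * norm ((x + a j *\<^sub>R e) - x)"
        proof (rule differentiable_bound[OF convex_UNIV])
          show "(h has_derivative (\<lambda>v. grad h y \<bullet> v)) (at y within UNIV)" for y
            using has_derivative_grad[OF d] by simp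
          show "onorm (\<lambda>v. grad h y \<bullet> v) \<le> M" for y
            using M by (intro onorm_bound) (auto intro!: order_trans[OF Cauchy_Schwarz_ineq2] mult_right_mono)
        qed auto
        then show ?thesis using True a01[of j] by (simp add: D_def field_simps)
      next
        case False
        have "norm x - norm (a j *\<^sub>R e) \<le> norm (x + a j *\<^sub>R e)"
          using norm_triangle_ineq4[of "x + a j *\<^sub>R e" "a j *\<^sub>R e"] by simp
        moreover have "norm (a j *\<^sub>R e) \<le> norm e" using a01[of j] by (simp add: mult_left_le_one_le)
        ultimately have "norm (x + a j *\<^sub>R e) > R" using False by linarith
        moreover have "norm x > R" using False norm_ge_zero[of e] by linarith
        ultimately have "x + a j *\<^sub>R e \<notin> K" "x \<notin> K" using R by force+
        then show ?thesis using K(2) M(1) by (simp add: D_def)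
      qed
    qed
  next
    show "(\<lambda>x. grad h x \<bullet> e) \<in> borel_measurable lborel" "D j \<in> borel_measurable lborel" for j
      unfolding D_def by measurable
    show "integrable lborel (\<lambda>x. indicator (cball 0 (R + norm e)) x * (M * norm e))"
      by (intro integrable_mult_left integrable_real_indicator) (use emeasure_lborel_cball_finite[of 0 "R + norm e"] in auto)
  qed
  have "(LINT x|lborel. D j x) = 0" for j
  proof -
    have ih: "integrable lborel h" using hc K by (intro integrable_cont_compact_support) auto
    have "integrable (distr lborel borel ((+) (a j *\<^sub>R e))) h" unfolding lborel_distr_plus by (rule ih)
    then have ih': "integrable lborel (\<lambda>x. h (x + a j *\<^sub>R e))"
      by (subst (asm) integrable_distr_eq) (auto simp: add.commute)
    have "(LINT x|lborel. h x) = (LINT x|distr lborel borel ((+) (a j *\<^sub>R e)). h x)"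
      by (simp add: lborel_distr_plus)
    also have "\<dots> = (LINT x|lborel. h (x + a j *\<^sub>R e))"
      by (subst integral_distr) (auto simp: add.commute)
    finally show ?thesis using ih ih' by (simp add: D_def)
  qed
  with lim show ?thesis using LIMSEQ_unique[OF tendsto_const] by fastforce
qed

lemma integral_lebesgue_on_eq_lborel:
  fixes f :: "'a::euclidean_space \<Rightarrow> 'b::{banach, second_countable_topology}"
  assumes "continuous_on UNIV f" "\<And>x. x \<notin> K \<Longrightarrow> f x = 0" "K \<subseteq> \<Omega>" "open \<Omega>"
  shows "(LINT x|lebesgue_on \<Omega>. f x) = (LINT x|lborel. f x)"
proof -
  have \<Omega>: "\<Omega> \<in> sets lebesgue" using assms by auto
  have "(\<lambda>x. indicator \<Omega> x *\<^sub>R f x) = f" using assms(2,3) by (auto simp: indicator_def fun_eq_iff)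
  then have "(LINT x|lebesgue_on \<Omega>. f x) = (LINT x|lebesgue. f x)"
    using \<Omega> by (simp add: integral_restrict_space)
  also have "\<dots> = (LINT x|lborel. f x)"
    using assms(1) by (intro integral_completion) (simp add: borel_measurable_continuous_onI)
  finally show ?thesis .
qed

lemma integrable_restrict_mono:
  fixes f :: "'a::euclidean_space \<Rightarrow> 'b::{banach, second_countable_topology}"
  assumes "integrable (lebesgue_on K) f" "K \<in> sets lebesgue" "\<Omega> \<in> sets lebesgue" "K \<subseteq> \<Omega>"
    "\<And>x. x \<notin> K \<Longrightarrow> f x = 0"
  shows "integrable (lebesgue_on \<Omega>) f"
proof -
  have "(\<lambda>x. indicator K x *\<^sub>R f x) = f" "(\<lambda>x. indicator \<Omega> x *\<^sub>R f x) = f"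
    using assms(4,5) by (auto simp: indicator_def fun_eq_iff)
  then show ?thesis using assms(1-3) by (simp add: integrable_restrict_space)
qed

text \<open>A general bounded bilinear B makes both orders of \<open>scaleR\<close> instances: a
  function times the gradient of a test function, and a test function times a vector field.\<close>

lemma integrable_loc_mult:
  fixes v :: "real ^ 'n \<Rightarrow> 'b::{banach, second_countable_topology}"
    and \<psi> :: "real ^ 'n \<Rightarrow> 'c::{banach, second_countable_topology}"
    and B :: "'b \<Rightarrow> 'c \<Rightarrow> 'd::{banach, second_countable_topology}"
  assumes v: "locally_integrable \<Omega> v" and B: "bounded_bilinear B"
    and \<psi>: "continuous_on UNIV \<psi>" "compact K" "K \<subseteq> \<Omega>" "\<And>x. x \<notin> K \<Longrightarrow> \<psi> x = 0" and \<Omega>: "open \<Omega>"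
  shows "integrable (lebesgue_on \<Omega>) (\<lambda>x. B (v x) (\<psi> x))"
proof (rule integrable_restrict_mono)
  interpret bounded_bilinear B by fact
  obtain M where M: "M > 0" "\<And>x. norm (\<psi> x) \<le> M"
    using bounded_cont_compact_support[OF \<psi>(1,2,4)] by blast
  obtain C where C: "C > 0" "\<And>a b. norm (B a b) \<le> norm a * norm b * C" using pos_bounded by blast
  have iv: "integrable (lebesgue_on K) v" using v \<psi> by (simp add: locally_integrable_def)
  have [measurable]: "\<psi> \<in> borel_measurable borel" using \<psi>(1) by (rule borel_measurable_continuous_onI)
  have m\<psi>: "\<psi> \<in> borel_measurable (lebesgue_on K)"
    by (intro measurable_restrict_space1 measurable_completion) simp
  show "integrable (lebesgue_on K) (\<lambda>x. B (v x) (\<psi> x))"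
  proof (rule Bochner_Integration.integrable_bound)
    show "integrable (lebesgue_on K) (\<lambda>x. M * C * norm (v x))" using iv by simp
    have "continuous_on UNIV (\<lambda>z. B (fst z) (snd z))" by (intro continuous_on continuous_on_fst continuous_on_snd continuous_on_id)
    then show "(\<lambda>x. B (v x) (\<psi> x)) \<in> borel_measurable (lebesgue_on K)"
      by (rule borel_measurable_continuous_Pair[OF borel_measurable_integrable[OF iv] m\<psi>, of B])
    show "AE x in lebesgue_on K. norm (B (v x) (\<psi> x)) \<le> norm (M * C * norm (v x))"
    proof (intro always_eventually allI)
      fix x
      have "norm (B (v x) (\<psi> x)) \<le> norm (v x) * norm (\<psi> x) * C" by (rule C)
      also have "\<dots> \<le> norm (v x) * M * C" using M C by (intro mult_right_mono mult_left_mono) auto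
      finally show "norm (B (v x) (\<psi> x)) \<le> norm (M * C * norm (v x))" using M C by (simp add: ac_simps)
    qed
  qed
  show "K \<in> sets lebesgue" using \<psi>(2) by (simp add: lmeasurable_compact fmeasurableD)
  show "\<Omega> \<in> sets lebesgue" using \<Omega> by auto
  show "B (v x) (\<psi> x) = 0" if "x \<notin> K" for x using \<psi>(4)[OF that] by (simp add: zero_right)
qed (use \<psi>(3) in simp)

lemma locally_integrable_cont:
  fixes f :: "real ^ 'n \<Rightarrow> 'b::{banach, second_countable_topology}"
  assumes "continuous_on UNIV f"
  shows "locally_integrable \<Omega> f"
  unfolding locally_integrable_def
proof safe
  fix K :: "(real ^ 'n) set" assume K: "compact K"
  have "integrable lborel (\<lambda>x. indicator K x *\<^sub>R f x)"
    using assms K by (intro borel_integrable_compact) (auto intro: continuous_on_subset)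
  then have "integrable lebesgue (\<lambda>x. indicator K x *\<^sub>R f x)"
    by (simp add: integrable_completion borel_measurable_integrable)
  moreover have "K \<in> sets lebesgue" using K by (simp add: lmeasurable_compact fmeasurableD)
  ultimately show "integrable (lebesgue_on K) f" by (subst integrable_restrict_space) auto
qed

text \<open>The gradient of a product of two test functions has integral 0; the product rule turns
  this into integration by parts. The vector identity is checked by pairing with an arbitrary
  e.\<close>

lemma has_weak_gradient_test:
  assumes "\<phi> \<in> test_functions \<Omega>" "open \<Omega>"
  shows "has_weak_gradient \<Omega> \<phi> (grad \<phi>)"
  unfolding has_weak_gradient_def
proof (intro conjI ballI)
  note \<phi> = test_functionsD[OF assms(1)]
  show "locally_integrable \<Omega> \<phi>" "locally_integrable \<Omega> (grad \<phi>)"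
    using \<phi>(3,4) by (auto intro: locally_integrable_cont)
  fix \<psi> assume "\<psi> \<in> test_functions \<Omega>"
  note \<psi> = test_functionsD[OF this]
  let ?K = "closure {x. \<phi> x \<noteq> 0}"
  have c1: "continuous_on UNIV (\<lambda>x. \<phi> x *\<^sub>R grad \<psi> x)" and c2: "continuous_on UNIV (\<lambda>x. \<psi> x *\<^sub>R grad \<phi> x)"
    by (intro continuous_on_scaleR \<phi>(3,4) \<psi>(3,4))+
  have i: "integrable lborel (\<lambda>x. \<phi> x *\<^sub>R grad \<psi> x)" "integrable lborel (\<lambda>x. \<psi> x *\<^sub>R grad \<phi> x)"
    by (rule integrable_cont_compact_support[OF c1 \<phi>(5)], drule \<phi>(7), simp)
      (rule integrable_cont_compact_support[OF c2 \<phi>(5)], drule \<phi>(8), simp)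
  have g: "grad (\<lambda>x. \<phi> x * \<psi> x) = (\<lambda>x. \<phi> x *\<^sub>R grad \<psi> x + \<psi> x *\<^sub>R grad \<phi> x)"
    using \<phi>(2) \<psi>(2) by (intro ext grad_mult)
  have "(LINT x|lborel. \<phi> x *\<^sub>R grad \<psi> x) + (LINT x|lborel. \<psi> x *\<^sub>R grad \<phi> x) = (LINT x|lborel. grad (\<lambda>x. \<phi> x * \<psi> x) x)"
    unfolding g using i by simp
  also have "\<dots> = 0"
  proof (rule vector_eq_rdot[THEN iffD1, rule_format])
    fix e
    have "(LINT x|lborel. grad (\<lambda>x. \<phi> x * \<psi> x) x) \<bullet> e = (LINT x|lborel. grad (\<lambda>x. \<phi> x * \<psi> x) x \<bullet> e)"
      unfolding g using i by (intro integral_inner_left[symmetric]) auto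
    also have "\<dots> = 0"
    proof (rule integral_grad_eq_0[OF _ _ \<phi>(5)])
      show "(\<lambda>x. \<phi> x * \<psi> x) differentiable (at x)" for x using \<phi>(2) \<psi>(2) by simp
      show "continuous_on UNIV (grad (\<lambda>x. \<phi> x * \<psi> x))" unfolding g by (rule continuous_on_add[OF c1 c2])
      show "\<phi> x * \<psi> x = 0" "grad (\<lambda>x. \<phi> x * \<psi> x) x = 0" if "x \<notin> closure {x. \<phi> x \<noteq> 0}" for x
        using \<phi>(7,8)[OF that] by (simp_all add: g)
    qed
    finally show "(LINT x|lborel. grad (\<lambda>x. \<phi> x * \<psi> x) x) \<bullet> e = 0 \<bullet> e" by simp
  qed
  finally have "(LINT x|lborel. \<phi> x *\<^sub>R grad \<psi> x) = - (LINT x|lborel. \<psi> x *\<^sub>R grad \<phi> x)"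
    by (simp add: eq_neg_iff_add_eq_0)
  moreover have "(LINT x|lebesgue_on \<Omega>. \<phi> x *\<^sub>R grad \<psi> x) = (LINT x|lborel. \<phi> x *\<^sub>R grad \<psi> x)"
    by (rule integral_lebesgue_on_eq_lborel[OF c1 _ \<phi>(6) assms(2)]) (drule \<phi>(7), simp)
  moreover have "(LINT x|lebesgue_on \<Omega>. \<psi> x *\<^sub>R grad \<phi> x) = (LINT x|lborel. \<psi> x *\<^sub>R grad \<phi> x)"
    by (rule integral_lebesgue_on_eq_lborel[OF c2 _ \<phi>(6) assms(2)]) (drule \<phi>(8), simp)
  ultimately show "(LINT x|lebesgue_on \<Omega>. \<phi> x *\<^sub>R grad \<psi> x) = - (LINT x|lebesgue_on \<Omega>. \<psi> x *\<^sub>R grad \<phi> x)"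
    by simp
qed

lemma locally_integrable_diff:
  "locally_integrable \<Omega> f \<Longrightarrow> locally_integrable \<Omega> g \<Longrightarrow> locally_integrable \<Omega> (\<lambda>x. f x - g x)"
  by (simp add: locally_integrable_def)

lemma has_weak_gradient_diff:
  assumes "has_weak_gradient \<Omega> u g" "has_weak_gradient \<Omega> u' g'" "open \<Omega>"
  shows "has_weak_gradient \<Omega> (\<lambda>x. u x - u' x) (\<lambda>x. g x - g' x)"
  unfolding has_weak_gradient_def
proof (intro conjI ballI)
  show "locally_integrable \<Omega> (\<lambda>x. u x - u' x)" "locally_integrable \<Omega> (\<lambda>x. g x - g' x)"
    using assms by (auto intro: locally_integrable_diff simp: has_weak_gradient_def)
  fix \<psi> assume \<psi>': "\<psi> \<in> test_functions \<Omega>"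
  note \<psi> = test_functionsD[OF this]
  have "integrable (lebesgue_on \<Omega>) (\<lambda>x. v x *\<^sub>R grad \<psi> x)"
    "integrable (lebesgue_on \<Omega>) (\<lambda>x. \<psi> x *\<^sub>R w x)"
    if "has_weak_gradient \<Omega> v w" for v w
  proof -
    have "locally_integrable \<Omega> v" "locally_integrable \<Omega> w" using that by (auto simp: has_weak_gradient_def)
    from integrable_loc_mult[OF this(1) bounded_bilinear_scaleR \<psi>(4,5,6,8) assms(3)]
      integrable_loc_mult[OF this(2) bounded_bilinear.flip[OF bounded_bilinear_scaleR] \<psi>(3,5,6,7) assms(3)]
    show "integrable (lebesgue_on \<Omega>) (\<lambda>x. v x *\<^sub>R grad \<psi> x)"
      "integrable (lebesgue_on \<Omega>) (\<lambda>x. \<psi> x *\<^sub>R w x)" by simp_all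
  qed
  note i = this[OF assms(1)] this[OF assms(2)]
  have "(LINT x|lebesgue_on \<Omega>. u x *\<^sub>R grad \<psi> x) = - (LINT x|lebesgue_on \<Omega>. \<psi> x *\<^sub>R g x)"
    "(LINT x|lebesgue_on \<Omega>. u' x *\<^sub>R grad \<psi> x) = - (LINT x|lebesgue_on \<Omega>. \<psi> x *\<^sub>R g' x)"
    using assms \<psi>' by (auto simp: has_weak_gradient_def)
  then show "(LINT x|lebesgue_on \<Omega>. (u x - u' x) *\<^sub>R grad \<psi> x) = - (LINT x|lebesgue_on \<Omega>. \<psi> x *\<^sub>R (g x - g' x))"
    using i by (simp add: algebra_simps)
qed

text \<open>A tensor product of one-dimensional bumps: smoothness is inherited from the factors, and
  integrals over boxes are enough to determine a function a.e.\<close>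

definition box_bump :: "real ^ 'n \<Rightarrow> real ^ 'n \<Rightarrow> nat \<Rightarrow> real ^ 'n \<Rightarrow> real" where
  "box_bump a b j x = (\<Prod>i\<in>UNIV. bump (a $ i) (b $ i) j (x $ i))"

lemma box_bump_test:
  assumes "cbox a b \<subseteq> \<Omega>"
  shows "box_bump a b j \<in> test_functions \<Omega>"
proof (rule test_functionsI[OF _ _ compact_cbox assms])
  show "C_k k (box_bump a b j)" for k
    unfolding box_bump_def by (rule C_k_prod[OF finite]) (rule C_k_compose[OF D_k_bump C_k_nth])
  show "{x. box_bump a b j x \<noteq> 0} \<subseteq> cbox a b"
  proof
    fix x assume "x \<in> {x. box_bump a b j x \<noteq> 0}"
    then have *: "bump (a $ i) (b $ i) j (x $ i) \<noteq> 0" for i by (simp add: box_bump_def)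
    have "a $ i \<le> x $ i \<and> x $ i \<le> b $ i" for i
      using *[of i] bump_eq_0[of "x $ i" "a $ i" "b $ i" j] by linarith
    then show "x \<in> cbox a b" by (simp add: mem_box_cart)
  qed
qed

lemma box_bump_tendsto: "(\<lambda>j. box_bump a b j x) \<longlonglongrightarrow> indicator (box a b) x"
proof -
  have "(\<lambda>j. box_bump a b j x) \<longlonglongrightarrow> (\<Prod>i\<in>UNIV. indicator {a $ i<..<b $ i} (x $ i))"
    unfolding box_bump_def by (intro tendsto_prod bump_tendsto)
  moreover have "(\<Prod>i\<in>UNIV. indicator {a $ i<..<b $ i} (x $ i)) = (indicator (box a b) x :: real)"
  proof (cases "x \<in> box a b")
    case False
    then obtain i where "x $ i \<notin> {a $ i<..<b $ i}" by (auto simp: mem_box_cart)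
    then have "(\<Prod>i\<in>UNIV. indicator {a $ i<..<b $ i} (x $ i)) = (0::real)"
      by (intro prod_zero bexI[of _ i]) auto
    then show ?thesis using False by simp
  qed (auto simp: mem_box_cart)
  ultimately show ?thesis by simp
qed

lemma box_bump_bounds: "0 \<le> box_bump a b j x" "box_bump a b j x \<le> 1"
  unfolding box_bump_def by (rule prod_nonneg, rule bump_bounds) (rule prod_le_1, simp add: bump_bounds)

subsection \<open>Uniqueness of weak gradients\<close>

text \<open>Boxes are an intersection-stable generator of the Borel sets, and the sets with
  vanishing integral are closed under complements and countable disjoint unions. Complements require
  the integral over the whole space, which is the limit over growing boxes.\<close>

lemma AE_eq_0_if_box_integrals_eq_0:
  fixes f :: "'a::euclidean_space \<Rightarrow> 'b::{banach, second_countable_topology}"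
  assumes f: "integrable lborel f"
    and 0: "\<And>a b. (LINT x|lborel. indicator (box a b) x *\<^sub>R f x) = 0"
  shows "AE x in lborel. f x = 0"
proof (rule sigma_finite_measure.density_zero[OF lborel.sigma_finite_measure_axioms f])
  have im: "integrable lborel (\<lambda>x. indicator A x *\<^sub>R f x)" if "A \<in> sets borel" for A
    using f that by (intro integrable_mult_indicator) auto
  let ?E = "range (\<lambda>(a, b). box a b :: 'a set)"
  have tot: "(LINT x|lborel. f x) = 0"
  proof -
    let ?A = "\<lambda>n::nat. box (- (real n *\<^sub>R One)) (real n *\<^sub>R One) :: 'a set"
    have "(\<lambda>n. LINT x|lborel. indicator (?A n) x *\<^sub>R f x) \<longlonglongrightarrow> (LINT x|lborel. f x)"
    proof (rule integral_dominated_convergence[where w="\<lambda>x. norm (f x)"])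
      show "AE x in lborel. (\<lambda>n. indicator (?A n) x *\<^sub>R f x) \<longlonglongrightarrow> f x"
      proof (intro always_eventually allI)
        fix x :: 'a
        obtain n0 where n0: "x \<in> ?A n0" using UN_box_eq_UNIV by blast
        have "\<forall>\<^sub>F n in sequentially. indicator (?A n) x *\<^sub>R f x = f x"
          using eventually_ge_at_top[of n0]
        proof eventually_elim
          case (elim n)
          then have "?A n0 \<subseteq> ?A n" by (intro subset_box_imp) auto
          then show ?case using n0 by auto
        qed
        then show "(\<lambda>n. indicator (?A n) x *\<^sub>R f x) \<longlonglongrightarrow> f x" by (rule tendsto_eventually)
      qed
      show "AE x in lborel. norm (indicator (?A n) x *\<^sub>R f x) \<le> norm (f x)" for n
        by (auto simp: indicator_def)
    qed (use f im borel_measurable_integrable in auto)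
    then show ?thesis using 0 LIMSEQ_unique[OF tendsto_const] by fastforce
  qed
  fix A :: "'a set" assume "A \<in> sets lborel"
  then have "A \<in> sigma_sets UNIV ?E" by (simp add: borel_eq_box)
  then have "A \<in> sets borel \<and> (LINT x|lborel. indicator A x *\<^sub>R f x) = 0"
  proof (induction rule: sigma_sets_induct_disjoint[rotated 2, consumes 1, case_names basic empty compl union])
    case (basic A)
    then show ?case using 0 by auto
  next
    case (compl A)
    have "(LINT x|lborel. indicator (UNIV - A) x *\<^sub>R f x) = (LINT x|lborel. f x - indicator A x *\<^sub>R f x)"
      by (intro Bochner_Integration.integral_cong) (auto simp: indicator_def)
    also have "\<dots> = 0" using compl im f tot by simp
    finally show ?case using compl by auto
  next
    case (union A)
    then have A: "A i \<in> sets borel" for i by auto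
    have "(\<Sum>i. LINT x|lborel. indicator (A i) x *\<^sub>R f x) = (LINT x|lborel. indicator (\<Union>(range A)) x *\<^sub>R f x)"
      using lebesgue_integral_countable_add[of A lborel f] A union(1) im[of "\<Union>(range A)"]
      by (force simp: set_lebesgue_integral_def set_integrable_def disjoint_family_on_def)
    then show ?case using union A by auto
  next
    show "Int_stable ?E" by (auto simp: Int_stable_def box_Int_box)
  qed auto
  then show "set_lebesgue_integral lborel A f = 0" by (simp add: set_lebesgue_integral_def)
qed

text \<open>A Lebesgue measurable f agrees a.e. with a Borel function, assembled here from its
  components, to which the previous result applies.\<close>

lemma AE_lebesgue_eq_0_if_box_integrals_eq_0:
  fixes f :: "real ^ 'n \<Rightarrow> real ^ 'n"
  assumes f: "integrable lebesgue f"
    and 0: "\<And>a b. (LINT x|lebesgue. indicator (box a b) x *\<^sub>R f x) = 0"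
  shows "AE x in lebesgue. f x = 0"
proof -
  have "(\<lambda>x. f x $ i) \<in> borel_measurable lebesgue" for i
    using borel_measurable_integrable[OF f]
    by (rule measurable_compose) (simp add: borel_measurable_continuous_onI continuous_on_component)
  then have "\<forall>i. \<exists>h. h \<in> borel_measurable lborel \<and> (AE x in lborel. f x $ i = h x)"
    using completion_ex_borel_measurable_real by blast
  then obtain h where h: "\<And>i. h i \<in> borel_measurable lborel" "\<And>i. AE x in lborel. f x $ i = h i x" by metis
  define f' where "f' x = (\<chi> i. h i x)" for x
  have "(\<lambda>x. f' x \<bullet> b) \<in> borel_measurable borel" if "b \<in> Basis" for b
    using that h(1) by (auto simp: f'_def Basis_vec_def inner_axis)
  then have [measurable]: "f' \<in> borel_measurable borel" by (subst borel_measurable_euclidean_space) auto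
  have eq: "AE x in lborel. f x = f' x"
  proof -
    have "AE x in lborel. \<forall>i\<in>UNIV. f x $ i = h i x" using h(2) by (intro AE_finite_allI) auto
    then show ?thesis by eventually_elim (simp add: f'_def vec_eq_iff)
  qed
  then have eq': "AE x in lebesgue. f x = f' x" by (rule AE_completion)
  have fm: "f \<in> borel_measurable lebesgue" using f by auto
  have f'm: "f' \<in> borel_measurable lebesgue" by (intro measurable_completion) simp
  have "integrable lebesgue f'" using f eq' f'm fm by (subst integrable_cong_AE[of _ _ f]) auto
  then have "integrable lborel f'" by (simp add: integrable_completion)
  moreover have "(LINT x|lborel. indicator (box a b) x *\<^sub>R f' x) = 0" for a b
  proof -
    have "(LINT x|lborel. indicator (box a b) x *\<^sub>R f' x) = (LINT x|lebesgue. indicator (box a b) x *\<^sub>R f' x)"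
      by (intro integral_completion[symmetric]) simp
    also have "\<dots> = (LINT x|lebesgue. indicator (box a b) x *\<^sub>R f x)"
      using eq' fm f'm by (intro integral_cong_AE borel_measurable_scaleR borel_measurable_indicator) auto
    finally show ?thesis using 0 by simp
  qed
  ultimately have "AE x in lborel. f' x = 0" by (rule AE_eq_0_if_box_integrals_eq_0)
  then have "AE x in lborel. f x = 0" using eq by eventually_elim simp
  then show ?thesis by (rule AE_completion)
qed

text \<open>The fundamental lemma of the calculus of variations. Bumps inside a compact box
  contained in \<Omega> converge boundedly to indicators of open boxes, so all box integrals of g
  restricted to that compact box vanish.\<close>

lemma AE_eq_0_if_test_integrals_eq_0:
  fixes g :: "real ^ 'n \<Rightarrow> real ^ 'n"
  assumes g: "locally_integrable \<Omega> g" and \<Omega>: "open \<Omega>"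
    and 0: "\<And>\<phi>. \<phi> \<in> test_functions \<Omega> \<Longrightarrow> (LINT x|lebesgue_on \<Omega>. \<phi> x *\<^sub>R g x) = 0"
  shows "AE x in lebesgue_on \<Omega>. g x = 0"
proof -
  have \<Omega>m: "\<Omega> \<in> sets lebesgue" using \<Omega> by auto
  have box: "AE x in lebesgue. x \<in> cbox u v \<longrightarrow> g x = 0" if uv: "cbox u v \<subseteq> \<Omega>" for u v
  proof -
    have "integrable (lebesgue_on (cbox u v)) g" using g uv by (simp add: locally_integrable_def)
    then have ig: "integrable lebesgue (\<lambda>x. indicator (cbox u v) x *\<^sub>R g x)" by (subst (asm) integrable_restrict_space) auto
    have "AE x in lebesgue. indicator (cbox u v) x *\<^sub>R g x = 0"
    proof (rule AE_lebesgue_eq_0_if_box_integrals_eq_0[OF ig])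
      fix a b
      \<comment> \<open>Corners of the intersection with the box from u to v: bumps there are
        admissible even if the box from a to b leaves \<Omega>.\<close>
      define c' where "c' = (\<chi> i. max (a $ i) (u $ i))"
      define d' where "d' = (\<chi> i. min (b $ i) (v $ i))"
      have cd: "box a b \<inter> box u v = box c' d'"
        by (auto simp: mem_box_cart c'_def d'_def set_eq_iff)
      have sub: "cbox c' d' \<subseteq> cbox u v" by (auto simp: mem_box_cart c'_def d'_def)
      have "(\<lambda>j. LINT x|lebesgue. box_bump c' d' j x *\<^sub>R (indicator (cbox u v) x *\<^sub>R g x)) \<longlonglongrightarrow>
        (LINT x|lebesgue. indicator (box c' d') x *\<^sub>R (indicator (cbox u v) x *\<^sub>R g x))"
      proof (rule integral_dominated_convergence[where w="\<lambda>x. norm (indicator (cbox u v) x *\<^sub>R g x)"])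
        show "AE x in lebesgue. (\<lambda>j. box_bump c' d' j x *\<^sub>R indicat_real (cbox u v) x *\<^sub>R g x)
          \<longlonglongrightarrow> indicat_real (box c' d') x *\<^sub>R indicat_real (cbox u v) x *\<^sub>R g x"
          by (intro always_eventually allI tendsto_scaleR box_bump_tendsto tendsto_const)
        show "AE x in lebesgue. norm (box_bump c' d' j x *\<^sub>R indicat_real (cbox u v) x *\<^sub>R g x)
          \<le> norm (indicat_real (cbox u v) x *\<^sub>R g x)" for j
          using box_bump_bounds[of c' d' j] by (intro always_eventually allI) (simp add: indicator_def mult_left_le_one_le)
        show "(\<lambda>x. box_bump c' d' j x *\<^sub>R indicat_real (cbox u v) x *\<^sub>R g x) \<in> borel_measurable lebesgue" for j
        proof (rule borel_measurable_scaleR[OF _ borel_measurable_integrable[OF ig]])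
          have "continuous_on UNIV (box_bump c' d' j)"
            using test_functionsD(3)[OF box_bump_test] uv sub by blast
          then show "box_bump c' d' j \<in> borel_measurable lebesgue"
            by (intro measurable_completion) (simp add: borel_measurable_continuous_onI)
        qed
        show "(\<lambda>x. indicat_real (box c' d') x *\<^sub>R indicat_real (cbox u v) x *\<^sub>R g x) \<in> borel_measurable lebesgue"
          by (rule borel_measurable_scaleR[OF borel_measurable_indicator borel_measurable_integrable[OF ig]]) auto
        show "integrable lebesgue (\<lambda>x. norm (indicat_real (cbox u v) x *\<^sub>R g x))" using ig by (rule integrable_norm)
      qed
      moreover have "(LINT x|lebesgue. box_bump c' d' j x *\<^sub>R (indicator (cbox u v) x *\<^sub>R g x)) = 0" for j
      proof -
        have "box_bump c' d' j x = 0" if "x \<notin> cbox u v" for x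
        proof -
          have "cbox c' d' \<subseteq> cbox c' d'" by simp
          from test_functionsD(6)[OF box_bump_test[OF this], of j] sub that
          have "x \<notin> closure {x. box_bump c' d' j x \<noteq> 0}" by blast
          from not_in_closure_Collect[OF this] show ?thesis by simp
        qed
        then have "(\<lambda>x. box_bump c' d' j x *\<^sub>R (indicator (cbox u v) x *\<^sub>R g x)) = (\<lambda>x. indicator \<Omega> x *\<^sub>R (box_bump c' d' j x *\<^sub>R g x))"
          using uv by (auto simp: fun_eq_iff indicator_def)
        then have "(LINT x|lebesgue. box_bump c' d' j x *\<^sub>R (indicator (cbox u v) x *\<^sub>R g x)) =
          (LINT x|lebesgue_on \<Omega>. box_bump c' d' j x *\<^sub>R g x)"
          using \<Omega>m by (simp add: integral_restrict_space)
        also have "\<dots> = 0" using sub uv by (intro 0 box_bump_test) auto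
        finally show ?thesis .
      qed
      ultimately have "(LINT x|lebesgue. indicator (box c' d') x *\<^sub>R (indicator (cbox u v) x *\<^sub>R g x)) = 0"
        using LIMSEQ_unique[OF tendsto_const] by fastforce
      \<comment> \<open>The bumps reproduce only the open box, whose boundary is negligible.\<close>
      moreover have "AE x in lebesgue. x \<notin> cbox u v - box u v"
      proof (rule AE_not_in, rule negligible_iff_null_sets[THEN iffD1])
        have "cbox u v - box u v = frontier (cbox u v)" by (simp add: frontier_def)
        then show "negligible (cbox u v - box u v)" using negligible_frontier_interval[of u v] by simp
      qed
      note bd = this
      have "(LINT x|lebesgue. indicator (box c' d') x *\<^sub>R (indicator (cbox u v) x *\<^sub>R g x)) =
        (LINT x|lebesgue. indicator (box a b) x *\<^sub>R (indicator (cbox u v) x *\<^sub>R g x))"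
        unfolding cd[symmetric]
      proof (rule integral_cong_AE)
        have "(\<lambda>x. indicat_real A x *\<^sub>R indicat_real (cbox u v) x *\<^sub>R g x) \<in> borel_measurable lebesgue"
          if "A \<in> sets lebesgue" for A
          using that by (rule borel_measurable_scaleR[OF borel_measurable_indicator borel_measurable_integrable[OF ig]])
        then show "(\<lambda>x. indicat_real (box a b \<inter> box u v) x *\<^sub>R indicat_real (cbox u v) x *\<^sub>R g x) \<in> borel_measurable lebesgue"
          "(\<lambda>x. indicat_real (box a b) x *\<^sub>R indicat_real (cbox u v) x *\<^sub>R g x) \<in> borel_measurable lebesgue" by auto
        show "AE x in lebesgue. indicat_real (box a b \<inter> box u v) x *\<^sub>R indicat_real (cbox u v) x *\<^sub>R g x =
          indicat_real (box a b) x *\<^sub>R indicat_real (cbox u v) x *\<^sub>R g x"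
          using bd by eventually_elim (auto simp: indicator_def)
      qed
      ultimately show "(LINT x|lebesgue. indicator (box a b) x *\<^sub>R (indicator (cbox u v) x *\<^sub>R g x)) = 0" by simp
    qed
    then show ?thesis by eventually_elim (auto simp: indicator_def)
  qed
  obtain \<D> where \<D>: "countable \<D>" "\<D> \<subseteq> Pow \<Omega>" "\<And>X. X \<in> \<D> \<Longrightarrow> \<exists>a b. X = cbox a b" "\<Union>\<D> = \<Omega>"
    using open_countable_Union_open_cbox[OF \<Omega>] by blast
  have "AE x in lebesgue. \<forall>X\<in>\<D>. x \<in> X \<longrightarrow> g x = 0"
  proof (rule AE_ball_countable[OF \<D>(1), THEN iffD2], rule ballI)
    fix X assume X: "X \<in> \<D>"
    then obtain a b where "X = cbox a b" using \<D> by blast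
    then show "AE x in lebesgue. x \<in> X \<longrightarrow> g x = 0" using box[of a b] X \<D>(2) by blast
  qed
  then show ?thesis using \<D>(4) \<Omega>m
    by (subst AE_restrict_space_iff) (auto elim!: eventually_mono)
qed

text \<open>The difference of two weak gradients of u is a weak gradient of u - u, hence orthogonal
  to all test functions.\<close>

lemma weak_gradient_unique:
  assumes g: "has_weak_gradient \<Omega> u g" and g': "has_weak_gradient \<Omega> u g'" and \<Omega>: "open \<Omega>"
  shows "AE x in lebesgue_on \<Omega>. g x = g' x"
proof -
  have d: "has_weak_gradient \<Omega> (\<lambda>x. u x - u x) (\<lambda>x. g x - g' x)"
    by (rule has_weak_gradient_diff[OF g g' \<Omega>])
  have "AE x in lebesgue_on \<Omega>. g x - g' x = 0"
  proof (rule AE_eq_0_if_test_integrals_eq_0[OF _ \<Omega>])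
    show "locally_integrable \<Omega> (\<lambda>x. g x - g' x)" using d by (simp add: has_weak_gradient_def)
    fix \<phi> assume "\<phi> \<in> test_functions \<Omega>"
    then have "(LINT x|lebesgue_on \<Omega>. (u x - u x) *\<^sub>R grad \<phi> x) = - (LINT x|lebesgue_on \<Omega>. \<phi> x *\<^sub>R (g x - g' x))"
      using d unfolding has_weak_gradient_def by blast
    then show "(LINT x|lebesgue_on \<Omega>. \<phi> x *\<^sub>R (g x - g' x)) = 0" by simp
  qed
  then show ?thesis by eventually_elim simp
qed

lemma has_weak_gradient_weak_grad: "has_weak_gradient \<Omega> u g \<Longrightarrow> has_weak_gradient \<Omega> u (weak_grad \<Omega> u)"
  unfolding weak_grad_def by (rule someI[of "has_weak_gradient \<Omega> u"])

lemma weak_grad_AE: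
  "has_weak_gradient \<Omega> u g \<Longrightarrow> open \<Omega> \<Longrightarrow> AE x in lebesgue_on \<Omega>. weak_grad \<Omega> u x = g x"
  by (rule weak_gradient_unique[OF has_weak_gradient_weak_grad])

text \<open>Integrability is given on compact sets only; \<Omega> is a countable union of closed
  boxes, on which measurability is pieced together.\<close>

lemma locally_integrable_measurable:
  fixes g :: "real ^ 'n \<Rightarrow> 'b::{banach, second_countable_topology}"
  assumes g: "locally_integrable \<Omega> g" and \<Omega>: "open \<Omega>"
  shows "g \<in> borel_measurable (lebesgue_on \<Omega>)"
proof -
  obtain \<D> where \<D>: "countable \<D>" "\<D> \<subseteq> Pow \<Omega>" "\<And>X. X \<in> \<D> \<Longrightarrow> \<exists>a b. X = cbox a b" "\<Union>\<D> = \<Omega>"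
    using open_countable_Union_open_cbox[OF \<Omega>] by blast
  show ?thesis
  proof (rule measurable_piecewise_restrict[OF \<D>(1)])
    show "\<And>X. X \<in> \<D> \<Longrightarrow> X \<inter> space (lebesgue_on \<Omega>) \<in> sets (lebesgue_on \<Omega>)"
      using \<D>(2,3) \<Omega> by (fastforce simp: sets_restrict_space_iff Int_absorb2)
    show "space (lebesgue_on \<Omega>) \<subseteq> \<Union>\<D>" using \<D>(4) by simp
    fix X assume X: "X \<in> \<D>"
    then obtain a b where ab: "X = cbox a b" using \<D> by blast
    have X\<Omega>: "X \<subseteq> \<Omega>" using X \<D>(2) by blast
    then have "integrable (lebesgue_on X) g" using g unfolding ab locally_integrable_def by simp
    moreover have "restrict_space (lebesgue_on \<Omega>) X = lebesgue_on X"
    proof (subst restrict_restrict_space)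
      show "\<Omega> \<inter> space lebesgue \<in> sets lebesgue" using \<Omega> by simp
      show "X \<inter> space lebesgue \<in> sets lebesgue" by (simp add: ab)
      have "\<Omega> \<inter> X = X" using X\<Omega> by blast
      then show "lebesgue_on (\<Omega> \<inter> X) = lebesgue_on X" by simp
    qed
    ultimately show "g \<in> restrict_space (lebesgue_on \<Omega>) X \<rightarrow>\<^sub>M borel"
      using borel_measurable_integrable by metis
  qed
qed

subsection \<open>Approximation by test functions\<close>

text \<open>\<open>qM\<close> and \<open>\<mu>M\<close> stand for the bounds that compactness of the
  closure provides. \<open>qM\<close> is at the same time the doubling exponent of the double phase
  function.\<close>

locale double_phase_data =
  fixes \<Omega> :: "(real ^ 'n) set" and p q \<mu> :: "real ^ 'n \<Rightarrow> real" and qM \<mu>M :: real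
  assumes open_\<Omega>: "open \<Omega>" and bounded_\<Omega>: "bounded \<Omega>"
    and cont: "continuous_on \<Omega> p" "continuous_on \<Omega> q" "continuous_on \<Omega> \<mu>"
    and p_gt_1: "x \<in> \<Omega> \<Longrightarrow> 1 < p x" and p_less_q: "x \<in> \<Omega> \<Longrightarrow> p x < q x"
    and q_le: "x \<in> \<Omega> \<Longrightarrow> q x \<le> qM"
    and \<mu>_nonneg: "x \<in> \<Omega> \<Longrightarrow> 0 \<le> \<mu> x" and \<mu>_le: "x \<in> \<Omega> \<Longrightarrow> \<mu> x \<le> \<mu>M"
    and qM: "1 < qM"
begin

abbreviation "M \<equiv> lebesgue_on \<Omega>"
abbreviation "H \<equiv> double_phase p q \<mu>"
abbreviation "\<rho> \<equiv> modular \<Omega> (double_phase p q \<mu>)"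

section \<open>Modular and norm of the double phase function\<close>

lemma \<Omega>_sets: "\<Omega> \<in> sets lebesgue" using open_\<Omega> by auto

lemma cont_measurable:
  fixes f :: "real ^ 'n \<Rightarrow> real"
  shows "continuous_on \<Omega> f \<Longrightarrow> f \<in> borel_measurable M"
  by (rule continuous_imp_measurable_on_sets_lebesgue[OF _ \<Omega>_sets])

lemmas pq_measurable [measurable] = cont[THEN cont_measurable]

lemma finite_M: "finite_measure M"
proof
  have "\<Omega> \<in> lmeasurable" using open_\<Omega> bounded_\<Omega> by (simp add: lmeasurable_open)
  then show "emeasure M (space M) \<noteq> \<infinity>"
    by (simp add: emeasure_restrict_space \<Omega>_sets fmeasurable_def)
qed

lemma H_nonneg: "x \<in> \<Omega> \<Longrightarrow> 0 \<le> H x t"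
  using \<mu>_nonneg by (simp add: double_phase_def)

lemma H_zero [simp]: "H x 0 = 0"
  by (simp add: double_phase_def)

lemma H_mono:
  assumes "x \<in> \<Omega>" "0 \<le> a" "a \<le> b"
  shows "H x a \<le> H x b"
  unfolding double_phase_def using assms p_gt_1[OF assms(1)] p_less_q[OF assms(1)] \<mu>_nonneg[OF assms(1)]
  by (intro add_mono mult_left_mono powr_mono2) auto

text \<open>Both exponents exceed 1, so a factor below 1 leaves \<open>H\<close> at least linearly;
  this takes the place of convexity.\<close>

lemma H_scale_le:
  assumes "x \<in> \<Omega>" "0 \<le> c" "c \<le> 1" "0 \<le> t"
  shows "H x (c * t) \<le> c * H x t"
proof -
  have "c powr p x \<le> c powr 1" "c powr q x \<le> c powr 1"
    using assms p_gt_1[OF assms(1)] p_less_q[OF assms(1)] by (intro powr_mono'; simp)+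
  then have "c powr p x * t powr p x + \<mu> x * (c powr q x * t powr q x)
      \<le> c * t powr p x + \<mu> x * (c * t powr q x)"
    using assms \<mu>_nonneg[OF assms(1)] by (intro add_mono mult_left_mono mult_right_mono) auto
  then show ?thesis using assms by (simp add: double_phase_def powr_mult algebra_simps)
qed

lemma H_scale_ge:
  assumes "x \<in> \<Omega>" "1 \<le> c" "0 \<le> t"
  shows "H x (c * t) \<le> c powr qM * H x t"
proof -
  have "c powr p x \<le> c powr qM" "c powr q x \<le> c powr qM"
    using assms p_less_q[OF assms(1)] q_le[OF assms(1)] by (auto intro!: powr_mono)
  then have "c powr p x * t powr p x + \<mu> x * (c powr q x * t powr q x)
      \<le> c powr qM * t powr p x + \<mu> x * (c powr qM * t powr q x)"
    using assms \<mu>_nonneg[OF assms(1)] by (intro add_mono mult_left_mono mult_right_mono) auto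
  then show ?thesis using assms by (simp add: double_phase_def powr_mult algebra_simps)
qed

lemma H_add:
  assumes "x \<in> \<Omega>" "0 \<le> a" "0 \<le> b"
  shows "H x (a + b) \<le> 2 powr qM * (H x a + H x b)"
proof -
  have "H x (a + b) \<le> H x (2 * max a b)" using assms by (intro H_mono) auto
  also have "\<dots> \<le> 2 powr qM * H x (max a b)" using assms by (intro H_scale_ge) auto
  also have "\<dots> \<le> 2 powr qM * (H x a + H x b)"
    using H_nonneg[OF assms(1)] by (intro mult_left_mono) (auto simp: max_def)
  finally show ?thesis .
qed

lemma le_1_add_H:
  assumes "x \<in> \<Omega>" "0 \<le> t"
  shows "t \<le> 1 + H x t"
proof (cases "t \<le> 1")
  case True
  then show ?thesis using H_nonneg[OF assms(1), of t] by linarith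
next
  case False
  then have "t powr 1 \<le> t powr p x" using p_gt_1[OF assms(1)] by (intro powr_mono) auto
  moreover have "0 \<le> \<mu> x * t powr q x" using \<mu>_nonneg[OF assms(1)] by simp
  ultimately show ?thesis using False by (simp add: double_phase_def)
qed

lemma H_measurable [measurable]:
  "f \<in> borel_measurable M \<Longrightarrow> (\<lambda>x. H x (f x)) \<in> borel_measurable M"
  unfolding double_phase_def
  by (intro borel_measurable_add borel_measurable_times powr_real_measurable pq_measurable)

lemma modular_mono:
  assumes "\<And>x. x \<in> \<Omega> \<Longrightarrow> \<bar>f x\<bar> \<le> \<bar>g x\<bar>"
  shows "\<rho> f \<le> \<rho> g"
  unfolding modular_def using assms by (intro nn_integral_mono ennreal_leI H_mono) auto

lemma modular_cong_AE:
  assumes "AE x in M. \<bar>f x\<bar> = \<bar>g x\<bar>"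
  shows "\<rho> f = \<rho> g"
  unfolding modular_def by (rule nn_integral_cong_AE) (use assms in \<open>auto elim!: eventually_mono\<close>)

lemma modular_add_le:
  assumes [measurable]: "f \<in> borel_measurable M" "g \<in> borel_measurable M" "h \<in> borel_measurable M"
    and le: "\<And>x. x \<in> \<Omega> \<Longrightarrow> \<bar>h x\<bar> \<le> \<bar>f x\<bar> + \<bar>g x\<bar>"
  shows "\<rho> h \<le> ennreal (2 powr qM) * (\<rho> f + \<rho> g)"
proof -
  have "\<rho> h \<le> (\<integral>\<^sup>+x. ennreal (2 powr qM) * (ennreal (H x \<bar>f x\<bar>) + ennreal (H x \<bar>g x\<bar>)) \<partial>M)"
    unfolding modular_def
  proof (intro nn_integral_mono)
    fix x assume "x \<in> space M"
    then have x: "x \<in> \<Omega>" by simp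
    have "H x \<bar>h x\<bar> \<le> H x (\<bar>f x\<bar> + \<bar>g x\<bar>)" using x le by (intro H_mono) auto
    also have "\<dots> \<le> 2 powr qM * (H x \<bar>f x\<bar> + H x \<bar>g x\<bar>)" using x by (intro H_add) auto
    finally show "ennreal (H x \<bar>h x\<bar>) \<le> ennreal (2 powr qM) * (ennreal (H x \<bar>f x\<bar>) + ennreal (H x \<bar>g x\<bar>))"
      using H_nonneg[OF x] by (simp add: ennreal_mult[symmetric] ennreal_plus[symmetric] ennreal_leI del: ennreal_plus)
  qed
  also have "\<dots> = ennreal (2 powr qM) * (\<rho> f + \<rho> g)"
    unfolding modular_def by (subst nn_integral_cmult) (auto simp: nn_integral_add)
  finally show ?thesis .
qed

lemma modular_scale_le:
  assumes [measurable]: "f \<in> borel_measurable M" and c: "0 \<le> c" "c \<le> 1"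
  shows "\<rho> (\<lambda>x. c * f x) \<le> ennreal c * \<rho> f"
proof -
  have "\<rho> (\<lambda>x. c * f x) \<le> (\<integral>\<^sup>+x. ennreal c * ennreal (H x \<bar>f x\<bar>) \<partial>M)"
    unfolding modular_def using c H_nonneg
    by (intro nn_integral_mono) (auto simp: abs_mult ennreal_mult[symmetric] intro!: ennreal_leI H_scale_le)
  then show ?thesis unfolding modular_def by (subst (asm) nn_integral_cmult) auto
qed

lemma modular_scale_ge:
  assumes [measurable]: "f \<in> borel_measurable M" and c: "1 \<le> c"
  shows "\<rho> (\<lambda>x. c * f x) \<le> ennreal (c powr qM) * \<rho> f"
proof -
  have "\<rho> (\<lambda>x. c * f x) \<le> (\<integral>\<^sup>+x. ennreal (c powr qM) * ennreal (H x \<bar>f x\<bar>) \<partial>M)"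
    unfolding modular_def using c H_nonneg
    by (intro nn_integral_mono) (auto simp: abs_mult ennreal_mult[symmetric] intro!: ennreal_leI H_scale_ge)
  then show ?thesis unfolding modular_def by (subst (asm) nn_integral_cmult) auto
qed

text \<open>By the doubling property \<open>H_scale_ge\<close>, a finite modular for one positive
  multiple of u implies a finite modular of u, so the scaling in the definition disappears.\<close>

lemma orlicz_space_iff: "u \<in> orlicz_space \<Omega> H \<longleftrightarrow> u \<in> borel_measurable M \<and> \<rho> u < \<infinity>"
proof
  assume "u \<in> orlicz_space \<Omega> H"
  then obtain a where a: "a > 0" "\<rho> (\<lambda>x. a * u x) < \<infinity>" and [measurable]: "u \<in> borel_measurable M"
    by (auto simp: orlicz_space_def)
  define l where "l = max 1 (1 / a)"
  have "\<rho> u \<le> \<rho> (\<lambda>x. l * (a * u x))"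
  proof (rule modular_mono)
    fix x
    have "1 \<le> l * a" using a by (auto simp: l_def max_def field_simps)
    then have "1 * \<bar>u x\<bar> \<le> (l * a) * \<bar>u x\<bar>" by (intro mult_right_mono) auto
    then show "\<bar>u x\<bar> \<le> \<bar>l * (a * u x)\<bar>" using a by (simp add: abs_mult l_def)
  qed
  also have "\<dots> \<le> ennreal (l powr qM) * \<rho> (\<lambda>x. a * u x)" by (rule modular_scale_ge) (auto simp: l_def)
  also have "\<dots> < \<infinity>" using a by (simp add: ennreal_mult_less_top)
  finally show "u \<in> borel_measurable M \<and> \<rho> u < \<infinity>" by simp
next
  assume "u \<in> borel_measurable M \<and> \<rho> u < \<infinity>"
  then show "u \<in> orlicz_space \<Omega> H" by (auto simp: orlicz_space_def intro!: exI[of _ 1])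
qed

lemma norm_set_nonempty:
  assumes "u \<in> orlicz_space \<Omega> H"
  shows "\<exists>\<alpha>>0. \<rho> (\<lambda>x. u x / \<alpha>) \<le> 1"
proof -
  have u[measurable]: "u \<in> borel_measurable M" and fin: "\<rho> u < \<infinity>" using assms by (auto simp: orlicz_space_iff)
  define c where "c = enn2real (\<rho> u)"
  have c: "\<rho> u = ennreal c" "0 \<le> c" using fin by (auto simp: c_def)
  define a where "a = max 1 c"
  have a: "a \<ge> 1" "c \<le> a" by (auto simp: a_def)
  have "\<rho> (\<lambda>x. (1 / a) * u x) \<le> ennreal (1 / a) * \<rho> u" using a by (intro modular_scale_le) auto
  also have "\<dots> = ennreal (c / a)" unfolding c using a c by (simp add: ennreal_mult[symmetric])
  also have "\<dots> \<le> 1" using a by (simp add: field_simps)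
  finally show ?thesis using a by (intro exI[of _ a]) auto
qed

lemma orlicz_norm_nonneg:
  assumes "u \<in> orlicz_space \<Omega> H"
  shows "0 \<le> orlicz_norm \<Omega> H u"
  unfolding orlicz_norm_def using norm_set_nonempty[OF assms] by (intro cInf_greatest) auto

text \<open>Some \<alpha> below \<epsilon> is admissible in the infimum and leaves the modular
  linearly. Together with \<open>norm_le_if_modular_le\<close> this makes smallness in norm and in
  modular equivalent.\<close>

lemma modular_le_if_norm_less:
  assumes "u \<in> orlicz_space \<Omega> H" "orlicz_norm \<Omega> H u < \<epsilon>" "0 < \<epsilon>" "\<epsilon> \<le> 1"
  shows "\<rho> u \<le> ennreal \<epsilon>"
proof -
  have [measurable]: "u \<in> borel_measurable M" using assms by (auto simp: orlicz_space_iff)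
  obtain \<alpha> where \<alpha>: "\<alpha> > 0" "\<rho> (\<lambda>x. u x / \<alpha>) \<le> 1" "\<alpha> < \<epsilon>"
    using cInf_lessD[of "{\<alpha>. \<alpha> > 0 \<and> \<rho> (\<lambda>x. u x / \<alpha>) \<le> 1}" \<epsilon>] assms(2) norm_set_nonempty[OF assms(1)]
    unfolding orlicz_norm_def by blast
  have "\<rho> u = \<rho> (\<lambda>x. \<alpha> * (u x / \<alpha>))" using \<alpha> by simp
  also have "\<dots> \<le> ennreal \<alpha> * \<rho> (\<lambda>x. u x / \<alpha>)" using \<alpha> assms by (intro modular_scale_le) auto
  also have "\<dots> \<le> ennreal \<alpha> * 1" using \<alpha> by (intro mult_left_mono) auto
  also have "\<dots> \<le> ennreal \<epsilon>" using \<alpha> by (simp add: ennreal_leI)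
  finally show ?thesis .
qed

lemma modular_div_le_1:
  assumes [measurable]: "u \<in> borel_measurable M" and \<delta>: "0 < \<delta>" "\<delta> \<le> 1" and le: "\<rho> u \<le> ennreal (\<delta> powr qM)"
  shows "\<rho> (\<lambda>x. u x / \<delta>) \<le> 1"
proof -
  have "\<rho> (\<lambda>x. (1 / \<delta>) * u x) \<le> ennreal ((1 / \<delta>) powr qM) * \<rho> u"
    using \<delta> by (intro modular_scale_ge) auto
  also have "\<dots> \<le> ennreal ((1 / \<delta>) powr qM) * ennreal (\<delta> powr qM)" using le by (intro mult_left_mono) auto
  also have "\<dots> = 1" using \<delta> by (simp add: ennreal_mult[symmetric] powr_divide)
  finally show ?thesis by simp
qed

lemma norm_le_if_modular_le:
  assumes "u \<in> borel_measurable M" "0 < \<delta>" "\<delta> \<le> 1" "\<rho> u \<le> ennreal (\<delta> powr qM)"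
  shows "orlicz_norm \<Omega> H u \<le> \<delta>"
  unfolding orlicz_norm_def
  by (rule cInf_lower) (use modular_div_le_1[OF assms] assms in \<open>auto intro!: bdd_belowI[of _ 0]\<close>)

lemma nn_integral_le_modular:
  assumes [measurable]: "f \<in> borel_measurable M"
  shows "(\<integral>\<^sup>+x. ennreal \<bar>f x\<bar> \<partial>M) \<le> emeasure M \<Omega> + \<rho> f"
proof -
  have "(\<integral>\<^sup>+x. ennreal \<bar>f x\<bar> \<partial>M) \<le> (\<integral>\<^sup>+x. 1 + ennreal (H x \<bar>f x\<bar>) \<partial>M)"
    using le_1_add_H H_nonneg by (intro nn_integral_mono) (auto simp: ennreal_plus[symmetric] ennreal_1[symmetric] simp del: ennreal_plus ennreal_1 intro!: ennreal_leI)
  also have "\<dots> = emeasure M \<Omega> + \<rho> f" by (subst nn_integral_add) (auto simp: modular_def)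
  finally show ?thesis .
qed

text \<open>A bound for the \<open>L\<^sup>1\<close> norm of every function with modular at most 1,
  by \<open>nn_integral_le_modular\<close>; the summand 1 is the bound for the modular.\<close>

definition mass :: real where "mass = measure M \<Omega> + 1"

lemma mass: "emeasure M \<Omega> + 1 = ennreal mass" "0 < mass"
proof -
  interpret finite_measure M by (rule finite_M)
  show "emeasure M \<Omega> + 1 = ennreal mass" by (simp add: mass_def emeasure_eq_measure)
  show "0 < mass" unfolding mass_def using measure_nonneg[of M \<Omega>] by linarith
qed

text \<open>The crude bound by \<open>mass\<close>, applied to f/\<delta> instead of f, becomes
  proportional to \<delta>.\<close>

lemma nn_integral_le_if_modular_le:
  assumes [measurable]: "f \<in> borel_measurable M" and \<delta>: "0 < \<delta>" "\<delta> \<le> 1" and le: "\<rho> f \<le> ennreal (\<delta> powr qM)"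
  shows "(\<integral>\<^sup>+x. ennreal \<bar>f x\<bar> \<partial>M) \<le> ennreal (\<delta> * mass)"
proof -
  have "(\<integral>\<^sup>+x. ennreal \<bar>f x / \<delta>\<bar> \<partial>M) \<le> emeasure M \<Omega> + \<rho> (\<lambda>x. f x / \<delta>)" by (rule nn_integral_le_modular) measurable
  also have "\<dots> \<le> emeasure M \<Omega> + 1" using modular_div_le_1[OF assms] by (intro add_mono) auto
  also have "\<dots> = ennreal mass" by (rule mass)
  finally have *: "(\<integral>\<^sup>+x. ennreal \<bar>f x / \<delta>\<bar> \<partial>M) \<le> ennreal mass" .
  have "(\<integral>\<^sup>+x. ennreal \<bar>f x\<bar> \<partial>M) = (\<integral>\<^sup>+x. ennreal \<delta> * ennreal \<bar>f x / \<delta>\<bar> \<partial>M)"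
    using \<delta> by (intro nn_integral_cong) (simp add: ennreal_mult[symmetric])
  also have "\<dots> = ennreal \<delta> * (\<integral>\<^sup>+x. ennreal \<bar>f x / \<delta>\<bar> \<partial>M)" by (rule nn_integral_cmult) measurable
  also have "\<dots> \<le> ennreal \<delta> * ennreal mass" using * by (intro mult_left_mono) auto
  finally show ?thesis using \<delta> mass by (simp add: ennreal_mult[symmetric])
qed

lemma integrable_if_modular_finite:
  fixes f :: "real ^ 'n \<Rightarrow> 'b::{banach, second_countable_topology}"
  assumes "f \<in> borel_measurable M" "\<rho> (\<lambda>x. norm (f x)) < \<infinity>"
  shows "integrable M f"
proof (rule integrableI_bounded[OF assms(1)])
  have "(\<integral>\<^sup>+x. ennreal \<bar>norm (f x)\<bar> \<partial>M) \<le> emeasure M \<Omega> + \<rho> (\<lambda>x. norm (f x))"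
    using assms(1) by (intro nn_integral_le_modular) auto
  also have "\<dots> < \<infinity>"
    using assms(2) finite_measure.emeasure_finite[OF finite_M, of \<Omega>] by (auto simp: less_top)
  finally show "(\<integral>\<^sup>+x. ennreal (norm (f x)) \<partial>M) < \<infinity>" by simp
qed

text \<open>Approximation in modular, with the gradient \<open>g\<close> as a separate argument: this avoids norms and the
  choice of a representative, and by \<open>W1_0_approximable\<close> and \<open>approximable_W1_0\<close> it is membership in \<open>W1_0\<close>.\<close>

definition approximable :: "(real ^ 'n \<Rightarrow> real) \<Rightarrow> (real ^ 'n \<Rightarrow> real ^ 'n) \<Rightarrow> bool" where
  "approximable u g \<longleftrightarrow> u \<in> borel_measurable M \<and> g \<in> borel_measurable M \<and>
    \<rho> u < \<infinity> \<and> \<rho> (\<lambda>x. norm (g x)) < \<infinity> \<and>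
    (\<forall>\<epsilon>>0. \<exists>\<phi>\<in>test_functions \<Omega>. \<rho> (\<lambda>x. u x - \<phi> x) \<le> ennreal \<epsilon> \<and> \<rho> (\<lambda>x. norm (g x - grad \<phi> x)) \<le> ennreal \<epsilon>)"

lemma test_measurable:
  assumes "\<phi> \<in> test_functions \<Omega>"
  shows "\<phi> \<in> borel_measurable M" "grad \<phi> \<in> borel_measurable M"
proof -
  have "f \<in> borel_measurable M" if "continuous_on UNIV f" for f :: "real ^ 'n \<Rightarrow> 'b::euclidean_space"
    using that \<Omega>_sets by (intro continuous_imp_measurable_on_sets_lebesgue) (auto intro: continuous_on_subset)
  then show "\<phi> \<in> borel_measurable M" "grad \<phi> \<in> borel_measurable M"
    using test_functionsD(3,4)[OF assms] by blast+
qed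

text \<open>The power \<open>qM\<close> makes the rate of convergence in \<open>L\<^sup>1\<close> equal to \<open>mass / (i + 1)\<close>.\<close>

definition fast_seq :: "(real ^ 'n \<Rightarrow> real) \<Rightarrow> (real ^ 'n \<Rightarrow> real ^ 'n) \<Rightarrow> (nat \<Rightarrow> real ^ 'n \<Rightarrow> real) \<Rightarrow> bool" where
  "fast_seq u g \<phi> \<longleftrightarrow> (\<forall>i. \<phi> i \<in> test_functions \<Omega> \<and>
    \<rho> (\<lambda>x. u x - \<phi> i x) \<le> ennreal ((1 / real (Suc i)) powr qM) \<and>
    \<rho> (\<lambda>x. norm (g x - grad (\<phi> i) x)) \<le> ennreal ((1 / real (Suc i)) powr qM))"

lemma approximable_seq: "approximable u g \<Longrightarrow> \<exists>\<phi>. fast_seq u g \<phi>"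
  unfolding fast_seq_def
proof (intro choice allI)
  fix i
  assume "approximable u g"
  moreover have "0 < (1 / real (Suc i)) powr qM" by simp
  ultimately show "\<exists>\<phi>. \<phi> \<in> test_functions \<Omega> \<and>
    \<rho> (\<lambda>x. u x - \<phi> x) \<le> ennreal ((1 / real (Suc i)) powr qM) \<and>
    \<rho> (\<lambda>x. norm (g x - grad \<phi> x)) \<le> ennreal ((1 / real (Suc i)) powr qM)"
    unfolding approximable_def by blast
qed

lemma fast_seqD:
  assumes a: "approximable u g" and \<phi>: "fast_seq u g \<phi>"
  shows "\<phi> i \<in> test_functions \<Omega>"
    "\<rho> (\<lambda>x. u x - \<phi> i x) \<le> ennreal ((1 / real (Suc i)) powr qM)"
    "\<rho> (\<lambda>x. norm (g x - grad (\<phi> i) x)) \<le> ennreal ((1 / real (Suc i)) powr qM)"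
    "(\<integral>\<^sup>+x. ennreal \<bar>u x - \<phi> i x\<bar> \<partial>M) \<le> ennreal (1 / real (Suc i) * mass)"
    "(\<integral>\<^sup>+x. ennreal (norm (g x - grad (\<phi> i) x)) \<partial>M) \<le> ennreal (1 / real (Suc i) * mass)"
proof -
  have [measurable]: "u \<in> borel_measurable M" "g \<in> borel_measurable M" using a by (auto simp: approximable_def)
  show \<phi>': "\<phi> i \<in> test_functions \<Omega>"
    "\<rho> (\<lambda>x. u x - \<phi> i x) \<le> ennreal ((1 / real (Suc i)) powr qM)"
    "\<rho> (\<lambda>x. norm (g x - grad (\<phi> i) x)) \<le> ennreal ((1 / real (Suc i)) powr qM)"
    using \<phi> unfolding fast_seq_def by blast+
  note [measurable] = test_measurable[OF \<phi>'(1)]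
  show "(\<integral>\<^sup>+x. ennreal \<bar>u x - \<phi> i x\<bar> \<partial>M) \<le> ennreal (1 / real (Suc i) * mass)"
    using \<phi>'(2) by (intro nn_integral_le_if_modular_le) auto
  have "(\<integral>\<^sup>+x. ennreal \<bar>norm (g x - grad (\<phi> i) x)\<bar> \<partial>M) \<le> ennreal (1 / real (Suc i) * mass)"
    using \<phi>'(3) by (intro nn_integral_le_if_modular_le) auto
  then show "(\<integral>\<^sup>+x. ennreal (norm (g x - grad (\<phi> i) x)) \<partial>M) \<le> ennreal (1 / real (Suc i) * mass)" by simp
qed

lemma rate_tendsto_0: "(\<lambda>i. ennreal (1 / real (Suc i) * c)) \<longlonglongrightarrow> 0"
proof -
  have "(\<lambda>i. ennreal (1 / real (Suc i) * c)) \<longlonglongrightarrow> ennreal (0 * c)"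
    using LIMSEQ_Suc[OF lim_1_over_n] by (intro tendsto_ennrealI tendsto_mult tendsto_const) simp
  then show ?thesis by simp
qed

lemma integrable_imp_locally_integrable:
  fixes f :: "real ^ 'n \<Rightarrow> 'b::{banach, second_countable_topology}"
  assumes "integrable M f"
  shows "locally_integrable \<Omega> f"
  unfolding locally_integrable_def
proof safe
  fix K assume K: "compact K" "K \<subseteq> \<Omega>"
  have Km: "K \<in> sets lebesgue" using K by (simp add: lmeasurable_compact fmeasurableD)
  have "integrable lebesgue (\<lambda>x. indicator \<Omega> x *\<^sub>R f x)"
    using assms \<Omega>_sets by (simp add: integrable_restrict_space)
  then have "integrable lebesgue (\<lambda>x. indicator K x *\<^sub>R (indicator \<Omega> x *\<^sub>R f x))"
    by (rule integrable_mult_indicator[OF Km])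
  moreover have "(\<lambda>x. indicator K x *\<^sub>R (indicator \<Omega> x *\<^sub>R f x)) = (\<lambda>x. indicator K x *\<^sub>R f x)"
    using K by (auto simp: indicator_def fun_eq_iff)
  ultimately show "integrable (lebesgue_on K) f" using Km by (simp add: integrable_restrict_space)
qed

lemma approximable_integrable:
  assumes "approximable u g"
  shows "integrable M u" "integrable M g"
proof -
  have *: "u \<in> borel_measurable M" "g \<in> borel_measurable M" "\<rho> u < \<infinity>" "\<rho> (\<lambda>x. norm (g x)) < \<infinity>"
    using assms by (auto simp: approximable_def)
  have "\<rho> (\<lambda>x. norm (u x)) = \<rho> u" by (simp add: modular_def)
  with * show "integrable M u" "integrable M g" by (auto intro!: integrable_if_modular_finite)
qed

text \<open>Both sides of the defining identity are continuous under convergence in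
  \<open>L\<^sup>1\<close>, because \<psi> and its gradient are bounded; so the identity passes from
  test functions to the limit.\<close>

lemma approximable_weak_gradient:
  assumes "approximable u g"
  shows "has_weak_gradient \<Omega> u g"
  unfolding has_weak_gradient_def
proof (intro conjI ballI)
  note i = approximable_integrable[OF assms]
  show loc: "locally_integrable \<Omega> u" "locally_integrable \<Omega> g" using i by (auto intro: integrable_imp_locally_integrable)
  fix \<psi> assume \<psi>': "\<psi> \<in> test_functions \<Omega>"
  note \<psi> = test_functionsD[OF \<psi>']
  have int: "integrable M (\<lambda>x. v x *\<^sub>R grad \<psi> x)" "integrable M (\<lambda>x. \<psi> x *\<^sub>R w x)"
    if "locally_integrable \<Omega> v" "locally_integrable \<Omega> w" for v w
    using integrable_loc_mult[OF that(1) bounded_bilinear_scaleR \<psi>(4,5,6,8) open_\<Omega>]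
      integrable_loc_mult[OF that(2) bounded_bilinear.flip[OF bounded_bilinear_scaleR] \<psi>(3,5,6,7) open_\<Omega>]
    by simp_all
  obtain B1 where B1: "B1 > 0" "\<And>x. norm (\<psi> x) \<le> B1" using bounded_cont_compact_support[OF \<psi>(3,5,7)] by blast
  obtain B2 where B2: "B2 > 0" "\<And>x. norm (grad \<psi> x) \<le> B2" using bounded_cont_compact_support[OF \<psi>(4,5,8)] by blast
  obtain \<phi> where "fast_seq u g \<phi>" using approximable_seq[OF assms] by blast
  note \<phi>5 = fast_seqD[OF assms this]
  note \<phi> = \<phi>5(1) and L1 = \<phi>5(4,5)
  have \<phi>w: "has_weak_gradient \<Omega> (\<phi> i) (grad (\<phi> i))" for i by (rule has_weak_gradient_test[OF \<phi> open_\<Omega>])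
  then have \<phi>l: "locally_integrable \<Omega> (\<phi> i)" "locally_integrable \<Omega> (grad (\<phi> i))" for i
    by (auto simp: has_weak_gradient_def)
  note [measurable] = test_measurable[OF \<phi>] borel_measurable_integrable[OF i(1)] borel_measurable_integrable[OF i(2)]
  have 1: "(\<lambda>i. LINT x|M. \<phi> i x *\<^sub>R grad \<psi> x) \<longlonglongrightarrow> (LINT x|M. u x *\<^sub>R grad \<psi> x)"
  proof (rule tendsto_L1_int)
    show "(\<lambda>i. \<integral>\<^sup>+x. ennreal (norm (\<phi> i x *\<^sub>R grad \<psi> x - u x *\<^sub>R grad \<psi> x)) \<partial>M) \<longlonglongrightarrow> 0"
    proof (rule tendsto_sandwich[OF _ _ tendsto_const])
      show "(\<lambda>i. ennreal (1 / real (Suc i) * (mass * B2))) \<longlonglongrightarrow> 0" by (rule rate_tendsto_0)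
      show "\<forall>\<^sub>F i in sequentially. (\<integral>\<^sup>+x. ennreal (norm (\<phi> i x *\<^sub>R grad \<psi> x - u x *\<^sub>R grad \<psi> x)) \<partial>M)
        \<le> ennreal (1 / real (Suc i) * (mass * B2))"
      proof (intro always_eventually allI)
        fix i
        have "(\<integral>\<^sup>+x. ennreal (norm (\<phi> i x *\<^sub>R grad \<psi> x - u x *\<^sub>R grad \<psi> x)) \<partial>M)
          \<le> (\<integral>\<^sup>+x. ennreal B2 * ennreal \<bar>u x - \<phi> i x\<bar> \<partial>M)"
        proof (intro nn_integral_mono)
          fix x
          have "norm (\<phi> i x *\<^sub>R grad \<psi> x - u x *\<^sub>R grad \<psi> x) = \<bar>u x - \<phi> i x\<bar> * norm (grad \<psi> x)"
            by (simp add: scaleR_left_diff_distrib[symmetric] abs_minus_commute)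
          also have "\<dots> \<le> \<bar>u x - \<phi> i x\<bar> * B2" using B2(2) by (intro mult_left_mono) auto
          finally show "ennreal (norm (\<phi> i x *\<^sub>R grad \<psi> x - u x *\<^sub>R grad \<psi> x)) \<le> ennreal B2 * ennreal \<bar>u x - \<phi> i x\<bar>"
            using B2(1) by (simp add: ennreal_mult[symmetric] mult.commute ennreal_leI)
        qed
        also have "\<dots> = ennreal B2 * (\<integral>\<^sup>+x. ennreal \<bar>u x - \<phi> i x\<bar> \<partial>M)" by (rule nn_integral_cmult) measurable
        also have "\<dots> \<le> ennreal B2 * ennreal (1 / real (Suc i) * mass)" using L1(1) by (intro mult_left_mono) auto
        also have "\<dots> = ennreal (1 / real (Suc i) * (mass * B2))"
          using B2(1) mass(2) by (simp add: ennreal_mult[symmetric] mult.commute)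
        finally show "(\<integral>\<^sup>+x. ennreal (norm (\<phi> i x *\<^sub>R grad \<psi> x - u x *\<^sub>R grad \<psi> x)) \<partial>M)
          \<le> ennreal (1 / real (Suc i) * (mass * B2))" .
      qed
    qed simp
  qed (use int(1)[OF loc] int(1)[OF \<phi>l] in auto)
  have 2: "(\<lambda>i. LINT x|M. \<psi> x *\<^sub>R grad (\<phi> i) x) \<longlonglongrightarrow> (LINT x|M. \<psi> x *\<^sub>R g x)"
  proof (rule tendsto_L1_int)
    show "(\<lambda>i. \<integral>\<^sup>+x. ennreal (norm (\<psi> x *\<^sub>R grad (\<phi> i) x - \<psi> x *\<^sub>R g x)) \<partial>M) \<longlonglongrightarrow> 0"
    proof (rule tendsto_sandwich[OF _ _ tendsto_const])
      show "(\<lambda>i. ennreal (1 / real (Suc i) * (mass * B1))) \<longlonglongrightarrow> 0" by (rule rate_tendsto_0)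
      show "\<forall>\<^sub>F i in sequentially. (\<integral>\<^sup>+x. ennreal (norm (\<psi> x *\<^sub>R grad (\<phi> i) x - \<psi> x *\<^sub>R g x)) \<partial>M)
        \<le> ennreal (1 / real (Suc i) * (mass * B1))"
      proof (intro always_eventually allI)
        fix i
        have "(\<integral>\<^sup>+x. ennreal (norm (\<psi> x *\<^sub>R grad (\<phi> i) x - \<psi> x *\<^sub>R g x)) \<partial>M)
          \<le> (\<integral>\<^sup>+x. ennreal B1 * ennreal (norm (g x - grad (\<phi> i) x)) \<partial>M)"
        proof (intro nn_integral_mono)
          fix x
          have "norm (\<psi> x *\<^sub>R grad (\<phi> i) x - \<psi> x *\<^sub>R g x) = \<bar>\<psi> x\<bar> * norm (g x - grad (\<phi> i) x)"
            by (simp add: scaleR_right_diff_distrib[symmetric] norm_minus_commute)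
          also have "\<dots> \<le> B1 * norm (g x - grad (\<phi> i) x)" using B1(2)[of x] by (intro mult_right_mono) auto
          finally show "ennreal (norm (\<psi> x *\<^sub>R grad (\<phi> i) x - \<psi> x *\<^sub>R g x)) \<le> ennreal B1 * ennreal (norm (g x - grad (\<phi> i) x))"
            using B1(1) by (simp add: ennreal_mult[symmetric] ennreal_leI)
        qed
        also have "\<dots> = ennreal B1 * (\<integral>\<^sup>+x. ennreal (norm (g x - grad (\<phi> i) x)) \<partial>M)" by (rule nn_integral_cmult) measurable
        also have "\<dots> \<le> ennreal B1 * ennreal (1 / real (Suc i) * mass)" using L1(2) by (intro mult_left_mono) auto
        also have "\<dots> = ennreal (1 / real (Suc i) * (mass * B1))"
          using B1(1) mass(2) by (simp add: ennreal_mult[symmetric] mult.commute)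
        finally show "(\<integral>\<^sup>+x. ennreal (norm (\<psi> x *\<^sub>R grad (\<phi> i) x - \<psi> x *\<^sub>R g x)) \<partial>M)
          \<le> ennreal (1 / real (Suc i) * (mass * B1))" .
      qed
    qed simp
  qed (use int(2)[OF loc] int(2)[OF \<phi>l] in auto)
  have "(LINT x|M. \<phi> i x *\<^sub>R grad \<psi> x) = - (LINT x|M. \<psi> x *\<^sub>R grad (\<phi> i) x)" for i
    using \<phi>w[of i] \<psi>' by (simp add: has_weak_gradient_def)
  with 1 have "(\<lambda>i. - (LINT x|M. \<psi> x *\<^sub>R grad (\<phi> i) x)) \<longlonglongrightarrow> (LINT x|M. u x *\<^sub>R grad \<psi> x)" by simp
  with tendsto_minus[OF 2] show "(LINT x|M. u x *\<^sub>R grad \<psi> x) = - (LINT x|M. \<psi> x *\<^sub>R g x)"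
    using LIMSEQ_unique by blast
qed

lemma weak_grad_sub_test_AE:
  assumes "has_weak_gradient \<Omega> u g" "\<phi> \<in> test_functions \<Omega>"
  shows "AE x in M. weak_grad \<Omega> (\<lambda>x. u x - \<phi> x) x = g x - grad \<phi> x"
  by (rule weak_grad_AE[OF has_weak_gradient_diff[OF assms(1) has_weak_gradient_test[OF assms(2) open_\<Omega>] open_\<Omega>] open_\<Omega>])

lemma weak_grad_measurable:
  assumes "has_weak_gradient \<Omega> u g"
  shows "weak_grad \<Omega> u \<in> borel_measurable M"
  using has_weak_gradient_weak_grad[OF assms] open_\<Omega>
  by (auto simp: has_weak_gradient_def intro: locally_integrable_measurable)

text \<open>\<open>W1_norm\<close> refers to \<open>weak_grad\<close> of a difference, an arbitrary
  choice among weak gradients. It agrees a.e. with g minus the gradient of the test function, and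
  modulars do not see null sets.\<close>

lemma approximable_W1_0:
  assumes a: "approximable u g"
  shows "u \<in> W1_0 \<Omega> H"
proof -
  have um[measurable]: "u \<in> borel_measurable M" "g \<in> borel_measurable M" using a by (auto simp: approximable_def)
  have w: "has_weak_gradient \<Omega> u g" by (rule approximable_weak_gradient[OF a])
  have [measurable]: "weak_grad \<Omega> u \<in> borel_measurable M" by (rule weak_grad_measurable[OF w])
  have "\<rho> (\<lambda>x. norm (weak_grad \<Omega> u x)) = \<rho> (\<lambda>x. norm (g x))"
    by (rule modular_cong_AE) (use weak_grad_AE[OF w open_\<Omega>] in \<open>auto elim!: eventually_mono\<close>)
  then have W1: "u \<in> W1 \<Omega> H" using a w by (auto simp: W1_def orlicz_space_iff approximable_def)
  have "\<exists>\<phi>\<in>test_functions \<Omega>. W1_norm \<Omega> H (\<lambda>x. u x - \<phi> x) < \<epsilon>" if \<epsilon>: "\<epsilon> > 0" for \<epsilon>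
  proof -
    define \<delta> where "\<delta> = min 1 (\<epsilon> / 3)"
    have \<delta>: "0 < \<delta>" "\<delta> \<le> 1" "\<delta> + \<delta> < \<epsilon>" using \<epsilon> by (auto simp: \<delta>_def)
    then have "\<delta> powr qM > 0" by simp
    then obtain \<phi> where \<phi>: "\<phi> \<in> test_functions \<Omega>" "\<rho> (\<lambda>x. u x - \<phi> x) \<le> ennreal (\<delta> powr qM)"
      "\<rho> (\<lambda>x. norm (g x - grad \<phi> x)) \<le> ennreal (\<delta> powr qM)"
      using a unfolding approximable_def by blast
    note [measurable] = test_measurable[OF \<phi>(1)]
    have w': "has_weak_gradient \<Omega> (\<lambda>x. u x - \<phi> x) (\<lambda>x. g x - grad \<phi> x)"
      by (rule has_weak_gradient_diff[OF w has_weak_gradient_test[OF \<phi>(1) open_\<Omega>] open_\<Omega>])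
    have [measurable]: "weak_grad \<Omega> (\<lambda>x. u x - \<phi> x) \<in> borel_measurable M" by (rule weak_grad_measurable[OF w'])
    have eq: "\<rho> (\<lambda>x. norm (weak_grad \<Omega> (\<lambda>x. u x - \<phi> x) x)) = \<rho> (\<lambda>x. norm (g x - grad \<phi> x))"
      by (rule modular_cong_AE) (use weak_grad_sub_test_AE[OF w \<phi>(1)] in \<open>auto elim!: eventually_mono\<close>)
    have "orlicz_norm \<Omega> H (\<lambda>x. u x - \<phi> x) \<le> \<delta>"
      using \<delta> \<phi> by (intro norm_le_if_modular_le) auto
    moreover have "orlicz_norm \<Omega> H (\<lambda>x. norm (weak_grad \<Omega> (\<lambda>x. u x - \<phi> x) x)) \<le> \<delta>"
      using \<delta> \<phi>(3) eq by (intro norm_le_if_modular_le) auto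
    ultimately show ?thesis using \<phi>(1) \<delta> by (intro bexI[of _ \<phi>]) (auto simp: W1_norm_def)
  qed
  with W1 show ?thesis by (simp add: W1_0_def)
qed

text \<open>This puts the differences of u and test functions into the Orlicz space. Otherwise the
  infimum in \<open>orlicz_norm\<close> might range over the empty set, and a small value of it
  would carry no information.\<close>

lemma test_modular_finite:
  assumes "\<phi> \<in> test_functions \<Omega>"
  shows "\<rho> \<phi> < \<infinity>" "\<rho> (\<lambda>x. norm (grad \<phi> x)) < \<infinity>"
proof -
  have fin: "\<rho> f < \<infinity>" if f: "\<And>x. \<bar>f x\<bar> \<le> B" "B > 0" for f B
  proof -
    have "\<rho> f \<le> (\<integral>\<^sup>+x. ennreal (max 1 B powr qM * (1 + \<mu>M)) \<partial>M)"
      unfolding modular_def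
    proof (intro nn_integral_mono ennreal_leI)
      fix x assume "x \<in> space M"
      then have x: "x \<in> \<Omega>" by simp
      have "H x \<bar>f x\<bar> \<le> H x (max 1 B * 1)" using f(1)[of x] by (intro H_mono x) auto
      also have "\<dots> \<le> max 1 B powr qM * H x 1" by (intro H_scale_ge x) auto
      also have "H x 1 \<le> 1 + \<mu>M" using \<mu>_le[OF x] by (simp add: double_phase_def)
      finally show "H x \<bar>f x\<bar> \<le> max 1 B powr qM * (1 + \<mu>M)" by (simp add: mult_left_mono)
    qed
    also have "\<dots> < \<infinity>" using finite_measure.emeasure_finite[OF finite_M, of \<Omega>]
      by (simp add: ennreal_mult_less_top less_top)
    finally show ?thesis .
  qed
  note \<phi> = test_functionsD[OF assms]
  obtain B1 where "B1 > 0" "\<And>x. norm (\<phi> x) \<le> B1" using bounded_cont_compact_support[OF \<phi>(3,5,7)] by blast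
  then show "\<rho> \<phi> < \<infinity>" by (intro fin) auto
  obtain B2 where "B2 > 0" "\<And>x. norm (grad \<phi> x) \<le> B2" using bounded_cont_compact_support[OF \<phi>(4,5,8)] by blast
  then show "\<rho> (\<lambda>x. norm (grad \<phi> x)) < \<infinity>" by (intro fin) auto
qed

lemma W1_0_approximable:
  assumes u: "u \<in> W1_0 \<Omega> H"
  shows "approximable u (weak_grad \<Omega> u)"
proof -
  obtain g where w0: "has_weak_gradient \<Omega> u g" using u by (auto simp: W1_0_def W1_def)
  have w: "has_weak_gradient \<Omega> u (weak_grad \<Omega> u)" by (rule has_weak_gradient_weak_grad[OF w0])
  have um[measurable]: "u \<in> borel_measurable M" "weak_grad \<Omega> u \<in> borel_measurable M"
    using u weak_grad_measurable[OF w] by (auto simp: W1_0_def W1_def orlicz_space_iff)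
  have fin: "\<rho> u < \<infinity>" "\<rho> (\<lambda>x. norm (weak_grad \<Omega> u x)) < \<infinity>"
    using u by (auto simp: W1_0_def W1_def orlicz_space_iff)
  have "\<exists>\<phi>\<in>test_functions \<Omega>. \<rho> (\<lambda>x. u x - \<phi> x) \<le> ennreal \<epsilon> \<and> \<rho> (\<lambda>x. norm (weak_grad \<Omega> u x - grad \<phi> x)) \<le> ennreal \<epsilon>"
    if \<epsilon>: "\<epsilon> > 0" for \<epsilon>
  proof -
    define \<delta> where "\<delta> = min 1 \<epsilon>"
    have \<delta>: "0 < \<delta>" "\<delta> \<le> 1" "\<delta> \<le> \<epsilon>" using \<epsilon> by (auto simp: \<delta>_def)
    then obtain \<phi> where \<phi>: "\<phi> \<in> test_functions \<Omega>" "W1_norm \<Omega> H (\<lambda>x. u x - \<phi> x) < \<delta>"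
      using u by (auto simp: W1_0_def)
    note [measurable] = test_measurable[OF \<phi>(1)]
    have w': "has_weak_gradient \<Omega> (\<lambda>x. u x - \<phi> x) (\<lambda>x. weak_grad \<Omega> u x - grad \<phi> x)"
      by (rule has_weak_gradient_diff[OF w has_weak_gradient_test[OF \<phi>(1) open_\<Omega>] open_\<Omega>])
    have [measurable]: "weak_grad \<Omega> (\<lambda>x. u x - \<phi> x) \<in> borel_measurable M" by (rule weak_grad_measurable[OF w'])
    have eq: "\<rho> (\<lambda>x. norm (weak_grad \<Omega> (\<lambda>x. u x - \<phi> x) x)) = \<rho> (\<lambda>x. norm (weak_grad \<Omega> u x - grad \<phi> x))"
      by (rule modular_cong_AE) (use weak_grad_sub_test_AE[OF w \<phi>(1)] in \<open>auto elim!: eventually_mono\<close>)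
    have "\<rho> (\<lambda>x. u x - \<phi> x) \<le> ennreal (2 powr qM) * (\<rho> u + \<rho> \<phi>)" by (rule modular_add_le) auto
    also have "\<dots> < \<infinity>" using fin test_modular_finite[OF \<phi>(1)] by (simp add: ennreal_mult_less_top)
    finally have o1: "(\<lambda>x. u x - \<phi> x) \<in> orlicz_space \<Omega> H" by (simp add: orlicz_space_iff)
    have "\<rho> (\<lambda>x. norm (weak_grad \<Omega> u x - grad \<phi> x))
      \<le> ennreal (2 powr qM) * (\<rho> (\<lambda>x. norm (weak_grad \<Omega> u x)) + \<rho> (\<lambda>x. norm (grad \<phi> x)))"
      by (rule modular_add_le) (auto intro: norm_triangle_ineq4)
    also have "\<dots> < \<infinity>" using fin test_modular_finite[OF \<phi>(1)] by (simp add: ennreal_mult_less_top)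
    finally have o2: "(\<lambda>x. norm (weak_grad \<Omega> (\<lambda>x. u x - \<phi> x) x)) \<in> orlicz_space \<Omega> H"
      by (simp add: orlicz_space_iff eq)
    have "orlicz_norm \<Omega> H (\<lambda>x. u x - \<phi> x) < \<delta>" "orlicz_norm \<Omega> H (\<lambda>x. norm (weak_grad \<Omega> (\<lambda>x. u x - \<phi> x) x)) < \<delta>"
      using \<phi>(2) orlicz_norm_nonneg[OF o1] orlicz_norm_nonneg[OF o2] by (auto simp: W1_norm_def)
    from modular_le_if_norm_less[OF o1 this(1) \<delta>(1,2)] modular_le_if_norm_less[OF o2 this(2) \<delta>(1,2)]
    have "\<rho> (\<lambda>x. u x - \<phi> x) \<le> ennreal \<delta>" "\<rho> (\<lambda>x. norm (weak_grad \<Omega> u x - grad \<phi> x)) \<le> ennreal \<delta>"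
      by (auto simp: eq)
    moreover have "ennreal \<delta> \<le> ennreal \<epsilon>" using \<delta> by (simp add: ennreal_leI)
    ultimately show ?thesis using \<phi>(1) by (meson order_trans)
  qed
  then show ?thesis using fin um by (auto simp: approximable_def)
qed

text \<open>Smallness in modular gives convergence in \<open>L\<^sup>1\<close>, hence a.e. along a
  subsequence. Pointwise convergence is what Fatou's lemma and the continuity of nonlinear functions
  of u ask for.\<close>

lemma fast_seq_AE_subseq:
  assumes a: "approximable u g" and \<phi>: "fast_seq u g \<phi>"
  shows "\<exists>s. strict_mono (s :: nat \<Rightarrow> nat) \<and> (AE x in M. (\<lambda>n. \<phi> (s n) x) \<longlonglongrightarrow> u x)"
proof -
  have [measurable]: "u \<in> borel_measurable M" using a by (auto simp: approximable_def)
  note \<phi>5 = fast_seqD[OF a \<phi>]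
  note [measurable] = test_measurable[OF \<phi>5(1)]
  have iu: "integrable M (\<lambda>x. u x - \<phi> i x)" for i
  proof (rule integrableI_bounded)
    show "(\<integral>\<^sup>+x. ennreal (norm (u x - \<phi> i x)) \<partial>M) < \<infinity>" using \<phi>5(4)[of i] by (simp add: le_less_trans)
  qed measurable
  have "(\<lambda>i. LINT x|M. norm (u x - \<phi> i x)) \<longlonglongrightarrow> 0"
  proof (rule tendsto_sandwich[OF _ _ tendsto_const])
    show "\<forall>\<^sub>F i in sequentially. 0 \<le> (LINT x|M. norm (u x - \<phi> i x))" by simp
    show "\<forall>\<^sub>F i in sequentially. (LINT x|M. norm (u x - \<phi> i x)) \<le> 1 / real (Suc i) * mass"
      using \<phi>5(4) mass(2) by (intro always_eventually allI integral_real_bounded) auto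
    have "(\<lambda>i. 1 / real (Suc i) * mass) \<longlonglongrightarrow> 0 * mass"
      by (intro tendsto_mult tendsto_const) (use LIMSEQ_Suc[OF lim_1_over_n] in simp)
    then show "(\<lambda>i. 1 / real (Suc i) * mass) \<longlonglongrightarrow> 0" by simp
  qed
  from tendsto_L1_AE_subseq[OF iu this] obtain s :: "nat \<Rightarrow> nat" where s: "strict_mono s"
    "AE x in M. (\<lambda>n. u x - \<phi> (s n) x) \<longlonglongrightarrow> 0" by blast
  from s(2) have "AE x in M. (\<lambda>n. \<phi> (s n) x) \<longlonglongrightarrow> u x"
  proof eventually_elim
    case (elim x)
    have "(\<lambda>n. u x - (u x - \<phi> (s n) x)) \<longlonglongrightarrow> u x - 0" using elim by (intro tendsto_diff tendsto_const)
    then show ?case by simp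
  qed
  with s(1) show ?thesis by blast
qed

text \<open>The chain rule in the closure of the test functions. The gradient error splits into
  (G'(u) - G'(\<phi>)) g, which tends to 0 in modular by dominated convergence along an a.e.
  convergent subsequence, and G'(\<phi>) (g - grad \<phi>), which is small since |G'| is at most
  1.\<close>

lemma approximable_compose:
  assumes a: "approximable u g"
    and G: "\<And>k. D_k k G" "G 0 = 0" "\<And>t. (G has_real_derivative G' t) (at t)" "\<And>t. \<bar>G' t\<bar> \<le> 1"
      "continuous_on UNIV G'"
  shows "approximable (\<lambda>x. G (u x)) (\<lambda>x. G' (u x) *\<^sub>R g x)"
proof -
  have um[measurable]: "u \<in> borel_measurable M" "g \<in> borel_measurable M"
    and fin: "\<rho> u < \<infinity>" "\<rho> (\<lambda>x. norm (g x)) < \<infinity>" using a by (auto simp: approximable_def)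
  have [measurable]: "G \<in> borel_measurable borel" "G' \<in> borel_measurable borel"
    using G(5) D_k_continuous[OF G(1)] by (auto intro: borel_measurable_continuous_onI)
  have Glip: "\<bar>G a - G b\<bar> \<le> \<bar>a - b\<bar>" for a b
  proof -
    have "norm (G a - G b) \<le> 1 * norm (a - b)"
      by (rule field_differentiable_bound[of UNIV G G']) (use G(3,4) in \<open>auto intro: DERIV_subset\<close>)
    then show ?thesis by simp
  qed
  have "\<rho> (\<lambda>x. G (u x)) \<le> \<rho> u" using Glip[of _ 0] G(2) by (intro modular_mono) auto
  also note fin(1)
  finally have 1: "\<rho> (\<lambda>x. G (u x)) < \<infinity>" .
  have "\<rho> (\<lambda>x. norm (G' (u x) *\<^sub>R g x)) \<le> \<rho> (\<lambda>x. norm (g x))"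
    using G(4) by (intro modular_mono) (simp add: mult_left_le_one_le)
  also note fin(2)
  finally have 2: "\<rho> (\<lambda>x. norm (G' (u x) *\<^sub>R g x)) < \<infinity>" .
  have "\<exists>\<phi>\<in>test_functions \<Omega>. \<rho> (\<lambda>x. G (u x) - \<phi> x) \<le> ennreal \<epsilon> \<and>
    \<rho> (\<lambda>x. norm (G' (u x) *\<^sub>R g x - grad \<phi> x)) \<le> ennreal \<epsilon>" if \<epsilon>: "\<epsilon> > 0" for \<epsilon>
  proof -
    obtain \<phi> where f: "fast_seq u g \<phi>" using approximable_seq[OF a] by blast
    note \<phi>5 = fast_seqD[OF a f]
    note \<phi> = \<phi>5(1) and r = \<phi>5(2,3)
    note [measurable] = test_measurable[OF \<phi>]
    obtain s where s: "strict_mono s" "AE x in M. (\<lambda>n. \<phi> (s n) x) \<longlonglongrightarrow> u x"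
      using fast_seq_AE_subseq[OF a f] by blast
    define f where "f n x = norm (G' (u x) *\<^sub>R g x - G' (\<phi> (s n) x) *\<^sub>R g x)" for n x
    have [measurable]: "f n \<in> borel_measurable M" for n unfolding f_def by measurable
    have f_eq: "f n x = \<bar>G' (u x) - G' (\<phi> (s n) x)\<bar> * norm (g x)" for n x
      by (simp add: f_def scaleR_left_diff_distrib[symmetric])
    have fle: "f n x \<le> 2 * norm (g x)" for n x
    proof -
      have "\<bar>G' (u x) - G' (\<phi> (s n) x)\<bar> \<le> 2" using G(4)[of "u x"] G(4)[of "\<phi> (s n) x"] by linarith
      then show ?thesis unfolding f_eq by (intro mult_right_mono) auto
    qed
    have "(\<lambda>n. \<integral>\<^sup>+x. ennreal (H x (f n x)) \<partial>M) \<longlonglongrightarrow> (\<integral>\<^sup>+x. 0 \<partial>M)"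
    proof (rule nn_integral_dominated_convergence[where w="\<lambda>x. ennreal (2 powr qM) * ennreal (H x (norm (g x)))"])
      show "(\<integral>\<^sup>+x. ennreal (2 powr qM) * ennreal (H x (norm (g x))) \<partial>M) < \<infinity>"
        using fin(2) by (subst nn_integral_cmult) (auto simp: modular_def ennreal_mult_less_top)
      show "AE x in M. ennreal (H x (f n x)) \<le> ennreal (2 powr qM) * ennreal (H x (norm (g x)))" for n
      proof (rule AE_I2)
        fix x assume "x \<in> space M"
        then have x: "x \<in> \<Omega>" by simp
        have "H x (f n x) \<le> H x (2 * norm (g x))" using fle by (intro H_mono x) (auto simp: f_def)
        also have "\<dots> \<le> 2 powr qM * H x (norm (g x))" by (intro H_scale_ge x) auto
        finally show "ennreal (H x (f n x)) \<le> ennreal (2 powr qM) * ennreal (H x (norm (g x)))"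
          using H_nonneg[OF x] by (simp add: ennreal_mult[symmetric] ennreal_leI)
      qed
      show "AE x in M. (\<lambda>n. ennreal (H x (f n x))) \<longlonglongrightarrow> 0"
        using s(2) AE_space
      proof eventually_elim
        case (elim x)
        then have x: "x \<in> \<Omega>" by simp
        have "(\<lambda>n. G' (\<phi> (s n) x)) \<longlonglongrightarrow> G' (u x)"
          using G(5) elim(1) by (intro isCont_tendsto_compose[of _ G']) (auto simp: continuous_on_eq_continuous_at)
        then have *: "(\<lambda>n. \<bar>G' (u x) - G' (\<phi> (s n) x)\<bar> * H x (2 * norm (g x))) \<longlonglongrightarrow> \<bar>G' (u x) - G' (u x)\<bar> * H x (2 * norm (g x))"
          by (intro tendsto_mult tendsto_const tendsto_rabs tendsto_diff)
        have "(\<lambda>n. H x (f n x)) \<longlonglongrightarrow> 0"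
        proof (rule tendsto_sandwich[OF _ _ tendsto_const])
          show "\<forall>\<^sub>F n in sequentially. H x (f n x) \<le> \<bar>G' (u x) - G' (\<phi> (s n) x)\<bar> * H x (2 * norm (g x))"
          proof (intro always_eventually allI)
            fix n
            let ?l = "\<bar>G' (u x) - G' (\<phi> (s n) x)\<bar>"
            have l: "?l \<le> 2" using G(4)[of "u x"] G(4)[of "\<phi> (s n) x"] by linarith
            \<comment> \<open>The difference of two values of G' may reach 2; halving it brings the
              factor into [0, 1], where \<open>H_scale_le\<close> applies.\<close>
            have "H x (f n x) = H x ((?l / 2) * (2 * norm (g x)))" by (simp add: f_eq)
            also have "\<dots> \<le> (?l / 2) * H x (2 * norm (g x))" using l by (intro H_scale_le x) auto
            also have "\<dots> \<le> ?l * H x (2 * norm (g x))" using H_nonneg[OF x] by (intro mult_right_mono) auto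
            finally show "H x (f n x) \<le> ?l * H x (2 * norm (g x))" .
          qed
          show "(\<lambda>n. \<bar>G' (u x) - G' (\<phi> (s n) x)\<bar> * H x (2 * norm (g x))) \<longlonglongrightarrow> 0" using * by simp
        qed (use H_nonneg[OF x] in auto)
        then have "(\<lambda>n. ennreal (H x (f n x))) \<longlonglongrightarrow> ennreal 0" by (rule tendsto_ennrealI)
        then show ?case by simp
      qed
    qed auto
    then have lim: "(\<lambda>n. \<rho> (f n)) \<longlonglongrightarrow> 0" unfolding modular_def by (simp add: f_def)
    \<comment> \<open>Leaves half of \<epsilon> to each part of the gradient error after the
      quasi-triangle constant \<open>2 powr qM\<close> is paid.\<close>
    define \<eta> where "\<eta> = min \<epsilon> (\<epsilon> / (2 * 2 powr qM))"
    have \<eta>: "\<eta> > 0" "\<eta> \<le> \<epsilon>" "2 powr qM * (\<eta> + \<eta>) \<le> \<epsilon>" using \<epsilon> by (auto simp: \<eta>_def min_def field_simps)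
    have "\<forall>\<^sub>F n in sequentially. \<rho> (f n) < ennreal \<eta>" using lim \<eta> by (intro order_tendstoD) auto
    moreover have "\<forall>\<^sub>F n in sequentially. (1 / real (Suc (s n))) powr qM < \<eta>"
    proof (rule order_tendstoD(2)[OF _ \<eta>(1)])
      have "(\<lambda>n. (1 / real (Suc n)) powr qM) \<longlonglongrightarrow> 0 powr qM"
        by (intro tendsto_powr2 tendsto_const) (use LIMSEQ_Suc[OF lim_1_over_n] qM in auto)
      then have "(\<lambda>n. (1 / real (Suc n)) powr qM) \<longlonglongrightarrow> 0" by simp
      from LIMSEQ_subseq_LIMSEQ[OF this s(1)] show "(\<lambda>n. (1 / real (Suc (s n))) powr qM) \<longlonglongrightarrow> 0" by (simp add: o_def)
    qed
    ultimately have "\<forall>\<^sub>F n in sequentially. \<rho> (f n) < ennreal \<eta> \<and> (1 / real (Suc (s n))) powr qM < \<eta>"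
      by eventually_elim simp
    then obtain n where n: "\<rho> (f n) < ennreal \<eta>" "(1 / real (Suc (s n))) powr qM < \<eta>"
      using eventually_happens trivial_limit_sequentially by blast
    let ?\<phi> = "\<phi> (s n)"
    have t: "(\<lambda>x. G (?\<phi> x)) \<in> test_functions \<Omega>" by (rule test_functions_compose[OF \<phi> G(1,2)])
    have gr: "grad (\<lambda>x. G (?\<phi> x)) x = G' (?\<phi> x) *\<^sub>R grad ?\<phi> x" for x
      by (rule grad_compose[OF test_functionsD(2)[OF \<phi>] G(3)])
    have r': "\<rho> (\<lambda>x. u x - ?\<phi> x) \<le> ennreal \<eta>" "\<rho> (\<lambda>x. norm (g x - grad ?\<phi> x)) \<le> ennreal \<eta>"
      using r[of "s n"] n(2) by (meson ennreal_leI less_imp_le order_trans)+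
    have "\<rho> (\<lambda>x. G (u x) - G (?\<phi> x)) \<le> \<rho> (\<lambda>x. u x - ?\<phi> x)" using Glip by (intro modular_mono) auto
    also have "\<dots> \<le> ennreal \<epsilon>" using r'(1) \<eta>(2) by (meson ennreal_leI order_trans)
    finally have A: "\<rho> (\<lambda>x. G (u x) - G (?\<phi> x)) \<le> ennreal \<epsilon>" .
    have "\<rho> (\<lambda>x. norm (G' (u x) *\<^sub>R g x - grad (\<lambda>x. G (?\<phi> x)) x))
      \<le> ennreal (2 powr qM) * (\<rho> (f n) + \<rho> (\<lambda>x. norm (g x - grad ?\<phi> x)))"
    proof (rule modular_add_le)
      fix x
      have "G' (u x) *\<^sub>R g x - G' (?\<phi> x) *\<^sub>R grad ?\<phi> x
        = (G' (u x) *\<^sub>R g x - G' (?\<phi> x) *\<^sub>R g x) + G' (?\<phi> x) *\<^sub>R (g x - grad ?\<phi> x)" by (simp add: algebra_simps)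
      then have "norm (G' (u x) *\<^sub>R g x - G' (?\<phi> x) *\<^sub>R grad ?\<phi> x) \<le> f n x + norm (G' (?\<phi> x) *\<^sub>R (g x - grad ?\<phi> x))"
        unfolding f_def by (metis norm_triangle_ineq)
      also have "norm (G' (?\<phi> x) *\<^sub>R (g x - grad ?\<phi> x)) \<le> norm (g x - grad ?\<phi> x)"
        using G(4) by (simp add: mult_left_le_one_le)
      finally show "\<bar>norm (G' (u x) *\<^sub>R g x - grad (\<lambda>x. G (?\<phi> x)) x)\<bar> \<le> \<bar>f n x\<bar> + \<bar>norm (g x - grad ?\<phi> x)\<bar>"
        unfolding gr by (simp add: f_def)
    qed (simp_all add: gr)
    also have "\<dots> \<le> ennreal (2 powr qM) * (ennreal \<eta> + ennreal \<eta>)"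
      using n(1) r'(2) by (intro mult_left_mono add_mono) auto
    also have "\<dots> = ennreal (2 powr qM * (\<eta> + \<eta>))" using \<eta>(1)
      by (subst ennreal_plus[symmetric]) (auto simp: ennreal_mult[symmetric])
    also have "\<dots> \<le> ennreal \<epsilon>" using \<eta>(3) by (rule ennreal_leI)
    finally show ?thesis using A t by (intro bexI[of _ "\<lambda>x. G (?\<phi> x)"]) auto
  qed
  then show ?thesis using 1 2 by (auto simp: approximable_def)
qed

end

subsection \<open>Pointwise Lipschitz constants\<close>

lemma lip_at_mono: "lip_at f x a \<Longrightarrow> a \<le> b \<Longrightarrow> lip_at f x b"
  unfolding lip_at_def
proof (intro allI impI)
  fix \<delta> :: real
  assume f: "\<forall>\<delta>>0. \<forall>\<^sub>F y in at x. \<bar>f y - f x\<bar> \<le> (a + \<delta>) * dist y x" and ab: "a \<le> b" and \<delta>: "0 < \<delta>"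
  from f \<delta> have "\<forall>\<^sub>F y in at x. \<bar>f y - f x\<bar> \<le> (a + \<delta>) * dist y x" by blast
  then show "\<forall>\<^sub>F y in at x. \<bar>f y - f x\<bar> \<le> (b + \<delta>) * dist y x"
  proof eventually_elim
    case (elim y)
    have "(a + \<delta>) * dist y x \<le> (b + \<delta>) * dist y x" using ab by (intro mult_right_mono) auto
    with elim show ?case by linarith
  qed
qed

lemma lip_at_cong:
  assumes "\<forall>\<^sub>F y in nhds x. f y = g y"
  shows "lip_at f x c \<longleftrightarrow> lip_at g x c"
proof -
  have "f x = g x" using assms by (rule eventually_nhds_x_imp_x)
  moreover have "\<forall>\<^sub>F y in at x. f y = g y" using assms by (simp add: eventually_at_filter eventually_mono)
  ultimately have "(\<forall>\<^sub>F y in at x. \<bar>f y - f x\<bar> \<le> (c + \<delta>) * dist y x) \<longleftrightarrow> (\<forall>\<^sub>F y in at x. \<bar>g y - g x\<bar> \<le> (c + \<delta>) * dist y x)" for \<delta>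
    by (intro eventually_subst) (auto elim: eventually_mono)
  then show ?thesis by (simp add: lip_at_def)
qed

lemma lip_at_isCont: "lip_at f x c \<Longrightarrow> isCont f x"
proof -
  assume "lip_at f x c"
  then have ev: "\<forall>\<^sub>F y in at x. \<bar>f y - f x\<bar> \<le> (c + 1) * dist y x" by (auto simp: lip_at_def)
  have "((\<lambda>y. (c + 1) * dist y x) \<longlongrightarrow> (c + 1) * dist x x) (at x)" by (intro tendsto_intros)
  then have "((\<lambda>y. (c + 1) * dist y x) \<longlongrightarrow> 0) (at x)" by simp
  then have "((\<lambda>y. f y - f x) \<longlongrightarrow> 0) (at x)"
    by (rule Lim_null_comparison[rotated]) (use ev in simp)
  then show ?thesis by (simp add: isCont_def LIM_zero_iff)
qed

lemma lip_at_lipschitz: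
  assumes "L-lipschitz_on S f" "open S" "x \<in> S"
  shows "lip_at f x L"
  unfolding lip_at_def
proof (intro allI impI)
  fix \<delta> :: real assume \<delta>: "\<delta> > 0"
  have "\<forall>\<^sub>F y in at x. y \<in> S" using assms(2,3) by (rule eventually_at_in_open')
  then show "\<forall>\<^sub>F y in at x. \<bar>f y - f x\<bar> \<le> (L + \<delta>) * dist y x"
  proof eventually_elim
    case (elim y)
    have "dist (f y) (f x) \<le> L * dist y x" using lipschitz_onD[OF assms(1) elim assms(3)] .
    also have "\<dots> \<le> (L + \<delta>) * dist y x" using \<delta> by (intro mult_right_mono) auto
    finally show ?case by (simp add: dist_real_def)
  qed
qed

text \<open>In the next rules the constant \<open>c + \<delta>\<close> is reached by perturbing all the constants
  involved by a common small \<open>\<eta>\<close>.\<close>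

lemma lip_atI_perturb:
  fixes k :: "real \<Rightarrow> real"
  assumes lim: "(k \<longlongrightarrow> c) (at_right 0)"
    and ev: "\<And>\<eta>. \<eta> > 0 \<Longrightarrow> \<forall>\<^sub>F y in at x. \<bar>f y - f x\<bar> \<le> k \<eta> * dist y x"
  shows "lip_at f x c"
  unfolding lip_at_def
proof (intro allI impI)
  fix \<delta> :: real assume \<delta>: "\<delta> > 0"
  have "\<forall>\<^sub>F \<eta> in at_right 0. k \<eta> < c + \<delta>" using lim \<delta> by (intro order_tendstoD) auto
  moreover have "\<forall>\<^sub>F \<eta> in at_right 0. (0::real) < \<eta>" by (rule eventually_at_right_less)
  ultimately have "\<forall>\<^sub>F \<eta> in at_right 0. k \<eta> < c + \<delta> \<and> 0 < \<eta>" by eventually_elim simp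
  then obtain \<eta> where \<eta>: "k \<eta> < c + \<delta>" "\<eta> > 0"
    using eventually_happens trivial_limit_at_right_real by blast
  from ev[OF \<eta>(2)] show "\<forall>\<^sub>F y in at x. \<bar>f y - f x\<bar> \<le> (c + \<delta>) * dist y x"
  proof eventually_elim
    case (elim y)
    have "k \<eta> * dist y x \<le> (c + \<delta>) * dist y x" using \<eta> by (intro mult_right_mono) auto
    with elim show ?case by linarith
  qed
qed

lemma lip_at_add:
  assumes "lip_at f x a" "lip_at g x b"
  shows "lip_at (\<lambda>y. f y + g y) x (a + b)"
proof (rule lip_atI_perturb)
  show "((\<lambda>\<eta>. (a + \<eta>) + (b + \<eta>)) \<longlongrightarrow> a + b) (at_right 0)" by (auto intro!: tendsto_eq_intros)
  fix \<eta> :: real assume "\<eta> > 0"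
  then have "\<forall>\<^sub>F y in at x. \<bar>f y - f x\<bar> \<le> (a + \<eta>) * dist y x" "\<forall>\<^sub>F y in at x. \<bar>g y - g x\<bar> \<le> (b + \<eta>) * dist y x"
    using assms by (auto simp: lip_at_def)
  then show "\<forall>\<^sub>F y in at x. \<bar>f y + g y - (f x + g x)\<bar> \<le> ((a + \<eta>) + (b + \<eta>)) * dist y x"
  proof eventually_elim
    case (elim y)
    then show ?case by (simp add: algebra_simps abs_le_iff)
  qed
qed

lemma lip_at_mult:
  assumes f: "lip_at f x a" and g: "lip_at g x b"
  shows "lip_at (\<lambda>y. f y * g y) x (\<bar>g x\<bar> * a + \<bar>f x\<bar> * b)"
proof (rule lip_atI_perturb)
  show "((\<lambda>\<eta>. (\<bar>g x\<bar> + \<eta>) * (a + \<eta>) + \<bar>f x\<bar> * (b + \<eta>)) \<longlongrightarrow> \<bar>g x\<bar> * a + \<bar>f x\<bar> * b) (at_right 0)"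
    by (auto intro!: tendsto_eq_intros)
  fix \<eta> :: real assume \<eta>: "\<eta> > 0"
  have "isCont (\<lambda>y. \<bar>g y\<bar>) x" using lip_at_isCont[OF g] by (intro continuous_intros)
  then have "\<forall>\<^sub>F y in at x. \<bar>g y\<bar> < \<bar>g x\<bar> + \<eta>" using \<eta> unfolding isCont_def by (intro order_tendstoD) auto
  moreover have "\<forall>\<^sub>F y in at x. \<bar>f y - f x\<bar> \<le> (a + \<eta>) * dist y x" "\<forall>\<^sub>F y in at x. \<bar>g y - g x\<bar> \<le> (b + \<eta>) * dist y x"
    using f g \<eta> by (auto simp: lip_at_def)
  ultimately show "\<forall>\<^sub>F y in at x. \<bar>f y * g y - f x * g x\<bar> \<le> ((\<bar>g x\<bar> + \<eta>) * (a + \<eta>) + \<bar>f x\<bar> * (b + \<eta>)) * dist y x"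
  proof eventually_elim
    case (elim y)
    have "f y * g y - f x * g x = g y * (f y - f x) + f x * (g y - g x)" by (simp add: algebra_simps)
    then have "\<bar>f y * g y - f x * g x\<bar> \<le> \<bar>g y\<bar> * \<bar>f y - f x\<bar> + \<bar>f x\<bar> * \<bar>g y - g x\<bar>"
      by (metis abs_mult abs_triangle_ineq)
    also have "\<dots> \<le> (\<bar>g x\<bar> + \<eta>) * ((a + \<eta>) * dist y x) + \<bar>f x\<bar> * ((b + \<eta>) * dist y x)"
      using elim \<eta> by (intro add_mono mult_mono mult_left_mono) auto
    finally show ?case by (simp add: algebra_simps)
  qed
qed

lemma lip_at_compose:
  assumes f: "lip_at f x a" and k: "(k has_real_derivative D) (at (f x))"
  shows "lip_at (\<lambda>y. k (f y)) x (\<bar>D\<bar> * a)"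
proof (rule lip_atI_perturb)
  show "((\<lambda>\<eta>. (\<bar>D\<bar> + \<eta>) * (a + \<eta>)) \<longlongrightarrow> \<bar>D\<bar> * a) (at_right 0)" by (auto intro!: tendsto_eq_intros)
  fix \<eta> :: real assume \<eta>: "\<eta> > 0"
  have "((\<lambda>z. \<bar>(k z - k (f x)) / (z - f x)\<bar>) \<longlongrightarrow> \<bar>D\<bar>) (at (f x))"
    using k unfolding has_field_derivative_iff by (rule tendsto_rabs)
  then have "\<forall>\<^sub>F z in at (f x). \<bar>(k z - k (f x)) / (z - f x)\<bar> < \<bar>D\<bar> + \<eta>" using \<eta> by (intro order_tendstoD) auto
  then have "\<forall>\<^sub>F z in at (f x). \<bar>k z - k (f x)\<bar> \<le> (\<bar>D\<bar> + \<eta>) * \<bar>z - f x\<bar>"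
    unfolding eventually_at_filter by eventually_elim (auto simp: abs_divide divide_simps)
  then have "\<forall>\<^sub>F z in nhds (f x). \<bar>k z - k (f x)\<bar> \<le> (\<bar>D\<bar> + \<eta>) * \<bar>z - f x\<bar>"
    unfolding eventually_at_filter by eventually_elim auto
  moreover have "filterlim f (nhds (f x)) (at x)" using lip_at_isCont[OF f] by (simp add: isCont_def)
  ultimately have "\<forall>\<^sub>F y in at x. \<bar>k (f y) - k (f x)\<bar> \<le> (\<bar>D\<bar> + \<eta>) * \<bar>f y - f x\<bar>"
    unfolding filterlim_iff by blast
  moreover have "\<forall>\<^sub>F y in at x. \<bar>f y - f x\<bar> \<le> (a + \<eta>) * dist y x" using f \<eta> by (auto simp: lip_at_def)
  ultimately show "\<forall>\<^sub>F y in at x. \<bar>k (f y) - k (f x)\<bar> \<le> ((\<bar>D\<bar> + \<eta>) * (a + \<eta>)) * dist y x"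
  proof eventually_elim
    case (elim y)
    have "(\<bar>D\<bar> + \<eta>) * \<bar>f y - f x\<bar> \<le> (\<bar>D\<bar> + \<eta>) * ((a + \<eta>) * dist y x)"
      using elim \<eta> by (intro mult_left_mono) auto
    with elim show ?case by (simp add: mult.assoc)
  qed
qed

lemma lip_at_differentiable:
  fixes f :: "real ^ 'n \<Rightarrow> real"
  assumes "f differentiable (at x)"
  shows "lip_at f x (norm (grad f x))"
  unfolding lip_at_def
proof (intro allI impI)
  fix \<delta> :: real assume \<delta>: "\<delta> > 0"
  from has_derivative_grad[OF assms] have "((\<lambda>y. norm (f y - f x - grad f x \<bullet> (y - x)) / norm (y - x)) \<longlongrightarrow> 0) (at x)"
    by (simp add: has_derivative_iff_norm)
  then have "\<forall>\<^sub>F y in at x. norm (f y - f x - grad f x \<bullet> (y - x)) / norm (y - x) < \<delta>"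
    using \<delta> by (rule order_tendstoD)
  then show "\<forall>\<^sub>F y in at x. \<bar>f y - f x\<bar> \<le> (norm (grad f x) + \<delta>) * dist y x"
    unfolding eventually_at_filter
  proof eventually_elim
    case (elim y)
    show ?case
    proof (intro impI)
      assume "y \<noteq> x"
      with elim have "\<bar>f y - f x - grad f x \<bullet> (y - x)\<bar> \<le> \<delta> * norm (y - x)" by (simp add: field_simps)
      moreover have "\<bar>grad f x \<bullet> (y - x)\<bar> \<le> norm (grad f x) * norm (y - x)" by (rule Cauchy_Schwarz_ineq2)
      ultimately show "\<bar>f y - f x\<bar> \<le> (norm (grad f x) + \<delta>) * dist y x"
        by (simp add: dist_norm algebra_simps abs_le_iff)
    qed
  qed
qed

text \<open>z vanishes at x at least linearly and is raised to a power of at least 1 + a, so f is of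
  smaller order than the distance. Once z is below 1, the variable exponent may be replaced by its
  lower bound.\<close>

lemma lip_at_zero_powr:
  fixes f z e :: "'a::metric_space \<Rightarrow> real"
  assumes z: "lip_at z x c" "z x = 0" and c: "0 < a"
    and ev: "\<forall>\<^sub>F y in nhds x. 0 \<le> f y \<and> 0 \<le> z y \<and> f y \<le> K * z y powr e y \<and> 1 + a \<le> e y"
    and K: "0 \<le> K"
  shows "lip_at f x 0"
proof -
  have "0 \<le> f x \<and> 0 \<le> z x \<and> f x \<le> K * z x powr e x \<and> 1 + a \<le> e x" using ev by (rule eventually_nhds_x_imp_x)
  then have fx: "f x = 0" using z(2) by auto
  define C where "C = \<bar>c\<bar> + 1"
  have C: "C > 0" by (simp add: C_def)
  have zC: "\<forall>\<^sub>F y in at x. \<bar>z y\<bar> \<le> C * dist y x"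
  proof -
    have "\<forall>\<^sub>F y in at x. \<bar>z y - z x\<bar> \<le> (c + 1) * dist y x" using z(1) by (auto simp: lip_at_def)
    then show ?thesis
    proof eventually_elim
      case (elim y)
      have "(c + 1) * dist y x \<le> C * dist y x" by (intro mult_right_mono) (auto simp: C_def)
      with elim z(2) show ?case by simp
    qed
  qed
  show ?thesis unfolding lip_at_def
  proof (intro allI impI)
    fix \<delta> :: real assume \<delta>: "\<delta> > 0"
    have lim: "((\<lambda>y. C * dist y x) \<longlongrightarrow> 0) (at x)" by (auto intro!: tendsto_eq_intros)
    then have "\<forall>\<^sub>F y in at x. C * dist y x < 1" by (rule order_tendstoD) simp
    moreover have "((\<lambda>y. K * C * (C * dist y x) powr a) \<longlongrightarrow> K * C * 0 powr a) (at x)"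
      using c C by (intro tendsto_mult tendsto_const tendsto_powr2 lim) (auto intro!: always_eventually)
    then have "\<forall>\<^sub>F y in at x. K * C * (C * dist y x) powr a < \<delta>" using \<delta> by (intro order_tendstoD) auto
    moreover have "\<forall>\<^sub>F y in at x. 0 \<le> f y \<and> 0 \<le> z y \<and> f y \<le> K * z y powr e y \<and> 1 + a \<le> e y"
      using ev by (simp add: eventually_at_filter eventually_mono)
    ultimately show "\<forall>\<^sub>F y in at x. \<bar>f y - f x\<bar> \<le> (0 + \<delta>) * dist y x"
      using zC
    proof eventually_elim
      case (elim y)
      have "f y \<le> K * z y powr e y" using elim by simp
      also have "z y powr e y \<le> z y powr (1 + a)" using elim by (intro powr_mono') auto
      also have "\<dots> \<le> (C * dist y x) powr (1 + a)" using elim c by (intro powr_mono2) auto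
      also have "K * (C * dist y x) powr (1 + a) = (K * C * (C * dist y x) powr a) * dist y x"
        using C by (cases "dist y x = 0") (auto simp: powr_add)
      also have "\<dots> \<le> \<delta> * dist y x" using elim by (intro mult_right_mono) auto
      finally show ?case using elim fx K by (simp add: mult_left_mono)
    qed
  qed
qed

subsection \<open>Sobolev inequalities with variable exponents\<close>

text \<open>The left side is differentiable on both sides of 0, so ln |\<phi>| can be differentiated
  without a case distinction on the sign.\<close>

lemma ln_square_half: "z \<noteq> 0 \<Longrightarrow> ln (z\<^sup>2) / 2 = ln \<bar>z :: real\<bar>"
proof -
  assume "z \<noteq> 0"
  have "ln (z\<^sup>2) = ln (\<bar>z\<bar> ^ 2)" by simp
  also have "\<dots> = 2 * ln \<bar>z\<bar>" using \<open>z \<noteq> 0\<close> by (subst ln_realpow) auto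
  finally show ?thesis by simp
qed

text \<open>The inequality in \<open>L\<^sup>1\<close> is applied to \<open>(\<omega>\<^bsup>1/h\<^esup> \<bar>\<phi>\<bar>)\<^bsup>m\<^esup>\<close>. Used first with \<open>h = p\<close>, \<open>\<omega> = 1\<close>, and then with
  \<open>h = q\<close>, \<open>\<omega> = \<mu>\<close>, where the remainder \<open>R\<close> absorbs the term with the derivative of \<open>\<mu>\<close> and is
  controlled by the first application.\<close>

locale sobolev_step =
  fixes \<Omega> :: "(real ^ 'n) set" and h m \<omega> :: "real ^ 'n \<Rightarrow> real" and R :: "real ^ 'n \<Rightarrow> real \<Rightarrow> real"
    and Lh Lm L\<omega> \<omega>M mM \<eta> K CR :: real
  assumes N2: "2 \<le> CARD('n)" and open_\<Omega>: "open \<Omega>"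
    and lip: "Lh-lipschitz_on \<Omega> h" "Lm-lipschitz_on \<Omega> m" "L\<omega>-lipschitz_on \<Omega> \<omega>"
    and h1: "x \<in> \<Omega> \<Longrightarrow> 1 < h x"
    and \<omega>: "x \<in> \<Omega> \<Longrightarrow> 0 \<le> \<omega> x" "x \<in> \<Omega> \<Longrightarrow> \<omega> x \<le> \<omega>M"
    and \<eta>: "0 < \<eta>" "x \<in> \<Omega> \<Longrightarrow> h x + \<eta> \<le> m x" "x \<in> \<Omega> \<Longrightarrow> (1 + \<eta>) * h x \<le> m x"
    and mM: "x \<in> \<Omega> \<Longrightarrow> m x \<le> mM"
    and K: "0 \<le> K" "x \<in> \<Omega> \<Longrightarrow> h x - 1 \<le> K"
      "x \<in> \<Omega> \<Longrightarrow> m x + \<eta> < m x * CARD('n) / (CARD('n) - 1)"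
      "x \<in> \<Omega> \<Longrightarrow> m x + \<eta> - h x \<le> K * (m x * CARD('n) / (CARD('n) - 1) - (m x + \<eta>))"
      "x \<in> \<Omega> \<Longrightarrow> (m x - 1) * h x / (h x - 1) \<le> m x * CARD('n) / (CARD('n) - 1)"
    and R: "x \<in> \<Omega> \<Longrightarrow> 0 \<le> t \<Longrightarrow> 0 \<le> R x t" "R x 0 = 0"
      "\<And>f. continuous_on \<Omega> f \<Longrightarrow> (\<And>x. 0 \<le> f x) \<Longrightarrow> continuous_on \<Omega> (\<lambda>x. R x (f x))"
    and CR: "0 < CR"
      "x \<in> \<Omega> \<Longrightarrow> 0 < \<omega> x \<Longrightarrow> 0 < t \<Longrightarrow> 0 < \<epsilon> \<Longrightarrow> \<epsilon> \<le> 1 \<Longrightarrow>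
        (\<omega> x powr (1 / h x) * t) powr m x / \<omega> x
        \<le> CR * (\<epsilon> powr (-K) * R x t + \<epsilon> * (\<omega> x powr (1 / h x) * t) powr (m x * CARD('n) / (CARD('n) - 1)))"
begin

text \<open>\<open>Q\<close> is the exponent that the Sobolev inequality in \<open>L\<^sup>1\<close>
  puts on w when it is applied to w^m. \<open>S\<close> is then the integrand on its left side, and
  \<open>E\<close> collects what may remain on the right.\<close>

definition Q :: "real ^ 'n \<Rightarrow> real" where "Q x = m x * CARD('n) / (CARD('n) - 1)"
definition S :: "real ^ 'n \<Rightarrow> real \<Rightarrow> real" where "S x t = (\<omega> x powr (1 / h x) * t) powr Q x"
definition E :: "(real ^ 'n \<Rightarrow> real) \<Rightarrow> real ^ 'n \<Rightarrow> real" where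
  "E \<phi> x = \<omega> x * norm (grad \<phi> x) powr h x + \<omega> x * \<bar>\<phi> x\<bar> powr h x + R x \<bar>\<phi> x\<bar>"
text \<open>The factors that arise in \<open>pointwise_estimate\<close>: 2/\<eta> from the
  logarithm, \<open>mM\<close> from the exponent, \<open>CR\<close> from the derivative of the
  weight. The estimate itself gives \<open>C - mM - 1\<close>; the rest is slack that keeps the
  constant at least 1.\<close>

definition C :: real where
  "C = 2 * mM + (\<bar>Lm\<bar> * (2 / \<eta>) + mM * (\<bar>L\<omega>\<bar> + \<bar>Lh\<bar> * (1 + \<omega>M\<^sup>2)) * CR) + 1"

lemma continuous: "continuous_on \<Omega> h" "continuous_on \<Omega> m" "continuous_on \<Omega> \<omega>" "continuous_on \<Omega> Q"
proof -
  show "continuous_on \<Omega> h" "continuous_on \<Omega> m" "continuous_on \<Omega> \<omega>"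
    using lip by (auto intro: lipschitz_on_continuous_on)
  then show "continuous_on \<Omega> Q" unfolding Q_def using N2 by (intro continuous_intros) auto
qed

lemma m_gt_1: "x \<in> \<Omega> \<Longrightarrow> 1 + \<eta> \<le> m x" and mM_gt: "x \<in> \<Omega> \<Longrightarrow> 1 < mM"
  using h1[of x] \<eta>(1) \<eta>(2)[of x] mM[of x] by auto

lemma C_pos: "x \<in> \<Omega> \<Longrightarrow> 1 \<le> C"
  using mM_gt[of x] CR(1) \<eta>(1) unfolding C_def by (auto intro!: add_nonneg_nonneg mult_nonneg_nonneg)

lemma Q_pos: "x \<in> \<Omega> \<Longrightarrow> 0 < Q x"
  using m_gt_1[of x] \<eta>(1) N2 unfolding Q_def by (intro divide_pos_pos mult_pos_pos) auto

lemma E_nonneg: "x \<in> \<Omega> \<Longrightarrow> 0 \<le> E \<phi> x"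
  unfolding E_def using \<omega>(1) R(1) by (intro add_nonneg_nonneg mult_nonneg_nonneg) auto

text \<open>The left side is w^m times a bound for the gradient of m ln w, where ln w = (ln
  \<omega>)/h + ln t: the terms belong to the derivatives of m, \<omega>, h and \<phi>. Young's
  inequality handles the gradient, a shift of the exponent the factor ln w, and the hypothesis on
  \<open>CR\<close> the quotient by \<omega>.\<close>

lemma pointwise_estimate:
  assumes x: "x \<in> \<Omega>" and pos: "0 < \<omega> x" "0 < t" and \<tau>: "0 \<le> \<tau>" and \<epsilon>: "0 < \<epsilon>" "\<epsilon> \<le> 1"
  defines "w \<equiv> \<omega> x powr (1 / h x) * t"
  shows "w powr m x * (\<bar>ln w\<bar> * \<bar>Lm\<bar> + m x * (\<bar>L\<omega>\<bar> / \<omega> x + \<bar>ln (\<omega> x)\<bar> * \<bar>Lh\<bar> + \<tau> / t))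
    \<le> C * (\<epsilon> powr (-K) * (\<omega> x * \<tau> powr h x + \<omega> x * t powr h x + R x t) + \<epsilon> * S x t)"
proof -
  have w: "w > 0" using pos by (simp add: w_def)
  define A where "A = \<omega> x * \<tau> powr h x"
  define B where "B = \<omega> x * t powr h x"
  define e where "e = \<epsilon> powr (-K)"
  have e1: "1 \<le> e" using \<epsilon> K(1) unfolding e_def by (simp add: powr_minus_divide powr_le1 divide_simps)
  have hx: "h x > 1" by (rule h1[OF x])
  have A: "0 \<le> A" "A = (\<omega> x powr (1 / h x) * \<tau>) powr h x"
    using pos \<tau> hx by (auto simp: A_def powr_mult powr_powr)
  have B: "0 \<le> B" "B = w powr h x"
    using pos hx by (auto simp: B_def w_def powr_mult powr_powr)
  have S: "0 \<le> S x t" "S x t = w powr Q x" by (auto simp: S_def w_def)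
  have R0: "0 \<le> R x t" using R(1)[OF x] pos by simp
  have mx: "1 < m x" "m x \<le> mM" using m_gt_1[OF x] \<eta>(1) mM[OF x] by auto
  have le1: "e * A + \<epsilon> * (B + S x t) \<le> e * (A + B + R x t) + \<epsilon> * S x t"
  proof -
    have "\<epsilon> * B \<le> e * B" using e1 \<epsilon> B by (intro mult_right_mono) auto
    moreover have "0 \<le> e * R x t" using e1 R0 by auto
    ultimately show ?thesis by (simp add: algebra_simps)
  qed
  have rhs0: "0 \<le> e * (A + B + R x t) + \<epsilon> * S x t" using e1 A B R0 S \<epsilon> by auto
  have T1: "w powr m x * (\<tau> / t) \<le> e * (A + B + R x t) + \<epsilon> * S x t"
  proof -
    have "w powr m x * (\<tau> / t) = w powr (m x - 1) * (\<omega> x powr (1 / h x) * \<tau>)"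
      using w pos by (simp add: powr_diff) (simp add: w_def)
    also have "\<dots> \<le> e * (\<omega> x powr (1 / h x) * \<tau>) powr h x + \<epsilon> * (w powr h x + w powr Q x)"
      unfolding e_def using w \<tau> hx \<eta>(1) \<eta>(2)[OF x] K(2)[OF x] K(5)[OF x] \<epsilon>
      by (intro powr_mult_le_Young) (auto simp: Q_def)
    also have "\<dots> = e * A + \<epsilon> * (B + S x t)" by (simp add: A B S)
    finally show ?thesis using le1 by linarith
  qed
  have T2: "w powr m x * \<bar>ln w\<bar> \<le> 2 / \<eta> * (e * (A + B + R x t) + \<epsilon> * S x t)"
  proof -
    have "w powr m x * \<bar>ln w\<bar> \<le> 2 / \<eta> * (e * w powr h x + \<epsilon> * w powr Q x)"
      unfolding e_def using w \<eta>(1) \<eta>(2)[OF x] K(1) K(3)[OF x] K(4)[OF x] \<epsilon>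
      by (intro powr_mult_abs_ln_le) (auto simp: Q_def)
    also have "\<dots> \<le> 2 / \<eta> * (e * (A + B + R x t) + \<epsilon> * S x t)"
      using \<eta>(1) e1 A R0 by (intro mult_left_mono) (auto simp: B(2)[symmetric] S(2)[symmetric] intro!: mult_left_mono)
    finally show ?thesis .
  qed
  have T3: "w powr m x / \<omega> x \<le> CR * (e * (A + B + R x t) + \<epsilon> * S x t)"
  proof -
    have "w powr m x / \<omega> x \<le> CR * (e * R x t + \<epsilon> * S x t)"
      unfolding w_def e_def S_def Q_def by (rule CR(2)[OF x pos \<epsilon>])
    also have "\<dots> \<le> CR * (e * (A + B + R x t) + \<epsilon> * S x t)"
      using CR(1) e1 A B \<epsilon> by (intro mult_left_mono add_mono) auto
    finally show ?thesis .
  qed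
  \<comment> \<open>The logarithm of the weight costs no more than a division by the weight, so T3
    covers both terms.\<close>
  have ln: "\<bar>ln (\<omega> x)\<bar> \<le> (1 + \<omega>M\<^sup>2) / \<omega> x"
    using abs_ln_mult_le[OF \<omega>(1)[OF x] \<omega>(2)[OF x]] pos by (simp add: field_simps)
  let ?r = "e * (A + B + R x t) + \<epsilon> * S x t"
  let ?D = "\<bar>L\<omega>\<bar> + \<bar>Lh\<bar> * (1 + \<omega>M\<^sup>2)"
  have "w powr m x * (\<bar>ln w\<bar> * \<bar>Lm\<bar> + m x * (\<bar>L\<omega>\<bar> / \<omega> x + \<bar>ln (\<omega> x)\<bar> * \<bar>Lh\<bar> + \<tau> / t))
    = \<bar>Lm\<bar> * (w powr m x * \<bar>ln w\<bar>) + m x * (w powr m x * (\<bar>L\<omega>\<bar> / \<omega> x + \<bar>ln (\<omega> x)\<bar> * \<bar>Lh\<bar>)) + m x * (w powr m x * (\<tau> / t))"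
    by (simp add: algebra_simps)
  also have "\<dots> \<le> \<bar>Lm\<bar> * (2 / \<eta> * ?r) + mM * (?D * (CR * ?r)) + mM * ?r"
  proof -
    have "\<bar>L\<omega>\<bar> / \<omega> x + \<bar>ln (\<omega> x)\<bar> * \<bar>Lh\<bar> \<le> \<bar>L\<omega>\<bar> / \<omega> x + (1 + \<omega>M\<^sup>2) / \<omega> x * \<bar>Lh\<bar>"
      using ln by (intro add_left_mono mult_right_mono) auto
    also have "\<dots> = ?D / \<omega> x" by (simp add: field_simps add_divide_distrib)
    finally have "w powr m x * (\<bar>L\<omega>\<bar> / \<omega> x + \<bar>ln (\<omega> x)\<bar> * \<bar>Lh\<bar>) \<le> w powr m x * (?D / \<omega> x)"
      by (intro mult_left_mono) auto
    also have "\<dots> = ?D * (w powr m x / \<omega> x)" by simp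
    also have "\<dots> \<le> ?D * (CR * ?r)" using T3 by (intro mult_left_mono) auto
    finally have T4: "w powr m x * (\<bar>L\<omega>\<bar> / \<omega> x + \<bar>ln (\<omega> x)\<bar> * \<bar>Lh\<bar>) \<le> ?D * (CR * ?r)" .
    have T40: "0 \<le> w powr m x * (\<bar>L\<omega>\<bar> / \<omega> x + \<bar>ln (\<omega> x)\<bar> * \<bar>Lh\<bar>)" using pos by simp
    have T10: "0 \<le> w powr m x * (\<tau> / t)" using pos \<tau> by simp
    show ?thesis
      by (intro add_mono mult_left_mono[OF T2] mult_mono[OF mx(2) T4 _ T40] mult_mono[OF mx(2) T1 _ T10]) (use mx in auto)
  qed
  also have "\<dots> = (C - mM - 1) * ?r" by (simp add: C_def algebra_simps)
  also have "\<dots> \<le> C * ?r" using rhs0 mx by (intro mult_right_mono) auto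
  finally show ?thesis by (simp add: A_def B_def e_def)
qed

section \<open>The inequality for powers of one test function\<close>

context
  fixes \<phi> assumes \<phi>: "\<phi> \<in> test_functions \<Omega>"
begin

definition f :: "real ^ 'n \<Rightarrow> real" where
  "f x = (if x \<in> \<Omega> then (\<omega> x powr (1 / h x) * \<bar>\<phi> x\<bar>) powr m x else 0)"

text \<open>An upper gradient of \<open>f\<close> for each \<epsilon> in (0, 1]. In contrast to the
  exact derivative it has no denominators and is continuous across the zeros of \<omega> and
  \<phi>.\<close>

definition G :: "real \<Rightarrow> real ^ 'n \<Rightarrow> real" where
  "G \<epsilon> x = (if x \<in> \<Omega> then C * (\<epsilon> powr (-K) * E \<phi> x + \<epsilon> * S x \<bar>\<phi> x\<bar>) else 0)"

text \<open>\<Omega> and the complement of the support of \<phi> are open and cover the space, and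
  on the overlap the function is 0.\<close>

lemma continuous_on_UNIV_if:
  assumes "continuous_on \<Omega> k" "\<And>x. x \<in> \<Omega> \<Longrightarrow> x \<notin> closure {x. \<phi> x \<noteq> 0} \<Longrightarrow> k x = 0"
  shows "continuous_on UNIV (\<lambda>x. if x \<in> \<Omega> then k x else (0::real))"
proof -
  let ?F = "closure {x. \<phi> x \<noteq> 0}"
  have sub: "?F \<subseteq> \<Omega>" by (rule test_functionsD(6)[OF \<phi>])
  have "continuous_on (\<Omega> \<union> - ?F) (\<lambda>x. if x \<in> \<Omega> then k x else 0)"
  proof (rule continuous_on_open_Un[OF open_\<Omega>])
    show "continuous_on \<Omega> (\<lambda>x. if x \<in> \<Omega> then k x else 0)" using assms(1) by (simp cong: continuous_on_cong)
    have "continuous_on (- ?F) (\<lambda>x. 0 :: real)" by simp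
    then show "continuous_on (- ?F) (\<lambda>x. if x \<in> \<Omega> then k x else 0)"
      by (rule continuous_on_eq) (use assms(2) in auto)
  qed auto
  moreover have "\<Omega> \<union> - ?F = UNIV" using sub by auto
  ultimately show ?thesis by simp
qed

lemma cont_w: "continuous_on \<Omega> (\<lambda>x. \<omega> x powr (1 / h x) * \<bar>\<phi> x\<bar>)"
proof -
  have "continuous_on \<Omega> \<phi>" using test_functionsD(3)[OF \<phi>] continuous_on_subset by blast
  moreover have "continuous_on \<Omega> (\<lambda>x. \<omega> x powr (1 / h x))"
    by (rule continuous_on_powr') (use continuous h1 \<omega>(1) in \<open>force intro!: continuous_intros\<close>)+
  ultimately show ?thesis by (intro continuous_on_mult continuous_on_rabs)
qed

lemma zero_off_support:
  assumes "x \<notin> closure {x. \<phi> x \<noteq> 0}"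
  shows "\<phi> x = 0" "grad \<phi> x = 0"
  using test_functionsD(7,8)[OF \<phi> assms] .

lemma continuous_f: "continuous_on UNIV f"
  unfolding f_def[abs_def]
proof (rule continuous_on_UNIV_if)
  show "continuous_on \<Omega> (\<lambda>x. (\<omega> x powr (1 / h x) * \<bar>\<phi> x\<bar>) powr m x)"
    by (rule continuous_on_powr'[OF cont_w continuous(2)]) (use m_gt_1 \<eta>(1) in force)
qed (drule zero_off_support(1), simp)

lemma cont_E: "continuous_on \<Omega> (E \<phi>)"
proof -
  have c: "continuous_on \<Omega> (\<lambda>x. norm (grad \<phi> x))" "continuous_on \<Omega> (\<lambda>x. \<bar>\<phi> x\<bar>)"
    using test_functionsD(3,4)[OF \<phi>]
    by (auto intro!: continuous_on_norm continuous_on_rabs intro: continuous_on_subset)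
  have "continuous_on \<Omega> (\<lambda>x. norm (grad \<phi> x) powr h x)" "continuous_on \<Omega> (\<lambda>x. \<bar>\<phi> x\<bar> powr h x)"
    by (rule continuous_on_powr'[OF c(1) continuous(1)], use h1 in force)
      (rule continuous_on_powr'[OF c(2) continuous(1)], use h1 in force)
  moreover have "continuous_on \<Omega> (\<lambda>x. R x \<bar>\<phi> x\<bar>)" by (rule R(3)[OF c(2)]) simp
  ultimately show ?thesis
    unfolding E_def[abs_def] using continuous(3) by (intro continuous_on_add continuous_on_mult)
qed

lemma cont_S: "continuous_on \<Omega> (\<lambda>x. S x \<bar>\<phi> x\<bar>)"
  unfolding S_def by (rule continuous_on_powr'[OF cont_w continuous(4)]) (use Q_pos in force)

lemma continuous_G: "continuous_on UNIV (G \<epsilon>)"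
  unfolding G_def[abs_def]
proof (rule continuous_on_UNIV_if)
  show "continuous_on \<Omega> (\<lambda>x. C * (\<epsilon> powr (-K) * E \<phi> x + \<epsilon> * S x \<bar>\<phi> x\<bar>))"
    by (intro continuous_on_add continuous_on_mult continuous_on_const cont_E cont_S)
next
  fix x assume "x \<notin> closure {x. \<phi> x \<noteq> 0}"
  from zero_off_support[OF this]
  show "C * (\<epsilon> powr (-K) * E \<phi> x + \<epsilon> * S x \<bar>\<phi> x\<bar>) = 0" by (simp add: E_def S_def R(2))
qed

lemma G_nonneg: "0 < \<epsilon> \<Longrightarrow> 0 \<le> G \<epsilon> x"
  using E_nonneg[of x] C_pos[of x] by (auto simp: G_def S_def intro!: mult_nonneg_nonneg add_nonneg_nonneg)

text \<open>Away from the zeros f = exp(m l) with l = ln w, so the rules for sums, products and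
  compositions give the constant, which \<open>pointwise_estimate\<close> bounds by G.\<close>

lemma lip_f_pos:
  assumes x: "x \<in> \<Omega>" and pos: "0 < \<omega> x" "\<phi> x \<noteq> 0" and \<epsilon>: "0 < \<epsilon>" "\<epsilon> \<le> 1"
  shows "lip_at f x (G \<epsilon> x)"
proof -
  have lh: "lip_at h x \<bar>Lh\<bar>" "lip_at m x \<bar>Lm\<bar>" "lip_at \<omega> x \<bar>L\<omega>\<bar>"
    using lip lipschitz_on_nonneg by (auto intro!: lip_at_mono[OF lip_at_lipschitz[OF _ open_\<Omega> x]])
  have hx: "1 < h x" by (rule h1[OF x])
  define w where "w = \<omega> x powr (1 / h x) * \<bar>\<phi> x\<bar>"
  have w: "w > 0" using pos by (simp add: w_def)
  define l where "l y = inverse (h y) * ln (\<omega> y) + ln ((\<phi> y)\<^sup>2) / 2" for y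
  have lx: "l x = ln w"
    unfolding l_def w_def ln_square_half[OF pos(2)] using pos by (simp add: ln_mult ln_powr inverse_eq_divide)
  have 1: "lip_at (\<lambda>y. inverse (h y)) x (\<bar>- (inverse (h x ^ 2))\<bar> * \<bar>Lh\<bar>)"
    by (rule lip_at_compose[where k=inverse, OF lh(1)])
      (use DERIV_inverse[of "h x" UNIV] hx in \<open>simp add: power2_eq_square\<close>)
  have 2: "lip_at (\<lambda>y. ln (\<omega> y)) x (\<bar>inverse (\<omega> x)\<bar> * \<bar>L\<omega>\<bar>)"
    by (rule lip_at_compose[where k=ln, OF lh(3)]) (rule DERIV_ln[OF pos(1)])
  have 3: "lip_at (\<lambda>y. ln ((\<phi> y)\<^sup>2) / 2) x (\<bar>inverse (\<phi> x)\<bar> * norm (grad \<phi> x))"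
  proof (rule lip_at_compose[where k="\<lambda>s. ln (s\<^sup>2) / 2", OF lip_at_differentiable[OF test_functionsD(2)[OF \<phi>]]])
    show "((\<lambda>s. ln (s\<^sup>2) / 2) has_real_derivative inverse (\<phi> x)) (at (\<phi> x))"
    proof -
      let ?z = "\<phi> x"
      have sq: "((\<lambda>s. s\<^sup>2) has_real_derivative 2 * ?z) (at ?z)" using DERIV_pow[of 2 ?z UNIV] by simp
      have "0 < ?z\<^sup>2" using pos(2) by simp
      from DERIV_cdivide[OF DERIV_chain2[where f=ln, OF DERIV_ln[OF this] sq], of 2]
      show ?thesis using pos(2) by (simp add: power2_eq_square)
    qed
  qed
  have 4: "lip_at l x (\<bar>ln (\<omega> x)\<bar> * \<bar>Lh\<bar> + \<bar>L\<omega>\<bar> / \<omega> x + norm (grad \<phi> x) / \<bar>\<phi> x\<bar>)"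
    unfolding l_def
  proof (rule lip_at_mono[OF lip_at_add[OF lip_at_mult[OF 1 2] 3]])
    have i: "inverse (h x) \<le> 1" "0 < inverse (h x)" using hx by (auto simp: inverse_le_1_iff)
    then have i2: "inverse (h x ^ 2) \<le> 1" "0 \<le> inverse (h x ^ 2)" by (auto simp: power_inverse[symmetric] power_le_one)
    have "\<bar>- (inverse (h x ^ 2))\<bar> * \<bar>Lh\<bar> \<le> 1 * \<bar>Lh\<bar>" using i2 by (intro mult_right_mono) auto
    then have "\<bar>ln (\<omega> x)\<bar> * (\<bar>- (inverse (h x ^ 2))\<bar> * \<bar>Lh\<bar>) \<le> \<bar>ln (\<omega> x)\<bar> * \<bar>Lh\<bar>" by (intro mult_left_mono) auto
    moreover have "\<bar>inverse (h x)\<bar> * (\<bar>inverse (\<omega> x)\<bar> * \<bar>L\<omega>\<bar>) \<le> 1 * (\<bar>inverse (\<omega> x)\<bar> * \<bar>L\<omega>\<bar>)"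
      using i by (intro mult_right_mono) auto
    moreover have "\<bar>inverse (\<omega> x)\<bar> * \<bar>L\<omega>\<bar> = \<bar>L\<omega>\<bar> / \<omega> x" using pos by (simp add: divide_inverse mult.commute)
    moreover have "\<bar>inverse (\<phi> x)\<bar> * norm (grad \<phi> x) = norm (grad \<phi> x) / \<bar>\<phi> x\<bar>" by (simp add: divide_inverse mult.commute)
    ultimately show "\<bar>ln (\<omega> x)\<bar> * (\<bar>- (inverse (h x ^ 2))\<bar> * \<bar>Lh\<bar>) + \<bar>inverse (h x)\<bar> * (\<bar>inverse (\<omega> x)\<bar> * \<bar>L\<omega>\<bar>) +
        \<bar>inverse (\<phi> x)\<bar> * norm (grad \<phi> x)
      \<le> \<bar>ln (\<omega> x)\<bar> * \<bar>Lh\<bar> + \<bar>L\<omega>\<bar> / \<omega> x + norm (grad \<phi> x) / \<bar>\<phi> x\<bar>" by linarith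
  qed
  from lip_at_compose[where k=exp, OF lip_at_mult[OF lh(2) 4] DERIV_exp]
  have 5: "lip_at (\<lambda>y. exp (m y * l y)) x (\<bar>exp (m x * l x)\<bar> * (\<bar>l x\<bar> * \<bar>Lm\<bar> + \<bar>m x\<bar> * (\<bar>ln (\<omega> x)\<bar> * \<bar>Lh\<bar> + \<bar>L\<omega>\<bar> / \<omega> x + norm (grad \<phi> x) / \<bar>\<phi> x\<bar>)))" .
  have "\<forall>\<^sub>F y in nhds x. y \<in> \<Omega>" using open_\<Omega> x by (rule eventually_nhds_in_open)
  moreover have "\<forall>\<^sub>F y in nhds x. 0 < \<omega> y"
  proof -
    have "isCont \<omega> x" using lip_at_isCont[OF lh(3)] .
    then have "\<forall>\<^sub>F y in at x. 0 < \<omega> y" using pos(1) unfolding isCont_def by (intro order_tendstoD)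
    then show ?thesis using pos(1) by (simp add: eventually_nhds_conv_at)
  qed
  moreover have "\<forall>\<^sub>F y in nhds x. \<phi> y \<noteq> 0"
  proof -
    have "isCont \<phi> x" using test_functionsD(3)[OF \<phi>] by (simp add: continuous_on_eq_continuous_at)
    then have "\<forall>\<^sub>F y in at x. \<phi> y \<noteq> 0" using pos(2) unfolding isCont_def by (rule tendsto_imp_eventually_ne)
    then show ?thesis using pos(2) by (simp add: eventually_nhds_conv_at)
  qed
  ultimately have "\<forall>\<^sub>F y in nhds x. f y = exp (m y * l y)"
  proof eventually_elim
    case (elim y)
    have "l y = ln (\<omega> y powr (1 / h y) * \<bar>\<phi> y\<bar>)"
      unfolding l_def ln_square_half[OF elim(3)] using elim by (simp add: ln_mult ln_powr inverse_eq_divide)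
    then show ?case using elim by (simp add: f_def powr_def)
  qed
  with 5 have "lip_at f x (\<bar>exp (m x * l x)\<bar> * (\<bar>l x\<bar> * \<bar>Lm\<bar> + \<bar>m x\<bar> * (\<bar>ln (\<omega> x)\<bar> * \<bar>Lh\<bar> + \<bar>L\<omega>\<bar> / \<omega> x + norm (grad \<phi> x) / \<bar>\<phi> x\<bar>)))"
    by (simp add: lip_at_cong)
  moreover have "\<bar>exp (m x * l x)\<bar> = w powr m x" using w by (simp add: lx powr_def)
  moreover have "\<bar>m x\<bar> = m x" using m_gt_1[OF x] \<eta>(1) by simp
  ultimately have "lip_at f x (w powr m x * (\<bar>ln w\<bar> * \<bar>Lm\<bar> + m x * (\<bar>L\<omega>\<bar> / \<omega> x + \<bar>ln (\<omega> x)\<bar> * \<bar>Lh\<bar> + norm (grad \<phi> x) / \<bar>\<phi> x\<bar>)))"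
    by (simp add: lx add.commute)
  then show ?thesis
  proof (rule lip_at_mono)
    show "w powr m x * (\<bar>ln w\<bar> * \<bar>Lm\<bar> + m x * (\<bar>L\<omega>\<bar> / \<omega> x + \<bar>ln (\<omega> x)\<bar> * \<bar>Lh\<bar> + norm (grad \<phi> x) / \<bar>\<phi> x\<bar>)) \<le> G \<epsilon> x"
      using pointwise_estimate[OF x pos(1) _ norm_ge_zero \<epsilon>, of "\<bar>\<phi> x\<bar>"] pos x
      by (simp add: G_def E_def w_def)
  qed
qed

text \<open>At such points f vanishes to an order above 1, either as |\<phi>|^m with m at least 1 +
  \<eta>, or as \<omega>^(m/h) with m/h at least 1 + \<eta>. The lower bounds for m in the locale
  are made for this.\<close>

lemma lip_f_zero:
  assumes x: "x \<in> \<Omega>" and z: "\<omega> x = 0 \<or> \<phi> x = 0"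
  shows "lip_at f x 0"
proof -
  have \<Omega>x: "\<forall>\<^sub>F y in nhds x. y \<in> \<Omega>" using open_\<Omega> x by (rule eventually_nhds_in_open)
  obtain B where B: "B > 0" "\<And>x. norm (\<phi> x) \<le> B"
    using bounded_cont_compact_support[OF test_functionsD(3,5,7)[OF \<phi>]] by blast
  show ?thesis
  proof (cases "\<phi> x = 0")
    case True
    have l: "lip_at \<phi> x (norm (grad \<phi> x))" by (rule lip_at_differentiable[OF test_functionsD(2)[OF \<phi>]])
    have la: "lip_at (\<lambda>y. \<bar>\<phi> y\<bar>) x (norm (grad \<phi> x))"
      unfolding lip_at_def
    proof (intro allI impI)
      fix \<delta> :: real assume "\<delta> > 0"
      then have "\<forall>\<^sub>F y in at x. \<bar>\<phi> y - \<phi> x\<bar> \<le> (norm (grad \<phi> x) + \<delta>) * dist y x" using l by (auto simp: lip_at_def)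
      then show "\<forall>\<^sub>F y in at x. \<bar>\<bar>\<phi> y\<bar> - \<bar>\<phi> x\<bar>\<bar> \<le> (norm (grad \<phi> x) + \<delta>) * dist y x"
        by eventually_elim (use True in simp)
    qed
    define K1 where "K1 = max 1 \<omega>M powr mM"
    have "\<forall>\<^sub>F y in nhds x. 0 \<le> f y \<and> 0 \<le> \<bar>\<phi> y\<bar> \<and> f y \<le> K1 * \<bar>\<phi> y\<bar> powr m y \<and> 1 + \<eta> \<le> m y"
      using \<Omega>x
    proof eventually_elim
      case (elim y)
      have "(\<omega> y powr (1 / h y)) powr m y = \<omega> y powr (m y / h y)" by (simp add: powr_powr)
      also have "\<dots> \<le> max 1 \<omega>M powr (m y / h y)"
        using \<omega>[OF elim] m_gt_1[OF elim] h1[OF elim] \<eta>(1) by (intro powr_mono2) auto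
      also have "\<dots> \<le> K1" unfolding K1_def
      proof (rule powr_mono)
        have "m y / h y \<le> m y" using h1[OF elim] m_gt_1[OF elim] \<eta>(1) by (simp add: divide_le_eq)
        then show "m y / h y \<le> mM" using mM[OF elim] by linarith
      qed simp
      finally have "(\<omega> y powr (1 / h y)) powr m y * \<bar>\<phi> y\<bar> powr m y \<le> K1 * \<bar>\<phi> y\<bar> powr m y" by (intro mult_right_mono) auto
      then show ?case using elim m_gt_1[OF elim] by (simp add: f_def powr_mult)
    qed
    then show ?thesis using True \<eta>(1) by (intro lip_at_zero_powr[OF la]) (auto simp: K1_def)
  next
    case False
    then have z: "\<omega> x = 0" using z by simp
    have l\<omega>: "lip_at \<omega> x L\<omega>" by (rule lip_at_lipschitz[OF lip(3) open_\<Omega> x])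
    define K1 where "K1 = max 1 B powr mM"
    have "\<forall>\<^sub>F y in nhds x. 0 \<le> f y \<and> 0 \<le> \<omega> y \<and> f y \<le> K1 * \<omega> y powr (m y / h y) \<and> 1 + \<eta> \<le> m y / h y"
      using \<Omega>x
    proof eventually_elim
      case (elim y)
      have "\<bar>\<phi> y\<bar> powr m y \<le> max 1 B powr m y" using B(2)[of y] m_gt_1[OF elim] \<eta>(1) by (intro powr_mono2) auto
      also have "\<dots> \<le> K1" unfolding K1_def using mM[OF elim] by (intro powr_mono) auto
      finally have "\<bar>\<phi> y\<bar> powr m y * \<omega> y powr (m y / h y) \<le> K1 * \<omega> y powr (m y / h y)" by (intro mult_right_mono) auto
      moreover have "f y = \<bar>\<phi> y\<bar> powr m y * \<omega> y powr (m y / h y)"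
        using elim \<omega>(1)[OF elim] by (simp add: f_def powr_mult powr_powr mult.commute)
      moreover have "1 + \<eta> \<le> m y / h y" using \<eta>(3)[OF elim] h1[OF elim] by (simp add: field_simps)
      ultimately show ?case using \<omega>(1)[OF elim] by simp
    qed
    then show ?thesis using z \<eta>(1) by (intro lip_at_zero_powr[OF l\<omega>]) (auto simp: K1_def)
  qed
qed

lemma lip_f:
  assumes \<epsilon>: "0 < \<epsilon>" "\<epsilon> \<le> 1"
  shows "lip_at f x (G \<epsilon> x)"
proof (cases "x \<in> \<Omega>")
  case True
  show ?thesis
  proof (cases "\<omega> x = 0 \<or> \<phi> x = 0")
    case True': True
    show ?thesis by (rule lip_at_mono[OF lip_f_zero[OF True True']]) (rule G_nonneg[OF \<epsilon>(1)])
  next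
    case False
    then have "0 < \<omega> x" "\<phi> x \<noteq> 0" using \<omega>(1)[OF True] by auto
    then show ?thesis using lip_f_pos[OF True] \<epsilon> by blast
  qed
next
  case False
  let ?F = "closure {x. \<phi> x \<noteq> 0}"
  have "\<forall>\<^sub>F y in nhds x. y \<in> - ?F"
    using False test_functionsD(6)[OF \<phi>] by (intro eventually_nhds_in_open) auto
  then have "\<forall>\<^sub>F y in nhds x. f y = 0"
    by eventually_elim (drule ComplD, drule zero_off_support(1), simp add: f_def)
  then have "lip_at f x 0 \<longleftrightarrow> lip_at (\<lambda>_. 0) x 0" by (rule lip_at_cong)
  moreover have "lip_at (\<lambda>_. 0 :: real) x 0" by (simp add: lip_at_def)
  ultimately show ?thesis using G_nonneg[OF \<epsilon>(1), of x] lip_at_mono by blast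
qed

lemma nn_integral_lborel_if:
  "(\<integral>\<^sup>+x. ennreal (if x \<in> \<Omega> then k x else 0) \<partial>lborel) = (\<integral>\<^sup>+x. ennreal (k x) \<partial>lebesgue_on \<Omega>)"
proof -
  have "(\<integral>\<^sup>+x. ennreal (k x) \<partial>lebesgue_on \<Omega>) = (\<integral>\<^sup>+x. ennreal (k x) * indicator \<Omega> x \<partial>lebesgue)"
    using open_\<Omega> by (intro nn_integral_restrict_space) auto
  also have "\<dots> = (\<integral>\<^sup>+x. ennreal (k x) * indicator \<Omega> x \<partial>lborel)" by (rule nn_integral_completion)
  also have "\<dots> = (\<integral>\<^sup>+x. ennreal (if x \<in> \<Omega> then k x else 0) \<partial>lborel)"
    by (intro nn_integral_cong) (auto simp: indicator_def)
  finally show ?thesis by simp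
qed

text \<open>Finiteness is required before the term with S can be absorbed; the integrand is
  continuous with compact support.\<close>

lemma S_integral_finite: "(\<integral>\<^sup>+x. ennreal (S x \<bar>\<phi> x\<bar>) \<partial>lebesgue_on \<Omega>) < \<infinity>"
proof -
  have c: "continuous_on UNIV (\<lambda>x. if x \<in> \<Omega> then S x \<bar>\<phi> x\<bar> else 0)"
  proof (rule continuous_on_UNIV_if)
    show "continuous_on \<Omega> (\<lambda>x. S x \<bar>\<phi> x\<bar>)" by (rule cont_S)
  qed (drule zero_off_support(1), simp add: S_def)
  have "integrable lborel (\<lambda>x. if x \<in> \<Omega> then S x \<bar>\<phi> x\<bar> else 0)"
    by (rule integrable_cont_compact_support[OF c test_functionsD(5)[OF \<phi>]]) (drule zero_off_support(1), simp add: S_def)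
  then have "(\<integral>\<^sup>+x. ennreal (norm (if x \<in> \<Omega> then S x \<bar>\<phi> x\<bar> else 0)) \<partial>lborel) < \<infinity>" by (simp add: integrable_iff_bounded)
  also have "(\<lambda>x. norm (if x \<in> \<Omega> then S x \<bar>\<phi> x\<bar> else 0)) = (\<lambda>x. if x \<in> \<Omega> then S x \<bar>\<phi> x\<bar> else 0)" by (auto simp: S_def)
  finally show ?thesis by (simp add: nn_integral_lborel_if)
qed

text \<open>\<open>GNS_upper_gradient\<close> for f and G. The power N/(N-1) turns f into S, so the
  same Y stands on both sides, on the right with a factor \<epsilon>.\<close>

lemma sobolev_eps:
  assumes \<epsilon>: "0 < \<epsilon>" "\<epsilon> \<le> 1"
    and X: "(\<integral>\<^sup>+x. ennreal (E \<phi> x) \<partial>lebesgue_on \<Omega>) \<le> ennreal X" "0 \<le> X"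
    and Y: "(\<integral>\<^sup>+x. ennreal (S x \<bar>\<phi> x\<bar>) \<partial>lebesgue_on \<Omega>) = ennreal Y" "0 \<le> Y"
    and ne: "\<Omega> \<noteq> {}"
  shows "Y \<le> (C * (\<epsilon> powr (-K) * X + \<epsilon> * Y)) powr (CARD('n) / (CARD('n) - 1))"
proof -
  obtain x0 where "x0 \<in> \<Omega>" using ne by blast
  from C_pos[OF this] have C: "1 \<le> C" .
  have [measurable]: "E \<phi> \<in> borel_measurable (lebesgue_on \<Omega>)" "(\<lambda>x. S x \<bar>\<phi> x\<bar>) \<in> borel_measurable (lebesgue_on \<Omega>)"
  proof -
    have "\<Omega> \<in> sets lebesgue" using open_\<Omega> by auto
    then show "E \<phi> \<in> borel_measurable (lebesgue_on \<Omega>)" "(\<lambda>x. S x \<bar>\<phi> x\<bar>) \<in> borel_measurable (lebesgue_on \<Omega>)"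
      using cont_E cont_S by (auto intro: continuous_imp_measurable_on_sets_lebesgue)
  qed
  have S0: "0 \<le> S x t" for x t by (simp add: S_def)
  let ?A = "C * (\<epsilon> powr (-K) * X + \<epsilon> * Y)"
  have "(\<integral>\<^sup>+x. ennreal (G \<epsilon> x) \<partial>lborel) = (\<integral>\<^sup>+x. ennreal (C * (\<epsilon> powr (-K) * E \<phi> x + \<epsilon> * S x \<bar>\<phi> x\<bar>)) \<partial>lebesgue_on \<Omega>)"
    unfolding G_def by (rule nn_integral_lborel_if)
  also have "\<dots> = (\<integral>\<^sup>+x. ennreal (C * \<epsilon> powr (-K)) * ennreal (E \<phi> x) + ennreal (C * \<epsilon>) * ennreal (S x \<bar>\<phi> x\<bar>) \<partial>lebesgue_on \<Omega>)"
    using E_nonneg S0 C \<epsilon> by (intro nn_integral_cong)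
      (auto simp: ennreal_mult[symmetric] ennreal_plus[symmetric] algebra_simps simp del: ennreal_plus)
  also have "\<dots> = ennreal (C * \<epsilon> powr (-K)) * (\<integral>\<^sup>+x. ennreal (E \<phi> x) \<partial>lebesgue_on \<Omega>) + ennreal (C * \<epsilon>) * (\<integral>\<^sup>+x. ennreal (S x \<bar>\<phi> x\<bar>) \<partial>lebesgue_on \<Omega>)"
    by (simp add: nn_integral_add nn_integral_cmult)
  also have "\<dots> \<le> ennreal (C * \<epsilon> powr (-K)) * ennreal X + ennreal (C * \<epsilon>) * ennreal Y"
    using X Y by (intro add_mono mult_left_mono) auto
  also have "\<dots> = ennreal ?A"
    using C \<epsilon> X Y by (auto simp: ennreal_mult[symmetric] ennreal_plus[symmetric] algebra_simps simp del: ennreal_plus)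
  finally have GA: "(\<integral>\<^sup>+x. ennreal (G \<epsilon> x) \<partial>lborel) \<le> ennreal ?A" .
  have A0: "0 \<le> ?A" using C \<epsilon> X Y by auto
  have D: "DIM(real ^ 'n) = CARD('n)" by simp
  have "(\<integral>\<^sup>+x. ennreal (f x powr (DIM(real ^ 'n) / (DIM(real ^ 'n) - 1))) \<partial>lborel)
    \<le> ennreal (?A powr (DIM(real ^ 'n) / (DIM(real ^ 'n) - 1)))"
  proof (rule GNS_upper_gradient[where K="closure {x. \<phi> x \<noteq> 0}", OF _ continuous_f _ _ _ continuous_G _ lip_f[OF \<epsilon>] GA A0])
    show "2 \<le> DIM(real ^ 'n)" using N2 by simp
    show "bounded (closure {x. \<phi> x \<noteq> 0})" using test_functionsD(5)[OF \<phi>] by (rule compact_imp_bounded)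
    show "f x = 0" if "x \<notin> closure {x. \<phi> x \<noteq> 0}" for x
      using zero_off_support(1)[OF that] by (simp add: f_def)
  qed (use \<epsilon> G_nonneg in \<open>auto simp: f_def\<close>)
  also have "(\<integral>\<^sup>+x. ennreal (f x powr (DIM(real ^ 'n) / (DIM(real ^ 'n) - 1))) \<partial>lborel)
    = (\<integral>\<^sup>+x. ennreal (if x \<in> \<Omega> then S x \<bar>\<phi> x\<bar> else 0) \<partial>lborel)"
    by (intro nn_integral_cong) (auto simp: f_def S_def Q_def powr_powr)
  also have "\<dots> = ennreal Y" by (simp only: nn_integral_lborel_if Y(1))
  finally show ?thesis by (simp add: D)
qed

end

end

text \<open>The interpolation estimates cost a factor \<open>\<epsilon>\<^bsup>-K\<^esup>\<close>; optimising \<open>\<epsilon>\<close> instead of fixing it turns them into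
  a bound that is superlinear in \<open>X\<close>, because \<open>K < N - 1\<close>.\<close>

lemma absorb_optimal_eps:
  fixes C K N X Y :: real
  assumes C: "1 \<le> C" and K: "0 \<le> K" "K < N - 1" and X: "0 \<le> X" and Y: "0 \<le> Y"
    and le: "\<And>\<epsilon>. 0 < \<epsilon> \<Longrightarrow> \<epsilon> \<le> 1 \<Longrightarrow> Y \<le> (C * (\<epsilon> powr (-K) * X + \<epsilon> * Y)) powr (N / (N - 1))"
  shows "Y \<le> ((2 * C) powr (N / (N - 1)) + (2 * C * (1 / (2 * C)) powr (-K)) powr (N / (N - 1 - K)))
    * (X powr (N / (N - 1)) + X powr (N / (N - 1 - K)))"
proof (cases "Y = 0")
  case True
  then show ?thesis by simp
next
  case False
  then have Y0: "Y > 0" using Y by simp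
  have N1: "N > 1" using K by simp
  define a where "a = N / (N - 1)"
  define b where "b = N / (N - 1 - K)"
  define c where "c = 1 / (2 * C)"
  have c: "0 < c" "C * c = 1 / 2" using C by (auto simp: c_def)
  have a: "a > 0" "1 / a = 1 - 1 / N" and b: "b > 0" using K N1 by (auto simp: a_def b_def field_simps)
  \<comment> \<open>Chosen such that C \<epsilon> Y is at most half of Y^(1-1/N) = Y^(1/a), which is
    then absorbed; the minimum keeps \<epsilon> admissible.\<close>
  define \<epsilon> where "\<epsilon> = min 1 (c * Y powr (- 1 / N))"
  have \<epsilon>: "0 < \<epsilon>" "\<epsilon> \<le> 1" "\<epsilon> \<le> c * Y powr (- 1 / N)" using c Y0 by (auto simp: \<epsilon>_def)
  have "Y powr (1 / a) \<le> ((C * (\<epsilon> powr (-K) * X + \<epsilon> * Y)) powr a) powr (1 / a)"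
    using le[OF \<epsilon>(1,2)] a(1) Y0 unfolding a_def[symmetric] by (intro powr_mono2) auto
  also have "\<dots> = C * (\<epsilon> powr (-K) * X + \<epsilon> * Y)"
    using a(1) C X Y0 \<epsilon> by (simp add: powr_powr)
  also have "\<dots> = C * \<epsilon> powr (-K) * X + C * (\<epsilon> * Y)" by (simp add: algebra_simps)
  also have "C * (\<epsilon> * Y) \<le> C * (c * Y powr (- 1 / N) * Y)"
    using \<epsilon> Y0 C by (intro mult_left_mono mult_right_mono) auto
  also have "\<dots> = Y powr (1 / a) / 2"
  proof -
    have "Y powr (- 1 / N) * Y powr 1 = Y powr (1 / a)" unfolding powr_add[symmetric] using a(2) by simp
    then have "Y powr (- 1 / N) * Y = Y powr (1 / a)" using Y0 by simp
    then show ?thesis using c(2) by (metis (no_types, opaque_lifting) mult.assoc mult.commute mult.left_neutral times_divide_eq_right)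
  qed
  finally have main: "Y powr (1 / a) \<le> 2 * C * \<epsilon> powr (-K) * X" by simp
  have "Y \<le> (2 * C) powr a * X powr a + (2 * C * c powr (-K)) powr b * X powr b"
  proof (cases "c * Y powr (- 1 / N) \<ge> 1")
    case True
    then have "\<epsilon> = 1" by (simp add: \<epsilon>_def)
    then have "(Y powr (1 / a)) powr a \<le> (2 * C * X) powr a" using main a(1) by (intro powr_mono2) auto
    then have "Y \<le> (2 * C) powr a * X powr a" using a(1) Y0 C X by (simp add: powr_powr powr_mult)
    then show ?thesis by (simp add: add_increasing2)
  next
    case False
    then have e: "\<epsilon> = c * Y powr (- 1 / N)" by (simp add: \<epsilon>_def)
    \<comment> \<open>The factor \<epsilon>^(-K) now contributes Y^(K/N). It can be moved to the
      left because 1/a - K/N = 1/b is positive, which is the condition K < N - 1.\<close>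
    have "Y powr (1 / a) \<le> (2 * C * c powr (-K) * X) * Y powr (K / N)"
      using main c Y0 unfolding e by (simp add: powr_mult powr_powr algebra_simps)
    then have "Y powr (1 / a) / Y powr (K / N) \<le> 2 * C * c powr (-K) * X" using Y0 by (simp add: field_simps)
    then have "Y powr (1 / a - K / N) \<le> 2 * C * c powr (-K) * X" by (simp add: powr_diff)
    moreover have "1 / a - K / N = 1 / b" using a N1 K by (simp add: b_def field_simps)
    ultimately have "(Y powr (1 / b)) powr b \<le> (2 * C * c powr (-K) * X) powr b" using b by (intro powr_mono2) auto
    then have "Y \<le> (2 * C * c powr (-K)) powr b * X powr b" using b Y0 C X c by (simp add: powr_powr powr_mult)
    then show ?thesis by (simp add: add_increasing)
  qed
  also have "\<dots> \<le> ((2 * C) powr a + (2 * C * c powr (-K)) powr b) * (X powr a + X powr b)"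
    by (simp add: algebra_simps)
  finally show ?thesis by (simp add: a_def b_def c_def)
qed

text \<open>Fatou's lemma, in the form that passes bounds for test functions or smooth truncations
  to their a.e. limits.\<close>

lemma nn_integral_le_if_AE_LIMSEQ:
  fixes u :: "nat \<Rightarrow> 'a \<Rightarrow> real"
  assumes [measurable]: "\<And>n. u n \<in> borel_measurable M"
    and lim: "AE x in M. (\<lambda>n. u n x) \<longlonglongrightarrow> v x"
    and le: "\<And>n. (\<integral>\<^sup>+x. ennreal (u n x) \<partial>M) \<le> c"
  shows "(\<integral>\<^sup>+x. ennreal (v x) \<partial>M) \<le> c"
proof -
  have "(\<integral>\<^sup>+x. ennreal (v x) \<partial>M) = (\<integral>\<^sup>+x. liminf (\<lambda>n. ennreal (u n x)) \<partial>M)"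
  proof (rule nn_integral_cong_AE)
    show "AE x in M. ennreal (v x) = liminf (\<lambda>n. ennreal (u n x))"
      using lim by eventually_elim (metis lim_imp_Liminf tendsto_ennrealI trivial_limit_sequentially)
  qed
  also have "\<dots> \<le> liminf (\<lambda>n. \<integral>\<^sup>+x. ennreal (u n x) \<partial>M)" by (rule nn_integral_liminf) measurable
  also have "\<dots> \<le> limsup (\<lambda>n. \<integral>\<^sup>+x. ennreal (u n x) \<partial>M)" by (rule Liminf_le_Limsup) simp
  also have "\<dots> \<le> c" using le by (intro Limsup_bounded) auto
  finally show ?thesis .
qed

text \<open>The critical exponent of h times (N-1)/N: the power to which a function is raised so
  that the Sobolev inequality in \<open>L\<^sup>1\<close> yields its critical exponent.\<close>

definition phi_star :: "real \<Rightarrow> real \<Rightarrow> real" where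
  "phi_star N h = h * (N - 1) / (N - h)"

lemma phi_star_mono: "h \<le> k \<Longrightarrow> 1 \<le> h \<Longrightarrow> k < N \<Longrightarrow> phi_star N h \<le> phi_star N k"
  unfolding phi_star_def by (intro frac_le mult_right_mono mult_nonneg_nonneg) auto

lemma phi_star_lipschitz:
  fixes h :: "'a::metric_space \<Rightarrow> real"
  assumes h: "L-lipschitz_on \<Omega> h" and 1: "\<And>x. x \<in> \<Omega> \<Longrightarrow> 1 \<le> h x" and k: "\<And>x. x \<in> \<Omega> \<Longrightarrow> h x \<le> k" "k < N"
    and c: "0 \<le> c" and N: "1 \<le> N"
  shows "(c * ((N - 1) * N / (N - k)\<^sup>2) * L)-lipschitz_on \<Omega> (\<lambda>x. c * phi_star N (h x))"
proof (rule lipschitz_onI)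
  have L: "0 \<le> L" using lipschitz_on_nonneg[OF h] .
  show "0 \<le> c * ((N - 1) * N / (N - k)\<^sup>2) * L" using L c N by auto
  fix x y assume xy: "x \<in> \<Omega>" "y \<in> \<Omega>"
  have pos: "N - h x > 0" "N - h y > 0" "N - k > 0" using k(1)[OF xy(1)] k(1)[OF xy(2)] k(2) by auto
  have "phi_star N (h x) - phi_star N (h y) = (N - 1) * N * (h x - h y) / ((N - h x) * (N - h y))"
    using pos by (simp add: phi_star_def field_simps)
  then have "\<bar>phi_star N (h x) - phi_star N (h y)\<bar> = (N - 1) * N * \<bar>h x - h y\<bar> / ((N - h x) * (N - h y))"
    using pos N by (simp add: abs_mult)
  also have "\<dots> \<le> (N - 1) * N * (L * dist x y) / ((N - k) * (N - k))"
  proof (intro frac_le mult_left_mono mult_mono)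
    show "\<bar>h x - h y\<bar> \<le> L * dist x y" using lipschitz_onD[OF h xy] by (simp add: dist_real_def)
  qed (use pos N L k(1)[OF xy(1)] k(1)[OF xy(2)] in auto)
  finally have "c * \<bar>phi_star N (h x) - phi_star N (h y)\<bar> \<le> c * ((N - 1) * N * (L * dist x y) / ((N - k) * (N - k)))"
    using c by (rule mult_left_mono)
  moreover have "dist (c * phi_star N (h x)) (c * phi_star N (h y)) = c * \<bar>phi_star N (h x) - phi_star N (h y)\<bar>"
    using c by (simp add: dist_real_def right_diff_distrib[symmetric] abs_mult)
  ultimately show "dist (c * phi_star N (h x)) (c * phi_star N (h y)) \<le> c * ((N - 1) * N / (N - k)\<^sup>2) * L * dist x y"
    by (simp add: power2_eq_square mult.assoc)
qed

text \<open>\<kappa> lowers the critical exponents, and \<eta> measures the room that is left above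
  p and q. The last assumption quantifies q/p < 1 + 1/N: the inequality q N/(N-q+1) < p N/(N-p) is
  equivalent to q N < p N + p.\<close>

locale double_phase_exponents = double_phase_data \<Omega> p q \<mu> qM \<mu>M
  for \<Omega> :: "(real ^ 'n) set" and p q \<mu> and qM \<mu>M :: real +
  fixes Lp Lq L\<mu> \<kappa> \<eta> :: real
  assumes N2: "2 \<le> CARD('n)" and nonempty: "\<Omega> \<noteq> {}"
    and lip: "Lp-lipschitz_on \<Omega> p" "Lq-lipschitz_on \<Omega> q" "L\<mu>-lipschitz_on \<Omega> \<mu>"
    and qM_less: "qM < CARD('n)"
    and \<kappa>: "0 < \<kappa>" "\<kappa> < 1"
    and \<eta>: "0 < \<eta>" "CARD('n) * \<eta> \<le> 1 / 2" "x \<in> \<Omega> \<Longrightarrow> (1 + \<eta>) * p x \<le> \<kappa> * phi_star CARD('n) (p x)"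
      "x \<in> \<Omega> \<Longrightarrow> (1 + \<eta>) * q x \<le> \<kappa> * phi_star CARD('n) (q x)"
    and ratio: "x \<in> \<Omega> \<Longrightarrow> q x * CARD('n) / (CARD('n) - q x + 1) \<le> \<kappa> * crit_exp p x"
begin

definition N :: real where "N = CARD('n)"
definition P :: "real ^ 'n \<Rightarrow> real" where "P x = \<kappa> * crit_exp p x"
definition Q :: "real ^ 'n \<Rightarrow> real" where "Q x = \<kappa> * crit_exp q x"
definition mM :: real where "mM = phi_star N qM"
text \<open>The first entry serves Young's inequality, the second the interpolation at the exponent
  m + \<eta>. Both are below N - 1, as \<open>absorb_optimal_eps\<close> demands.\<close>

definition K :: real where "K = max (qM - 1) ((N - 1) * (1 - 1 / (2 * mM)))"

lemma N_ge: "2 \<le> N" using N2 by (simp add: N_def)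

lemma mM_gt: "1 < mM"
  using qM qM_less N_ge unfolding mM_def phi_star_def N_def[symmetric] by (simp add: field_simps)

lemma K: "0 \<le> K" "K < N - 1" "qM - 1 \<le> K"
proof -
  have "(N - 1) * (1 - 1 / (2 * mM)) < (N - 1) * 1"
    using N_ge mM_gt by (intro mult_strict_left_mono) auto
  then show "K < N - 1" using qM_less by (simp add: K_def N_def[symmetric])
qed (use qM in \<open>auto simp: K_def\<close>)

text \<open>The conditions of \<open>sobolev_step\<close> on exponents, checked for one number h at
  a time so that p and q share them. The last inequality is m \<le> \<open>phi_star N h\<close> with
  the denominator cleared.\<close>

lemma step_conditions:
  assumes h: "1 < h" "h \<le> qM" and m_def: "m = \<kappa> * phi_star N h" and m: "(1 + \<eta>) * h \<le> m"
  shows "m \<le> mM" "h + \<eta> \<le> m" "m + \<eta> < m * N / (N - 1)"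
    "m + \<eta> - h \<le> K * (m * N / (N - 1) - (m + \<eta>))"
    "(m - 1) * h / (h - 1) \<le> m * N / (N - 1)" "m * (N - h) \<le> h * (N - 1)"
proof -
  have hN: "h < N" using h qM_less by (simp add: N_def)
  have \<eta>N: "N * \<eta> \<le> 1 / 2" using \<eta>(2) by (simp add: N_def)
  have "h * 1 + \<eta> * 1 \<le> (1 + \<eta>) * h" using h \<eta>(1) by (simp add: algebra_simps)
  then show hm: "h + \<eta> \<le> m" using m by linarith
  have ps: "0 \<le> phi_star N h" using h hN N_ge by (simp add: phi_star_def)
  have "m \<le> 1 * phi_star N h" unfolding m_def using \<kappa> ps by (intro mult_right_mono) auto
  then have mle: "m \<le> phi_star N h" by simp
  also have "\<dots> \<le> mM" unfolding mM_def using h qM_less by (intro phi_star_mono) (auto simp: N_def)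
  finally show mM': "m \<le> mM" .
  show mN: "m * (N - h) \<le> h * (N - 1)" using mle hN by (simp add: phi_star_def field_simps)
  have m1: "1 < m" using hm h \<eta>(1) by linarith
  have N1\<eta>: "(N - 1) * \<eta> < 1 / 2" using \<eta>N \<eta>(1) by (simp add: algebra_simps)
  then have "(N - 1) * \<eta> < m" using m1 by linarith
  then have e1: "\<eta> < m / (N - 1)" using N_ge by (simp add: field_simps)
  have split: "m * N / (N - 1) = m + m / (N - 1)" using N_ge by (simp add: field_simps)
  show "m + \<eta> < m * N / (N - 1)" using e1 split by simp
  \<comment> \<open>z/(N-1) is the gap between m N/(N-1) and m + \<eta>. As N \<eta> is at most 1/2
    and h exceeds 1, half a unit is left over; since z is at most \<open>mM\<close>, it is worth at
    least z/(2 mM). This is the origin of the second entry of \<open>K\<close>.\<close>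
  define z where "z = m - (N - 1) * \<eta>"
  have z: "0 \<le> z" "z \<le> mM" using \<open>(N - 1) * \<eta> < m\<close> mM' \<eta>(1) N_ge by (auto simp: z_def intro: order_trans[of _ m])
  have "m + \<eta> - h \<le> z - 1 / 2" using \<eta>N h by (simp add: z_def algebra_simps)
  also have "\<dots> \<le> z - z / (2 * mM)" using z mM_gt by (simp add: field_simps)
  also have "\<dots> = (N - 1) * (1 - 1 / (2 * mM)) * (z / (N - 1))" using N_ge mM_gt by (simp add: field_simps)
  also have "\<dots> \<le> K * (z / (N - 1))" using z N_ge by (intro mult_right_mono) (auto simp: K_def)
  also have "z / (N - 1) = m * N / (N - 1) - (m + \<eta>)" unfolding split using N_ge by (simp add: z_def diff_divide_distrib)
  finally show "m + \<eta> - h \<le> K * (m * N / (N - 1) - (m + \<eta>))" .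
  have "(m - 1) * h * (N - 1) \<le> m * N * (h - 1)" using mN by (simp add: algebra_simps)
  then have "(m - 1) * h \<le> m * N * (h - 1) / (N - 1)" using N_ge by (simp add: pos_le_divide_eq)
  then have "(m - 1) * h \<le> m * N / (N - 1) * (h - 1)" by simp
  then show "(m - 1) * h / (h - 1) \<le> m * N / (N - 1)" using h by (simp add: pos_divide_le_eq)
qed

lemma P_eq: "P x = \<kappa> * phi_star N (p x) * N / (N - 1)" and Q_eq: "Q x = \<kappa> * phi_star N (q x) * N / (N - 1)"
  using N_ge by (auto simp: P_def Q_def crit_exp_def phi_star_def N_def[symmetric] divide_simps)

lemma p_bounds: "x \<in> \<Omega> \<Longrightarrow> 1 < p x \<and> p x \<le> qM" and q_bounds: "x \<in> \<Omega> \<Longrightarrow> 1 < q x \<and> q x \<le> qM"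
  using p_gt_1[of x] p_less_q[of x] q_le[of x] by auto

lemma continuous_P: "continuous_on \<Omega> P" and continuous_Q: "continuous_on \<Omega> Q"
proof -
  show "continuous_on \<Omega> P" unfolding P_def[abs_def] crit_exp_def
    by (intro continuous_intros cont) (use p_bounds qM_less in force)
  show "continuous_on \<Omega> Q" unfolding Q_def[abs_def] crit_exp_def
    by (intro continuous_intros cont) (use q_bounds qM_less in force)
qed

lemma p_less_P: "x \<in> \<Omega> \<Longrightarrow> p x < P x" and q_less_Q: "x \<in> \<Omega> \<Longrightarrow> q x < Q x"
proof -
  have "h < \<kappa> * phi_star N h * N / (N - 1)" if h: "1 < h" "h \<le> qM" and m: "(1 + \<eta>) * h \<le> \<kappa> * phi_star N h" for h
    using step_conditions(2,3)[OF h refl m] \<eta>(1) by linarith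
  then show "x \<in> \<Omega> \<Longrightarrow> p x < P x" "x \<in> \<Omega> \<Longrightarrow> q x < Q x"
    unfolding P_eq Q_eq using p_bounds q_bounds \<eta>(3,4) by (auto simp: N_def)
qed

text \<open>A constant weight has no derivative to absorb. The condition on \<open>CR\<close>
  becomes interpolation of t^m between t^p and the exponent m N/(N-1), hence R is t^p and
  \<open>CR\<close> is 1.\<close>

lemma step_A: "sobolev_step \<Omega> p (\<lambda>x. \<kappa> * phi_star N (p x)) (\<lambda>_. 1) (\<lambda>x t. t powr p x)
  Lp (\<kappa> * ((N - 1) * N / (N - qM)\<^sup>2) * Lp) 0 1 mM \<eta> K 1"
proof unfold_locales
  have cN: "real CARD('n) = N" "real (CARD('n) - 1) = N - 1" using N2 by (auto simp: N_def of_nat_diff)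
  show "2 \<le> CARD('n)" by (rule N2)
  show "open \<Omega>" by (rule open_\<Omega>)
  show "Lp-lipschitz_on \<Omega> p" by (rule lip)
  show "(\<kappa> * ((N - 1) * N / (N - qM)\<^sup>2) * Lp)-lipschitz_on \<Omega> (\<lambda>x. \<kappa> * phi_star N (p x))"
    by (rule phi_star_lipschitz[OF lip(1)]) (use p_bounds qM_less \<kappa> N_ge in \<open>auto simp: N_def less_imp_le\<close>)
  show "0-lipschitz_on \<Omega> (\<lambda>_. 1 :: real)" by (simp add: lipschitz_on_def)
  show "0 < \<eta>" by (rule \<eta>)
  show "0 \<le> K" by (rule K)
  fix f :: "real ^ 'n \<Rightarrow> real" assume "continuous_on \<Omega> f" "\<And>x. 0 \<le> f x"
  then show "continuous_on \<Omega> (\<lambda>x. f x powr p x)"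
    by (intro continuous_on_powr' cont) (use p_bounds in force)+
next
  fix x assume x: "x \<in> \<Omega>"
  have cN: "real CARD('n) = N" "real (CARD('n) - 1) = N - 1" using N2 by (auto simp: N_def of_nat_diff)
  have pb: "1 < p x" "p x \<le> qM" using p_bounds[OF x] by auto
  have m: "(1 + \<eta>) * p x \<le> \<kappa> * phi_star N (p x)" using \<eta>(3)[OF x] by (simp add: N_def)
  note s = step_conditions[OF pb refl m]
  show "1 < p x" "(1 + \<eta>) * p x \<le> \<kappa> * phi_star N (p x)" "p x - 1 \<le> K" using pb m K(3) by auto
  show "p x + \<eta> \<le> \<kappa> * phi_star N (p x)" "\<kappa> * phi_star N (p x) \<le> mM" using s by auto
  show "\<kappa> * phi_star N (p x) + \<eta> < \<kappa> * phi_star N (p x) * CARD('n) / (CARD('n) - 1)"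
    "\<kappa> * phi_star N (p x) + \<eta> - p x \<le> K * (\<kappa> * phi_star N (p x) * CARD('n) / (CARD('n) - 1) - (\<kappa> * phi_star N (p x) + \<eta>))"
    "(\<kappa> * phi_star N (p x) - 1) * p x / (p x - 1) \<le> \<kappa> * phi_star N (p x) * CARD('n) / (CARD('n) - 1)"
    unfolding cN using s by auto
  fix t \<epsilon> :: real assume t: "0 < t" "0 < \<epsilon>" "\<epsilon> \<le> 1"
  have "t powr (\<kappa> * phi_star N (p x)) \<le> \<epsilon> powr - K * t powr p x + \<epsilon> * t powr (\<kappa> * phi_star N (p x) * N / (N - 1))"
  proof (rule powr_interp)
    have "\<kappa> * phi_star N (p x) - p x \<le> K * (\<kappa> * phi_star N (p x) * N / (N - 1) - (\<kappa> * phi_star N (p x) + \<eta>))"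
      using s(4) \<eta>(1) by linarith
    also have "\<dots> \<le> K * (\<kappa> * phi_star N (p x) * N / (N - 1) - \<kappa> * phi_star N (p x))"
      using K(1) \<eta>(1) by (intro mult_left_mono) auto
    finally show "\<kappa> * phi_star N (p x) - p x \<le> K * (\<kappa> * phi_star N (p x) * N / (N - 1) - \<kappa> * phi_star N (p x))" .
  qed (use t s \<eta>(1) in auto)
  then show "(1 powr (1 / p x) * t) powr (\<kappa> * phi_star N (p x)) / 1
    \<le> 1 * (\<epsilon> powr - K * t powr p x + \<epsilon> * (1 powr (1 / p x) * t) powr (\<kappa> * phi_star N (p x) * CARD('n) / (CARD('n) - 1)))"
    by (simp add: cN)
qed auto

text \<open>The derivative of the weight produces \<open>\<mu>\<^bsup>b-1\<^esup> t\<^bsup>m\<^esup>\<close> with \<open>b = m / q\<close>; it is a product of powers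
  \<open>w\<^bsup>\<alpha>Q\<^esup> t\<^bsup>q\<^esup>\<close> with \<open>\<alpha> = (m - q) / Q\<close>, and \<open>ratio\<close> says that \<open>q / (1 - \<alpha>)\<close> stays below the
  critical exponent of \<open>p\<close>.\<close>

lemma step_B: "sobolev_step \<Omega> q (\<lambda>x. \<kappa> * phi_star N (q x)) \<mu> (\<lambda>x t. t powr p x + t powr P x)
  Lq (\<kappa> * ((N - 1) * N / (N - qM)\<^sup>2) * Lq) L\<mu> \<mu>M mM \<eta> K 1"
proof unfold_locales
  show "2 \<le> CARD('n)" by (rule N2)
  show "open \<Omega>" by (rule open_\<Omega>)
  show "Lq-lipschitz_on \<Omega> q" "L\<mu>-lipschitz_on \<Omega> \<mu>" by (rule lip)+
  show "(\<kappa> * ((N - 1) * N / (N - qM)\<^sup>2) * Lq)-lipschitz_on \<Omega> (\<lambda>x. \<kappa> * phi_star N (q x))"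
    by (rule phi_star_lipschitz[OF lip(2)]) (use q_bounds qM_less \<kappa> N_ge in \<open>auto simp: N_def less_imp_le\<close>)
  show "0 < \<eta>" by (rule \<eta>)
  show "0 \<le> K" by (rule K)
  fix f :: "real ^ 'n \<Rightarrow> real" assume f: "continuous_on \<Omega> f" "\<And>x. 0 \<le> f x"
  have P0: "x \<in> \<Omega> \<Longrightarrow> 0 < P x" for x using p_bounds p_less_P by fastforce
  have "continuous_on \<Omega> (\<lambda>x. f x powr p x)" "continuous_on \<Omega> (\<lambda>x. f x powr P x)"
    by (rule continuous_on_powr'[OF f(1) cont(1)], use f(2) p_bounds in force)
      (rule continuous_on_powr'[OF f(1) continuous_P], use f(2) P0 in force)
  then show "continuous_on \<Omega> (\<lambda>x. f x powr p x + f x powr P x)" by (rule continuous_on_add)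
next
  fix x assume x: "x \<in> \<Omega>"
  have cN: "real CARD('n) = N" "real (CARD('n) - 1) = N - 1" using N2 by (auto simp: N_def of_nat_diff)
  have qb: "1 < q x" "q x \<le> qM" using q_bounds[OF x] by auto
  define m where "m = \<kappa> * phi_star N (q x)"
  have m: "(1 + \<eta>) * q x \<le> m" using \<eta>(4)[OF x] by (simp add: N_def m_def)
  note s = step_conditions[OF qb m_def m]
  show "1 < q x" "(1 + \<eta>) * q x \<le> \<kappa> * phi_star N (q x)" "q x - 1 \<le> K" using qb m K(3) by (auto simp: m_def)
  show "q x + \<eta> \<le> \<kappa> * phi_star N (q x)" "\<kappa> * phi_star N (q x) \<le> mM" using s by (auto simp: m_def)
  show "\<kappa> * phi_star N (q x) + \<eta> < \<kappa> * phi_star N (q x) * CARD('n) / (CARD('n) - 1)"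
    "\<kappa> * phi_star N (q x) + \<eta> - q x \<le> K * (\<kappa> * phi_star N (q x) * CARD('n) / (CARD('n) - 1) - (\<kappa> * phi_star N (q x) + \<eta>))"
    "(\<kappa> * phi_star N (q x) - 1) * q x / (q x - 1) \<le> \<kappa> * phi_star N (q x) * CARD('n) / (CARD('n) - 1)"
    unfolding cN using s by (auto simp: m_def)
  show "0 \<le> \<mu> x" "\<mu> x \<le> \<mu>M" using \<mu>_nonneg[OF x] \<mu>_le[OF x] .
  fix t \<epsilon> :: real assume t: "0 < \<mu> x" "0 < t" "0 < \<epsilon>" "\<epsilon> \<le> 1"
  define w where "w = \<mu> x powr (1 / q x) * t"
  have w: "0 < w" using t by (simp add: w_def)
  define Qx where "Qx = m * N / (N - 1)"
  have mq: "q x \<le> m" using s(2) \<eta>(1) by linarith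
  have Qm: "Qx = m + m / (N - 1)" using N_ge by (simp add: Qx_def field_simps)
  have Q0: "0 < Qx" using mq qb N_ge unfolding Qm by (intro add_pos_nonneg) auto
  define \<alpha> where "\<alpha> = (m - q x) / Qx"
  have m0: "0 < m / (N - 1) + q x" using mq qb N_ge by (intro add_nonneg_pos) auto
  have \<alpha>: "0 \<le> \<alpha>" "\<alpha> < 1" "1 - \<alpha> = (m / (N - 1) + q x) / Qx"
    using mq Q0 m0 by (auto simp: \<alpha>_def Qm field_simps)
  have e: "q x / (1 - \<alpha>) = q x * (m * N) / (m + q x * (N - 1))"
  proof -
    have n1: "N - 1 \<noteq> 0" using N_ge by simp
    have "m / (N - 1) + q x = (m + q x * (N - 1)) / (N - 1)" using n1 by (simp add: add_divide_distrib)
    then have "q x / (1 - \<alpha>) = q x * (m * N / (N - 1)) / ((m + q x * (N - 1)) / (N - 1))"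
      using Q0 by (simp add: \<alpha>(3) Qx_def)
    then show ?thesis using n1 by simp
  qed
  have eq: "q x \<le> q x / (1 - \<alpha>)" using \<alpha> qb by (simp add: field_simps)
  \<comment> \<open>The exponent q m N/(m + q(N-1)) increases with m and equals q N/(N-q+1) when m
    is \<open>phi_star\<close> of q; that value is what \<open>ratio\<close> compares with
    P.\<close>
  have eP: "q x / (1 - \<alpha>) \<le> P x"
  proof -
    have qN: "q x < N" using qb qM_less by (simp add: N_def)
    have "m * (N - q x + 1) \<le> m + q x * (N - 1)" using s(6) by (simp add: algebra_simps)
    then have "(q x * N) * (m * (N - q x + 1)) \<le> (q x * N) * (m + q x * (N - 1))"
      using qb N_ge by (intro mult_left_mono) auto
    then have le: "q x * (m * N) * (N - q x + 1) \<le> q x * N * (m + q x * (N - 1))" by (simp only: ac_simps)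
    have d: "0 < m + q x * (N - 1)" "0 < N - q x + 1" using qN mq qb N_ge by (auto intro!: add_pos_nonneg)
    have "q x * (m * N) / (m + q x * (N - 1)) \<le> q x * N / (N - q x + 1)"
      using le d by (subst pos_divide_le_eq[OF d(1)], subst times_divide_eq_left, subst pos_le_divide_eq[OF d(2)])
    also have "\<dots> \<le> P x" using ratio[OF x] by (simp add: P_def N_def)
    finally show ?thesis using e by simp
  qed
  \<comment> \<open>The side condition of \<open>Young_eps\<close>; multiplied by \<open>Qx\<close>
    it follows once more from the upper bound of m by \<open>phi_star\<close> of q.\<close>
  have \<alpha>K: "\<alpha> \<le> K * (1 - \<alpha>)"
  proof -
    have "m - q x \<le> (q x - 1) * (m / (N - 1) + q x)"
    proof -
      have "m * (N - q x) / (N - 1) \<le> q x * (N - 1) / (N - 1)" using s(6) N_ge by (intro divide_right_mono) auto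
      then have "m * (N - q x) / (N - 1) \<le> q x" using N_ge by simp
      moreover have "q x * 1 \<le> q x * q x" using qb by (intro mult_left_mono) auto
      moreover have "(q x - 1) * (m / (N - 1) + q x) - (m - q x) = q x * q x - m * (N - q x) / (N - 1)"
        using N_ge by (simp add: field_simps)
      ultimately show ?thesis by linarith
    qed
    also have "\<dots> \<le> K * (m / (N - 1) + q x)" using K(3) qb m0 by (intro mult_right_mono) auto
    finally have "(m - q x) / Qx \<le> K * (m / (N - 1) + q x) / Qx" using Q0 by (intro divide_right_mono) auto
    then show ?thesis unfolding \<alpha>(3) by (simp add: \<alpha>_def)
  qed
  have "(t powr (q x / (1 - \<alpha>))) powr (1 - \<alpha>) * (w powr Qx) powr \<alpha>
    \<le> \<epsilon> powr - K * t powr (q x / (1 - \<alpha>)) + \<epsilon> * w powr Qx"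
    using \<alpha> \<alpha>K t by (intro Young_eps) auto
  moreover have "(t powr (q x / (1 - \<alpha>))) powr (1 - \<alpha>) * (w powr Qx) powr \<alpha> = w powr m / \<mu> x"
  proof -
    have "Qx * \<alpha> = m - q x" using Q0 by (simp add: \<alpha>_def)
    then have "(w powr Qx) powr \<alpha> = w powr m / w powr q x" unfolding powr_powr by (simp add: powr_diff)
    moreover have "w powr q x = \<mu> x * t powr q x" using t qb by (simp add: w_def powr_mult powr_powr)
    moreover have "(t powr (q x / (1 - \<alpha>))) powr (1 - \<alpha>) = t powr q x" using \<alpha>(2) by (simp add: powr_powr)
    ultimately show ?thesis using t by simp
  qed
  moreover have "t powr (q x / (1 - \<alpha>)) \<le> t powr p x + t powr P x"
    using eq eP t(2) p_less_q[OF x] by (intro powr_le_add) auto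
  then have "\<epsilon> powr - K * t powr (q x / (1 - \<alpha>)) \<le> \<epsilon> powr - K * (t powr p x + t powr P x)"
    by (intro mult_left_mono) auto
  ultimately have "w powr m / \<mu> x \<le> \<epsilon> powr - K * (t powr p x + t powr P x) + \<epsilon> * w powr Qx" by linarith
  then show "(\<mu> x powr (1 / q x) * t) powr (\<kappa> * phi_star N (q x)) / \<mu> x
    \<le> 1 * (\<epsilon> powr - K * (t powr p x + t powr P x) + \<epsilon> * (\<mu> x powr (1 / q x) * t) powr (\<kappa> * phi_star N (q x) * CARD('n) / (CARD('n) - 1)))"
    unfolding w_def m_def Qx_def cN by simp
next
  fix x and t :: real
  show "0 \<le> t powr p x + t powr P x" "0 powr p x + 0 powr P x = (0 :: real)" "(0 :: real) < 1" by simp_all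
qed

end

section \<open>The embedding for the double phase modular\<close>

lemma powr_add_le_mult:
  fixes u v c :: real
  assumes "0 \<le> u" "0 \<le> v" "0 \<le> c"
  shows "(u + v) powr c \<le> 2 powr c * (u powr c + v powr c)"
proof -
  have "(u + v) powr c \<le> (2 * max u v) powr c" using assms by (intro powr_mono2) auto
  also have "\<dots> = 2 powr c * max u v powr c" using assms by (simp add: powr_mult)
  also have "\<dots> \<le> 2 powr c * (u powr c + v powr c)" by (intro mult_left_mono) (auto simp: max_def)
  finally show ?thesis .
qed

text \<open>The optimal \<epsilon> eliminates Y from the right side with a constant that depends on
  C, K and the dimension only, hence works for all test functions.\<close>

lemma (in sobolev_step) sobolev_modular:
  assumes KN: "K < real CARD('n) - 1" and ne: "\<Omega> \<noteq> {}"
  shows "\<exists>D>0. \<forall>\<phi>\<in>test_functions \<Omega>. \<forall>X\<ge>0. (\<integral>\<^sup>+x. ennreal (E \<phi> x) \<partial>lebesgue_on \<Omega>) \<le> ennreal X \<longrightarrow>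
    (\<integral>\<^sup>+x. ennreal (S x \<bar>\<phi> x\<bar>) \<partial>lebesgue_on \<Omega>)
    \<le> ennreal (D * (X powr (real CARD('n) / (real CARD('n) - 1)) + X powr (real CARD('n) / (real CARD('n) - 1 - K))))"
proof -
  obtain x0 where "x0 \<in> \<Omega>" using ne by blast
  then have C: "1 \<le> C" by (rule C_pos)
  define D where "D = (2 * C) powr (real CARD('n) / (real CARD('n) - 1)) + (2 * C * (1 / (2 * C)) powr (-K)) powr (real CARD('n) / (real CARD('n) - 1 - K))"
  have "0 < D" using C unfolding D_def by (intro add_pos_nonneg) auto
  moreover have "(\<integral>\<^sup>+x. ennreal (S x \<bar>\<phi> x\<bar>) \<partial>lebesgue_on \<Omega>)
    \<le> ennreal (D * (X powr (real CARD('n) / (real CARD('n) - 1)) + X powr (real CARD('n) / (real CARD('n) - 1 - K))))"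
    if \<phi>: "\<phi> \<in> test_functions \<Omega>" and X: "0 \<le> X" "(\<integral>\<^sup>+x. ennreal (E \<phi> x) \<partial>lebesgue_on \<Omega>) \<le> ennreal X" for \<phi> X
  proof -
    define Y where "Y = enn2real (\<integral>\<^sup>+x. ennreal (S x \<bar>\<phi> x\<bar>) \<partial>lebesgue_on \<Omega>)"
    have Y: "(\<integral>\<^sup>+x. ennreal (S x \<bar>\<phi> x\<bar>) \<partial>lebesgue_on \<Omega>) = ennreal Y" "0 \<le> Y"
      using S_integral_finite[OF \<phi>] by (auto simp: Y_def)
    have cN: "real (CARD('n) - 1) = real CARD('n) - 1" using N2 by (simp add: of_nat_diff)
    have "Y \<le> D * (X powr (real CARD('n) / (real CARD('n) - 1)) + X powr (real CARD('n) / (real CARD('n) - 1 - K)))"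
      unfolding D_def
    proof (rule absorb_optimal_eps[OF C K(1) KN X(1) Y(2)])
      fix \<epsilon> :: real assume "0 < \<epsilon>" "\<epsilon> \<le> 1"
      from sobolev_eps[OF \<phi> this X(2,1) Y ne]
      show "Y \<le> (C * (\<epsilon> powr - K * X + \<epsilon> * Y)) powr (real CARD('n) / (real CARD('n) - 1))" by (simp add: cN)
    qed
    then show ?thesis unfolding Y(1) by (rule ennreal_leI)
  qed
  ultimately show ?thesis by blast
qed

context double_phase_exponents
begin

text \<open>The exponents \<open>P = \<kappa> p\<^sup>*\<close>, \<open>Q = \<kappa> q\<^sup>*\<close> with \<open>\<kappa> < 1\<close> leave room for the logarithms that arise when
  variable exponents are differentiated.\<close>

definition PT :: "real ^ 'n \<Rightarrow> real \<Rightarrow> real" where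
  "PT x t = t powr P x + (\<mu> x powr (1 / q x) * t) powr Q x"

lemma PT_nonneg: "0 \<le> PT x t" and PT_zero [simp]: "PT x 0 = 0"
  by (simp_all add: PT_def)

lemma PQ_measurable: "P \<in> borel_measurable M" "Q \<in> borel_measurable M" "(\<lambda>x. 1 / q x) \<in> borel_measurable M"
  using continuous_P continuous_Q cont_measurable pq_measurable(2) by auto

lemma PT_measurable [measurable]: "f \<in> borel_measurable M \<Longrightarrow> (\<lambda>x. PT x (f x)) \<in> borel_measurable M"
  unfolding PT_def
  by (intro borel_measurable_add borel_measurable_times powr_real_measurable pq_measurable PQ_measurable)

lemma PT_tendsto:
  assumes x: "x \<in> \<Omega>" and t: "(t \<longlongrightarrow> l) F"
  shows "((\<lambda>n. PT x \<bar>t n\<bar>) \<longlongrightarrow> PT x \<bar>l\<bar>) F"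
proof -
  have "0 < P x" "0 < Q x" using p_less_P[OF x] q_less_Q[OF x] p_bounds[OF x] q_bounds[OF x] by auto
  then show ?thesis unfolding PT_def
    by (intro tendsto_add tendsto_powr2 tendsto_mult tendsto_const tendsto_rabs t) (auto intro!: always_eventually)
qed

text \<open>|\<phi>|^P is among the data of the weighted step, so the input of that step is X plus
  the output of the unweighted one. Composing two bounds of the form X^a + X^b raises the upper
  exponent to b^2, while the lower one stays above 1; this superlinearity is the gain.\<close>

lemma gain_test:
  "\<exists>D a b. 0 < D \<and> 1 < a \<and> a \<le> b \<and> (\<forall>\<phi>\<in>test_functions \<Omega>. \<forall>X\<ge>0.
    \<rho> (\<lambda>x. norm (grad \<phi> x)) + \<rho> \<phi> \<le> ennreal X \<longrightarrow>
    (\<integral>\<^sup>+x. ennreal (PT x \<bar>\<phi> x\<bar>) \<partial>M) \<le> ennreal (D * (X powr a + X powr b)))"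
proof -
  have cN: "real CARD('n) = N" "real (CARD('n) - 1) = N - 1" using N2 by (auto simp: N_def of_nat_diff)
  define a where "a = N / (N - 1)"
  define b where "b = N / (N - 1 - K)"
  have ab: "1 < a" "a \<le> b" "1 < b"
  proof -
    show "1 < a" using N_ge by (simp add: a_def)
    show "a \<le> b" unfolding a_def b_def using K N_ge by (intro frac_le) auto
    then show "1 < b" using \<open>1 < a\<close> by linarith
  qed
  have KN: "K < real CARD('n) - 1" using K(2) by (simp add: cN)
  obtain DA where DA: "0 < DA" "\<And>\<phi> X. \<phi> \<in> test_functions \<Omega> \<Longrightarrow> 0 \<le> X \<Longrightarrow>
      (\<integral>\<^sup>+x. ennreal (norm (grad \<phi> x) powr p x + \<bar>\<phi> x\<bar> powr p x + \<bar>\<phi> x\<bar> powr p x) \<partial>M) \<le> ennreal X \<Longrightarrow>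
      (\<integral>\<^sup>+x. ennreal (\<bar>\<phi> x\<bar> powr P x) \<partial>M) \<le> ennreal (DA * (X powr a + X powr b))"
    using sobolev_step.sobolev_modular[OF step_A KN nonempty]
    unfolding sobolev_step.E_def[OF step_A] sobolev_step.S_def[OF step_A] sobolev_step.Q_def[OF step_A]
      cN P_eq[symmetric] a_def[symmetric] b_def[symmetric] by auto
  obtain DB where DB: "0 < DB" "\<And>\<phi> X. \<phi> \<in> test_functions \<Omega> \<Longrightarrow> 0 \<le> X \<Longrightarrow>
      (\<integral>\<^sup>+x. ennreal (\<mu> x * norm (grad \<phi> x) powr q x + \<mu> x * \<bar>\<phi> x\<bar> powr q x + (\<bar>\<phi> x\<bar> powr p x + \<bar>\<phi> x\<bar> powr P x)) \<partial>M) \<le> ennreal X \<Longrightarrow>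
      (\<integral>\<^sup>+x. ennreal ((\<mu> x powr (1 / q x) * \<bar>\<phi> x\<bar>) powr Q x) \<partial>M) \<le> ennreal (DB * (X powr a + X powr b))"
    using sobolev_step.sobolev_modular[OF step_B KN nonempty]
    unfolding sobolev_step.E_def[OF step_B] sobolev_step.S_def[OF step_B] sobolev_step.Q_def[OF step_B]
      cN Q_eq[symmetric] a_def[symmetric] b_def[symmetric] by auto
  define D1 where "D1 = DA * 2 powr b"
  define D2 where "D2 = 1 + 2 * D1"
  define D3 where "D3 = DB * (2 * ((2 * D2) powr a + (2 * D2) powr b))"
  define D where "D = 2 * D1 + D3"
  have D1: "0 < D1" using DA by (simp add: D1_def)
  have D2: "1 < D2" using D1 by (simp add: D2_def)
  have D3: "0 < D3" unfolding D3_def using DB D2 by (intro mult_pos_pos add_pos_pos) auto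
  have aab: "a \<le> a * b" "a * b \<le> b * b" "b \<le> b * b" using ab by (auto intro: mult_right_mono)
  then have abb: "a \<le> b * b" by linarith
  have "(\<integral>\<^sup>+x. ennreal (PT x \<bar>\<phi> x\<bar>) \<partial>M) \<le> ennreal (D * (X powr a + X powr (b * b)))"
    if \<phi>: "\<phi> \<in> test_functions \<Omega>" and X: "0 \<le> X" "\<rho> (\<lambda>x. norm (grad \<phi> x)) + \<rho> \<phi> \<le> ennreal X" for \<phi> X
  proof -
    note [measurable] = test_measurable[OF \<phi>] PQ_measurable
    let ?HH = "\<lambda>x. ennreal (H x (norm (grad \<phi> x))) + ennreal (H x \<bar>\<phi> x\<bar>)"
    have HH: "(\<integral>\<^sup>+x. ?HH x \<partial>M) \<le> ennreal X"
      using X(2) unfolding modular_def by (subst nn_integral_add) auto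
    have Pm: "(\<lambda>x. \<bar>\<phi> x\<bar> powr P x) \<in> borel_measurable M"
      by (intro powr_real_measurable PQ_measurable) measurable
    have "(\<integral>\<^sup>+x. ennreal (norm (grad \<phi> x) powr p x + \<bar>\<phi> x\<bar> powr p x + \<bar>\<phi> x\<bar> powr p x) \<partial>M) \<le> (\<integral>\<^sup>+x. ennreal 2 * ?HH x \<partial>M)"
    proof (intro nn_integral_mono)
      fix x assume "x \<in> space M"
      then have x: "x \<in> \<Omega>" by simp
      have "norm (grad \<phi> x) powr p x + \<bar>\<phi> x\<bar> powr p x + \<bar>\<phi> x\<bar> powr p x \<le> 2 * (H x (norm (grad \<phi> x)) + H x \<bar>\<phi> x\<bar>)"
        using \<mu>_nonneg[OF x] by (simp add: double_phase_def)
      then show "ennreal (norm (grad \<phi> x) powr p x + \<bar>\<phi> x\<bar> powr p x + \<bar>\<phi> x\<bar> powr p x) \<le> ennreal 2 * ?HH x"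
        using H_nonneg[OF x] by (simp add: ennreal_mult[symmetric] ennreal_plus[symmetric] ennreal_leI del: ennreal_plus ennreal_numeral)
    qed
    also have "\<dots> = ennreal 2 * (\<integral>\<^sup>+x. ?HH x \<partial>M)" by (rule nn_integral_cmult) measurable
    also have "\<dots> \<le> ennreal 2 * ennreal X" using HH by (intro mult_left_mono) auto
    also have "\<dots> = ennreal (2 * X)" using X(1) by (simp add: ennreal_mult)
    finally have "(\<integral>\<^sup>+x. ennreal (\<bar>\<phi> x\<bar> powr P x) \<partial>M) \<le> ennreal (DA * ((2 * X) powr a + (2 * X) powr b))"
      using X(1) by (intro DA(2)[OF \<phi>]) auto
    also have "\<dots> \<le> ennreal (D1 * (X powr a + X powr b))"
    proof (rule ennreal_leI)
      have "(2::real) powr a \<le> 2 powr b" using ab by (intro powr_mono) auto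
      then have "2 powr a * X powr a + 2 powr b * X powr b \<le> 2 powr b * X powr a + 2 powr b * X powr b"
        by (intro add_mono mult_right_mono) auto
      then show "DA * ((2 * X) powr a + (2 * X) powr b) \<le> D1 * (X powr a + X powr b)"
        using DA(1) X(1) unfolding D1_def mult.assoc by (intro mult_left_mono) (auto simp: powr_mult algebra_simps)
    qed
    finally have PA: "(\<integral>\<^sup>+x. ennreal (\<bar>\<phi> x\<bar> powr P x) \<partial>M) \<le> ennreal (D1 * (X powr a + X powr b))" .
    define X' where "X' = X + D1 * (X powr a + X powr b)"
    have X'0: "0 \<le> X'" using X D1 by (simp add: X'_def)
    have "(\<integral>\<^sup>+x. ennreal (\<mu> x * norm (grad \<phi> x) powr q x + \<mu> x * \<bar>\<phi> x\<bar> powr q x + (\<bar>\<phi> x\<bar> powr p x + \<bar>\<phi> x\<bar> powr P x)) \<partial>M)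
      \<le> (\<integral>\<^sup>+x. ?HH x + ennreal (\<bar>\<phi> x\<bar> powr P x) \<partial>M)"
    proof (intro nn_integral_mono)
      fix x assume "x \<in> space M"
      then have x: "x \<in> \<Omega>" by simp
      have "\<mu> x * norm (grad \<phi> x) powr q x + \<mu> x * \<bar>\<phi> x\<bar> powr q x + (\<bar>\<phi> x\<bar> powr p x + \<bar>\<phi> x\<bar> powr P x)
        \<le> H x (norm (grad \<phi> x)) + H x \<bar>\<phi> x\<bar> + \<bar>\<phi> x\<bar> powr P x"
        by (simp add: double_phase_def)
      then show "ennreal (\<mu> x * norm (grad \<phi> x) powr q x + \<mu> x * \<bar>\<phi> x\<bar> powr q x + (\<bar>\<phi> x\<bar> powr p x + \<bar>\<phi> x\<bar> powr P x))
        \<le> ?HH x + ennreal (\<bar>\<phi> x\<bar> powr P x)"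
        using H_nonneg[OF x] by (simp add: ennreal_plus[symmetric] ennreal_leI del: ennreal_plus)
    qed
    also have "\<dots> = (\<integral>\<^sup>+x. ?HH x \<partial>M) + (\<integral>\<^sup>+x. ennreal (\<bar>\<phi> x\<bar> powr P x) \<partial>M)"
      using Pm by (intro nn_integral_add) measurable
    also have "\<dots> \<le> ennreal X + ennreal (D1 * (X powr a + X powr b))" using HH PA by (rule add_mono)
    also have "\<dots> = ennreal X'" using X(1) D1 by (simp add: X'_def)
    finally have QB: "(\<integral>\<^sup>+x. ennreal ((\<mu> x powr (1 / q x) * \<bar>\<phi> x\<bar>) powr Q x) \<partial>M) \<le> ennreal (DB * (X' powr a + X' powr b))"
      using X'0 by (intro DB(2)[OF \<phi>]) auto
    have e: "X powr t \<le> X powr a + X powr (b * b)" if "a \<le> t" "t \<le> b * b" for t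
      using X(1) that by (rule powr_le_add)
    \<comment> \<open>As 1 < a \<le> b, the middle power is dominated and X' is at most a multiple
      of X + X^b. Powers a and b of this sum only involve exponents between a and b^2.\<close>
    have "X powr a \<le> X powr 1 + X powr b" using X(1) ab by (intro powr_le_add) auto
    then have "X powr a + X powr b \<le> 2 * (X + X powr b)" using X(1) by simp
    then have "D1 * (X powr a + X powr b) \<le> D1 * (2 * (X + X powr b))" using D1 by (intro mult_left_mono) auto
    moreover have "0 \<le> X powr b" by simp
    moreover have "D2 * (X + X powr b) = (X + X powr b) + D1 * (2 * (X + X powr b))"
      by (simp add: D2_def algebra_simps)
    ultimately have X'D: "X' \<le> D2 * (X + X powr b)" unfolding X'_def by linarith
    have pw: "X' powr c \<le> (2 * D2) powr c * (2 * (X powr a + X powr (b * b)))" if c: "c = a \<or> c = b" for c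
    proof -
      have c0: "0 \<le> c" using c ab by auto
      have "X' powr c \<le> (D2 * (X + X powr b)) powr c" using X'D X'0 c0 by (intro powr_mono2)
      also have "\<dots> = D2 powr c * (X + X powr b) powr c" using D2 X(1) by (simp add: powr_mult)
      also have "\<dots> \<le> D2 powr c * (2 powr c * (X powr c + (X powr b) powr c))"
        using X(1) c0 by (intro mult_left_mono powr_add_le_mult) auto
      also have "\<dots> = (2 * D2) powr c * (X powr c + X powr (b * c))"
        using D2 by (simp add: powr_mult powr_powr)
      also have "\<dots> \<le> (2 * D2) powr c * (2 * (X powr a + X powr (b * b)))"
      proof (intro mult_left_mono)
        have "X powr c \<le> X powr a + X powr (b * b)" using c ab aab abb by (intro e) auto
        moreover have "X powr (b * c) \<le> X powr a + X powr (b * b)" using c ab aab abb by (intro e) (auto simp: mult.commute)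
        ultimately have "X powr c + X powr (b * c) \<le> (X powr a + X powr (b * b)) + (X powr a + X powr (b * b))"
          by (rule add_mono)
        then show "X powr c + X powr (b * c) \<le> 2 * (X powr a + X powr (b * b))" by (simp only: mult_2)
      qed auto
      finally show ?thesis .
    qed
    have "DB * (X' powr a + X' powr b) \<le> DB * ((2 * D2) powr a * (2 * (X powr a + X powr (b * b))) + (2 * D2) powr b * (2 * (X powr a + X powr (b * b))))"
      using DB(1) pw by (intro mult_left_mono add_mono) auto
    also have "\<dots> = D3 * (X powr a + X powr (b * b))" by (simp add: D3_def algebra_simps)
    finally have QB': "(\<integral>\<^sup>+x. ennreal ((\<mu> x powr (1 / q x) * \<bar>\<phi> x\<bar>) powr Q x) \<partial>M) \<le> ennreal (D3 * (X powr a + X powr (b * b)))"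
      using QB by (meson ennreal_leI order_trans)
    have "X powr a + X powr b \<le> 2 * (X powr a + X powr (b * b))"
      using e[of b] ab aab abb by (smt (verit) powr_ge_zero)
    then have "D1 * (X powr a + X powr b) \<le> 2 * D1 * (X powr a + X powr (b * b))"
      using D1 by (simp add: mult.assoc) 
    then have PA': "(\<integral>\<^sup>+x. ennreal (\<bar>\<phi> x\<bar> powr P x) \<partial>M) \<le> ennreal (2 * D1 * (X powr a + X powr (b * b)))"
      using PA by (meson ennreal_leI order_trans)
    have "(\<integral>\<^sup>+x. ennreal (PT x \<bar>\<phi> x\<bar>) \<partial>M) = (\<integral>\<^sup>+x. ennreal (\<bar>\<phi> x\<bar> powr P x) + ennreal ((\<mu> x powr (1 / q x) * \<bar>\<phi> x\<bar>) powr Q x) \<partial>M)"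
      by (simp add: PT_def)
    also have "\<dots> = (\<integral>\<^sup>+x. ennreal (\<bar>\<phi> x\<bar> powr P x) \<partial>M) + (\<integral>\<^sup>+x. ennreal ((\<mu> x powr (1 / q x) * \<bar>\<phi> x\<bar>) powr Q x) \<partial>M)"
    proof (rule nn_integral_add)
      show "(\<lambda>x. ennreal (\<bar>\<phi> x\<bar> powr P x)) \<in> borel_measurable M" using Pm by measurable
      have "(\<lambda>x. (\<mu> x powr (1 / q x) * \<bar>\<phi> x\<bar>) powr Q x) \<in> borel_measurable M"
        by (intro powr_real_measurable borel_measurable_times PQ_measurable pq_measurable) measurable
      then show "(\<lambda>x. ennreal ((\<mu> x powr (1 / q x) * \<bar>\<phi> x\<bar>) powr Q x)) \<in> borel_measurable M" by measurable
    qed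
    also have "\<dots> \<le> ennreal (2 * D1 * (X powr a + X powr (b * b))) + ennreal (D3 * (X powr a + X powr (b * b)))"
      using PA' QB' by (rule add_mono)
    also have "\<dots> = ennreal (D * (X powr a + X powr (b * b)))"
      using D1 D3 by (subst ennreal_plus[symmetric]) (auto simp: D_def algebra_simps)
    finally show ?thesis .
  qed
  moreover have "0 < D" using D1 D3 by (simp add: D_def)
  moreover have "a \<le> b * b" using aab ab by linarith
  ultimately show ?thesis using ab(1) by blast
qed

text \<open>Approximating test functions have modulars bounded by a fixed multiple of X as soon as
  the approximation error is below X/2; \<open>gain_test\<close> and Fatou's lemma then give the
  bound for w.\<close>

lemma gain:
  "\<exists>D a b. 0 < D \<and> 1 < a \<and> a \<le> b \<and> (\<forall>w g X. approximable w g \<longrightarrow> 0 \<le> X \<longrightarrow>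
    \<rho> (\<lambda>x. norm (g x)) + \<rho> w \<le> ennreal X \<longrightarrow>
    (\<integral>\<^sup>+x. ennreal (PT x \<bar>w x\<bar>) \<partial>M) \<le> ennreal (D * (X powr a + X powr b)))"
proof -
  obtain D a b where D: "0 < D" "1 < a" "a \<le> b" and t: "\<And>\<phi> X. \<phi> \<in> test_functions \<Omega> \<Longrightarrow> 0 \<le> X \<Longrightarrow>
    \<rho> (\<lambda>x. norm (grad \<phi> x)) + \<rho> \<phi> \<le> ennreal X \<Longrightarrow> (\<integral>\<^sup>+x. ennreal (PT x \<bar>\<phi> x\<bar>) \<partial>M) \<le> ennreal (D * (X powr a + X powr b))"
    using gain_test by blast
  define L where "L = 2 powr qM * 2"
  have L: "1 < L" using powr_mono[of 0 qM 2] qM by (simp add: L_def)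
  define D' where "D' = D * L powr b"
  have main: "(\<integral>\<^sup>+x. ennreal (PT x \<bar>w x\<bar>) \<partial>M) \<le> ennreal (D' * (X powr a + X powr b))"
    if a: "approximable w g" and X: "0 < X" "\<rho> (\<lambda>x. norm (g x)) + \<rho> w \<le> ennreal X" for w g X
  proof -
    have [measurable]: "w \<in> borel_measurable M" "g \<in> borel_measurable M" using a by (auto simp: approximable_def)
    obtain \<phi> where f: "fast_seq w g \<phi>" using approximable_seq[OF a] by blast
    note \<phi> = fast_seqD[OF a f]
    note [measurable] = test_measurable[OF \<phi>(1)]
    obtain s :: "nat \<Rightarrow> nat" where s: "strict_mono s" "AE x in M. (\<lambda>n. \<phi> (s n) x) \<longlonglongrightarrow> w x"
      using fast_seq_AE_subseq[OF a f] by blast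
    have "\<forall>\<^sub>F n in sequentially. (1 / real (Suc n)) powr qM < X / 2"
    proof (rule order_tendstoD(2))
      have "(\<lambda>n. (1 / real (Suc n)) powr qM) \<longlonglongrightarrow> 0 powr qM"
        by (intro tendsto_powr2 tendsto_const) (use LIMSEQ_Suc[OF lim_1_over_n] qM in auto)
      then show "(\<lambda>n. (1 / real (Suc n)) powr qM) \<longlonglongrightarrow> 0" by simp
    qed (use X in simp)
    then obtain n0 where n0: "\<And>n. n \<ge> n0 \<Longrightarrow> (1 / real (Suc n)) powr qM < X / 2"
      unfolding eventually_sequentially by blast
    have le: "(\<integral>\<^sup>+x. ennreal (PT x \<bar>\<phi> i x\<bar>) \<partial>M) \<le> ennreal (D' * (X powr a + X powr b))" if i: "i \<ge> n0" for i
    proof -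
      let ?d = "(1 / real (Suc i)) powr qM"
      have "\<rho> (\<phi> i) \<le> ennreal (2 powr qM) * (\<rho> w + \<rho> (\<lambda>x. w x - \<phi> i x))"
        by (rule modular_add_le) auto
      also have "\<dots> \<le> ennreal (2 powr qM) * (\<rho> w + ennreal ?d)" using \<phi>(2) by (intro mult_left_mono add_mono) auto
      finally have 1: "\<rho> (\<phi> i) \<le> ennreal (2 powr qM) * (\<rho> w + ennreal ?d)" .
      have "\<rho> (\<lambda>x. norm (grad (\<phi> i) x)) \<le> ennreal (2 powr qM) * (\<rho> (\<lambda>x. norm (g x)) + \<rho> (\<lambda>x. norm (g x - grad (\<phi> i) x)))"
      proof (rule modular_add_le)
        fix x
        show "\<bar>norm (grad (\<phi> i) x)\<bar> \<le> \<bar>norm (g x)\<bar> + \<bar>norm (g x - grad (\<phi> i) x)\<bar>"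
          using norm_triangle_ineq4[of "g x" "g x - grad (\<phi> i) x"] by simp
      qed measurable
      also have "\<dots> \<le> ennreal (2 powr qM) * (\<rho> (\<lambda>x. norm (g x)) + ennreal ?d)" using \<phi>(3) by (intro mult_left_mono add_mono) auto
      finally have "\<rho> (\<lambda>x. norm (grad (\<phi> i) x)) + \<rho> (\<phi> i)
        \<le> ennreal (2 powr qM) * (\<rho> (\<lambda>x. norm (g x)) + ennreal ?d) + ennreal (2 powr qM) * (\<rho> w + ennreal ?d)"
        using 1 by (rule add_mono)
      also have "\<dots> = ennreal (2 powr qM) * ((\<rho> (\<lambda>x. norm (g x)) + \<rho> w) + (ennreal ?d + ennreal ?d))"
        by (simp add: distrib_left ac_simps)
      also have "\<dots> \<le> ennreal (2 powr qM) * (ennreal X + ennreal X)"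
      proof (intro mult_left_mono add_mono X)
        have "ennreal ?d + ennreal ?d = ennreal (?d + ?d)" by (subst ennreal_plus[symmetric]) auto
        also have "\<dots> \<le> ennreal X" using n0[OF i] by (intro ennreal_leI) linarith
        finally show "ennreal ?d + ennreal ?d \<le> ennreal X" .
      qed auto
      also have "\<dots> = ennreal (L * X)"
        using X(1) by (simp add: L_def ennreal_mult[symmetric] ennreal_plus[symmetric] del: ennreal_plus)
      finally have "(\<integral>\<^sup>+x. ennreal (PT x \<bar>\<phi> i x\<bar>) \<partial>M) \<le> ennreal (D * ((L * X) powr a + (L * X) powr b))"
        using X L by (intro t[OF \<phi>(1)]) auto
      also have "\<dots> \<le> ennreal (D' * (X powr a + X powr b))"
      proof (rule ennreal_leI)
        have "L powr a * X powr a + L powr b * X powr b \<le> L powr b * X powr a + L powr b * X powr b"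
          using D L by (intro add_mono mult_right_mono powr_mono) auto
        then have "D * (L powr a * X powr a + L powr b * X powr b) \<le> D * (L powr b * X powr a + L powr b * X powr b)"
          using D by (intro mult_left_mono) auto
        then show "D * ((L * X) powr a + (L * X) powr b) \<le> D' * (X powr a + X powr b)"
          using L X by (simp add: D'_def powr_mult algebra_simps)
      qed
      finally show ?thesis .
    qed
    show ?thesis
    proof (rule nn_integral_le_if_AE_LIMSEQ)
      show "(\<lambda>x. PT x \<bar>\<phi> (s (n + n0)) x\<bar>) \<in> borel_measurable M" for n by measurable
      show "(\<integral>\<^sup>+x. ennreal (PT x \<bar>\<phi> (s (n + n0)) x\<bar>) \<partial>M) \<le> ennreal (D' * (X powr a + X powr b))" for n
        using le seq_suble[OF s(1), of "n + n0"] by simp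
      show "AE x in M. (\<lambda>n. PT x \<bar>\<phi> (s (n + n0)) x\<bar>) \<longlonglongrightarrow> PT x \<bar>w x\<bar>"
        using s(2) AE_space
      proof eventually_elim
        case (elim x)
        then show ?case using PT_tendsto[of x "\<lambda>n. \<phi> (s (n + n0)) x" "w x"] LIMSEQ_ignore_initial_segment[of "\<lambda>n. \<phi> (s n) x"] by simp
      qed
    qed
  qed
  have D': "0 < D'" using D L by (simp add: D'_def)
  have "(\<integral>\<^sup>+x. ennreal (PT x \<bar>w x\<bar>) \<partial>M) \<le> ennreal (D' * (X powr a + X powr b))"
    if a: "approximable w g" and X: "0 \<le> X" "\<rho> (\<lambda>x. norm (g x)) + \<rho> w \<le> ennreal X" for w g X
  \<comment> \<open>For X = 0 no approximation error fits below X/2; but then the modular of w is 0,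
    and w vanishes a.e.\<close>
  proof (cases "X = 0")
    case True
    have [measurable]: "w \<in> borel_measurable M" using a by (auto simp: approximable_def)
    have "\<rho> w = 0" using X True by simp
    then have "AE x in M. ennreal (H x \<bar>w x\<bar>) = 0" unfolding modular_def by (subst (asm) nn_integral_0_iff_AE) auto
    then have "AE x in M. ennreal (PT x \<bar>w x\<bar>) = 0" using AE_space
    proof eventually_elim
      case (elim x)
      then have x: "x \<in> \<Omega>" by simp
      from elim have "H x \<bar>w x\<bar> \<le> 0" by (simp add: ennreal_eq_0_iff)
      moreover have "0 \<le> \<mu> x * \<bar>w x\<bar> powr q x" using \<mu>_nonneg[OF x] by simp
      ultimately have "\<bar>w x\<bar> powr p x \<le> 0" unfolding double_phase_def by linarith
      then have "w x = 0" by simp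
      then show ?case by simp
    qed
    then have "(\<integral>\<^sup>+x. ennreal (PT x \<bar>w x\<bar>) \<partial>M) = 0" by (subst nn_integral_0_iff_AE) auto
    then show ?thesis by simp
  next
    case False
    then show ?thesis using main[OF a _ X(2)] X(1) by simp
  qed
  then show ?thesis using D' D(2,3) by blast
qed

end

subsection \<open>Truncations\<close>

text \<open>A smooth version of the indicator of \<open>k < \<bar>t\<bar>\<close>; the cut-off at \<open>k + 1 + j\<close> makes the growth
  condition on \<open>A\<close> useful, since that one is critical in \<open>t\<close>.\<close>

definition trunc' :: "real \<Rightarrow> nat \<Rightarrow> real \<Rightarrow> real" where
  "trunc' k j t = bump k (k + 1 + real j) j t + bump k (k + 1 + real j) j (- t)"

lemma D_k_trunc': "D_k n (trunc' k j)"
  using D_k_add[OF D_k_bump D_k_affine[OF D_k_bump, of n _ _ _ "-1" 0]] unfolding trunc'_def by simp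

lemma trunc'_even: "trunc' k j (- t) = trunc' k j t"
  by (simp add: trunc'_def)

lemma trunc'_eq_0: "0 < k \<Longrightarrow> \<bar>t\<bar> \<le> k \<or> k + 1 + real j \<le> \<bar>t\<bar> \<Longrightarrow> trunc' k j t = 0"
  unfolding trunc'_def by (subst (1 2) bump_eq_0) auto

lemma trunc'_bounds:
  assumes "0 < k"
  shows "0 \<le> trunc' k j t" "trunc' k j t \<le> 1"
proof -
  show "0 \<le> trunc' k j t" unfolding trunc'_def using bump_bounds(1) by (intro add_nonneg_nonneg)
  have "bump k (k + 1 + real j) j t = 0 \<or> bump k (k + 1 + real j) j (- t) = 0"
    using assms bump_eq_0[of t k] bump_eq_0[of "-t" k] by (cases "0 \<le> t") auto
  then show "trunc' k j t \<le> 1" unfolding trunc'_def using bump_bounds(2) by auto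
qed

lemma trunc'_tendsto:
  assumes "0 < k"
  shows "(\<lambda>j. trunc' k j t) \<longlonglongrightarrow> (if k < \<bar>t\<bar> then 1 else 0)"
proof -
  have b: "(\<lambda>j. bump k (k + 1 + real j) j t) \<longlonglongrightarrow> (if k < t then 1 else 0)" for t
    using bump_tendsto_at_top[of k t "k + 1"] by (auto simp: bump_eq_0)
  have "(\<lambda>j. trunc' k j t) \<longlonglongrightarrow> (if k < t then 1 else 0) + (if k < - t then 1 else 0)"
    unfolding trunc'_def by (intro tendsto_add b)
  moreover have "(if k < t then 1 else 0) + (if k < - t then 1 else 0) = (if k < \<bar>t\<bar> then 1 else (0::real))"
    using assms by auto
  ultimately show ?thesis by simp
qed

lemma trunc_exists: "\<exists>G. G 0 = 0 \<and> (\<forall>t. (G has_real_derivative trunc' k j t) (at t))"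
proof -
  have "isCont (trunc' k j) t" for t
    using D_k_continuous[OF D_k_trunc'[of 0]] by (simp add: continuous_on_eq_continuous_at)
  then obtain F where F: "\<And>t. (F has_vector_derivative trunc' k j t) (at t)"
    using einterval_antiderivative[of "-\<infinity>" \<infinity> "trunc' k j"] by auto
  then have "((\<lambda>t. F t - F 0) has_real_derivative trunc' k j t) (at t)" for t
    using DERIV_diff[OF F[of t, unfolded has_real_derivative_iff_has_vector_derivative[symmetric]] DERIV_const] by simp
  then show ?thesis by (intro exI[of _ "\<lambda>t. F t - F 0"]) auto
qed

text \<open>A smooth odd substitute for sign(t) times the positive part of |t| - k. The
  normalisation at 0 makes compositions with test functions compactly supported.\<close>

definition trunc :: "real \<Rightarrow> nat \<Rightarrow> real \<Rightarrow> real" where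
  "trunc k j = (SOME G. G 0 = 0 \<and> (\<forall>t. (G has_real_derivative trunc' k j t) (at t)))"

lemma trunc: "trunc k j 0 = 0" "(trunc k j has_real_derivative trunc' k j t) (at t)"
  using someI_ex[OF trunc_exists[of k j]] unfolding trunc_def by blast+

lemma D_k_trunc: "D_k n (trunc k j)"
proof (cases n)
  case 0
  then show ?thesis using has_real_derivative_continuous_on[OF trunc(2)] by simp
next
  case (Suc m)
  then show ?thesis using D_k_SucI[OF trunc(2) D_k_trunc'] by simp
qed

lemma trunc_odd: "trunc k j (- t) = - trunc k j t"
proof -
  have "((\<lambda>t. trunc k j t + trunc k j (- t)) has_real_derivative 0) (at t)" for t
  proof -
    have m: "((\<lambda>t. - t) has_real_derivative - 1) (at t)" by (auto intro!: derivative_eq_intros)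
    from DERIV_chain2[where f="trunc k j", OF trunc(2) m]
    have "((\<lambda>t. trunc k j (- t)) has_real_derivative trunc' k j (- t) * - 1) (at t)" .
    from DERIV_add[OF trunc(2)[of k j t] this] show ?thesis by (simp add: trunc'_even)
  qed
  then have "trunc k j t + trunc k j (- t) = trunc k j 0 + trunc k j (- 0)"
    by (intro DERIV_isconst_all) auto
  then show ?thesis by (simp add: trunc(1))
qed

lemma trunc_nonneg_eq_integral:
  assumes "0 \<le> t"
  shows "trunc k j t = (LINT s|lebesgue_on {0..t}. trunc' k j s)"
proof -
  have "(trunc' k j has_integral trunc k j t - trunc k j 0) {0..t}"
    using assms trunc(2) by (intro fundamental_theorem_of_calculus)
      (auto simp: has_real_derivative_iff_has_vector_derivative[symmetric] intro: DERIV_subset)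
  moreover have "integrable (lebesgue_on {0..t}) (trunc' k j)"
    using D_k_continuous[OF D_k_trunc'[of 0]] by (intro integrable_continuous_real continuous_imp_integrable_real) (auto intro: continuous_on_subset)
  ultimately show ?thesis by (simp add: trunc(1) lebesgue_integral_eq_integral integral_unique)
qed

lemma trunc_tendsto_nonneg:
  assumes k: "0 < k" and t: "0 \<le> t"
  shows "(\<lambda>j. trunc k j t) \<longlonglongrightarrow> max 0 (t - k)"
proof -
  have "(\<lambda>j. LINT s|lebesgue_on {0..t}. trunc' k j s) \<longlonglongrightarrow> (LINT s|lebesgue_on {0..t}. (if k < \<bar>s\<bar> then 1 else 0))"
  proof (rule integral_dominated_convergence[where w="\<lambda>_. 1"])
    show "trunc' k j \<in> borel_measurable (lebesgue_on {0..t})" for j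
      by (intro continuous_imp_measurable_on_sets_lebesgue)
        (auto intro: continuous_on_subset[OF D_k_continuous[OF D_k_trunc'[of 0]]])
    show "AE x in lebesgue_on {0..t}. norm (trunc' k j x) \<le> 1" for j using trunc'_bounds[OF k] by auto
    show "AE x in lebesgue_on {0..t}. (\<lambda>j. trunc' k j x) \<longlonglongrightarrow> (if k < \<bar>x\<bar> then 1 else 0)" using trunc'_tendsto[OF k] by auto
    show "integrable (lebesgue_on {0..t}) (\<lambda>_. 1 :: real)"
      using continuous_imp_integrable_real[of 0 t "\<lambda>_. 1 :: real"] by simp
    show "(\<lambda>x. if k < \<bar>x\<bar> then 1 else (0::real)) \<in> borel_measurable (lebesgue_on {0..t})"
      by (intro measurable_restrict_space1 measurable_completion) measurable
  qed
  moreover have "(LINT s|lebesgue_on {0..t}. (if k < \<bar>s\<bar> then 1 else (0::real))) = max 0 (t - k)"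
  proof -
    have "(LINT s|lebesgue_on {0..t}. (if k < \<bar>s\<bar> then 1 else (0::real))) = (LINT s|lborel. indicator {k<..t} s)"
    proof -
      have "(LINT s|lebesgue_on {0..t}. (if k < \<bar>s\<bar> then 1 else (0::real))) = (LINT s|lebesgue. indicator {0..t} s *\<^sub>R (if k < \<bar>s\<bar> then 1 else (0::real)))"
        by (intro integral_restrict_space) auto
      also have "(\<lambda>s. indicator {0..t} s *\<^sub>R (if k < \<bar>s\<bar> then 1 else (0::real))) = indicator {k<..t}"
        using k by (auto simp: fun_eq_iff indicator_def)
      also have "(LINT s|lebesgue. indicator {k<..t} s) = (LINT s|lborel. (indicator {k<..t} s :: real))"
        by (intro integral_completion) auto
      finally show ?thesis .
    qed
    also have "\<dots> = max 0 (t - k)"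
      by (cases "k \<le> t") (auto simp: measure_def emeasure_lborel_Ioc)
    finally show ?thesis .
  qed
  ultimately show ?thesis using trunc_nonneg_eq_integral[OF t] by simp
qed

text \<open>The derivative vanishes up to k and lies between 0 and 1 beyond.\<close>

lemma trunc_bounds_nonneg:
  assumes k: "0 < k" and t: "0 \<le> t"
  shows "0 \<le> trunc k j t" "trunc k j t \<le> max 0 (t - k)"
proof -
  show "0 \<le> trunc k j t"
    using DERIV_nonneg_imp_nondecreasing[of 0 t "trunc k j"] t trunc trunc'_bounds(1)[OF k] by fastforce
  have c: "trunc k j s = 0" if "0 \<le> s" "s \<le> k" for s
  proof -
    have "trunc k j s - trunc k j 0 = integral {0..s} (trunc' k j)"
    proof -
      have "(trunc' k j has_integral trunc k j s - trunc k j 0) {0..s}"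
        using that trunc(2) by (intro fundamental_theorem_of_calculus)
          (auto simp: has_real_derivative_iff_has_vector_derivative[symmetric] intro: DERIV_subset)
      then show ?thesis by (simp add: integral_unique)
    qed
    also have "\<dots> = integral {0..s} (\<lambda>_. 0)" using that k by (intro integral_cong trunc'_eq_0) auto
    finally show ?thesis by (simp add: trunc(1))
  qed
  show "trunc k j t \<le> max 0 (t - k)"
  proof (cases "t \<le> k")
    case True
    then show ?thesis using c[OF t] by simp
  next
    case False
    have "\<bar>trunc k j t - trunc k j k\<bar> \<le> 1 * \<bar>t - k\<bar>"
      using field_differentiable_bound[of UNIV "trunc k j" "trunc' k j" 1 t k] trunc(2) trunc'_bounds[OF k]
      by (auto simp: abs_le_iff)
    then show ?thesis using False c[of k] k by auto
  qed
qed

lemma trunc_abs: "0 < k \<Longrightarrow> \<bar>trunc k j t\<bar> = trunc k j \<bar>t\<bar>"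
  using trunc_bounds_nonneg(1)[of k "\<bar>t\<bar>" j] trunc_odd[of k j t] by (cases "0 \<le> t") auto

lemma trunc_abs_le: "0 < k \<Longrightarrow> \<bar>trunc k j t\<bar> \<le> max 0 (\<bar>t\<bar> - k)"
  using trunc_bounds_nonneg(2)[of k "\<bar>t\<bar>" j] trunc_abs[of k j t] by simp

lemma trunc_abs_tendsto: "0 < k \<Longrightarrow> (\<lambda>j. \<bar>trunc k j t\<bar>) \<longlonglongrightarrow> max 0 (\<bar>t\<bar> - k)"
  using trunc_tendsto_nonneg[of k "\<bar>t\<bar>"] by (simp add: trunc_abs)

text \<open>The pair (u, g) is a limit of simple functions, for which measurability of F in x alone
  is enough. Continuity in (t, \<xi>) passes to the limit off a null set, and completeness of
  Lebesgue measure disposes of that set.\<close>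

lemma caratheodory_measurable:
  fixes F :: "real ^ 'n \<Rightarrow> real \<Rightarrow> real ^ 'n \<Rightarrow> 'b::euclidean_space"
  assumes F: "caratheodory \<Omega> F" and \<Omega>: "\<Omega> \<in> sets lebesgue"
    and u: "u \<in> borel_measurable (lebesgue_on \<Omega>)" and g: "g \<in> borel_measurable (lebesgue_on \<Omega>)"
  shows "(\<lambda>x. F x (u x) (g x)) \<in> borel_measurable (lebesgue_on \<Omega>)"
proof -
  let ?M = "lebesgue_on \<Omega>"
  have z: "(\<lambda>x. (u x, g x)) \<in> borel_measurable ?M" using u g by (rule borel_measurable_Pair)
  obtain s where s: "\<And>i. simple_function ?M (s i)" "\<And>x. x \<in> space ?M \<Longrightarrow> (\<lambda>i. s i x) \<longlonglongrightarrow> (u x, g x)"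
    using borel_measurable_implies_sequence_metric[OF z, of 0] by blast
  have Fs: "(\<lambda>x. F x (fst (s i x)) (snd (s i x))) \<in> borel_measurable ?M" for i
  proof (rule measurable_compose_countable'[where f="\<lambda>c x. F x (fst c) (snd c)" and I="s i ` space ?M"])
    show "(\<lambda>x. F x (fst c) (snd c)) \<in> borel_measurable ?M" for c using F by (simp add: caratheodory_def)
    have fin: "finite (s i ` space ?M)" using s(1) by (rule simple_functionD)
    then show "countable (s i ` space ?M)" by (rule countable_finite)
    show "s i \<in> ?M \<rightarrow>\<^sub>M count_space (s i ` space ?M)"
      using fin simple_functionD(2)[OF s(1), of i] by (subst measurable_count_space_eq2) auto
  qed
  obtain N0 where N0: "{x \<in> space ?M. \<not> continuous_on UNIV (\<lambda>(t, \<xi>). F x t \<xi>)} \<subseteq> N0" "N0 \<in> null_sets ?M"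
    using F unfolding caratheodory_def eventually_ae_filter by blast
  then have N0s: "N0 \<in> sets ?M" by auto
  have "(\<lambda>x. if x \<in> N0 then 0 else F x (u x) (g x)) \<in> borel_measurable ?M"
  proof (rule borel_measurable_LIMSEQ_metric)
    show "(\<lambda>x. if x \<in> N0 then 0 else F x (fst (s i x)) (snd (s i x))) \<in> borel_measurable ?M" for i
      using N0s Fs by measurable
    fix x assume x: "x \<in> space ?M"
    show "(\<lambda>i. if x \<in> N0 then 0 else F x (fst (s i x)) (snd (s i x))) \<longlonglongrightarrow> (if x \<in> N0 then 0 else F x (u x) (g x))"
    proof (cases "x \<in> N0")
      case False
      then have c: "continuous_on UNIV (\<lambda>(t, \<xi>). F x t \<xi>)" using N0(1) x by blast
      have "((\<lambda>(t, \<xi>). F x t \<xi>) \<longlongrightarrow> (case (u x, g x) of (t, \<xi>) \<Rightarrow> F x t \<xi>)) (nhds (u x, g x))"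
        using c by (simp add: continuous_on_eq_continuous_at isCont_def tendsto_at_iff_tendsto_nhds)
      from filterlim_compose[OF this s(2)[OF x]] show ?thesis using False by (simp add: case_prod_unfold)
    qed simp
  qed
  then have "(\<lambda>x. if x \<in> \<Omega> then (if x \<in> N0 then 0 else F x (u x) (g x)) else 0) \<in> borel_measurable lebesgue"
    using \<Omega> by (rule borel_measurable_if_I)
  moreover have "AE x in lebesgue. (if x \<in> \<Omega> then (if x \<in> N0 then 0 else F x (u x) (g x)) else 0) = (if x \<in> \<Omega> then F x (u x) (g x) else 0)"
  proof -
    have "N0 \<in> null_sets lebesgue" using N0(2) \<Omega> null_sets_restrict_space by blast
    from AE_not_in[OF this] show ?thesis by eventually_elim simp
  qed
  ultimately have "(\<lambda>x. if x \<in> \<Omega> then F x (u x) (g x) else 0) \<in> borel_measurable lebesgue"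
    by (rule borel_measurable_AE)
  then show ?thesis by (rule borel_measurable_if_D)
qed

subsection \<open>The energy estimate\<close>

lemma powr_le_max_powr:
  fixes t T e e' :: real
  assumes "0 \<le> t" "t \<le> T" "0 \<le> e" "e \<le> e'"
  shows "t powr e \<le> max 1 T powr e'"
proof -
  have "t powr e \<le> max 1 T powr e" using assms by (intro powr_mono2) auto
  also have "\<dots> \<le> max 1 T powr e'" using assms by (intro powr_mono) auto
  finally show ?thesis .
qed

lemma powr_minus_1_mult: "0 \<le> (t::real) \<Longrightarrow> t powr (e - 1) * t = t powr e"
  by (cases "t = 0") (auto simp: powr_diff)

lemma powr_le_1_add:
  fixes t a e :: real
  assumes "0 \<le> t" "0 \<le> a" "a \<le> e"
  shows "t powr a \<le> 1 + t powr e"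
proof -
  have "t powr a \<le> t powr 0 + t powr e" using assms by (intro powr_le_add)
  also have "\<dots> \<le> 1 + t powr e" by auto
  finally show ?thesis .
qed

text \<open>Strict subcriticality of r and s enters as \<theta>2 < 1. Two-sided bounds on r/P and
  s/Q allow \<Psi> to be compared with two fixed powers of \<open>PT\<close> instead of one that
  depends on x.\<close>

locale double_phase_problem =
  double_phase_exponents \<Omega> p q \<mu> qM \<mu>M Lp Lq L\<mu> \<kappa> \<eta>
  for \<Omega> :: "(real ^ 'n) set" and p q \<mu> and qM \<mu>M Lp Lq L\<mu> \<kappa> \<eta> :: real +
  fixes r s :: "real ^ 'n \<Rightarrow> real"
    and A :: "real ^ 'n \<Rightarrow> real \<Rightarrow> real ^ 'n \<Rightarrow> real ^ 'n"
    and B :: "real ^ 'n \<Rightarrow> real \<Rightarrow> real ^ 'n \<Rightarrow> real"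
    and \<alpha>1 \<alpha>2 \<alpha>3 \<beta> \<theta>1 \<theta>2 rM :: real
  assumes rs_cont: "continuous_on \<Omega> r" "continuous_on \<Omega> s"
    and r_gt: "x \<in> \<Omega> \<Longrightarrow> p x < r x" and s_gt: "x \<in> \<Omega> \<Longrightarrow> q x < s x"
    and rM: "x \<in> \<Omega> \<Longrightarrow> r x \<le> rM" "x \<in> \<Omega> \<Longrightarrow> s x \<le> rM"
    and \<theta>: "0 < \<theta>1" "\<theta>1 \<le> \<theta>2" "\<theta>2 < 1"
    and r\<theta>: "x \<in> \<Omega> \<Longrightarrow> \<theta>1 * P x \<le> r x" "x \<in> \<Omega> \<Longrightarrow> r x \<le> \<theta>2 * P x"
    and s\<theta>: "x \<in> \<Omega> \<Longrightarrow> \<theta>1 * Q x \<le> s x" "x \<in> \<Omega> \<Longrightarrow> s x \<le> \<theta>2 * Q x"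
    and coeff_pos: "0 < \<alpha>1" "0 < \<alpha>2" "0 < \<alpha>3" "0 < \<beta>"
    and car: "caratheodory \<Omega> A" "caratheodory \<Omega> B"
    and A_growth: "AE x in lebesgue_on \<Omega>. \<forall>t \<xi>.
      norm (A x t \<xi>) \<le> \<alpha>1 *
        (\<bar>t\<bar> powr (crit_exp p x / conj_exp p x)
         + \<mu> x powr ((real CARD('n) - 1) / (real CARD('n) - q x))
             * \<bar>t\<bar> powr (crit_exp q x / conj_exp q x)
         + norm \<xi> powr (p x - 1) + \<mu> x * norm \<xi> powr (q x - 1) + 1)"
    and A_coercive: "AE x in lebesgue_on \<Omega>. \<forall>t \<xi>.
      A x t \<xi> \<bullet> \<xi> \<ge> \<alpha>2 * (norm \<xi> powr p x + \<mu> x * norm \<xi> powr q x)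
        - \<alpha>3 * (\<bar>t\<bar> powr r x + \<mu> x powr (s x / q x) * \<bar>t\<bar> powr s x + 1)"
    and B_growth: "AE x in lebesgue_on \<Omega>. \<forall>t \<xi>.
      \<bar>B x t \<xi>\<bar> \<le> \<beta> *
        (\<bar>t\<bar> powr (r x - 1) + \<mu> x powr (s x / q x) * \<bar>t\<bar> powr (s x - 1)
         + norm \<xi> powr (p x / conj_exp r x)
         + \<mu> x powr (1 / q x + 1 / conj_exp s x) * norm \<xi> powr (q x / conj_exp s x) + 1)"
begin

section \<open>The function \<Psi> and the lower order term\<close>

abbreviation "\<Psi> \<equiv> double_phase_sub q \<mu> r s"

lemma rs_measurable: "r \<in> borel_measurable M" "s \<in> borel_measurable M"
  using rs_cont by (auto intro: cont_measurable)

lemma rs_gt_1: "x \<in> \<Omega> \<Longrightarrow> 1 < r x" "x \<in> \<Omega> \<Longrightarrow> 1 < s x"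
  using r_gt[of x] s_gt[of x] p_bounds[of x] q_bounds[of x] by auto

lemma rM_gt_1: "1 < rM"
  using nonempty rs_gt_1(1) rM(1) by fastforce

lemma \<Psi>_eq:
  assumes "x \<in> \<Omega>" "0 \<le> t"
  shows "\<Psi> x t = t powr r x + (\<mu> x powr (1 / q x) * t) powr s x"
  using assms \<mu>_nonneg[OF assms(1)] by (simp add: double_phase_sub_def powr_mult powr_powr)

lemma \<Psi>_nonneg: "0 \<le> \<Psi> x t"
  by (simp add: double_phase_sub_def)

lemma \<Psi>_zero [simp]: "\<Psi> x 0 = 0"
  by (simp add: double_phase_sub_def)

lemma \<Psi>_measurable [measurable]: "f \<in> borel_measurable M \<Longrightarrow> (\<lambda>x. \<Psi> x (f x)) \<in> borel_measurable M"
  unfolding double_phase_sub_def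
  by (intro borel_measurable_add borel_measurable_times powr_real_measurable borel_measurable_divide
      pq_measurable rs_measurable)

lemma \<Psi>_mono:
  assumes "x \<in> \<Omega>" "0 \<le> a" "a \<le> b"
  shows "\<Psi> x a \<le> \<Psi> x b"
  unfolding double_phase_sub_def using assms rs_gt_1[OF assms(1)]
  by (intro add_mono mult_left_mono powr_mono2) auto

lemma \<Psi>_scale_le:
  assumes "x \<in> \<Omega>" "0 \<le> c" "c \<le> 1" "0 \<le> t"
  shows "\<Psi> x (c * t) \<le> c * \<Psi> x t"
proof -
  have "c powr r x \<le> c powr 1" "c powr s x \<le> c powr 1"
    using assms rs_gt_1[OF assms(1)] by (intro powr_mono'; simp)+
  then have "c powr r x * t powr r x + \<mu> x powr (s x / q x) * (c powr s x * t powr s x)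
      \<le> c * t powr r x + \<mu> x powr (s x / q x) * (c * t powr s x)"
    using assms by (intro add_mono mult_left_mono mult_right_mono) auto
  then show ?thesis using assms by (simp add: double_phase_sub_def powr_mult algebra_simps)
qed

lemma \<Psi>_scale_ge:
  assumes "x \<in> \<Omega>" "1 \<le> c" "0 \<le> t"
  shows "\<Psi> x (c * t) \<le> c powr rM * \<Psi> x t"
proof -
  have "c powr r x \<le> c powr rM" "c powr s x \<le> c powr rM"
    using assms rM[OF assms(1)] by (auto intro!: powr_mono)
  then have "c powr r x * t powr r x + \<mu> x powr (s x / q x) * (c powr s x * t powr s x)
      \<le> c powr rM * t powr r x + \<mu> x powr (s x / q x) * (c powr rM * t powr s x)"
    using assms by (intro add_mono mult_left_mono mult_right_mono) auto
  then show ?thesis using assms by (simp add: double_phase_sub_def powr_mult algebra_simps)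
qed

text \<open>Each summand of \<Psi> is a power of the corresponding summand of \<open>PT\<close>,
  with exponent r/P or s/Q between \<theta>1 and \<theta>2.\<close>

lemma \<Psi>_le_PT:
  assumes x: "x \<in> \<Omega>" and t: "0 \<le> t"
  shows "\<Psi> x t \<le> 2 * (PT x t powr \<theta>1 + PT x t powr \<theta>2)"
proof -
  have PQ: "0 < P x" "0 < Q x" using p_less_P[OF x] q_less_Q[OF x] p_bounds[OF x] q_bounds[OF x] by auto
  have le: "y powr e \<le> PT x t powr \<theta>1 + PT x t powr \<theta>2"
    if y: "0 \<le> y" and R: "0 < R" "y powr R \<le> PT x t" "\<theta>1 * R \<le> e" "e \<le> \<theta>2 * R" for y e R
  proof -
    have "y powr e = (y powr R) powr (e / R)" using R by (simp add: powr_powr)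
    also have "\<dots> \<le> (y powr R) powr \<theta>1 + (y powr R) powr \<theta>2"
      using R by (intro powr_le_add) (auto simp: field_simps)
    also have "\<dots> \<le> PT x t powr \<theta>1 + PT x t powr \<theta>2" using R \<theta> by (intro add_mono powr_mono2) auto
    finally show ?thesis .
  qed
  have "t powr r x \<le> PT x t powr \<theta>1 + PT x t powr \<theta>2"
    using r\<theta>[OF x] by (intro le[OF t PQ(1)]) (auto simp: PT_def)
  moreover have "(\<mu> x powr (1 / q x) * t) powr s x \<le> PT x t powr \<theta>1 + PT x t powr \<theta>2"
    using s\<theta>[OF x] t by (intro le[OF _ PQ(2)]) (auto simp: PT_def)
  ultimately show ?thesis by (simp add: \<Psi>_eq[OF x t])
qed

lemma \<Psi>_le_1_PT:
  assumes x: "x \<in> \<Omega>" and t: "0 \<le> t"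
  shows "\<Psi> x t \<le> 4 * (1 + PT x t)"
proof -
  have "PT x t powr \<theta>1 \<le> 1 + PT x t powr 1" "PT x t powr \<theta>2 \<le> 1 + PT x t powr 1"
    using \<theta> PT_nonneg[of x t] by (intro powr_le_1_add; simp)+
  then show ?thesis using \<Psi>_le_PT[OF x t] PT_nonneg[of x t] by simp
qed

lemma H_le_\<Psi>:
  assumes x: "x \<in> \<Omega>" and t: "0 \<le> t"
  shows "H x t \<le> 2 + \<Psi> x t"
proof -
  have "t powr p x \<le> 1 + t powr r x" using t p_bounds[OF x] r_gt[OF x] by (intro powr_le_1_add) auto
  moreover have "\<mu> x * t powr q x = (\<mu> x powr (1 / q x) * t) powr q x"
    using t q_bounds[OF x] \<mu>_nonneg[OF x] by (simp add: powr_mult powr_powr)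
  moreover have "(\<mu> x powr (1 / q x) * t) powr q x \<le> 1 + (\<mu> x powr (1 / q x) * t) powr s x"
    using t q_bounds[OF x] s_gt[OF x] by (intro powr_le_1_add) auto
  ultimately show ?thesis by (simp add: \<Psi>_eq[OF x t] double_phase_def)
qed

text \<open>The gradient terms are products suited to Young's inequality with the pairs r, r' and s,
  s'. The weight divides accordingly: \<mu>^(1/q) joins |t| and \<mu>^(1/s') joins the power of
  \<xi>, which explains its exponent in the growth condition.\<close>

lemma B_bound:
  assumes x: "x \<in> \<Omega>" and \<epsilon>: "0 < \<epsilon>" "\<epsilon> \<le> 1" and \<xi>: "0 \<le> \<xi>"
  shows "(\<bar>t\<bar> powr (r x - 1) + \<mu> x powr (s x / q x) * \<bar>t\<bar> powr (s x - 1)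
         + \<xi> powr (p x / conj_exp r x)
         + \<mu> x powr (1 / q x + 1 / conj_exp s x) * \<xi> powr (q x / conj_exp s x) + 1) * \<bar>t\<bar>
    \<le> \<epsilon> * H x \<xi> + (\<epsilon> powr (- rM) + 2) * (\<Psi> x \<bar>t\<bar> + 1)"
proof -
  have rs: "1 < r x" "1 < s x" using rs_gt_1[OF x] by auto
  have qx: "1 < q x" "1 < p x" using q_bounds[OF x] p_bounds[OF x] by auto
  have \<mu>x: "0 \<le> \<mu> x" by (rule \<mu>_nonneg[OF x])
  let ?w = "\<mu> x powr (1 / q x) * \<bar>t\<bar>"
  let ?e = "\<epsilon> powr (- rM)"
  have young: "(y powr (1 / e)) * z powr (1 - 1 / e) \<le> ?e * y + \<epsilon> * z"
    if "0 \<le> y" "0 \<le> z" "1 < e" "e \<le> rM" for y z e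
  proof -
    have "y powr (1 - (1 - 1 / e)) * z powr (1 - 1 / e) \<le> ?e * y + \<epsilon> * z"
    proof (intro Young_eps)
      have "1 - 1 / e = (e - 1) / e" using that by (simp add: field_simps)
      also have "\<dots> \<le> rM / e" using that by (intro divide_right_mono) auto
      finally show "1 - 1 / e \<le> rM * (1 - (1 - 1 / e))" by simp
    qed (use that \<epsilon> in auto)
    then show ?thesis by simp
  qed
  have a: "p x / conj_exp r x = p x * (1 - 1 / r x)" "q x / conj_exp s x = q x * (1 - 1 / s x)"
    "1 / conj_exp s x = 1 - 1 / s x"
    using rs by (simp_all add: conj_exp_def field_simps)
  have T1: "\<bar>t\<bar> powr (r x - 1) * \<bar>t\<bar> = \<bar>t\<bar> powr r x" by (simp add: powr_minus_1_mult)
  have T2: "\<mu> x powr (s x / q x) * \<bar>t\<bar> powr (s x - 1) * \<bar>t\<bar> = ?w powr s x"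
    using \<mu>x by (simp add: mult.assoc powr_minus_1_mult powr_mult powr_powr)
  have "\<xi> powr (p x / conj_exp r x) * \<bar>t\<bar> = (\<bar>t\<bar> powr r x) powr (1 / r x) * (\<xi> powr p x) powr (1 - 1 / r x)"
    unfolding a using rs by (simp add: powr_powr mult.commute)
  also have "\<dots> \<le> ?e * \<bar>t\<bar> powr r x + \<epsilon> * \<xi> powr p x" using rs rM[OF x] by (intro young) auto
  finally have T3: "\<xi> powr (p x / conj_exp r x) * \<bar>t\<bar> \<le> ?e * \<bar>t\<bar> powr r x + \<epsilon> * \<xi> powr p x" .
  have "\<mu> x powr (1 / q x + 1 / conj_exp s x) * \<xi> powr (q x / conj_exp s x) * \<bar>t\<bar>
    = (?w powr s x) powr (1 / s x) * (\<mu> x * \<xi> powr q x) powr (1 - 1 / s x)"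
    unfolding a powr_add using rs \<mu>x \<xi> by (simp add: powr_powr powr_mult algebra_simps)
  also have "\<dots> \<le> ?e * ?w powr s x + \<epsilon> * (\<mu> x * \<xi> powr q x)" using rs rM[OF x] \<mu>x by (intro young) auto
  finally have T4: "\<mu> x powr (1 / q x + 1 / conj_exp s x) * \<xi> powr (q x / conj_exp s x) * \<bar>t\<bar>
    \<le> ?e * ?w powr s x + \<epsilon> * (\<mu> x * \<xi> powr q x)" .
  have "\<bar>t\<bar> powr 1 \<le> 1 + \<bar>t\<bar> powr r x" using rs by (intro powr_le_1_add) auto
  then have T5: "\<bar>t\<bar> \<le> 1 + \<bar>t\<bar> powr r x" by simp
  have "0 \<le> ?e" "0 \<le> \<bar>t\<bar> powr r x" "0 \<le> ?w powr s x" by auto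
  note nn = this
  show ?thesis unfolding \<Psi>_eq[OF x abs_ge_zero] double_phase_def
  proof (rule order_trans)
    show "(\<bar>t\<bar> powr (r x - 1) + \<mu> x powr (s x / q x) * \<bar>t\<bar> powr (s x - 1)
         + \<xi> powr (p x / conj_exp r x)
         + \<mu> x powr (1 / q x + 1 / conj_exp s x) * \<xi> powr (q x / conj_exp s x) + 1) * \<bar>t\<bar>
      \<le> \<bar>t\<bar> powr r x + ?w powr s x + (?e * \<bar>t\<bar> powr r x + \<epsilon> * \<xi> powr p x)
        + (?e * ?w powr s x + \<epsilon> * (\<mu> x * \<xi> powr q x)) + (1 + \<bar>t\<bar> powr r x)"
      unfolding distrib_right mult_1_left using T1 T2 T3 T4 T5 by linarith
    show "\<bar>t\<bar> powr r x + ?w powr s x + (?e * \<bar>t\<bar> powr r x + \<epsilon> * \<xi> powr p x)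
        + (?e * ?w powr s x + \<epsilon> * (\<mu> x * \<xi> powr q x)) + (1 + \<bar>t\<bar> powr r x)
      \<le> \<epsilon> * (\<xi> powr p x + \<mu> x * \<xi> powr q x) + (?e + 2) * (\<bar>t\<bar> powr r x + ?w powr s x + 1)"
      unfolding distrib_left distrib_right mult_1_left mult_1_right using nn by linarith
  qed
qed

text \<open>With this \<epsilon> the gradient part of B consumes at most half of the coercivity
  constant \<alpha>2; \<open>cE\<close> is what the other terms amount to after division by the
  remaining half.\<close>

definition c\<epsilon> :: real where "c\<epsilon> = min 1 (\<alpha>2 / (2 * \<beta>))"
definition cE :: real where "cE = 2 * (\<alpha>3 + \<beta> * (c\<epsilon> powr (- rM) + 2)) / \<alpha>2"

lemma c\<epsilon>: "0 < c\<epsilon>" "c\<epsilon> \<le> 1" "\<beta> * c\<epsilon> \<le> \<alpha>2 / 2"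
proof -
  show "0 < c\<epsilon>" "c\<epsilon> \<le> 1" using coeff_pos by (auto simp: c\<epsilon>_def)
  have "\<beta> * c\<epsilon> \<le> \<beta> * (\<alpha>2 / (2 * \<beta>))" unfolding c\<epsilon>_def using coeff_pos by (intro mult_left_mono) auto
  then show "\<beta> * c\<epsilon> \<le> \<alpha>2 / 2" using coeff_pos by simp
qed

lemma cE_pos: "0 < cE"
  using coeff_pos unfolding cE_def by (intro divide_pos_pos mult_pos_pos add_pos_pos add_nonneg_pos) auto

context
  fixes u assumes sol: "weak_solution \<Omega> (double_phase p q \<mu>) A B u"
begin

abbreviation g :: "real ^ 'n \<Rightarrow> real ^ 'n" where "g \<equiv> weak_grad \<Omega> u"
definition I :: "real \<Rightarrow> real ^ 'n \<Rightarrow> real" where "I k x = (if k < \<bar>u x\<bar> then 1 else 0)"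

lemma u_approx: "approximable u g"
  using sol by (intro W1_0_approximable) (simp add: weak_solution_def)

lemma u_measurable [measurable]: "u \<in> borel_measurable M" "g \<in> borel_measurable M"
  using u_approx by (auto simp: approximable_def)

lemma I_measurable [measurable]: "I k \<in> borel_measurable M"
  unfolding I_def[abs_def] by measurable

lemma I_bounds: "0 \<le> I k x" "I k x \<le> 1"
  by (auto simp: I_def)

lemma integrable_H: "integrable M (\<lambda>x. H x (norm (g x)))" "integrable M (\<lambda>x. H x \<bar>u x\<bar>)"
proof -
  have fin: "\<rho> (\<lambda>x. norm (g x)) < \<infinity>" "\<rho> u < \<infinity>" using u_approx by (auto simp: approximable_def)
  have i: "integrable M (\<lambda>x. H x \<bar>f x\<bar>)" if [measurable]: "f \<in> borel_measurable M" and "\<rho> f < \<infinity>" for f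
  proof (rule integrableI_nonneg)
    show "AE x in M. 0 \<le> H x \<bar>f x\<bar>" using H_nonneg by (intro AE_I2) auto
  qed (use that in \<open>auto simp: modular_def\<close>)
  from i[of "\<lambda>x. norm (g x)"] i[of u] fin show "integrable M (\<lambda>x. H x (norm (g x)))" "integrable M (\<lambda>x. H x \<bar>u x\<bar>)" by auto
qed

text \<open>The energy space only provides integrability of \<open>H\<close>; for \<Psi>, with its
  larger exponents, the embedding \<open>gain\<close> is needed.\<close>

lemma integrable_\<Psi>: "integrable M (\<lambda>x. \<Psi> x \<bar>u x\<bar>)"
proof -
  obtain D a b where D: "\<And>X. 0 \<le> X \<Longrightarrow> \<rho> (\<lambda>x. norm (g x)) + \<rho> u \<le> ennreal X \<Longrightarrow>
    (\<integral>\<^sup>+x. ennreal (PT x \<bar>u x\<bar>) \<partial>M) \<le> ennreal (D * (X powr a + X powr b))"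
    using gain u_approx by blast
  have "\<rho> (\<lambda>x. norm (g x)) + \<rho> u < \<infinity>" using u_approx by (auto simp: approximable_def)
  then obtain X where "0 \<le> X" "\<rho> (\<lambda>x. norm (g x)) + \<rho> u = ennreal X"
    by (metis ennreal_cases infinity_ennreal_def less_irrefl)
  with D[of X] have PTf: "(\<integral>\<^sup>+x. ennreal (PT x \<bar>u x\<bar>) \<partial>M) < \<infinity>" by (simp add: le_less_trans)
  have iPT: "integrable M (\<lambda>x. PT x \<bar>u x\<bar>)"
    by (rule integrableI_nonneg) (use PTf PT_nonneg in auto)
  interpret finite_measure M by (rule finite_M)
  show ?thesis
  proof (rule Bochner_Integration.integrable_bound[where f="\<lambda>x. 4 * (1 + PT x \<bar>u x\<bar>)"])
    show "integrable M (\<lambda>x. 4 * (1 + PT x \<bar>u x\<bar>))" using iPT by simp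
    show "AE x in M. norm (\<Psi> x \<bar>u x\<bar>) \<le> norm (4 * (1 + PT x \<bar>u x\<bar>))"
      using \<Psi>_le_1_PT \<Psi>_nonneg PT_nonneg by (intro AE_I2) auto
  qed measurable
qed

lemma integrable_I:
  assumes "integrable M f"
  shows "integrable M (\<lambda>x. I k x * f x)"
proof (rule Bochner_Integration.integrable_bound[OF assms])
  have [measurable]: "f \<in> borel_measurable M" using assms by auto
  show "(\<lambda>x. I k x * f x) \<in> borel_measurable M" by measurable
qed (auto simp: I_def)

lemma integrable_\<Psi>1: "integrable M (\<lambda>x. \<Psi> x \<bar>u x\<bar> + 1)"
proof -
  interpret finite_measure M by (rule finite_M)
  show ?thesis using integrable_\<Psi> by simp
qed

lemma AB_measurable: "(\<lambda>x. A x (u x) (g x)) \<in> borel_measurable M" "(\<lambda>x. B x (u x) (g x)) \<in> borel_measurable M"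
  by (rule caratheodory_measurable[OF car(1) \<Omega>_sets u_measurable])
    (rule caratheodory_measurable[OF car(2) \<Omega>_sets u_measurable])

lemma trunc_approx:
  assumes "0 < k"
  shows "approximable (\<lambda>x. trunc k j (u x)) (\<lambda>x. trunc' k j (u x) *\<^sub>R g x)"
proof (rule approximable_compose[OF u_approx D_k_trunc trunc])
  show "\<bar>trunc' k j t\<bar> \<le> 1" for t using trunc'_bounds[OF assms, of j t] by auto
  show "continuous_on UNIV (trunc' k j)" using D_k_trunc'[of 0] by simp
qed

lemma trunc_le_I: "0 < k \<Longrightarrow> \<bar>trunc k j (u x)\<bar> \<le> I k x * \<bar>u x\<bar>"
  using trunc_abs_le[of k j "u x"] by (auto simp: I_def)

lemma trunc'_le_I: "0 < k \<Longrightarrow> trunc' k j (u x) \<le> I k x"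
  using trunc'_bounds[of k j "u x"] trunc'_eq_0[of k "u x" j] by (auto simp: I_def)

lemma trunc'_measurable [measurable]: "trunc' k j \<in> borel_measurable borel"
  using D_k_trunc'[of 0] by (intro borel_measurable_continuous_onI) simp

lemma trunc_measurable [measurable]: "trunc k j \<in> borel_measurable borel"
  using D_k_continuous[OF D_k_trunc[of 0]] by (intro borel_measurable_continuous_onI) simp

lemma AE_B_bound:
  "AE x in M. \<forall>\<epsilon>. 0 < \<epsilon> \<longrightarrow> \<epsilon> \<le> 1 \<longrightarrow> \<bar>B x (u x) (g x)\<bar> * \<bar>u x\<bar>
    \<le> \<beta> * (\<epsilon> * H x (norm (g x)) + (\<epsilon> powr (- rM) + 2) * (\<Psi> x \<bar>u x\<bar> + 1))"
  using B_growth AE_space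
proof eventually_elim
  case (elim x)
  then have x: "x \<in> \<Omega>" by simp
  show ?case
  proof (intro allI impI)
    fix \<epsilon> :: real assume \<epsilon>: "0 < \<epsilon>" "\<epsilon> \<le> 1"
    let ?b = "\<bar>u x\<bar> powr (r x - 1) + \<mu> x powr (s x / q x) * \<bar>u x\<bar> powr (s x - 1)
         + norm (g x) powr (p x / conj_exp r x)
         + \<mu> x powr (1 / q x + 1 / conj_exp s x) * norm (g x) powr (q x / conj_exp s x) + 1"
    have "\<bar>B x (u x) (g x)\<bar> \<le> \<beta> * ?b" using elim(1) by blast
    then have "\<bar>B x (u x) (g x)\<bar> * \<bar>u x\<bar> \<le> \<beta> * ?b * \<bar>u x\<bar>" by (intro mult_right_mono) auto
    also have "\<dots> = \<beta> * (?b * \<bar>u x\<bar>)" by (rule mult.assoc)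
    also have "\<dots> \<le> \<beta> * (\<epsilon> * H x (norm (g x)) + (\<epsilon> powr (- rM) + 2) * (\<Psi> x \<bar>u x\<bar> + 1))"
      using coeff_pos by (intro mult_left_mono B_bound x \<epsilon>) auto
    finally show "\<bar>B x (u x) (g x)\<bar> * \<bar>u x\<bar> \<le> \<beta> * (\<epsilon> * H x (norm (g x)) + (\<epsilon> powr (- rM) + 2) * (\<Psi> x \<bar>u x\<bar> + 1))" .
  qed
qed

lemma integrable_Bw:
  assumes "0 < k"
  shows "integrable M (\<lambda>x. B x (u x) (g x) * trunc k j (u x))"
proof (rule Bochner_Integration.integrable_bound)
  show "integrable M (\<lambda>x. \<beta> * (1 * H x (norm (g x)) + (1 powr (- rM) + 2) * (\<Psi> x \<bar>u x\<bar> + 1)))"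
    by (intro integrable_mult_right Bochner_Integration.integrable_add[OF integrable_mult_right[OF integrable_H(1)] integrable_mult_right[OF integrable_\<Psi>1]])
  show "(\<lambda>x. B x (u x) (g x) * trunc k j (u x)) \<in> borel_measurable M"
    by (intro borel_measurable_times AB_measurable measurable_compose[OF u_measurable(1) trunc_measurable])
  show "AE x in M. norm (B x (u x) (g x) * trunc k j (u x)) \<le> norm (\<beta> * (1 * H x (norm (g x)) + (1 powr (- rM) + 2) * (\<Psi> x \<bar>u x\<bar> + 1)))"
    using AE_B_bound
  proof eventually_elim
    case (elim x)
    have "\<bar>trunc k j (u x)\<bar> \<le> \<bar>u x\<bar>" using trunc_le_I[OF assms, of j x] by (auto simp: I_def split: if_splits)
    then have "norm (B x (u x) (g x) * trunc k j (u x)) \<le> \<bar>B x (u x) (g x)\<bar> * \<bar>u x\<bar>"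
      by (simp add: abs_mult mult_left_mono)
    also have "\<dots> \<le> \<beta> * (1 * H x (norm (g x)) + (1 powr (- rM) + 2) * (\<Psi> x \<bar>u x\<bar> + 1))" using elim by (metis order_refl zero_less_one)
    finally show ?case by simp
  qed
qed

text \<open>The growth condition contains critical powers of |t|. The factor \<open>trunc'\<close>
  vanishes where |u| is at least T, so on its support these powers are bounded, and the integrand is
  dominated by c |g| + H(x, |g|) up to a factor.\<close>

lemma integrable_Aw:
  assumes k: "0 < k"
  shows "integrable M (\<lambda>x. trunc' k j (u x) * (A x (u x) (g x) \<bullet> g x))"
proof (rule Bochner_Integration.integrable_bound)
  define T where "T = k + 1 + real j"
  define E0 where "E0 = N * qM / (N - qM)"
  define E1 where "E1 = (N - 1) / (N - qM)"
  define c where "c = max 1 T powr E0 + max 1 \<mu>M powr E1 * max 1 T powr E0 + 1"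
  have "(\<lambda>x. norm (g x)) \<in> borel_measurable M" by measurable
  then have "integrable M g" using approximable_integrable[OF u_approx] by simp
  then show "integrable M (\<lambda>x. \<alpha>1 * (c * norm (g x) + H x (norm (g x))))"
    using integrable_H by (intro integrable_mult_right Bochner_Integration.integrable_add) auto
  show "(\<lambda>x. trunc' k j (u x) * (A x (u x) (g x) \<bullet> g x)) \<in> borel_measurable M"
    by (intro borel_measurable_times borel_measurable_inner AB_measurable u_measurable measurable_compose[OF u_measurable(1) trunc'_measurable])
  have Nq: "qM < N" using qM_less by (simp add: N_def)
  \<comment> \<open>The quotient of the critical by the conjugate exponent is N(h-1)/(N-h), bounded
    while h is at most \<open>qM\<close>.\<close>
  have ce: "0 \<le> crit_exp h x / conj_exp h x \<and> crit_exp h x / conj_exp h x \<le> E0"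
    if h: "1 < h x" "h x \<le> qM" for h :: "real ^ 'n \<Rightarrow> real" and x
  proof -
    have e: "crit_exp h x / conj_exp h x = N * (h x - 1) / (N - h x)"
      using h Nq by (simp add: crit_exp_def conj_exp_def N_def[symmetric] field_simps)
    have "N * (h x - 1) / (N - h x) \<le> E0" unfolding E0_def
      using h Nq N_ge by (intro frac_le mult_left_mono mult_nonneg_nonneg) auto
    then show ?thesis unfolding e using h Nq N_ge by auto
  qed
  show "AE x in M. norm (trunc' k j (u x) * (A x (u x) (g x) \<bullet> g x)) \<le> norm (\<alpha>1 * (c * norm (g x) + H x (norm (g x))))"
    using A_growth AE_space
  proof eventually_elim
    case (elim x)
    then have x: "x \<in> \<Omega>" by simp
    have c0: "0 \<le> c" unfolding c_def by (intro add_nonneg_nonneg) auto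
    have rhs0: "0 \<le> \<alpha>1 * (c * norm (g x) + H x (norm (g x)))" using coeff_pos c0 H_nonneg[OF x] by auto
    show ?case
    proof (cases "trunc' k j (u x) = 0")
      case True
      then show ?thesis using rhs0 by simp
    next
      case False
      then have uT: "\<bar>u x\<bar> \<le> T" using trunc'_eq_0[OF k, of "u x" j] by (fastforce simp: T_def)
      have pb: "1 < p x" "p x \<le> qM" "1 < q x" "q x \<le> qM" using p_bounds[OF x] q_bounds[OF x] by auto
      have "\<bar>u x\<bar> powr (crit_exp p x / conj_exp p x) \<le> max 1 T powr E0"
        using ce[of p x] pb uT by (intro powr_le_max_powr) auto
      moreover have "\<mu> x powr ((real CARD('n) - 1) / (real CARD('n) - q x)) * \<bar>u x\<bar> powr (crit_exp q x / conj_exp q x)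
        \<le> max 1 \<mu>M powr E1 * max 1 T powr E0"
      proof (intro mult_mono)
        show "\<mu> x powr ((real CARD('n) - 1) / (real CARD('n) - q x)) \<le> max 1 \<mu>M powr E1"
          unfolding E1_def N_def using \<mu>_nonneg[OF x] \<mu>_le[OF x] pb qM_less N2
          by (intro powr_le_max_powr frac_le) auto
        show "\<bar>u x\<bar> powr (crit_exp q x / conj_exp q x) \<le> max 1 T powr E0"
          using ce[of q x] pb uT by (intro powr_le_max_powr) auto
      qed auto
      moreover have "norm (A x (u x) (g x)) \<le> \<alpha>1 *
        (\<bar>u x\<bar> powr (crit_exp p x / conj_exp p x)
         + \<mu> x powr ((real CARD('n) - 1) / (real CARD('n) - q x)) * \<bar>u x\<bar> powr (crit_exp q x / conj_exp q x)
         + norm (g x) powr (p x - 1) + \<mu> x * norm (g x) powr (q x - 1) + 1)" using elim(1) by blast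
      moreover have "\<alpha>1 * (\<bar>u x\<bar> powr (crit_exp p x / conj_exp p x)
         + \<mu> x powr ((real CARD('n) - 1) / (real CARD('n) - q x)) * \<bar>u x\<bar> powr (crit_exp q x / conj_exp q x)
         + norm (g x) powr (p x - 1) + \<mu> x * norm (g x) powr (q x - 1) + 1)
        \<le> \<alpha>1 * (c + norm (g x) powr (p x - 1) + \<mu> x * norm (g x) powr (q x - 1))"
        using coeff_pos(1) calculation(1,2) by (intro mult_left_mono) (auto simp: c_def)
      ultimately have An: "norm (A x (u x) (g x)) \<le> \<alpha>1 * (c + norm (g x) powr (p x - 1) + \<mu> x * norm (g x) powr (q x - 1))"
        by linarith
      have "norm (trunc' k j (u x) * (A x (u x) (g x) \<bullet> g x)) \<le> 1 * (norm (A x (u x) (g x)) * norm (g x))"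
        unfolding norm_mult using trunc'_bounds[OF k, of j "u x"] Cauchy_Schwarz_ineq2[of "A x (u x) (g x)" "g x"]
        by (intro mult_mono) auto
      also have "\<dots> \<le> \<alpha>1 * (c + norm (g x) powr (p x - 1) + \<mu> x * norm (g x) powr (q x - 1)) * norm (g x)"
        using An by (simp add: mult_right_mono)
      also have "\<dots> = \<alpha>1 * (c * norm (g x) + norm (g x) powr (p x - 1) * norm (g x) + \<mu> x * (norm (g x) powr (q x - 1) * norm (g x)))"
        by (simp add: algebra_simps)
      also have "\<dots> = \<alpha>1 * (c * norm (g x) + H x (norm (g x)))"
        by (simp add: powr_minus_1_mult double_phase_def)
      finally show ?thesis using rhs0 by simp
    qed
  qed
qed

text \<open>The equation is tested with the truncation of u; coercivity bounds one side from below,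
  \<open>AE_B_bound\<close> with \<epsilon> = \<open>c\<epsilon>\<close> the other from above. The
  gradient term on the right carries the full indicator \<open>I k\<close> and not
  \<open>trunc'\<close>, so it cannot be absorbed before j tends to infinity.\<close>

lemma trunc_energy:
  assumes k: "0 < k"
  shows "\<alpha>2 * (LINT x|M. trunc' k j (u x) * H x (norm (g x)))
    \<le> \<alpha>2 / 2 * (LINT x|M. I k x * H x (norm (g x)))
      + (\<alpha>3 + \<beta> * (c\<epsilon> powr (- rM) + 2)) * (LINT x|M. I k x * (\<Psi> x \<bar>u x\<bar> + 1))"
proof -
  let ?w = "\<lambda>x. trunc k j (u x)" and ?\<psi> = "\<lambda>x. trunc' k j (u x)"
  let ?a = "\<lambda>x. A x (u x) (g x)" and ?b = "\<lambda>x. B x (u x) (g x)"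
  let ?H = "\<lambda>x. H x (norm (g x))" and ?P = "\<lambda>x. \<Psi> x \<bar>u x\<bar> + 1"
  let ?c = "c\<epsilon> powr (- rM) + 2"
  note ap = trunc_approx[OF k, of j]
  note [measurable] = AB_measurable
  have w: "?w \<in> W1_0 \<Omega> H" by (rule approximable_W1_0[OF ap])
  have wg: "AE x in M. weak_grad \<Omega> ?w x = ?\<psi> x *\<^sub>R g x"
    by (rule weak_grad_AE[OF approximable_weak_gradient[OF ap] open_\<Omega>])
  have [measurable]: "weak_grad \<Omega> ?w \<in> borel_measurable M"
    by (rule weak_grad_measurable[OF approximable_weak_gradient[OF ap]])
  have "(LINT x|M. ?\<psi> x * (?a x \<bullet> g x)) = (LINT x|M. ?a x \<bullet> weak_grad \<Omega> ?w x)"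
    by (rule integral_cong_AE) (use wg in \<open>auto elim!: eventually_mono intro!: borel_measurable_times borel_measurable_inner\<close>)
  also have "\<dots> = (LINT x|M. ?b x * ?w x)" using sol w by (simp add: weak_solution_def)
  finally have eq: "(LINT x|M. ?\<psi> x * (?a x \<bullet> g x)) = (LINT x|M. ?b x * ?w x)" .
  have i\<psi>H: "integrable M (\<lambda>x. ?\<psi> x * ?H x)"
  proof (rule Bochner_Integration.integrable_bound[OF integrable_H(1)])
    show "AE x in M. norm (?\<psi> x * ?H x) \<le> norm (?H x)"
      using trunc'_bounds[OF k] H_nonneg by (intro AE_I2) (simp add: mult_left_le_one_le)
  qed measurable
  note iIH = integrable_I[OF integrable_H(1), of k] and iIP = integrable_I[OF integrable_\<Psi>1, of k]
  have "\<alpha>2 * (LINT x|M. ?\<psi> x * ?H x) - \<alpha>3 * (LINT x|M. I k x * ?P x)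
    = (LINT x|M. \<alpha>2 * (?\<psi> x * ?H x) - \<alpha>3 * (I k x * ?P x))"
    using i\<psi>H iIP by simp
  also have "\<dots> \<le> (LINT x|M. ?\<psi> x * (?a x \<bullet> g x))"
  proof (rule integral_mono_AE)
    show "integrable M (\<lambda>x. \<alpha>2 * (?\<psi> x * ?H x) - \<alpha>3 * (I k x * ?P x))" using i\<psi>H iIP by simp
    show "integrable M (\<lambda>x. ?\<psi> x * (?a x \<bullet> g x))" by (rule integrable_Aw[OF k])
    show "AE x in M. \<alpha>2 * (?\<psi> x * ?H x) - \<alpha>3 * (I k x * ?P x) \<le> ?\<psi> x * (?a x \<bullet> g x)"
      using A_coercive
    proof eventually_elim
      case (elim x)
      have P0: "0 \<le> ?P x" using \<Psi>_nonneg[of x "\<bar>u x\<bar>"] by linarith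
      have "\<alpha>2 * ?H x - \<alpha>3 * ?P x \<le> ?a x \<bullet> g x"
        using elim by (simp add: double_phase_def double_phase_sub_def)
      then have "?\<psi> x * (\<alpha>2 * ?H x - \<alpha>3 * ?P x) \<le> ?\<psi> x * (?a x \<bullet> g x)"
        using trunc'_bounds[OF k] by (intro mult_left_mono) auto
      moreover have "\<alpha>3 * (?\<psi> x * ?P x) \<le> \<alpha>3 * (I k x * ?P x)"
        using coeff_pos P0 trunc'_le_I[OF k] by (intro mult_left_mono mult_right_mono) auto
      ultimately show ?case by (simp add: right_diff_distrib mult.left_commute)
    qed
  qed
  also have "\<dots> = (LINT x|M. ?b x * ?w x)" by (rule eq)
  also have "\<dots> \<le> (LINT x|M. \<alpha>2 / 2 * (I k x * ?H x) + \<beta> * ?c * (I k x * ?P x))"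
  proof (rule integral_mono_AE)
    show "integrable M (\<lambda>x. ?b x * ?w x)" by (rule integrable_Bw[OF k])
    show "integrable M (\<lambda>x. \<alpha>2 / 2 * (I k x * ?H x) + \<beta> * ?c * (I k x * ?P x))" using iIH iIP by simp
    show "AE x in M. ?b x * ?w x \<le> \<alpha>2 / 2 * (I k x * ?H x) + \<beta> * ?c * (I k x * ?P x)"
      using AE_B_bound AE_space
    proof eventually_elim
      case (elim x)
      then have x: "x \<in> \<Omega>" by simp
      have "?b x * ?w x \<le> \<bar>?b x\<bar> * \<bar>?w x\<bar>" by (metis abs_ge_self abs_mult)
      also have "\<dots> \<le> \<bar>?b x\<bar> * (I k x * \<bar>u x\<bar>)" using trunc_le_I[OF k] by (intro mult_left_mono) auto
      also have "\<dots> = I k x * (\<bar>?b x\<bar> * \<bar>u x\<bar>)" by simp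
      also have "\<dots> \<le> I k x * (\<beta> * (c\<epsilon> * ?H x + ?c * ?P x))"
        using elim(1) c\<epsilon> I_bounds by (intro mult_left_mono) auto
      also have "\<dots> = (\<beta> * c\<epsilon>) * (I k x * ?H x) + \<beta> * ?c * (I k x * ?P x)" by (simp add: algebra_simps)
      also have "(\<beta> * c\<epsilon>) * (I k x * ?H x) \<le> \<alpha>2 / 2 * (I k x * ?H x)"
        using c\<epsilon>(3) I_bounds H_nonneg[OF x] by (intro mult_right_mono) auto
      finally show ?case by simp
    qed
  qed
  also have "\<dots> = \<alpha>2 / 2 * (LINT x|M. I k x * ?H x) + \<beta> * ?c * (LINT x|M. I k x * ?P x)"
    using iIH iIP by simp
  finally show ?thesis by (simp add: algebra_simps)
qed

text \<open>As j grows, \<open>trunc'\<close> tends to the indicator of |u| > k. Both gradient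
  integrals of \<open>trunc_energy\<close> then agree, and half of the left one survives.\<close>

lemma energy:
  assumes k: "0 < k"
  shows "(LINT x|M. I k x * H x (norm (g x))) \<le> cE * (LINT x|M. I k x * (\<Psi> x \<bar>u x\<bar> + 1))"
proof -
  let ?H = "\<lambda>x. H x (norm (g x))"
  have "(\<lambda>j. LINT x|M. trunc' k j (u x) * ?H x) \<longlonglongrightarrow> (LINT x|M. I k x * ?H x)"
  proof (rule integral_dominated_convergence[where w="?H"])
    show "AE x in M. (\<lambda>j. trunc' k j (u x) * ?H x) \<longlonglongrightarrow> I k x * ?H x"
      using trunc'_tendsto[OF k] unfolding I_def by (intro AE_I2 tendsto_mult tendsto_const) auto
    show "AE x in M. norm (trunc' k j (u x) * ?H x) \<le> ?H x" for j
      using trunc'_bounds[OF k] H_nonneg by (intro AE_I2) (simp add: mult_left_le_one_le)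
    show "integrable M ?H" by (rule integrable_H)
  qed measurable
  then have "(\<lambda>j. \<alpha>2 * (LINT x|M. trunc' k j (u x) * ?H x)) \<longlonglongrightarrow> \<alpha>2 * (LINT x|M. I k x * ?H x)"
    by (intro tendsto_mult tendsto_const)
  then have "\<alpha>2 * (LINT x|M. I k x * ?H x) \<le> \<alpha>2 / 2 * (LINT x|M. I k x * ?H x)
      + (\<alpha>3 + \<beta> * (c\<epsilon> powr (- rM) + 2)) * (LINT x|M. I k x * (\<Psi> x \<bar>u x\<bar> + 1))"
    by (rule LIMSEQ_le_const2) (use trunc_energy[OF k] in blast)
  then have "\<alpha>2 / 2 * (LINT x|M. I k x * ?H x) \<le> (\<alpha>3 + \<beta> * (c\<epsilon> powr (- rM) + 2)) * (LINT x|M. I k x * (\<Psi> x \<bar>u x\<bar> + 1))"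
    by simp
  then show ?thesis using coeff_pos(2) by (simp add: cE_def field_simps)
qed

end

end

subsection \<open>De Giorgi iteration\<close>

text \<open>By induction Y n \<le> Z l^n with l = B^(-1/\<delta>1): the factor (l^n)^\<delta>1 =
  B^(-n) cancels the growing coefficient, and the smallness condition supplies the additional l. The
  larger exponent \<delta>2 is only better because l < 1.\<close>

lemma fast_geometric_convergence:
  fixes Y :: "nat \<Rightarrow> real" and \<delta>1 \<delta>2 S B Z :: real
  assumes \<delta>: "0 < \<delta>1" "\<delta>1 \<le> \<delta>2" and B: "1 < B" and S: "0 \<le> S"
    and Y: "\<And>n. 0 \<le> Y n" "Y 0 \<le> Z"
    and step: "\<And>n. Y (Suc n) \<le> S * B ^ n * (Y n powr (1 + \<delta>1) + Y n powr (1 + \<delta>2))"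
    and small: "S * (Z powr \<delta>1 + Z powr \<delta>2) \<le> B powr (- 1 / \<delta>1)"
  shows "Y \<longlonglongrightarrow> 0"
proof -
  define l where "l = B powr (- 1 / \<delta>1)"
  have l: "0 < l" "l < 1" using B \<delta> by (auto simp: l_def powr_less_one)
  have l\<delta>: "l powr \<delta>1 = 1 / B" unfolding l_def powr_powr using B \<delta> by (simp add: powr_minus_divide)
  have Z: "0 \<le> Z" using Y(1)[of 0] Y(2) by simp
  have le: "Y n \<le> Z * l ^ n" for n
  proof (induction n)
    case (Suc n)
    have ln: "0 < l ^ n" "l ^ n \<le> 1" using l by (auto simp: power_le_one)
    have l1: "(l ^ n) powr \<delta>1 = 1 / B ^ n"
    proof -
      have "(l ^ n) powr \<delta>1 = (l powr \<delta>1) ^ n"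
        using l by (simp add: powr_powr mult.commute flip: powr_realpow)
      then show ?thesis by (simp add: l\<delta> power_one_over)
    qed
    have l2: "(l ^ n) powr \<delta>2 \<le> 1 / B ^ n"
      unfolding l1[symmetric] using ln \<delta> by (intro powr_mono') auto
    have e: "Y n powr (1 + \<delta>) \<le> (Z * l ^ n) * (Z powr \<delta> * (1 / B ^ n))"
      if \<delta>: "0 < \<delta>" "(l ^ n) powr \<delta> \<le> 1 / B ^ n" for \<delta>
    proof -
      have "Y n powr (1 + \<delta>) \<le> (Z * l ^ n) powr (1 + \<delta>)" using Suc Y \<delta> by (intro powr_mono2) auto
      also have "\<dots> = (Z * l ^ n) * (Z powr \<delta> * (l ^ n) powr \<delta>)"
        using Z ln \<delta> by (cases "Z = 0") (auto simp: powr_add powr_mult)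
      also have "\<dots> \<le> (Z * l ^ n) * (Z powr \<delta> * (1 / B ^ n))"
        using \<delta> Z ln by (intro mult_left_mono) auto
      finally show ?thesis .
    qed
    have "Y (Suc n) \<le> S * B ^ n * (Y n powr (1 + \<delta>1) + Y n powr (1 + \<delta>2))" by (rule step)
    also have "\<dots> \<le> S * B ^ n * ((Z * l ^ n) * (Z powr \<delta>1 * (1 / B ^ n)) + (Z * l ^ n) * (Z powr \<delta>2 * (1 / B ^ n)))"
      using e[of \<delta>1] e[of \<delta>2] l1 l2 \<delta> S B by (intro mult_left_mono add_mono mult_nonneg_nonneg) auto
    also have "\<dots> = (Z * l ^ n) * (S * (Z powr \<delta>1 + Z powr \<delta>2))" using B by (simp add: field_simps)
    also have "\<dots> \<le> (Z * l ^ n) * l" using small Z ln unfolding l_def[symmetric] by (intro mult_left_mono) auto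
    finally show ?case by (simp only: power_Suc mult_ac)
  qed (use Y in simp)
  have "(\<lambda>n. Z * l ^ n) \<longlonglongrightarrow> Z * 0" using l by (intro tendsto_mult tendsto_const LIMSEQ_realpow_zero) auto
  then have "(\<lambda>n. Z * l ^ n) \<longlonglongrightarrow> 0" by simp
  then show ?thesis
    by (rule real_tendsto_sandwich[OF always_eventually always_eventually tendsto_const, rotated 2])
      (use Y(1) le in blast)+
qed

lemma powr_le_powr_sum:
  fixes t F c a b e e1 e2 :: real
  assumes "0 \<le> t" "0 \<le> F" "F \<le> c * (t powr a + t powr b)" "0 \<le> c" "0 \<le> a" "a \<le> b" "0 \<le> e1" "e1 \<le> e" "e \<le> e2"
  shows "F powr e \<le> 2 * (2 * c) powr e * (t powr (a * e1) + t powr (b * e2))"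
proof -
  have ae: "a * e1 \<le> a * e" "a * e \<le> b * e2" "a * e1 \<le> b * e" "b * e \<le> b * e2"
    using assms by (auto intro!: mult_mono mult_left_mono)
  have "F powr e \<le> (c * (t powr a + t powr b)) powr e" using assms by (intro powr_mono2) auto
  also have "\<dots> = c powr e * (t powr a + t powr b) powr e" using assms by (simp add: powr_mult)
  also have "\<dots> \<le> c powr e * (2 powr e * ((t powr a) powr e + (t powr b) powr e))"
    using assms by (intro mult_left_mono powr_add_le_mult) auto
  also have "\<dots> = (2 * c) powr e * (t powr (a * e) + t powr (b * e))"
    using assms by (simp add: powr_powr powr_mult)
  also have "\<dots> \<le> (2 * c) powr e * ((t powr (a * e1) + t powr (b * e2)) + (t powr (a * e1) + t powr (b * e2)))"
    using assms ae by (intro mult_left_mono add_mono powr_le_add) auto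
  finally show ?thesis by (simp add: algebra_simps)
qed

context double_phase_problem
begin

section \<open>Comparison of two levels\<close>

lemma pos_part_scaled:
  fixes h k t :: real
  assumes "0 < h" "h < k" "k < \<bar>t\<bar>"
  shows "\<bar>t\<bar> \<le> k / (k - h) * max 0 (\<bar>t\<bar> - h)"
proof -
  have "(k - h) * \<bar>t\<bar> \<le> k * (\<bar>t\<bar> - h)"
    using assms by (simp add: algebra_simps mult_left_mono)
  then show ?thesis using assms by (simp add: field_simps)
qed

text \<open>Where |t| exceeds k, it is at most a multiple of its excess over the lower level h, so
  \<Psi> of the full value is controlled by \<Psi> of the excess.\<close>

lemma level_\<Psi>:
  assumes x: "x \<in> \<Omega>" and h: "0 < h" "h < k" and t: "k < \<bar>t\<bar>"
  shows "\<Psi> x \<bar>t\<bar> \<le> (k / (k - h)) powr rM * \<Psi> x (max 0 (\<bar>t\<bar> - h))"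
proof -
  have "\<Psi> x \<bar>t\<bar> \<le> \<Psi> x (k / (k - h) * max 0 (\<bar>t\<bar> - h))"
    using pos_part_scaled[OF h t] by (intro \<Psi>_mono x) auto
  also have "\<dots> \<le> (k / (k - h)) powr rM * \<Psi> x (max 0 (\<bar>t\<bar> - h))"
    using h by (intro \<Psi>_scale_ge x) (auto simp: field_simps)
  finally show ?thesis .
qed

text \<open>Chebyshev's inequality in pointwise form: the excess over h is more than k - h, whose
  power r is below \<Psi>. The sum of two powers bounds (k - h)^(-r) for every r between 1 and
  \<open>rM\<close>.\<close>

lemma level_1:
  assumes x: "x \<in> \<Omega>" and h: "0 < h" "h < k" and t: "k < \<bar>t\<bar>"
  shows "1 \<le> ((k - h) powr - 1 + (k - h) powr - rM) * \<Psi> x (max 0 (\<bar>t\<bar> - h))"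
proof -
  have "1 = (k - h) powr (- r x) * (k - h) powr r x" using h by (simp flip: powr_add)
  also have "\<dots> \<le> ((k - h) powr - 1 + (k - h) powr - rM) * (k - h) powr r x"
  proof (intro mult_right_mono)
    have "(k - h) powr (- r x) \<le> (k - h) powr - rM + (k - h) powr - 1"
      using h rs_gt_1[OF x] rM[OF x] by (intro powr_le_add) auto
    then show "(k - h) powr (- r x) \<le> (k - h) powr - 1 + (k - h) powr - rM" by simp
  qed auto
  also have "\<dots> \<le> ((k - h) powr - 1 + (k - h) powr - rM) * \<Psi> x (max 0 (\<bar>t\<bar> - h))"
  proof (intro mult_left_mono)
    have "(k - h) powr r x \<le> \<Psi> x (k - h)" by (simp add: double_phase_sub_def)
    also have "\<dots> \<le> \<Psi> x (max 0 (\<bar>t\<bar> - h))" using h t by (intro \<Psi>_mono x) auto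
    finally show "(k - h) powr r x \<le> \<Psi> x (max 0 (\<bar>t\<bar> - h))" .
  qed auto
  finally show ?thesis .
qed

context
  fixes u assumes sol: "weak_solution \<Omega> (double_phase p q \<mu>) A B u"
begin

definition v :: "real \<Rightarrow> real ^ 'n \<Rightarrow> real" where "v k x = max 0 (\<bar>u x\<bar> - k)"
definition Z :: "real \<Rightarrow> real" where "Z k = (LINT x|M. \<Psi> x (v k x))"
abbreviation "J \<equiv> I u"
definition mass_above :: "real \<Rightarrow> real" where "mass_above k = (LINT x|M. J k x)"
text \<open>The right side of the energy estimate at level k; the summand 1 stems from the constants
  in the structure conditions.\<close>

definition \<Psi>_above :: "real \<Rightarrow> real" where "\<Psi>_above k = (LINT x|M. J k x * (\<Psi> x \<bar>u x\<bar> + 1))"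

lemma v_measurable [measurable]: "v k \<in> borel_measurable M"
  using u_measurable(1)[OF sol] unfolding v_def[abs_def] by measurable

lemma v_nonneg: "0 \<le> v k x" and v_le: "0 \<le> k \<Longrightarrow> v k x \<le> \<bar>u x\<bar>"
  by (auto simp: v_def)

lemma integrable_\<Psi>v:
  assumes "0 \<le> k"
  shows "integrable M (\<lambda>x. \<Psi> x (v k x))"
proof (rule Bochner_Integration.integrable_bound[OF integrable_\<Psi>[OF sol]])
  show "AE x in M. norm (\<Psi> x (v k x)) \<le> norm (\<Psi> x \<bar>u x\<bar>)"
    using \<Psi>_mono v_nonneg v_le[OF assms] \<Psi>_nonneg by (intro AE_I2) auto
qed measurable

lemma Z_nonneg: "0 \<le> Z k"
  unfolding Z_def using \<Psi>_nonneg by (intro integral_nonneg_AE) auto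

lemma Z_le: "0 \<le> k \<Longrightarrow> Z k \<le> (LINT x|M. \<Psi> x \<bar>u x\<bar>)"
  unfolding Z_def using \<Psi>_mono v_nonneg v_le
  by (intro integral_mono integrable_\<Psi>v integrable_\<Psi>[OF sol]) auto

lemma integrable_J: "integrable M (J k)"
proof -
  interpret finite_measure M by (rule finite_M)
  show ?thesis using integrable_I[OF sol, of "\<lambda>_. 1" k] by simp
qed

lemma above_nonneg: "0 \<le> mass_above k" "mass_above k \<le> \<Psi>_above k"
proof -
  show "0 \<le> mass_above k" unfolding mass_above_def
    using I_bounds[OF sol] by (intro integral_nonneg_AE) auto
  show "mass_above k \<le> \<Psi>_above k" unfolding mass_above_def \<Psi>_above_def
  proof (intro integral_mono integrable_J integrable_I[OF sol integrable_\<Psi>1[OF sol]])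
    show "J k x \<le> J k x * (\<Psi> x \<bar>u x\<bar> + 1)" for x
      using \<Psi>_nonneg[of x "\<bar>u x\<bar>"] I_bounds[OF sol, of k x] by (simp add: mult_le_cancel_left1)
  qed
qed

lemma mass_above_le:
  assumes h: "0 < h" "h < k"
  shows "mass_above k \<le> ((k - h) powr - 1 + (k - h) powr - rM) * Z h"
proof -
  have "mass_above k \<le> (LINT x|M. ((k - h) powr - 1 + (k - h) powr - rM) * \<Psi> x (v h x))"
    unfolding mass_above_def
  proof (intro integral_mono integrable_J integrable_mult_right integrable_\<Psi>v)
    fix x assume "x \<in> space M"
    then have x: "x \<in> \<Omega>" by simp
    show "J k x \<le> ((k - h) powr - 1 + (k - h) powr - rM) * \<Psi> x (v h x)"
      using level_1[OF x h, of "u x"] \<Psi>_nonneg[of x "v h x"] by (auto simp: I_def[OF sol] v_def)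
  qed (use h in simp)
  then show ?thesis by (simp add: Z_def)
qed

lemma \<Psi>_above_le:
  assumes h: "0 < h" "h < k"
  shows "\<Psi>_above k \<le> ((k / (k - h)) powr rM + ((k - h) powr - 1 + (k - h) powr - rM)) * Z h"
proof -
  have "\<Psi>_above k \<le> (LINT x|M. ((k / (k - h)) powr rM + ((k - h) powr - 1 + (k - h) powr - rM)) * \<Psi> x (v h x))"
    unfolding \<Psi>_above_def
  proof (intro integral_mono integrable_I[OF sol integrable_\<Psi>1[OF sol]] integrable_mult_right integrable_\<Psi>v)
    fix x assume "x \<in> space M"
    then have x: "x \<in> \<Omega>" by simp
    show "J k x * (\<Psi> x \<bar>u x\<bar> + 1) \<le> ((k / (k - h)) powr rM + ((k - h) powr - 1 + (k - h) powr - rM)) * \<Psi> x (v h x)"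
      using level_1[OF x h, of "u x"] level_\<Psi>[OF x h, of "u x"] \<Psi>_nonneg[of x "v h x"]
      unfolding distrib_right[of "(k / (k - h)) powr rM"] by (auto simp: I_def[OF sol] v_def)
  qed (use h in simp)
  then show ?thesis by (simp add: Z_def)
qed

text \<open>Truncation multiplies the gradient by at most the indicator and keeps the function below
  the indicator times |u|. The first modular is then bounded by \<open>energy\<close>, the second by
  \<open>H_le_\<Psi>\<close>.\<close>

lemma modular_trunc:
  assumes k: "0 < k"
  shows "\<rho> (\<lambda>x. norm (trunc' k j (u x) *\<^sub>R weak_grad \<Omega> u x)) + \<rho> (\<lambda>x. trunc k j (u x)) \<le> ennreal ((cE + 2) * \<Psi>_above k)"
proof -
  let ?H = "\<lambda>x. H x (norm (weak_grad \<Omega> u x))"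
  have J: "0 \<le> J k x" "J k x \<le> 1" for x using I_bounds[OF sol] .
  have H0: "0 \<le> J k x * ?H x" if "x \<in> \<Omega>" for x using J H_nonneg[OF that] by simp
  have "\<rho> (\<lambda>x. norm (trunc' k j (u x) *\<^sub>R weak_grad \<Omega> u x)) \<le> (\<integral>\<^sup>+x. ennreal (J k x * ?H x) \<partial>M)"
    unfolding modular_def
  proof (intro nn_integral_mono ennreal_leI)
    fix x assume "x \<in> space M"
    then have x: "x \<in> \<Omega>" by simp
    have "\<bar>norm (trunc' k j (u x) *\<^sub>R weak_grad \<Omega> u x)\<bar> \<le> J k x * norm (weak_grad \<Omega> u x)"
      using trunc'_le_I[OF sol k, of j x] trunc'_bounds[OF k, of j "u x"] by (auto intro!: mult_right_mono)
    then have "H x \<bar>norm (trunc' k j (u x) *\<^sub>R weak_grad \<Omega> u x)\<bar> \<le> H x (J k x * norm (weak_grad \<Omega> u x))"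
      by (intro H_mono x) auto
    also have "\<dots> \<le> J k x * ?H x" using J by (intro H_scale_le x) auto
    finally show "H x \<bar>norm (trunc' k j (u x) *\<^sub>R weak_grad \<Omega> u x)\<bar> \<le> J k x * ?H x" .
  qed
  also have "\<dots> = ennreal (LINT x|M. J k x * ?H x)"
    using H0 by (intro nn_integral_eq_integral integrable_I[OF sol integrable_H(1)[OF sol]] AE_I2) auto
  also have "\<dots> \<le> ennreal (cE * \<Psi>_above k)"
    unfolding \<Psi>_above_def by (intro ennreal_leI energy[OF sol k])
  finally have 1: "\<rho> (\<lambda>x. norm (trunc' k j (u x) *\<^sub>R weak_grad \<Omega> u x)) \<le> ennreal (cE * \<Psi>_above k)" .
  have "\<rho> (\<lambda>x. trunc k j (u x)) \<le> (\<integral>\<^sup>+x. ennreal (2 * (J k x * (\<Psi> x \<bar>u x\<bar> + 1))) \<partial>M)"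
    unfolding modular_def
  proof (intro nn_integral_mono ennreal_leI)
    fix x assume "x \<in> space M"
    then have x: "x \<in> \<Omega>" by simp
    have "H x \<bar>trunc k j (u x)\<bar> \<le> H x (J k x * \<bar>u x\<bar>)"
      using trunc_le_I[OF sol k] by (intro H_mono x) auto
    also have "\<dots> \<le> J k x * H x \<bar>u x\<bar>" using J by (intro H_scale_le x) auto
    also have "\<dots> \<le> J k x * (2 * (\<Psi> x \<bar>u x\<bar> + 1))"
      using J H_le_\<Psi>[OF x, of "\<bar>u x\<bar>"] \<Psi>_nonneg[of x "\<bar>u x\<bar>"] by (intro mult_left_mono) auto
    finally show "H x \<bar>trunc k j (u x)\<bar> \<le> 2 * (J k x * (\<Psi> x \<bar>u x\<bar> + 1))" by (metis mult.left_commute)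
  qed
  also have "\<dots> = ennreal (LINT x|M. 2 * (J k x * (\<Psi> x \<bar>u x\<bar> + 1)))"
    using J \<Psi>_nonneg by (intro nn_integral_eq_integral integrable_mult_right integrable_I[OF sol integrable_\<Psi>1[OF sol]] AE_I2) auto
  also have "\<dots> = ennreal (2 * \<Psi>_above k)" by (simp add: \<Psi>_above_def)
  finally have 2: "\<rho> (\<lambda>x. trunc k j (u x)) \<le> ennreal (2 * \<Psi>_above k)" .
  have "0 \<le> \<Psi>_above k" using above_nonneg[of k] by simp
  then have "ennreal (cE * \<Psi>_above k) + ennreal (2 * \<Psi>_above k) = ennreal ((cE + 2) * \<Psi>_above k)"
    using cE_pos by (subst ennreal_plus[symmetric]) (auto simp: distrib_right)
  then show ?thesis using add_mono[OF 1 2] by simp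
qed

text \<open>\<open>gain\<close> applies to the smooth truncations with a bound that does not depend
  on j; Fatou's lemma gives the result for the positive part of |u| - k.\<close>

lemma PT_level:
  assumes k: "0 < k"
    and gain: "\<And>w g X. approximable w g \<Longrightarrow> 0 \<le> X \<Longrightarrow> \<rho> (\<lambda>x. norm (g x)) + \<rho> w \<le> ennreal X \<Longrightarrow>
    (\<integral>\<^sup>+x. ennreal (PT x \<bar>w x\<bar>) \<partial>M) \<le> ennreal (D * (X powr a + X powr b))"
  shows "(\<integral>\<^sup>+x. ennreal (PT x (v k x)) \<partial>M)
    \<le> ennreal (D * (((cE + 2) * \<Psi>_above k) powr a + ((cE + 2) * \<Psi>_above k) powr b))"
proof (rule nn_integral_le_if_AE_LIMSEQ[where u="\<lambda>j x. PT x \<bar>trunc k j (u x)\<bar>"])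
  show "(\<lambda>x. PT x \<bar>trunc k j (u x)\<bar>) \<in> borel_measurable M" for j
    by (intro PT_measurable borel_measurable_abs measurable_compose[OF u_measurable(1)[OF sol] trunc_measurable[OF sol]])
  show "AE x in M. (\<lambda>j. PT x \<bar>trunc k j (u x)\<bar>) \<longlonglongrightarrow> PT x (v k x)"
  proof (rule AE_I2)
    fix x assume "x \<in> space M"
    then have x: "x \<in> \<Omega>" by simp
    have "(\<lambda>j. PT x \<bar>\<bar>trunc k j (u x)\<bar>\<bar>) \<longlonglongrightarrow> PT x \<bar>v k x\<bar>"
      unfolding v_def by (intro PT_tendsto x trunc_abs_tendsto k)
    then show "(\<lambda>j. PT x \<bar>trunc k j (u x)\<bar>) \<longlonglongrightarrow> PT x (v k x)" using v_nonneg[of k x] by simp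
  qed
  show "(\<integral>\<^sup>+x. ennreal (PT x \<bar>trunc k j (u x)\<bar>) \<partial>M)
    \<le> ennreal (D * (((cE + 2) * \<Psi>_above k) powr a + ((cE + 2) * \<Psi>_above k) powr b))" for j
    using cE_pos above_nonneg[of k] by (intro gain[OF trunc_approx[OF sol k] _ modular_trunc[OF k]]) auto
qed

text \<open>The excess vanishes where |u| is at most k, so the indicator may be inserted with the
  power 1 - \<theta>. Hoelder's inequality then yields a power of the measure of the level set,
  which supplies what the power \<theta> < 1 of \<open>T\<close> lacks.\<close>

lemma Z_le_PT:
  assumes T: "0 \<le> T" "(\<integral>\<^sup>+x. ennreal (PT x (v k x)) \<partial>M) \<le> ennreal T" and k: "0 \<le> k"
  shows "Z k \<le> 2 * (mass_above k powr (1 - \<theta>1) * T powr \<theta>1 + mass_above k powr (1 - \<theta>2) * T powr \<theta>2)"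
proof -
  have J: "0 \<le> J k x" "J k x \<le> 1" for x using I_bounds[OF sol] .
  have [measurable]: "J k \<in> borel_measurable M" by (rule I_measurable[OF sol])
  have nnJ: "(\<integral>\<^sup>+x. ennreal (J k x) \<partial>M) \<le> ennreal (mass_above k)"
    unfolding mass_above_def using J by (subst nn_integral_eq_integral[OF integrable_J]) auto
  have hol: "(\<integral>\<^sup>+x. ennreal (J k x powr (1 - \<theta>) * PT x (v k x) powr \<theta>) \<partial>M) \<le> ennreal (mass_above k powr (1 - \<theta>) * T powr \<theta>)"
    if "0 < \<theta>" "\<theta> < 1" for \<theta>
    using J PT_nonneg T that nnJ above_nonneg[of k] by (intro nn_integral_Holder) auto
  have meas: "(\<lambda>x. ennreal (J k x powr (1 - \<theta>) * PT x (v k x) powr \<theta>)) \<in> borel_measurable M" for \<theta>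
    by measurable
  have "(\<integral>\<^sup>+x. ennreal (\<Psi> x (v k x)) \<partial>M) \<le> (\<integral>\<^sup>+x. (2 * (ennreal (J k x powr (1 - \<theta>1) * PT x (v k x) powr \<theta>1) + ennreal (J k x powr (1 - \<theta>2) * PT x (v k x) powr \<theta>2))) \<partial>M)"
  proof (intro nn_integral_mono)
    fix x assume "x \<in> space M"
    then have x: "x \<in> \<Omega>" by simp
    have "\<Psi> x (v k x) \<le> 2 * (J k x powr (1 - \<theta>1) * PT x (v k x) powr \<theta>1 + J k x powr (1 - \<theta>2) * PT x (v k x) powr \<theta>2)"
      using \<Psi>_le_PT[OF x v_nonneg[of k x]] by (cases "k < \<bar>u x\<bar>") (auto simp: I_def[OF sol] v_def)
    then have "ennreal (\<Psi> x (v k x)) \<le> ennreal (2 * (J k x powr (1 - \<theta>1) * PT x (v k x) powr \<theta>1 + J k x powr (1 - \<theta>2) * PT x (v k x) powr \<theta>2))"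
      by (rule ennreal_leI)
    then show "ennreal (\<Psi> x (v k x)) \<le> 2 * (ennreal (J k x powr (1 - \<theta>1) * PT x (v k x) powr \<theta>1) + ennreal (J k x powr (1 - \<theta>2) * PT x (v k x) powr \<theta>2))"
      by (simp add: ennreal_mult')
  qed
  also have "\<dots> = 2 * ((\<integral>\<^sup>+x. ennreal (J k x powr (1 - \<theta>1) * PT x (v k x) powr \<theta>1) \<partial>M) + (\<integral>\<^sup>+x. ennreal (J k x powr (1 - \<theta>2) * PT x (v k x) powr \<theta>2) \<partial>M))"
    by (subst nn_integral_cmult) (auto intro!: borel_measurable_add meas simp: nn_integral_add[OF meas meas])
  also have "\<dots> \<le> 2 * (ennreal (mass_above k powr (1 - \<theta>1) * T powr \<theta>1) + ennreal (mass_above k powr (1 - \<theta>2) * T powr \<theta>2))"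
    using \<theta> by (intro mult_left_mono add_mono hol) auto
  also have "\<dots> = ennreal (2 * (mass_above k powr (1 - \<theta>1) * T powr \<theta>1 + mass_above k powr (1 - \<theta>2) * T powr \<theta>2))"
    by (simp add: ennreal_mult')
  finally have "ennreal (Z k) \<le> ennreal (2 * (mass_above k powr (1 - \<theta>1) * T powr \<theta>1 + mass_above k powr (1 - \<theta>2) * T powr \<theta>2))"
    unfolding Z_def using \<Psi>_nonneg by (subst (asm) nn_integral_eq_integral[OF integrable_\<Psi>v[OF k]]) auto
  then show ?thesis by (subst (asm) ennreal_le_iff) auto
qed

end

end

text \<open>This sorts the factors: dependence on the iteration step goes into W, on the final level
  into L, on the previous iterate into z. The power of z is (1 - \<theta>) + \<theta> a = 1 +
  \<theta>(a-1), or the same with b, and thus above 1.\<close>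

lemma Hoelder_term_bound:
  fixes z L W c D a b \<theta> m G :: real
  assumes z: "0 \<le> z" and L: "0 \<le> L" and W: "1 \<le> W" and c: "1 \<le> c" and D: "0 < D" and ab: "1 < a" "a \<le> b"
    and \<theta>: "0 < \<theta>" "\<theta> < 1" and m: "0 \<le> m" "m \<le> W * L" and G: "0 \<le> G" "G \<le> W * (1 + L)"
  shows "(m * z) powr (1 - \<theta>) * (D * ((c * (G * z)) powr a + (c * (G * z)) powr b)) powr \<theta>
    \<le> 2 * (D + 1) * c powr b * W powr (b + 1) * ((1 + L) powr b * L powr (1 - \<theta>))
      * (z powr (1 + \<theta> * (a - 1)) + z powr (1 + \<theta> * (b - 1)))"
proof -
  define X where "X = (D + 1) * (c * (W * (1 + L))) powr b"
  have base: "1 \<le> c * (W * (1 + L))"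
    using c W L by (metis le_add_same_cancel1 mult_ge1_I)
  have "1 * 1 \<le> X" unfolding X_def using D ab base by (intro mult_mono ge_one_powr_ge_zero) auto
  then have X: "1 \<le> X" by simp
  have Gz: "G * z \<le> W * (1 + L) * z" using G z by (intro mult_right_mono)
  have t: "(c * (G * z)) powr e \<le> (c * (W * (1 + L))) powr b * z powr e" if "0 \<le> e" "e \<le> b" for e
  proof -
    have "(c * (G * z)) powr e \<le> (c * (W * (1 + L)) * z) powr e"
      using c G z that Gz mult_left_mono[OF Gz, of c] by (intro powr_mono2) (simp_all add: mult.assoc)
    also have "\<dots> = (c * (W * (1 + L))) powr e * z powr e" using base z by (simp add: powr_mult)
    also have "\<dots> \<le> (c * (W * (1 + L))) powr b * z powr e"
      using that base by (intro mult_right_mono powr_mono) auto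
    finally show ?thesis .
  qed
  have "D * ((c * (G * z)) powr a + (c * (G * z)) powr b)
      \<le> (D + 1) * ((c * (W * (1 + L))) powr b * z powr a + (c * (W * (1 + L))) powr b * z powr b)"
    using D ab by (intro mult_mono add_mono t) auto
  also have "\<dots> = X * (z powr a + z powr b)" by (simp add: X_def algebra_simps)
  finally have "(D * ((c * (G * z)) powr a + (c * (G * z)) powr b)) powr \<theta> \<le> (X * (z powr a + z powr b)) powr \<theta>"
    using D \<theta> by (intro powr_mono2) auto
  also have "\<dots> = X powr \<theta> * (z powr a + z powr b) powr \<theta>" using X by (simp add: powr_mult)
  also have "\<dots> \<le> X powr 1 * (2 powr \<theta> * ((z powr a) powr \<theta> + (z powr b) powr \<theta>))"
    using X \<theta> by (intro mult_mono powr_mono powr_add_le_mult) auto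
  also have "\<dots> \<le> X powr 1 * (2 powr 1 * ((z powr a) powr \<theta> + (z powr b) powr \<theta>))"
    using X \<theta> by (intro mult_left_mono mult_right_mono powr_mono) auto
  also have "\<dots> = 2 * X * (z powr (a * \<theta>) + z powr (b * \<theta>))" using X by (simp add: powr_powr)
  finally have T: "(D * ((c * (G * z)) powr a + (c * (G * z)) powr b)) powr \<theta> \<le> 2 * X * (z powr (a * \<theta>) + z powr (b * \<theta>))" .
  have "(m * z) powr (1 - \<theta>) \<le> (W * (L * z)) powr (1 - \<theta>)"
    using m z \<theta> by (intro powr_mono2) (auto simp: mult.assoc[symmetric] intro!: mult_right_mono)
  also have "\<dots> = W powr (1 - \<theta>) * (L powr (1 - \<theta>) * z powr (1 - \<theta>))" using W L z by (simp add: powr_mult)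
  also have "\<dots> \<le> W powr 1 * (L powr (1 - \<theta>) * z powr (1 - \<theta>))" using W \<theta> by (intro mult_right_mono powr_mono) auto
  finally have M: "(m * z) powr (1 - \<theta>) \<le> W * (L powr (1 - \<theta>) * z powr (1 - \<theta>))" using W by simp
  have "(m * z) powr (1 - \<theta>) * (D * ((c * (G * z)) powr a + (c * (G * z)) powr b)) powr \<theta>
    \<le> (W * (L powr (1 - \<theta>) * z powr (1 - \<theta>))) * (2 * X * (z powr (a * \<theta>) + z powr (b * \<theta>)))"
    using M T W by (intro mult_mono) auto
  also have "\<dots> = 2 * X * W * L powr (1 - \<theta>) * (z powr (1 - \<theta>) * z powr (a * \<theta>) + z powr (1 - \<theta>) * z powr (b * \<theta>))"
    by (simp add: algebra_simps)
  also have "z powr (1 - \<theta>) * z powr (a * \<theta>) = z powr (1 + \<theta> * (a - 1))"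
    by (simp add: algebra_simps flip: powr_add)
  also have "z powr (1 - \<theta>) * z powr (b * \<theta>) = z powr (1 + \<theta> * (b - 1))"
    by (simp add: algebra_simps flip: powr_add)
  also have "2 * X * W * L powr (1 - \<theta>) = 2 * (D + 1) * c powr b * W powr (b + 1) * ((1 + L) powr b * L powr (1 - \<theta>))"
    using c W L by (simp add: X_def powr_mult powr_add)
  finally show ?thesis .
qed

text \<open>For k at least 1, L is of the order 1/k and 1 + L is bounded; for smaller k both are of
  the order k^(-R). Only negative powers of k result, with exponents free of \<theta>, so the
  recursion constant becomes small at high levels.\<close>

lemma level_factor_bound:
  fixes k R b \<theta> \<theta>2 L :: real
  assumes k: "0 < k" and R: "1 \<le> R" and b: "1 \<le> b" and \<theta>: "0 < \<theta>" "\<theta> \<le> \<theta>2" "\<theta>2 < 1"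
    and L: "L = k powr - 1 + k powr - R"
  shows "(1 + L) powr b * L powr (1 - \<theta>) \<le> 2 * 3 powr b * (k powr - (1 - \<theta>2) + k powr - (R * (b + 1)))"
proof -
  have two: "2 powr (1 - \<theta>) \<le> (2 :: real)" using powr_mono[of "1 - \<theta>" 1 2] \<theta> by simp
  have L0: "0 \<le> L" by (simp add: L)
  show ?thesis
  proof (cases "1 \<le> k")
    case True
    have "k powr - R \<le> k powr - 1" "k powr - 1 \<le> k powr 0" using True R by (intro powr_mono; simp)+
    moreover have "k powr 0 = 1" using k by simp
    ultimately have LL: "L \<le> 2 * k powr - 1" "1 + L \<le> 3" unfolding L by linarith+
    have "L powr (1 - \<theta>) \<le> (2 * k powr - 1) powr (1 - \<theta>)" using LL L0 \<theta> by (intro powr_mono2) auto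
    also have "\<dots> = 2 powr (1 - \<theta>) * k powr - (1 - \<theta>)" unfolding powr_mult powr_powr by simp
    also have "\<dots> \<le> 2 * k powr - (1 - \<theta>2)" using two True \<theta> by (intro mult_mono powr_mono) auto
    finally have "(1 + L) powr b * L powr (1 - \<theta>) \<le> 3 powr b * (2 * k powr - (1 - \<theta>2))"
      using LL L0 b by (intro mult_mono powr_mono2) auto
    also have "\<dots> = 2 * 3 powr b * k powr - (1 - \<theta>2)" by simp
    also have "\<dots> \<le> 2 * 3 powr b * (k powr - (1 - \<theta>2) + k powr - (R * (b + 1)))" by (intro mult_left_mono) auto
    finally show ?thesis .
  next
    case False
    have "k powr - 1 \<le> k powr - R" "k powr 0 \<le> k powr - R" using False k R by (intro powr_mono'; simp)+
    moreover have "k powr 0 = 1" using k by simp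
    ultimately have LL: "L \<le> 2 * k powr - R" "1 + L \<le> 3 * k powr - R" unfolding L by linarith+
    have "L powr (1 - \<theta>) \<le> (2 * k powr - R) powr (1 - \<theta>)" using LL L0 \<theta> by (intro powr_mono2) auto
    also have "\<dots> = 2 powr (1 - \<theta>) * k powr - (R * (1 - \<theta>))" unfolding powr_mult powr_powr by simp
    also have "\<dots> \<le> 2 * k powr - R" using two False k \<theta> R by (intro mult_mono powr_mono') auto
    finally have 1: "L powr (1 - \<theta>) \<le> 2 * k powr - R" .
    have "(1 + L) powr b \<le> (3 * k powr - R) powr b" using LL L0 b by (intro powr_mono2) auto
    also have "\<dots> = 3 powr b * k powr - (R * b)" unfolding powr_mult powr_powr by simp
    finally have "(1 + L) powr b * L powr (1 - \<theta>) \<le> (3 powr b * k powr - (R * b)) * (2 * k powr - R)"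
      using 1 by (intro mult_mono) auto
    also have "\<dots> = 2 * 3 powr b * (k powr - (R * b) * k powr - R)" by simp
    also have "k powr - (R * b) * k powr - R = k powr - (R * (b + 1))" by (simp add: algebra_simps flip: powr_add)
    also have "2 * 3 powr b * k powr - (R * (b + 1)) \<le> 2 * 3 powr b * (k powr - (1 - \<theta>2) + k powr - (R * (b + 1)))"
      by (intro mult_left_mono) auto
    finally show ?thesis .
  qed
qed

context double_phase_problem
begin

text \<open>One De Giorgi step. By the form of the levels, k' - h = k/w and k'/(k' - h) = w - 1, so
  the loss is a power of w, geometric in n for w = 2^(n+2), times a factor that depends on k
  only.\<close>

lemma level_step:
  assumes sol: "weak_solution \<Omega> (double_phase p q \<mu>) A B u"
    and D: "0 < D" "1 < a" "a \<le> b"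
    and gain: "\<And>w g X. approximable w g \<Longrightarrow> 0 \<le> X \<Longrightarrow> \<rho> (\<lambda>x. norm (g x)) + \<rho> w \<le> ennreal X \<Longrightarrow>
    (\<integral>\<^sup>+x. ennreal (PT x \<bar>w x\<bar>) \<partial>M) \<le> ennreal (D * (X powr a + X powr b))"
    and k: "0 < k" and w: "2 \<le> w" and h: "h = k * (1 - 2 / w)" "k' = k * (1 - 1 / w)" "2 < w"
    and \<delta>: "\<delta>1 = \<theta>1 * (a - 1)" "\<delta>2 = \<theta>2 * (b - 1)"
  shows "Z u k' \<le> 32 * (D + 1) * (3 * (cE + 2)) powr b * w powr (rM * (b + 1))
    * (k powr - (1 - \<theta>2) + k powr - (rM * (b + 1))) * (Z u h powr (1 + \<delta>1) + Z u h powr (1 + \<delta>2))"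
proof -
  define L where "L = k powr - 1 + k powr - rM"
  define W where "W = w powr rM"
  define z where "z = Z u h"
  define m where "m = (k' - h) powr - 1 + (k' - h) powr - rM"
  define G where "G = (k' / (k' - h)) powr rM + m"
  define c where "c = cE + 2"
  have R: "1 < rM" by (rule rM_gt_1)
  have w2: "0 < 1 - 2 / w" "1 - 2 / w < 1 - 1 / w" using h(3) by (auto simp: field_simps)
  have hk: "0 < h" "h < k'" unfolding h(1,2) using k w2 by (auto intro: mult_pos_pos mult_strict_left_mono simp del: diff_less_eq)
  then have hk': "0 < k'" by simp
  have d: "k' - h = k / w" unfolding h(1,2) using h(3) by (simp add: field_simps)
  have ratio: "k' / (k' - h) = w - 1" unfolding d unfolding h(2) using k h(3) by (simp add: field_simps)
  have z0: "0 \<le> z" unfolding z_def by (rule Z_nonneg[OF sol])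
  have L0: "0 \<le> L" by (simp add: L_def)
  have W1: "1 \<le> W" unfolding W_def using w R by (intro ge_one_powr_ge_zero) auto
  have wW: "w \<le> W" unfolding W_def using powr_mono[of 1 rM w] w R by simp
  have "(k / w) powr - 1 = w * k powr - 1" using k w by (simp add: powr_minus field_simps)
  moreover have "(k / w) powr - rM = W * k powr - rM" using k w by (simp add: W_def powr_minus powr_divide field_simps)
  ultimately have m_eq: "m = w * k powr - 1 + W * k powr - rM" unfolding m_def d by simp
  have m: "0 \<le> m" "m \<le> W * L"
    unfolding m_eq L_def distrib_left using w W1 wW by (intro add_nonneg_nonneg add_mono mult_right_mono mult_nonneg_nonneg; simp)+
  have "(k' / (k' - h)) powr rM \<le> W" unfolding ratio W_def using w R by (intro powr_mono2) auto
  then have G: "0 \<le> G" "G \<le> W * (1 + L)" unfolding G_def distrib_left using m by auto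
  have c1: "1 \<le> c" using cE_pos by (simp add: c_def)
  have up: "\<Psi>_above u k' \<le> G * z" unfolding G_def m_def z_def by (rule \<Psi>_above_le[OF sol hk(1,2)])
  have mp: "mass_above u k' \<le> m * z" unfolding m_def z_def by (rule mass_above_le[OF sol hk(1,2)])
  have nn: "0 \<le> mass_above u k'" "0 \<le> \<Psi>_above u k'" using above_nonneg[OF sol, of k'] by auto
  define T where "T = D * ((c * \<Psi>_above u k') powr a + (c * \<Psi>_above u k') powr b)"
  define T' where "T' = D * ((c * (G * z)) powr a + (c * (G * z)) powr b)"
  have T: "0 \<le> T" "T \<le> T'" unfolding T_def T'_def using D c1 up nn
    by (auto intro!: mult_left_mono add_mono powr_mono2)
  let ?F = "k powr - (1 - \<theta>2) + k powr - (rM * (b + 1))"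
  let ?Y = "z powr (1 + \<delta>1) + z powr (1 + \<delta>2)"
  have term_le: "mass_above u k' powr (1 - \<theta>) * T powr \<theta> \<le> 8 * (D + 1) * (3 * c) powr b * W powr (b + 1) * ?F * ?Y"
    if \<theta>': "\<theta>1 \<le> \<theta>" "\<theta> \<le> \<theta>2" for \<theta>
  proof -
    have t01: "0 < \<theta>" "\<theta> < 1" using \<theta> \<theta>' by auto
    have "mass_above u k' powr (1 - \<theta>) * T powr \<theta> \<le> (m * z) powr (1 - \<theta>) * T' powr \<theta>"
      using t01 T nn mp by (intro mult_mono powr_mono2) auto
    also have "\<dots> \<le> 2 * (D + 1) * c powr b * W powr (b + 1) * ((1 + L) powr b * L powr (1 - \<theta>))
      * (z powr (1 + \<theta> * (a - 1)) + z powr (1 + \<theta> * (b - 1)))"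
      unfolding T'_def by (intro Hoelder_term_bound z0 L0 W1 c1 D t01 m G)
    also have "\<dots> \<le> 2 * (D + 1) * c powr b * W powr (b + 1) * (2 * 3 powr b * ?F) * (2 * ?Y)"
    proof (rule mult_mono[OF mult_left_mono])
      show "(1 + L) powr b * L powr (1 - \<theta>) \<le> 2 * 3 powr b * ?F"
        using k R D t01 \<theta> \<theta>' by (intro level_factor_bound L_def) auto
      have "\<theta>1 * (a - 1) \<le> \<theta> * (a - 1)" "\<theta> * (a - 1) \<le> \<theta>2 * (b - 1)"
        "\<theta>1 * (a - 1) \<le> \<theta> * (b - 1)" "\<theta> * (b - 1) \<le> \<theta>2 * (b - 1)"
        using \<theta> \<theta>' D by (auto intro!: mult_mono)
      then have "z powr (1 + \<theta> * (a - 1)) \<le> ?Y" "z powr (1 + \<theta> * (b - 1)) \<le> ?Y"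
        using z0 by (auto simp: \<delta> intro!: powr_le_add)
      then show "z powr (1 + \<theta> * (a - 1)) + z powr (1 + \<theta> * (b - 1)) \<le> 2 * ?Y" by simp
    qed (use D in auto)
    also have "\<dots> = 8 * (D + 1) * (3 powr b * c powr b) * W powr (b + 1) * ?F * ?Y" by (simp only: mult_ac)
    also have "3 powr b * c powr b = (3 * c) powr b" using c1 by (simp add: powr_mult)
    finally show ?thesis .
  qed
  have "Z u k' \<le> 2 * (mass_above u k' powr (1 - \<theta>1) * T powr \<theta>1 + mass_above u k' powr (1 - \<theta>2) * T powr \<theta>2)"
    using hk' PT_level[OF sol hk' gain] T(1) by (intro Z_le_PT[OF sol]) (auto simp: T_def c_def)
  also have "\<dots> \<le> 2 * (8 * (D + 1) * (3 * c) powr b * W powr (b + 1) * ?F * ?Y + 8 * (D + 1) * (3 * c) powr b * W powr (b + 1) * ?F * ?Y)"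
    using \<theta> by (intro mult_left_mono add_mono term_le) auto
  also have "\<dots> = 32 * (D + 1) * (3 * c) powr b * W powr (b + 1) * ?F * ?Y" by simp
  also have "W powr (b + 1) = w powr (rM * (b + 1))" by (simp add: W_def powr_powr)
  finally show ?thesis by (simp add: c_def z_def)
qed

end

context double_phase_problem
begin

lemma AE_bound_if_Z_eq_0:
  assumes sol: "weak_solution \<Omega> (double_phase p q \<mu>) A B u" and k: "0 \<le> k" and Z: "Z u k = 0"
  shows "AE x in M. \<bar>u x\<bar> \<le> k"
proof -
  have "AE x in M. \<Psi> x (v u k x) = 0"
    using Z \<Psi>_nonneg unfolding Z_def[OF sol] by (subst (asm) integral_nonneg_eq_0_iff_AE[OF integrable_\<Psi>v[OF sol k]]) auto
  then show ?thesis
  proof eventually_elim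
    case (elim x)
    have "v u k x powr r x = 0" using elim by (simp add: double_phase_sub_def add_nonneg_eq_0_iff)
    then show ?case by (simp add: v_def[OF sol])
  qed
qed

lemma Z_antimono:
  assumes sol: "weak_solution \<Omega> (double_phase p q \<mu>) A B u" and k: "0 \<le> h" "h \<le> k"
  shows "Z u k \<le> Z u h"
  unfolding Z_def[OF sol]
proof (intro integral_mono integrable_\<Psi>v[OF sol])
  fix x assume "x \<in> space M"
  then show "\<Psi> x (v u k x) \<le> \<Psi> x (v u h x)" using k by (intro \<Psi>_mono) (auto simp: v_def[OF sol])
qed (use k in auto)

text \<open>De Giorgi iteration along the levels \<open>k (1 - 2\<^bsup>-n-1\<^esup>)\<close>; \<open>k\<close> is chosen large enough for the start
  value to satisfy the smallness condition of \<open>fast_geometric_convergence\<close>.\<close>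

lemma sup_bound_\<Psi>:
  "\<exists>C \<tau>1 \<tau>2. 0 < C \<and> 0 < \<tau>1 \<and> 0 < \<tau>2 \<and> (\<forall>u \<alpha>. weak_solution \<Omega> (double_phase p q \<mu>) A B u \<longrightarrow> 0 < \<alpha> \<longrightarrow>
    (LINT x|M. \<Psi> x \<bar>u x\<bar>) \<le> \<alpha> + \<alpha> powr rM \<longrightarrow> (AE x in M. \<bar>u x\<bar> \<le> C * (\<alpha> powr \<tau>1 + \<alpha> powr \<tau>2)))"
proof -
  obtain D a b where D: "0 < D" "1 < a" "a \<le> b"
    and gain: "\<And>w g X. approximable w g \<Longrightarrow> 0 \<le> X \<Longrightarrow> \<rho> (\<lambda>x. norm (g x)) + \<rho> w \<le> ennreal X \<Longrightarrow>
      (\<integral>\<^sup>+x. ennreal (PT x \<bar>w x\<bar>) \<partial>M) \<le> ennreal (D * (X powr a + X powr b))"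
    using gain by blast
  define \<gamma> where "\<gamma> = 1 - \<theta>2"
  define \<Gamma> where "\<Gamma> = rM * (b + 1)"
  define \<delta>1 where "\<delta>1 = \<theta>1 * (a - 1)"
  define \<delta>2 where "\<delta>2 = \<theta>2 * (b - 1)"
  define Bc where "Bc = 2 powr \<Gamma>"
  define l where "l = Bc powr (- 1 / \<delta>1)"
  define C0 where "C0 = 32 * (D + 1) * (3 * (cE + 2)) powr b * 4 powr \<Gamma>"
  have R: "1 < rM" by (rule rM_gt_1)
  have "1 * 1 \<le> rM * (b + 1)" using R D by (intro mult_mono) auto
  then have \<gamma>: "0 < \<gamma>" "\<gamma> \<le> \<Gamma>" "0 < \<Gamma>" using \<theta> by (auto simp: \<gamma>_def \<Gamma>_def)
  have \<delta>: "0 < \<delta>1" "\<delta>1 \<le> \<delta>2" using \<theta> D by (auto simp: \<delta>1_def \<delta>2_def intro!: mult_mono)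
  have Bc: "1 < Bc" unfolding Bc_def using \<gamma> by simp
  have l0: "0 < l" using Bc by (simp add: l_def)
  have C0: "0 < C0" using D cE_pos by (simp add: C0_def)
  define c0 where "c0 = 2 * 2 powr \<delta>1 + 2 * (2 powr \<delta>2 :: real)"
  define c1 where "c1 = 2 * C0 / l * c0"
  define C where "C = 2 * (2 * c1) powr (1 / \<gamma>) + 2 * (2 * c1) powr (1 / \<Gamma>)"
  have c0: "0 < c0" unfolding c0_def by (intro add_pos_pos) auto
  have c1: "0 < c1" unfolding c1_def using C0 l0 c0 by simp
  have C: "0 < C" unfolding C_def using c1 by (intro add_pos_pos) auto
  have main: "AE x in M. \<bar>u x\<bar> \<le> C * (\<alpha> powr (\<delta>1 * (1 / \<Gamma>)) + \<alpha> powr (rM * \<delta>2 * (1 / \<gamma>)))"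
    if sol: "weak_solution \<Omega> (double_phase p q \<mu>) A B u" and \<alpha>: "0 < \<alpha>"
      and V: "(LINT x|M. \<Psi> x \<bar>u x\<bar>) \<le> \<alpha> + \<alpha> powr rM" for u \<alpha>
  proof -
    define Zb where "Zb = \<alpha> + \<alpha> powr rM"
    define W0 where "W0 = Zb powr \<delta>1 + Zb powr \<delta>2"
    define E where "E = 2 * C0 * W0 / l"
    \<comment> \<open>Large enough for k^(-\<gamma>) and k^(-\<Gamma>) to be at most 1/E; as E is 2
      C0 W0/l, the smallness condition S W0 \<le> l follows. The explicit form also makes k a bound
      in terms of \<alpha>.\<close>
    define k where "k = E powr (1 / \<gamma>) + E powr (1 / \<Gamma>)"
    have Zb: "0 < Zb" using \<alpha> by (simp add: Zb_def add_pos_nonneg)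
    have W0: "0 < W0" using Zb unfolding W0_def by (intro add_pos_pos) auto
    have E: "0 < E" unfolding E_def using W0 C0 l0 by simp
    have k: "0 < k" unfolding k_def using E by (intro add_pos_pos) auto
    have kE: "k powr - e \<le> 1 / E" if "e = \<gamma> \<or> e = \<Gamma>" for e
    proof -
      have e: "0 < e" "E powr (1 / e) \<le> k" using that \<gamma> unfolding k_def by auto
      have "k powr - e \<le> (E powr (1 / e)) powr - e" using e E by (intro powr_mono2') auto
      also have "\<dots> = 1 / E" unfolding powr_powr using e E by (simp add: powr_minus_divide)
      finally show ?thesis .
    qed
    define S where "S = C0 * (k powr - \<gamma> + k powr - \<Gamma>)"
    have S: "0 \<le> S" using C0 by (simp add: S_def)
    have "S * W0 \<le> C0 * (1 / E + 1 / E) * W0"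
      unfolding S_def using kE C0 W0 by (intro mult_right_mono mult_left_mono add_mono) auto
    also have "\<dots> = l" using C0 W0 l0 by (simp add: E_def field_simps)
    finally have small: "S * (Zb powr \<delta>1 + Zb powr \<delta>2) \<le> Bc powr (- 1 / \<delta>1)" by (simp add: W0_def l_def)
    define Y where "Y n = Z u (k * (1 - (1 / 2) ^ Suc n))" for n
    have lev: "0 \<le> k * (1 - (1 / 2) ^ Suc n)" "k * (1 - (1 / 2) ^ Suc n) \<le> k" for n
    proof -
      have "(1 / 2 :: real) ^ Suc n \<le> 1" "0 \<le> (1 / 2 :: real) ^ Suc n" by (rule power_le_one) auto
      then show "0 \<le> k * (1 - (1 / 2) ^ Suc n)" "k * (1 - (1 / 2) ^ Suc n) \<le> k"
        using k by (auto simp: mult_left_le simp del: power_Suc)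
    qed
    have "Y \<longlonglongrightarrow> 0"
    proof (rule fast_geometric_convergence[OF \<delta> Bc S _ _ _ small])
      show "0 \<le> Y n" for n unfolding Y_def by (rule Z_nonneg[OF sol])
      show "Y 0 \<le> Zb" unfolding Y_def Zb_def using Z_le[OF sol lev(1)] V by (rule order_trans)
      show "Y (Suc n) \<le> S * Bc ^ n * (Y n powr (1 + \<delta>1) + Y n powr (1 + \<delta>2))" for n
      proof -
        \<comment> \<open>The two levels of step n are k(1 - 2/w) and k(1 - 1/w), in the notation of
          \<open>level_step\<close>.\<close>
        define w where "w = (2 :: real) ^ (n + 2)"
        have w: "2 < w" using one_less_power[of "2::real" "Suc n"] by (simp add: w_def)
        have "w powr \<Gamma> = 4 powr \<Gamma> * (2 ^ n) powr \<Gamma>" by (simp add: w_def powr_mult[symmetric] mult.commute)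
        also have "(2 ^ n) powr \<Gamma> = Bc ^ n"
          by (simp add: Bc_def powr_powr mult.commute flip: powr_realpow)
        finally have wB: "w powr \<Gamma> = 4 powr \<Gamma> * Bc ^ n" .
        have "Z u (k * (1 - (1 / 2) ^ Suc (Suc n))) \<le> 32 * (D + 1) * (3 * (cE + 2)) powr b * w powr (rM * (b + 1))
          * (k powr - (1 - \<theta>2) + k powr - (rM * (b + 1))) * (Y n powr (1 + \<delta>1) + Y n powr (1 + \<delta>2))"
          unfolding Y_def using w
          by (intro level_step[OF sol D gain k] \<delta>1_def \<delta>2_def) (auto simp: w_def power_one_over field_simps)
        also have "\<dots> = S * Bc ^ n * (Y n powr (1 + \<delta>1) + Y n powr (1 + \<delta>2))"
          unfolding S_def C0_def \<gamma>_def[symmetric] \<Gamma>_def[symmetric] wB by simp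
        finally show ?thesis unfolding Y_def .
      qed
    qed
    moreover have "Z u k \<le> Y n" for n unfolding Y_def using lev[of n] by (intro Z_antimono[OF sol])
    ultimately have "Z u k \<le> 0" by (intro LIMSEQ_le_const) auto
    then have "Z u k = 0" using Z_nonneg[OF sol, of k] by simp
    then have AE: "AE x in M. \<bar>u x\<bar> \<le> k" using k by (intro AE_bound_if_Z_eq_0[OF sol]) auto
    \<comment> \<open>From here k is expressed by \<alpha>. Each passage, from Zb to W0 and from E
      to k, widens the range of exponents; its final ends \<delta>1/\<Gamma> and rM
      \<delta>2/\<gamma> are the two exponents of the claim.\<close>
    have Zb_le: "Zb \<le> 1 * (\<alpha> powr 1 + \<alpha> powr rM)" using \<alpha> by (simp add: Zb_def)
    have "Zb powr e \<le> 2 * (2 * 1) powr e * (\<alpha> powr (1 * \<delta>1) + \<alpha> powr (rM * \<delta>2))" if "e = \<delta>1 \<or> e = \<delta>2" for e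
      using that \<delta> \<alpha> Zb R by (intro powr_le_powr_sum Zb_le) auto
    from this[of \<delta>1] this[of \<delta>2] have "W0 \<le> c0 * (\<alpha> powr \<delta>1 + \<alpha> powr (rM * \<delta>2))"
      unfolding W0_def c0_def distrib_right[of "2 * 2 powr \<delta>1"] by simp
    then have "E \<le> 2 * C0 / l * (c0 * (\<alpha> powr \<delta>1 + \<alpha> powr (rM * \<delta>2)))"
      unfolding E_def using C0 l0 by (simp add: divide_right_mono)
    then have E_le: "E \<le> c1 * (\<alpha> powr \<delta>1 + \<alpha> powr (rM * \<delta>2))" by (simp add: c1_def)
    have "1 * \<delta>2 \<le> rM * \<delta>2" using R \<delta> by (intro mult_right_mono) auto
    then have "\<delta>1 \<le> rM * \<delta>2" using \<delta> by linarith
    moreover have "1 / \<Gamma> \<le> 1 / \<gamma>" using \<gamma> by (simp add: frac_le)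
    ultimately have "E powr e \<le> 2 * (2 * c1) powr e * (\<alpha> powr (\<delta>1 * (1 / \<Gamma>)) + \<alpha> powr (rM * \<delta>2 * (1 / \<gamma>)))"
      if "e = 1 / \<gamma> \<or> e = 1 / \<Gamma>" for e
      using that \<delta> \<alpha> E c1 \<gamma> by (intro powr_le_powr_sum E_le) auto
    from this[of "1 / \<gamma>"] this[of "1 / \<Gamma>"]
    have "k \<le> C * (\<alpha> powr (\<delta>1 * (1 / \<Gamma>)) + \<alpha> powr (rM * \<delta>2 * (1 / \<gamma>)))"
      unfolding k_def C_def distrib_right[of "2 * (2 * c1) powr (1 / \<gamma>)"] by simp
    then show ?thesis using AE by (auto elim!: eventually_mono)
  qed
  have "0 < \<delta>1 * (1 / \<Gamma>)" "0 < rM * \<delta>2 * (1 / \<gamma>)" using \<delta> \<gamma> R by auto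
  then show ?thesis using C main by blast
qed

text \<open>A factor \<alpha> leaves \<Psi> as \<alpha> if it is at most 1 and as \<alpha>^rM
  otherwise; the sum covers both cases.\<close>

lemma \<Psi>_div_integral:
  assumes sol: "weak_solution \<Omega> (double_phase p q \<mu>) A B u" and \<alpha>: "0 < \<alpha>"
    and le: "modular \<Omega> \<Psi> (\<lambda>x. u x / \<alpha>) \<le> 1"
  shows "(LINT x|M. \<Psi> x \<bar>u x\<bar>) \<le> \<alpha> + \<alpha> powr rM"
proof -
  have [measurable]: "u \<in> borel_measurable M" by (rule u_measurable(1)[OF sol])
  have pw: "\<Psi> x \<bar>u x\<bar> \<le> (\<alpha> + \<alpha> powr rM) * \<Psi> x \<bar>u x / \<alpha>\<bar>" if x: "x \<in> \<Omega>" for x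
  proof -
    have eq: "\<bar>u x\<bar> = \<alpha> * \<bar>u x / \<alpha>\<bar>" using \<alpha> by simp
    have "\<Psi> x (\<alpha> * \<bar>u x / \<alpha>\<bar>) \<le> \<alpha> * \<Psi> x \<bar>u x / \<alpha>\<bar> \<or> \<Psi> x (\<alpha> * \<bar>u x / \<alpha>\<bar>) \<le> \<alpha> powr rM * \<Psi> x \<bar>u x / \<alpha>\<bar>"
      using \<Psi>_scale_le[OF x, of \<alpha> "\<bar>u x / \<alpha>\<bar>"] \<Psi>_scale_ge[OF x, of \<alpha> "\<bar>u x / \<alpha>\<bar>"] \<alpha>
      by (cases "\<alpha> \<le> 1") simp_all
    moreover have "0 \<le> \<alpha> * \<Psi> x \<bar>u x / \<alpha>\<bar>" "0 \<le> \<alpha> powr rM * \<Psi> x \<bar>u x / \<alpha>\<bar>" using \<alpha> \<Psi>_nonneg by auto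
    ultimately show ?thesis unfolding eq[symmetric] distrib_right by linarith
  qed
  have "ennreal (LINT x|M. \<Psi> x \<bar>u x\<bar>) = (\<integral>\<^sup>+x. ennreal (\<Psi> x \<bar>u x\<bar>) \<partial>M)"
    using \<Psi>_nonneg by (intro nn_integral_eq_integral[symmetric] integrable_\<Psi>[OF sol]) auto
  also have "\<dots> \<le> (\<integral>\<^sup>+x. ennreal (\<alpha> + \<alpha> powr rM) * ennreal (\<Psi> x \<bar>u x / \<alpha>\<bar>) \<partial>M)"
  proof (intro nn_integral_mono)
    fix x assume "x \<in> space M"
    then have "ennreal (\<Psi> x \<bar>u x\<bar>) \<le> ennreal ((\<alpha> + \<alpha> powr rM) * \<Psi> x \<bar>u x / \<alpha>\<bar>)" by (intro ennreal_leI pw) simp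
    then show "ennreal (\<Psi> x \<bar>u x\<bar>) \<le> ennreal (\<alpha> + \<alpha> powr rM) * ennreal (\<Psi> x \<bar>u x / \<alpha>\<bar>)"
      using \<alpha> by (subst ennreal_mult'[symmetric]) (auto intro: add_nonneg_nonneg)
  qed
  also have "\<dots> = ennreal (\<alpha> + \<alpha> powr rM) * modular \<Omega> \<Psi> (\<lambda>x. u x / \<alpha>)"
    unfolding modular_def by (rule nn_integral_cmult) measurable
  also have "\<dots> \<le> ennreal (\<alpha> + \<alpha> powr rM) * 1" by (intro mult_left_mono le) simp
  finally have "ennreal (LINT x|M. \<Psi> x \<bar>u x\<bar>) \<le> ennreal (\<alpha> + \<alpha> powr rM)" by (simp del: ennreal_plus)
  then show ?thesis using \<alpha> by (subst (asm) ennreal_le_iff) (auto intro: add_nonneg_nonneg)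
qed

text \<open>Dividing u by a number \<alpha> \<ge> 1 divides the finite integral of \<Psi> by at
  least \<alpha>. Hence the infimum in the norm is over a nonempty set.\<close>

lemma \<Psi>_norm_set:
  assumes sol: "weak_solution \<Omega> (double_phase p q \<mu>) A B u"
  shows "\<exists>\<alpha>>0. modular \<Omega> \<Psi> (\<lambda>x. u x / \<alpha>) \<le> 1"
proof -
  have [measurable]: "u \<in> borel_measurable M" by (rule u_measurable(1)[OF sol])
  define V where "V = (LINT x|M. \<Psi> x \<bar>u x\<bar>)"
  define \<alpha> where "\<alpha> = max 1 V"
  have \<alpha>: "1 \<le> \<alpha>" "V \<le> \<alpha>" by (auto simp: \<alpha>_def)
  have "modular \<Omega> \<Psi> (\<lambda>x. u x / \<alpha>) \<le> (\<integral>\<^sup>+x. ennreal (1 / \<alpha> * \<Psi> x \<bar>u x\<bar>) \<partial>M)"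
    unfolding modular_def
  proof (intro nn_integral_mono ennreal_leI)
    fix x assume "x \<in> space M"
    then have x: "x \<in> \<Omega>" by simp
    show "\<Psi> x \<bar>u x / \<alpha>\<bar> \<le> 1 / \<alpha> * \<Psi> x \<bar>u x\<bar>"
      using \<Psi>_scale_le[OF x, of "1 / \<alpha>" "\<bar>u x\<bar>"] \<alpha> by simp
  qed
  also have "\<dots> = ennreal (LINT x|M. 1 / \<alpha> * \<Psi> x \<bar>u x\<bar>)"
    using \<alpha> \<Psi>_nonneg by (intro nn_integral_eq_integral integrable_mult_right integrable_\<Psi>[OF sol]) auto
  also have "\<dots> = ennreal (1 / \<alpha> * V)" by (simp only: integral_mult_right_zero V_def)
  also have "\<dots> \<le> 1" using \<alpha> by (simp add: ennreal_le_1 divide_le_eq_1)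
  finally show ?thesis using \<alpha> by (intro exI[of _ \<alpha>]) auto
qed

lemma \<Psi>_modular_le_1:
  assumes sol: "weak_solution \<Omega> (double_phase p q \<mu>) A B u" and \<alpha>: "orlicz_norm \<Omega> \<Psi> u < \<alpha>"
  shows "0 < \<alpha> \<and> modular \<Omega> \<Psi> (\<lambda>x. u x / \<alpha>) \<le> 1"
proof -
  have "{\<alpha>. 0 < \<alpha> \<and> modular \<Omega> \<Psi> (\<lambda>x. u x / \<alpha>) \<le> 1} \<noteq> {}" using \<Psi>_norm_set[OF sol] by blast
  from cInf_lessD[OF this \<alpha>[unfolded orlicz_norm_def]]
  obtain b where b: "0 < b" "modular \<Omega> \<Psi> (\<lambda>x. u x / b) \<le> 1" "b < \<alpha>" by blast
  have "modular \<Omega> \<Psi> (\<lambda>x. u x / \<alpha>) \<le> modular \<Omega> \<Psi> (\<lambda>x. u x / b)"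
    unfolding modular_def using b by (intro nn_integral_mono ennreal_leI \<Psi>_mono) (auto intro!: divide_left_mono)
  then show ?thesis using b by auto
qed

text \<open>The infimum n in the norm may be 0, where no scaling is admissible. The bound is
  therefore taken at numbers \<open>\<alpha> i\<close> decreasing to n and passed to the limit off a
  common null set; a sum of two powers is at most twice their maximum.\<close>

theorem a_priori_bound:
  "\<exists>C>0. \<exists>\<tau>1>0. \<exists>\<tau>2>0. \<forall>u. weak_solution \<Omega> (double_phase p q \<mu>) A B u \<longrightarrow>
    u \<in> Linf_space \<Omega> \<and>
    Linf_norm \<Omega> u \<le> C * max (orlicz_norm \<Omega> \<Psi> u powr \<tau>1) (orlicz_norm \<Omega> \<Psi> u powr \<tau>2)"
proof -
  obtain C \<tau>1 \<tau>2 where C: "0 < C" "0 < \<tau>1" "0 < \<tau>2"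
    and bd: "\<And>u \<alpha>. weak_solution \<Omega> (double_phase p q \<mu>) A B u \<Longrightarrow> 0 < \<alpha> \<Longrightarrow>
      (LINT x|M. \<Psi> x \<bar>u x\<bar>) \<le> \<alpha> + \<alpha> powr rM \<Longrightarrow> (AE x in M. \<bar>u x\<bar> \<le> C * (\<alpha> powr \<tau>1 + \<alpha> powr \<tau>2))"
    using sup_bound_\<Psi> by blast
  have "u \<in> Linf_space \<Omega> \<and> Linf_norm \<Omega> u \<le> (2 * C) * max (orlicz_norm \<Omega> \<Psi> u powr \<tau>1) (orlicz_norm \<Omega> \<Psi> u powr \<tau>2)"
    if sol: "weak_solution \<Omega> (double_phase p q \<mu>) A B u" for u
  proof -
    define n where "n = orlicz_norm \<Omega> \<Psi> u"
    have n: "0 \<le> n" unfolding n_def orlicz_norm_def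
      using \<Psi>_norm_set[OF sol] by (intro cInf_greatest) auto
    define \<alpha> where "\<alpha> i = n + 1 / real (Suc i)" for i
    have \<alpha>: "n < \<alpha> i" "0 < \<alpha> i" for i using n by (auto simp: \<alpha>_def add_nonneg_pos)
    have "AE x in M. \<forall>i. \<bar>u x\<bar> \<le> C * (\<alpha> i powr \<tau>1 + \<alpha> i powr \<tau>2)"
    proof (subst AE_all_countable, intro allI)
      fix i
      have "0 < \<alpha> i \<and> modular \<Omega> \<Psi> (\<lambda>x. u x / \<alpha> i) \<le> 1" using \<alpha>(1)[of i] unfolding n_def by (rule \<Psi>_modular_le_1[OF sol])
      then show "AE x in M. \<bar>u x\<bar> \<le> C * (\<alpha> i powr \<tau>1 + \<alpha> i powr \<tau>2)"
        by (intro bd[OF sol] \<Psi>_div_integral[OF sol]) auto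
    qed
    moreover have "(\<lambda>i. C * (\<alpha> i powr \<tau>1 + \<alpha> i powr \<tau>2)) \<longlonglongrightarrow> C * (n powr \<tau>1 + n powr \<tau>2)"
    proof -
      have "\<alpha> \<longlonglongrightarrow> n + 0" unfolding \<alpha>_def[abs_def]
        by (intro tendsto_add tendsto_const LIMSEQ_Suc[OF lim_1_over_n])
      then have "\<alpha> \<longlonglongrightarrow> n" by simp
      then show ?thesis using C \<alpha>(2)
        by (intro tendsto_mult tendsto_add tendsto_const tendsto_powr2) (auto intro!: always_eventually less_imp_le)
    qed
    ultimately have AE: "AE x in M. \<bar>u x\<bar> \<le> C * (n powr \<tau>1 + n powr \<tau>2)"
      by (auto elim!: eventually_mono intro!: LIMSEQ_le_const)
    let ?b = "2 * C * max (n powr \<tau>1) (n powr \<tau>2)"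
    have "C * (n powr \<tau>1 + n powr \<tau>2) \<le> C * (2 * max (n powr \<tau>1) (n powr \<tau>2))" using C by (intro mult_left_mono) auto
    then have "AE x in M. \<bar>u x\<bar> \<le> ?b" using AE by (auto elim!: eventually_mono)
    then have AEe: "AE x in M. ereal \<bar>u x\<bar> \<le> ereal ?b" by (auto elim!: eventually_mono)
    have um: "u \<in> borel_measurable M" by (rule u_measurable(1)[OF sol])
    have uE: "(\<lambda>x. ereal \<bar>u x\<bar>) \<in> borel_measurable M" using um by measurable
    have le: "esssup M (\<lambda>x. ereal \<bar>u x\<bar>) \<le> ereal ?b" by (rule esssup_I[OF uE AEe])
    \<comment> \<open>\<open>Linf_norm\<close> converts an extended real. Non-negativity, which
      rests on the positive measure of \<Omega>, excludes the value minus infinity.\<close>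
    have ge: "0 \<le> esssup M (\<lambda>x. ereal \<bar>u x\<bar>)"
    proof -
      have "emeasure M (space M) \<noteq> 0"
        using nonempty open_\<Omega> open_not_negligible[of \<Omega>] \<Omega>_sets
        by (auto simp: emeasure_restrict_space negligible_iff_emeasure0)
      then have "esssup M (\<lambda>x. ereal 0) = ereal 0" by (intro esssup_const) auto
      moreover have "esssup M (\<lambda>x. ereal 0) \<le> esssup M (\<lambda>x. ereal \<bar>u x\<bar>)" by (intro esssup_mono) auto
      ultimately show ?thesis by (simp add: zero_ereal_def)
    qed
    have "u \<in> Linf_space \<Omega>" unfolding Linf_space_def using um le by (auto intro: le_less_trans)
    moreover have "Linf_norm \<Omega> u \<le> ?b" unfolding Linf_norm_def
      using le ge by (cases "esssup M (\<lambda>x. ereal \<bar>u x\<bar>)") auto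
    ultimately show ?thesis by (simp add: n_def)
  qed
  then show ?thesis using C by (intro exI[of _ "2 * C"] conjI exI[of _ \<tau>1] exI[of _ \<tau>2]) auto
qed

end

subsection \<open>Choice of the exponents\<close>

text \<open>The maximum over a compact set is attained, which turns each strict inequality between
  exponents into one with a uniform gap.\<close>

lemma continuous_less_gap:
  fixes f :: "'a::topological_space \<Rightarrow> real"
  assumes "compact S" "S \<noteq> {}" "continuous_on S f" "\<And>x. x \<in> S \<Longrightarrow> f x < c"
  shows "\<exists>c'<c. \<forall>x\<in>S. f x \<le> c'"
  using continuous_attains_sup[OF assms(1-3)] assms(4) by blast

theorem theorem4p2:
  fixes \<Omega> :: "(real ^ 'n) set"
    and p q \<mu> r s :: "real ^ 'n \<Rightarrow> real"
    and A :: "real ^ 'n \<Rightarrow> real \<Rightarrow> real ^ 'n \<Rightarrow> real ^ 'n"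
    and B :: "real ^ 'n \<Rightarrow> real \<Rightarrow> real ^ 'n \<Rightarrow> real"
    and \<alpha>1 \<alpha>2 \<alpha>3 \<beta> :: real
  assumes N: "CARD('n) \<ge> 2"
    and \<Omega>: "domain \<Omega>" "bounded \<Omega>" "lipschitz_boundary \<Omega>"
    and p_lip: "\<exists>L. L-lipschitz_on (closure \<Omega>) p"
    and q_lip: "\<exists>L. L-lipschitz_on (closure \<Omega>) q"
    and pq: "\<And>x. x \<in> closure \<Omega> \<Longrightarrow> 1 < p x \<and> p x < q x \<and> q x < real CARD('n)"
    and ratio: "(SUP x\<in>closure \<Omega>. q x / p x) < 1 + 1 / real CARD('n)"
    and \<mu>_lip: "\<exists>L. L-lipschitz_on (closure \<Omega>) \<mu>"
    and \<mu>_nonneg: "\<And>x. x \<in> closure \<Omega> \<Longrightarrow> \<mu> x \<ge> 0"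
    and r_cont: "continuous_on (closure \<Omega>) r"
    and s_cont: "continuous_on (closure \<Omega>) s"
    and r_bounds: "\<And>x. x \<in> closure \<Omega> \<Longrightarrow> p x < r x \<and> r x < crit_exp p x"
    and s_bounds: "\<And>x. x \<in> closure \<Omega> \<Longrightarrow> q x < s x \<and> s x < crit_exp q x"
    and pos: "\<alpha>1 > 0" "\<alpha>2 > 0" "\<alpha>3 > 0" "\<beta> > 0"
    and A_car: "caratheodory \<Omega> A"
    and B_car: "caratheodory \<Omega> B"
    and A_growth: "AE x in lebesgue_on \<Omega>. \<forall>t \<xi>.
      norm (A x t \<xi>) \<le> \<alpha>1 *
        (\<bar>t\<bar> powr (crit_exp p x / conj_exp p x)
         + \<mu> x powr ((real CARD('n) - 1) / (real CARD('n) - q x))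
             * \<bar>t\<bar> powr (crit_exp q x / conj_exp q x)
         + norm \<xi> powr (p x - 1) + \<mu> x * norm \<xi> powr (q x - 1) + 1)"
    and A_coercive: "AE x in lebesgue_on \<Omega>. \<forall>t \<xi>.
      A x t \<xi> \<bullet> \<xi> \<ge> \<alpha>2 * (norm \<xi> powr p x + \<mu> x * norm \<xi> powr q x)
        - \<alpha>3 * (\<bar>t\<bar> powr r x + \<mu> x powr (s x / q x) * \<bar>t\<bar> powr s x + 1)"
    and B_growth: "AE x in lebesgue_on \<Omega>. \<forall>t \<xi>.
      \<bar>B x t \<xi>\<bar> \<le> \<beta> *
        (\<bar>t\<bar> powr (r x - 1) + \<mu> x powr (s x / q x) * \<bar>t\<bar> powr (s x - 1)
         + norm \<xi> powr (p x / conj_exp r x)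
         + \<mu> x powr (1 / q x + 1 / conj_exp s x) * norm \<xi> powr (q x / conj_exp s x) + 1)"
  shows "\<exists>C>0. \<exists>\<tau>1>0. \<exists>\<tau>2>0. \<forall>u. weak_solution \<Omega> (double_phase p q \<mu>) A B u \<longrightarrow>
    u \<in> Linf_space \<Omega> \<and>
    Linf_norm \<Omega> u \<le> C * max (orlicz_norm \<Omega> (double_phase_sub q \<mu> r s) u powr \<tau>1)
                              (orlicz_norm \<Omega> (double_phase_sub q \<mu> r s) u powr \<tau>2)"
proof -
  let ?N = "real CARD('n)"
  let ?S = "closure \<Omega>"
  have open\<Omega>: "open \<Omega>" and ne: "\<Omega> \<noteq> {}" using \<Omega>(1) by (auto simp: domain_def)
  have sub: "\<Omega> \<subseteq> ?S" by (rule closure_subset)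
  have S: "compact ?S" "?S \<noteq> {}" using \<Omega>(2) ne by (auto simp: compact_closure)
  have N2: "2 \<le> ?N" using N by simp
  obtain Lp Lq L\<mu> where L: "Lp-lipschitz_on ?S p" "Lq-lipschitz_on ?S q" "L\<mu>-lipschitz_on ?S \<mu>"
    using p_lip q_lip \<mu>_lip by blast
  note c = L[THEN lipschitz_on_continuous_on]
  have pq': "1 < p x" "p x < q x" "q x < ?N" "1 < q x" "p x < ?N" if "x \<in> ?S" for x using pq[OF that] by auto
  have crit_cont: "continuous_on ?S (crit_exp h)" if "continuous_on ?S h" "\<And>x. x \<in> ?S \<Longrightarrow> h x < ?N" for h
    unfolding crit_exp_def using that by (intro continuous_on_divide continuous_on_mult continuous_on_diff continuous_on_const) force+
  have crit_pos: "0 < crit_exp p x" "0 < crit_exp q x" if "x \<in> ?S" for x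
    unfolding crit_exp_def using pq'[OF that] N2 by auto
  obtain qM where qM: "qM < ?N" "\<And>x. x \<in> ?S \<Longrightarrow> q x \<le> qM"
    using continuous_less_gap[OF S c(2) pq'(3)] by blast
  \<comment> \<open>A uniform lower bound above 1 for p, obtained from the maximum of -p; as p < q
    it serves q as well.\<close>
  obtain pm' where pm': "pm' < - 1" "\<And>x. x \<in> ?S \<Longrightarrow> - p x \<le> pm'"
    using continuous_less_gap[OF S continuous_on_minus[OF c(1)], of "- 1"] pq'(1) by auto
  define pm where "pm = - pm'"
  have pm: "1 < pm" "pm \<le> p x" "pm \<le> q x" if "x \<in> ?S" for x
    using pm' pm'(2)[OF that] pq'(2)[OF that] by (auto simp: pm_def)
  obtain \<mu>M where \<mu>M: "\<And>x. x \<in> ?S \<Longrightarrow> \<mu> x \<le> \<mu>M"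
    using continuous_attains_sup[OF S c(3)] by blast
  obtain R1 R2 where R12: "\<And>x. x \<in> ?S \<Longrightarrow> r x \<le> R1" "\<And>x. x \<in> ?S \<Longrightarrow> s x \<le> R2"
    using continuous_attains_sup[OF S r_cont] continuous_attains_sup[OF S s_cont] by blast
  \<comment> \<open>The condition q/p < 1 + 1/N becomes a comparison with the critical exponent of
    p, so that it can take part in the choice of \<kappa>.\<close>
  obtain \<kappa>2 where \<kappa>2: "\<kappa>2 < 1" "\<And>x. x \<in> ?S \<Longrightarrow> q x * ?N / (?N - q x + 1) / crit_exp p x \<le> \<kappa>2"
  proof -
    have bdd: "bdd_above ((\<lambda>x. q x / p x) ` ?S)"
    proof (intro bounded_imp_bdd_above compact_imp_bounded compact_continuous_image S continuous_on_divide c)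
      show "\<forall>x\<in>?S. p x \<noteq> 0" using pq'(1) by force
    qed
    have qp: "q x / p x < 1 + 1 / ?N" if "x \<in> ?S" for x
      using cSUP_upper[OF that bdd] ratio by (rule le_less_trans)
    have "q x * ?N / (?N - q x + 1) / crit_exp p x < 1" if x: "x \<in> ?S" for x
    proof -
      note b = pq'[OF x]
      have "q x < p x + p x / ?N" using qp[OF x] b by (simp add: divide_less_eq algebra_simps)
      then have "q x * ?N < (p x + p x / ?N) * ?N" using N2 by (intro mult_strict_right_mono) auto
      then have "q x * ?N < p x * ?N + p x" using N2 by (simp add: distrib_right)
      then have "q x * (?N - p x) < p x * (?N - q x + 1)" by (simp add: algebra_simps)
      then have "q x * (?N - p x) * ?N < p x * (?N - q x + 1) * ?N" using N2 by (intro mult_strict_right_mono) auto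
      then have "q x * ?N / (?N - q x + 1) < crit_exp p x" unfolding crit_exp_def
        using b by (simp add: pos_divide_less_eq pos_less_divide_eq mult_ac)
      then show ?thesis by (subst pos_divide_less_eq[OF crit_pos(1)[OF x]]) simp
    qed
    moreover have "continuous_on ?S (\<lambda>x. q x * ?N / (?N - q x + 1) / crit_exp p x)"
    proof (intro continuous_on_divide continuous_on_mult continuous_on_add continuous_on_diff continuous_on_const c crit_cont pq')
      show "\<forall>x\<in>?S. ?N - q x + 1 \<noteq> 0" using pq'(3) by force
      show "\<forall>x\<in>?S. crit_exp p x \<noteq> 0" using crit_pos(1) by force
    qed
    ultimately show ?thesis using that continuous_less_gap[OF S, of "\<lambda>x. q x * ?N / (?N - q x + 1) / crit_exp p x" 1] by blast
  qed
  have crit_gap: "\<exists>\<kappa>3<1. \<forall>x\<in>?S. f x / crit_exp h x \<le> \<kappa>3"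
    if "continuous_on ?S f" "continuous_on ?S h" "\<And>x. x \<in> ?S \<Longrightarrow> h x < ?N" "\<And>x. x \<in> ?S \<Longrightarrow> 0 < crit_exp h x"
      "\<And>x. x \<in> ?S \<Longrightarrow> f x < crit_exp h x" for f h
  proof (rule continuous_less_gap[OF S])
    show "continuous_on ?S (\<lambda>x. f x / crit_exp h x)"
    proof (rule continuous_on_divide[OF that(1) crit_cont[OF that(2,3)]])
      show "\<forall>x\<in>?S. crit_exp h x \<noteq> 0"
      proof
        fix x assume "x \<in> ?S"
        from that(4)[OF this] show "crit_exp h x \<noteq> 0" by simp
      qed
    qed
    show "f x / crit_exp h x < 1" if "x \<in> ?S" for x using \<open>\<And>x. x \<in> ?S \<Longrightarrow> 0 < crit_exp h x\<close>[OF that] \<open>\<And>x. x \<in> ?S \<Longrightarrow> f x < crit_exp h x\<close>[OF that] by simp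
  qed
  obtain \<kappa>3 where \<kappa>3: "\<kappa>3 < 1" "\<And>x. x \<in> ?S \<Longrightarrow> r x / crit_exp p x \<le> \<kappa>3"
    using crit_gap[OF r_cont c(1) pq'(5) crit_pos(1)] r_bounds by blast
  obtain \<kappa>4 where \<kappa>4: "\<kappa>4 < 1" "\<And>x. x \<in> ?S \<Longrightarrow> s x / crit_exp q x \<le> \<kappa>4"
    using crit_gap[OF s_cont c(2) pq'(3) crit_pos(2)] s_bounds by blast
  have pm1: "1 < pm" "pm < ?N" "1 < qM"
    using S(2) pm pq' qM(2) by (metis all_not_in_conv le_less_trans less_le_trans)+
  \<comment> \<open>The smallest value of \<open>phi_star\<close> of h divided by h, for h from
    \<open>pm\<close> upwards. It exceeds 1, which leaves room for some \<kappa> < 1 with \<kappa>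
    \<omega> > 1.\<close>
  define \<omega> where "\<omega> = (?N - 1) / (?N - pm)"
  have \<omega>: "1 < \<omega>" unfolding \<omega>_def using pm1 by simp
  \<comment> \<open>The largest of the fractions that have to stay strictly below \<kappa>: for the
    room above p and q, for the ratio of the exponents, for r and for s. The midpoint of \<kappa>0
    and 1 lies above all of them and makes \<theta>2 = \<kappa>0/\<kappa> less than 1.\<close>
  define \<kappa>0 where "\<kappa>0 = max (1 / \<omega>) (max \<kappa>2 (max \<kappa>3 \<kappa>4))"
  define \<kappa> where "\<kappa> = (1 + \<kappa>0) / 2"
  have \<kappa>0: "0 < \<kappa>0" "\<kappa>0 < 1" "1 / \<omega> \<le> \<kappa>0" "\<kappa>2 \<le> \<kappa>0" "\<kappa>3 \<le> \<kappa>0" "\<kappa>4 \<le> \<kappa>0"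
    using \<kappa>2 \<kappa>3 \<kappa>4 \<omega> by (auto simp: \<kappa>0_def less_max_iff_disj)
  have \<kappa>: "0 < \<kappa>" "\<kappa> < 1" "\<kappa>0 < \<kappa>" using \<kappa>0 by (auto simp: \<kappa>_def)
  have \<kappa>\<omega>: "1 < \<kappa> * \<omega>"
  proof -
    have "1 / \<omega> < \<kappa>" using \<kappa>0(3) \<kappa>(3) by linarith
    then show ?thesis using \<omega> by (simp add: divide_less_eq)
  qed
  define \<eta> where "\<eta> = min (1 / (2 * ?N)) (\<kappa> * \<omega> - 1)"
  have \<eta>: "0 < \<eta>" "?N * \<eta> \<le> 1 / 2" "1 + \<eta> \<le> \<kappa> * \<omega>"
  proof -
    show "0 < \<eta>" "1 + \<eta> \<le> \<kappa> * \<omega>" using \<kappa>\<omega> N2 by (auto simp: \<eta>_def)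
    have "?N * \<eta> \<le> ?N * (1 / (2 * ?N))" using N2 unfolding \<eta>_def by (intro mult_left_mono) auto
    then show "?N * \<eta> \<le> 1 / 2" using N2 by simp
  qed
  have phi: "(1 + \<eta>) * h \<le> \<kappa> * phi_star ?N h" if h: "pm \<le> h" "h < ?N" for h
  proof -
    have "\<omega> \<le> (?N - 1) / (?N - h)" unfolding \<omega>_def using h N2 by (intro divide_left_mono) auto
    then have "\<kappa> * \<omega> \<le> \<kappa> * ((?N - 1) / (?N - h))" using \<kappa> by (intro mult_left_mono) auto
    then have "(1 + \<eta>) * h \<le> \<kappa> * ((?N - 1) / (?N - h)) * h" using \<eta>(3) pm1 h by (intro mult_right_mono) auto
    then show ?thesis by (simp add: phi_star_def mult_ac)
  qed
  define cM where "cM = ?N * qM / (?N - qM)"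
  have cM: "0 < cM" using pm1 qM N2 by (simp add: cM_def)
  have crit_le: "crit_exp h x \<le> cM" if "0 < h x" "h x \<le> qM" for h :: "real ^ 'n \<Rightarrow> real" and x
    unfolding crit_exp_def cM_def using that qM(1) N2 by (intro frac_le mult_left_mono) auto
  define \<theta>2 where "\<theta>2 = \<kappa>0 / \<kappa>"
  \<comment> \<open>P and Q are at most \<open>cM\<close>, while r and s exceed 1; so 1/cM is a
    uniform lower bound for r/P and s/Q.\<close>
  define \<theta>1 where "\<theta>1 = min \<theta>2 (1 / cM)"
  have \<theta>: "0 < \<theta>1" "\<theta>1 \<le> \<theta>2" "\<theta>2 < 1" "\<theta>1 \<le> 1 / cM" using \<kappa>0 \<kappa> cM by (auto simp: \<theta>1_def \<theta>2_def)
  have upper: "f \<le> \<theta>2 * (\<kappa> * cr)" if "0 < cr" "f / cr \<le> \<kappa>'" "\<kappa>' \<le> \<kappa>0" for f cr \<kappa>'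
  proof -
    have "f / cr \<le> \<kappa>0" using that by linarith
    then have "f \<le> \<kappa>0 * cr" using that by (simp add: pos_divide_le_eq)
    then show ?thesis using \<kappa> by (simp add: \<theta>2_def)
  qed
  have lower: "\<theta>1 * (\<kappa> * cr) \<le> f" if "0 < cr" "cr \<le> cM" "1 < f" for f cr
  proof -
    have "\<theta>1 * (\<kappa> * cr) \<le> 1 / cM * (1 * cM)" using that \<theta> \<kappa> cM by (intro mult_mono) auto
    then show ?thesis using that cM by simp
  qed
  interpret e: double_phase_exponents \<Omega> p q \<mu> qM \<mu>M Lp Lq L\<mu> \<kappa> \<eta>
  proof unfold_locales
    show "continuous_on \<Omega> p" "continuous_on \<Omega> q" "continuous_on \<Omega> \<mu>" by (rule continuous_on_subset[OF _ sub]; rule c)+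
    show "Lp-lipschitz_on \<Omega> p" "Lq-lipschitz_on \<Omega> q" "L\<mu>-lipschitz_on \<Omega> \<mu>" by (rule lipschitz_on_subset[OF _ sub]; rule L)+
    fix x assume "x \<in> \<Omega>"
    then have x: "x \<in> ?S" using sub by blast
    show "1 < p x" "p x < q x" "q x \<le> qM" "0 \<le> \<mu> x" "\<mu> x \<le> \<mu>M" using pq'[OF x] qM(2)[OF x] \<mu>_nonneg[OF x] \<mu>M[OF x] by auto
    show "(1 + \<eta>) * p x \<le> \<kappa> * phi_star ?N (p x)" "(1 + \<eta>) * q x \<le> \<kappa> * phi_star ?N (q x)"
      using pm[OF x] pq'[OF x] by (intro phi; simp)+
    have "q x * ?N / (?N - q x + 1) / crit_exp p x \<le> \<kappa>" using \<kappa>2(2)[OF x] \<kappa>0(4) \<kappa>(3) by linarith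
    then show "q x * ?N / (?N - q x + 1) \<le> \<kappa> * crit_exp p x" by (subst (asm) pos_divide_le_eq[OF crit_pos(1)[OF x]])
  qed (use open\<Omega> \<Omega>(2) pm1 N ne qM(1) \<kappa> \<eta> in auto)
  interpret double_phase_problem \<Omega> p q \<mu> qM \<mu>M Lp Lq L\<mu> \<kappa> \<eta> r s A B \<alpha>1 \<alpha>2 \<alpha>3 \<beta> \<theta>1 \<theta>2 "max R1 R2"
  proof unfold_locales
    show "continuous_on \<Omega> r" "continuous_on \<Omega> s" using r_cont s_cont sub by (auto intro: continuous_on_subset)
    fix x assume "x \<in> \<Omega>"
    then have x: "x \<in> ?S" using sub by blast
    note b = pq'[OF x] and r = r_bounds[OF x] and s = s_bounds[OF x]
    show "p x < r x" "q x < s x" using r s by auto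
    show "r x \<le> max R1 R2" "s x \<le> max R1 R2" using R12[OF x] by auto
    show "\<theta>1 * e.P x \<le> r x" "\<theta>1 * e.Q x \<le> s x" unfolding e.P_def e.Q_def
      using b r s qM(2)[OF x] by (intro lower crit_pos[OF x] crit_le; simp)+
    show "r x \<le> \<theta>2 * e.P x" "s x \<le> \<theta>2 * e.Q x" unfolding e.P_def e.Q_def
      by (rule upper[OF crit_pos(1)[OF x] \<kappa>3(2)[OF x] \<kappa>0(5)]) (rule upper[OF crit_pos(2)[OF x] \<kappa>4(2)[OF x] \<kappa>0(6)])
  qed (use \<theta> pos A_car B_car A_growth A_coercive B_growth in \<open>assumption | auto\<close>)
  show ?thesis by (rule a_priori_bound)
qed

end
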